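(* Let $\kappa\in\mathbb{R}$ and let $(X,d)$ be an Alexandrov space with curvature $\ge\kappa$. Suppose that there are a point $p\in X$ and finite sequences $\{x_i\}_{i\in I}\subset X$ of points and $\{\lambda_i\}_{i\in I}$ of positive real numbers such that $$\sum_{i,j\in I}\lambda_i\lambda_j\left\langle\overrightarrow{px_i},\overrightarrow{px_j}\right\rangle_\kappa=0 .$$ Then $[p,\{x_i\mid i\in I\}]$ can be isometrically embedded into the model space $M_\kappa$, and $\overline{\mathrm{conv}}\,[p,\{x_i\mid i\in I\}]$ is isometric to $\overline{\mathrm{conv}}$ of the embedded image of $[p,\{x_i\mid i\in I\}]$ in $M_\kappa$.
   Context: Subsets of metric spaces carry the restricted metric; isometric embedding means distance-preserving map. Comparison angle: $\mathrm{peri}(x,y,z):=d(x,y)+d(y,z)+d(z,x)$. For $\kappa>0$ let $S_\kappa(r)=\sin(\sqrt\kappa r)/\sqrt\kappa$, for $\kappa<0$ let $S_\kappa(r)=\sinh(\sqrt{-\kappa}r)/\sqrt{-\kappa}$, and $C_\kappa:=S_\kappa'$. For points $x,y,z$ of a metric space (with $x\ne y$, $x\neq z$, and $\mathrm{peri}(x,y,z)<2\pi/\sqrt\kappa$ if $\kappa>0$), $\tilde\angle_\kappa(x;y,z)\in[0,\pi]$ is defined by $\cos\tilde\angle_\kappa(x;y,z)=\frac{d(x,y)^2+d(x,z)^2-d(y,z)^2}{2d(x,y)d(x,z)}$ if $\kappa=0$, and $\cos\tilde\angle_\kappa(x;y,z)=\frac{C_\kappa(d(y,z))-C_\kappa(d(x,y))C_\kappa(d(x,z))}{\kappa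 S_\kappa(d(x,y))S_\kappa(d(x,z))}$ if $\kappa\ne0$. A metric space has curvature $\ge\kappa$ if $\tilde\angle_\kappa(x;y,z)+\tilde\angle_\kappa(x;z,w)+\tilde\angle_\kappa(x;w,y)\le2\pi$ for every quadruple $(x;y,z,w)$ of four distinct points whose size (the maximum of the perimeters of all triangles formed by the four points) is less than $2\pi/\sqrt\kappa$ if $\kappa>0$. An Alexandrov space with curvature $\ge\kappa$ is a complete length space (distance = infimum of lengths of connecting curves; not necessarily geodesic, locally compact or finite dimensional) with curvature $\ge\kappa$. Inner product: $\langle\overrightarrow{xy},\overrightarrow{xz}\rangle_\kappa:=d(x,y)d(x,z)\cos\tilde\angle_\kappa(x;y,z)$; it is $0$ if $d(x,y)d(x,z)=0$, and it is $+\infty$ if $\kappa>0$, $d(x,y)d(x,z)>0$ and $\tilde\angle_\kappa(x;y,z)$ is not well-defined. For subsets $A,B$ of a metric space, $[A,B]:=\{x: d(a,b)=d(a,x)+d(x,b)\text{ for some }a\in A,\,b\in B\}$, and $[a,B]:=[\{a\},B]$. $M_\kappa$ is the infinite dimensional model space of constant curvature $\kappa$: the Elliptic, Euclidean or Hyperbolic cone (according to $\kappa>0$, $=0$, $<0$) over the unit sphere of an infinite dimensional separable Hilbert space. For a subset $D$ of a metric space, $\overline{\mathrm{conv}}\,D$ is defined as follows. For a subset $E$, $H_1(E)$ is the set of points $x$ such that $x\in E$ or $x$ lies on a geodesic segment $ab$ that is the unique geodesic segment connecting its end points $a,b\in E$. Put $H_0:=D$, $H_n:=H_1(H_{n-1})$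 for $n\ge1$; $\overline{\mathrm{conv}}\,D$ is the closure of $\bigcup_{n\ge0}H_n$. (A geodesic is a constant speed curve whose length equals the distance between its end points.) *)

theory Defs
  imports "HOL-Analysis.Analysis"
begin

section \<open>Comparison angles and curvature bounds\<close>

definition peri :: "'a metric \<Rightarrow> 'a \<Rightarrow> 'a \<Rightarrow> 'a \<Rightarrow> real" where
  "peri X x y z = mdist X x y + mdist X y z + mdist X z x"

text \<open>The case \<open>\<kappa> = 0\<close> is never used; it is the limit of the other two.\<close>
definition sn :: "real \<Rightarrow> real \<Rightarrow> real" where
  "sn \<kappa> r = (if \<kappa> > 0 then sin (sqrt \<kappa> * r) / sqrt \<kappa>
             else if \<kappa> < 0 then sinh (sqrt (- \<kappa>) * r) / sqrt (- \<kappa>)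
             else r)"

definition cs :: "real \<Rightarrow> real \<Rightarrow> real" where
  "cs \<kappa> = deriv (sn \<kappa>)"

lemma cs_pos: "\<kappa> > 0 \<Longrightarrow> cs \<kappa> r = cos (sqrt \<kappa> * r)"
  unfolding cs_def sn_def
  by (rule DERIV_imp_deriv) (auto intro!: derivative_eq_intros simp: field_simps)

lemma cs_neg:
  assumes "\<kappa> < 0"
  shows "cs \<kappa> r = cosh (sqrt (- \<kappa>) * r)"
proof -
  have "((\<lambda>r. sinh (k * r) / k) has_real_derivative cosh (k * r)) (at r)" if "k > 0" for k
    using that by (auto intro!: derivative_eq_intros)
  from DERIV_imp_deriv[OF this, of "sqrt (- \<kappa>)"] show ?thesis
    using assms unfolding cs_def sn_def by simp
qed

definition angle_defined :: "real \<Rightarrow> 'a metric \<Rightarrow> 'a \<Rightarrow> 'a \<Rightarrow> 'a \<Rightarrow> bool" where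
  "angle_defined \<kappa> X x y z \<longleftrightarrow>
     x \<noteq> y \<and> x \<noteq> z \<and> (\<kappa> > 0 \<longrightarrow> peri X x y z < 2 * pi / sqrt \<kappa>)"

text \<open>Meaningful only if \<^term>\<open>angle_defined \<kappa> X x y z\<close>.\<close>
definition comparison_angle :: "real \<Rightarrow> 'a metric \<Rightarrow> 'a \<Rightarrow> 'a \<Rightarrow> 'a \<Rightarrow> real" where
  "comparison_angle \<kappa> X x y z = arccos
     (if \<kappa> = 0
      then ((mdist X x y)\<^sup>2 + (mdist X x z)\<^sup>2 - (mdist X y z)\<^sup>2) / (2 * mdist X x y * mdist X x z)
      else (cs \<kappa> (mdist X y z) - cs \<kappa> (mdist X x y) * cs \<kappa> (mdist X x z))
             / (\<kappa> * sn \<kappa> (mdist X x y) * sn \<kappa> (mdist X x z)))"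

definition quadruple_size :: "'a metric \<Rightarrow> 'a \<Rightarrow> 'a \<Rightarrow> 'a \<Rightarrow> 'a \<Rightarrow> real" where
  "quadruple_size X x y z w = Max {peri X x y z, peri X x y w, peri X x z w, peri X y z w}"

definition curvature_ge :: "real \<Rightarrow> 'a metric \<Rightarrow> bool" where
  "curvature_ge \<kappa> X \<longleftrightarrow>
     (\<forall>x\<in>mspace X. \<forall>y\<in>mspace X. \<forall>z\<in>mspace X. \<forall>w\<in>mspace X.
        distinct [x, y, z, w] \<and> (\<kappa> > 0 \<longrightarrow> quadruple_size X x y z w < 2 * pi / sqrt \<kappa>) \<longrightarrow>
        comparison_angle \<kappa> X x y z + comparison_angle \<kappa> X x z w + comparison_angle \<kappa> X x w y
          \<le> 2 * pi)"

definition inner_prod :: "real \<Rightarrow> 'a metric \<Rightarrow> 'a \<Rightarrow> 'a \<Rightarrow> 'a \<Rightarrow> ereal" where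
  "inner_prod \<kappa> X x y z =
     (if mdist X x y * mdist X x z = 0 then 0
      else if \<kappa> > 0 \<and> \<not> angle_defined \<kappa> X x y z then \<infinity>
      else ereal (mdist X x y * mdist X x z * cos (comparison_angle \<kappa> X x y z)))"

section \<open>Length of curves, geodesics, convex hulls\<close>

text \<open>The lists need not contain the end points; adding them can only increase the sum.\<close>
definition curve_length :: "'a metric \<Rightarrow> (real \<Rightarrow> 'a) \<Rightarrow> real \<Rightarrow> real \<Rightarrow> ereal" where
  "curve_length X \<gamma> a b =
     (SUP ts \<in> {ts. sorted ts \<and> set ts \<subseteq> {a..b}}.
        ereal (\<Sum>i<length ts - 1. mdist X (\<gamma> (ts ! i)) (\<gamma> (ts ! Suc i))))"

text \<open>Infimum in \<^typ>\<open>ereal\<close>: points not joined by a curve violate the equation.\<close>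
definition length_space :: "'a metric \<Rightarrow> bool" where
  "length_space X \<longleftrightarrow>
     (\<forall>x\<in>mspace X. \<forall>y\<in>mspace X.
        ereal (mdist X x y) =
        (INF \<gamma> \<in> {\<gamma>. pathin (mtopology_of X) \<gamma> \<and> \<gamma> 0 = x \<and> \<gamma> 1 = y}. curve_length X \<gamma> 0 1))"

definition alexandrov_space :: "real \<Rightarrow> 'a metric \<Rightarrow> bool" where
  "alexandrov_space \<kappa> X \<longleftrightarrow> mcomplete_of X \<and> length_space X \<and> curvature_ge \<kappa> X"

definition constant_speed :: "'a metric \<Rightarrow> (real \<Rightarrow> 'a) \<Rightarrow> bool" where
  "constant_speed X \<gamma> \<longleftrightarrow>
     (\<exists>v. \<forall>s t. 0 \<le> s \<and> s \<le> t \<and> t \<le> 1 \<longrightarrow> curve_length X \<gamma> s t = ereal (v * (t - s)))"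

definition geodesic :: "'a metric \<Rightarrow> (real \<Rightarrow> 'a) \<Rightarrow> bool" where
  "geodesic X \<gamma> \<longleftrightarrow> pathin (mtopology_of X) \<gamma> \<and> constant_speed X \<gamma> \<and>
     curve_length X \<gamma> 0 1 = ereal (mdist X (\<gamma> 0) (\<gamma> 1))"

text \<open>A segment is the image of a geodesic, so uniqueness below is uniqueness of the image.\<close>
definition geodesic_segment :: "'a metric \<Rightarrow> 'a \<Rightarrow> 'a \<Rightarrow> 'a set \<Rightarrow> bool" where
  "geodesic_segment X a b S \<longleftrightarrow> (\<exists>\<gamma>. geodesic X \<gamma> \<and> \<gamma> 0 = a \<and> \<gamma> 1 = b \<and> S = \<gamma> ` {0..1})"

definition conv_step :: "'a metric \<Rightarrow> 'a set \<Rightarrow> 'a set" where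
  "conv_step X E = E \<union>
     {x. \<exists>a\<in>E. \<exists>b\<in>E. \<exists>S. geodesic_segment X a b S \<and>
           (\<forall>S'. geodesic_segment X a b S' \<longrightarrow> S' = S) \<and> x \<in> S}"

definition closed_conv :: "'a metric \<Rightarrow> 'a set \<Rightarrow> 'a set" where
  "closed_conv X D = mtopology_of X closure_of (\<Union>n. (conv_step X ^^ n) D)"

definition metric_between :: "'a metric \<Rightarrow> 'a set \<Rightarrow> 'a set \<Rightarrow> 'a set" where
  "metric_between X A B =
     {x \<in> mspace X. \<exists>a\<in>A. \<exists>b\<in>B. mdist X a b = mdist X a x + mdist X x b}"

definition isometric_embedding :: "'a metric \<Rightarrow> 'b metric \<Rightarrow> ('a \<Rightarrow> 'b) \<Rightarrow> bool" where
  "isometric_embedding X Y f \<longleftrightarrow> f \<in> mspace X \<rightarrow> mspace Y \<and>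
     (\<forall>x\<in>mspace X. \<forall>y\<in>mspace X. mdist Y (f x) (f y) = mdist X x y)"

definition isometric :: "'a metric \<Rightarrow> 'b metric \<Rightarrow> bool" where
  "isometric X Y \<longleftrightarrow> (\<exists>g. isometric_embedding X Y g \<and> g ` mspace X = mspace Y)"

section \<open>The Hilbert space of square-summable sequences\<close>

typedef ell2 = "{x :: nat \<Rightarrow> real. summable (\<lambda>n. (x n)\<^sup>2)}"
  by (rule exI[of _ "\<lambda>_. 0"]) simp

setup_lifting type_definition_ell2

lemma summable_mult_ell2:
  fixes x y :: "nat \<Rightarrow> real"
  assumes "summable (\<lambda>n. (x n)\<^sup>2)" "summable (\<lambda>n. (y n)\<^sup>2)"
  shows "summable (\<lambda>n. x n * y n)"
proof (rule summable_comparison_test)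
  show "summable (\<lambda>n. (x n)\<^sup>2 + (y n)\<^sup>2)"
    using assms by (rule summable_add)
  have "\<bar>a * b\<bar> \<le> a\<^sup>2 + b\<^sup>2" for a b :: real
  proof -
    have "2 * \<bar>a\<bar> * \<bar>b\<bar> \<le> a\<^sup>2 + b\<^sup>2"
      using sum_squares_bound[of "\<bar>a\<bar>" "\<bar>b\<bar>"] by simp
    moreover have "0 \<le> \<bar>a\<bar> * \<bar>b\<bar>" by simp
    ultimately have "\<bar>a\<bar> * \<bar>b\<bar> \<le> a\<^sup>2 + b\<^sup>2" by linarith
    then show ?thesis by (simp add: abs_mult)
  qed
  then show "\<exists>N. \<forall>n\<ge>N. norm (x n * y n) \<le> (x n)\<^sup>2 + (y n)\<^sup>2" by simp
qed

lemma summable_add_ell2: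
  fixes x y :: "nat \<Rightarrow> real"
  assumes "summable (\<lambda>n. (x n)\<^sup>2)" "summable (\<lambda>n. (y n)\<^sup>2)"
  shows "summable (\<lambda>n. (x n + y n)\<^sup>2)"
proof -
  have "summable (\<lambda>n. (x n)\<^sup>2 + (y n)\<^sup>2 + 2 * (x n * y n))"
    by (intro summable_add summable_mult assms summable_mult_ell2)
  then show ?thesis by (simp add: power2_sum mult.assoc)
qed

instantiation ell2 :: real_inner
begin

lift_definition zero_ell2 :: ell2 is "\<lambda>_. 0" by simp
lift_definition plus_ell2 :: "ell2 \<Rightarrow> ell2 \<Rightarrow> ell2" is "\<lambda>x y n. x n + y n"
  by (rule summable_add_ell2)
lift_definition uminus_ell2 :: "ell2 \<Rightarrow> ell2" is "\<lambda>x n. - x n" by simp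
lift_definition minus_ell2 :: "ell2 \<Rightarrow> ell2 \<Rightarrow> ell2" is "\<lambda>x y n. x n - y n"
  subgoal for x y using summable_add_ell2[of x "\<lambda>n. - y n"] by simp
  done
lift_definition scaleR_ell2 :: "real \<Rightarrow> ell2 \<Rightarrow> ell2" is "\<lambda>c x n. c * x n"
  by (simp add: power_mult_distrib summable_mult)
lift_definition inner_ell2 :: "ell2 \<Rightarrow> ell2 \<Rightarrow> real" is "\<lambda>x y. \<Sum>n. x n * y n" .

definition norm_ell2 :: "ell2 \<Rightarrow> real" where "norm_ell2 x = sqrt (inner x x)"
definition sgn_ell2 :: "ell2 \<Rightarrow> ell2" where "sgn_ell2 x = inverse (norm x) *\<^sub>R x"
definition dist_ell2 :: "ell2 \<Rightarrow> ell2 \<Rightarrow> real" where "dist_ell2 x y = norm (x - y)"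
definition uniformity_ell2 :: "(ell2 \<times> ell2) filter" where
  "uniformity_ell2 = (INF e\<in>{0<..}. principal {(x, y). dist x y < e})"
definition open_ell2 :: "ell2 set \<Rightarrow> bool" where
  "open_ell2 U = (\<forall>x\<in>U. \<forall>\<^sub>F (x', y) in uniformity. x' = x \<longrightarrow> y \<in> U)"

instance
proof
  fix x y z :: ell2 and a b :: real and U :: "ell2 set"
  show "x + y + z = x + (y + z)" by transfer (simp add: add.assoc)
  show "x + y = y + x" by transfer (simp add: add.commute)
  show "0 + x = x" by transfer simp
  show "- x + x = 0" by transfer simp
  show "x - y = x + - y" by transfer simp
  show "a *\<^sub>R (x + y) = a *\<^sub>R x + a *\<^sub>R y" by transfer (simp add: distrib_left)
  show "(a + b) *\<^sub>R x = a *\<^sub>R x + b *\<^sub>R x" by transfer (simp add: distrib_right)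
  show "a *\<^sub>R b *\<^sub>R x = (a * b) *\<^sub>R x" by transfer (simp add: mult.assoc)
  show "1 *\<^sub>R x = x" by transfer simp
  show "sgn x = inverse (norm x) *\<^sub>R x" by (rule sgn_ell2_def)
  show "dist x y = norm (x - y)" by (rule dist_ell2_def)
  show "uniformity = (INF e\<in>{0<..}. principal {(x :: ell2, y). dist x y < e})"
    by (rule uniformity_ell2_def)
  show "open U = (\<forall>x\<in>U. \<forall>\<^sub>F (x', y) in uniformity. x' = x \<longrightarrow> y \<in> U)"
    by (rule open_ell2_def)
  show "inner x y = inner y x" by transfer (simp add: mult.commute)
  show "inner (x + y) z = inner x z + inner y z"
    by transfer (simp add: distrib_right suminf_add summable_mult_ell2)
  show "inner (a *\<^sub>R x) y = a * inner x y"
    by transfer (simp add: mult.assoc suminf_mult summable_mult_ell2)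
  show "0 \<le> inner x x"
    by transfer (auto intro!: suminf_nonneg simp: summable_mult_ell2)
  show "inner x x = 0 \<longleftrightarrow> x = 0"
  proof transfer
    fix f :: "nat \<Rightarrow> real" assume f: "summable (\<lambda>n. (f n)\<^sup>2)"
    have "(\<Sum>n. (f n)\<^sup>2) = 0 \<longleftrightarrow> (\<forall>n. (f n)\<^sup>2 = 0)"
      by (rule suminf_eq_zero_iff[OF f]) simp
    then show "(\<Sum>n. f n * f n) = 0 \<longleftrightarrow> f = (\<lambda>_. 0)"
      by (auto simp: power2_eq_square)
  qed
  show "norm x = sqrt (inner x x)" by (rule norm_ell2_def)
qed

end


section \<open>The model space\<close>

text \<open>
  The side opposite to the angle \<open>\<theta>\<close> in a \<open>\<kappa>\<close>-plane triangle with adjacent sides \<open>r\<close>, \<open>s\<close>.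
\<close>
definition cone_side :: "real \<Rightarrow> real \<Rightarrow> real \<Rightarrow> real \<Rightarrow> real" where
  "cone_side \<kappa> r s \<theta> =
     (if \<kappa> > 0 then
        arccos (cos (sqrt \<kappa> * r) * cos (sqrt \<kappa> * s)
                + sin (sqrt \<kappa> * r) * sin (sqrt \<kappa> * s) * cos \<theta>) / sqrt \<kappa>
      else if \<kappa> < 0 then
        arcosh (cosh (sqrt (- \<kappa>) * r) * cosh (sqrt (- \<kappa>) * s)
                - sinh (sqrt (- \<kappa>) * r) * sinh (sqrt (- \<kappa>) * s) * cos \<theta>) / sqrt (- \<kappa>)
      else sqrt (r\<^sup>2 + s\<^sup>2 - 2 * r * s * cos \<theta>))"

text \<open>
  The cone over the unit sphere of \<^typ>\<open>ell2\<close> with its angular metric \<open>arccos (u \<bullet> v)\<close>. For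
  \<open>\<kappa> > 0\<close> it is the spherical suspension, with radii in \<open>[0, pi / sqrt \<kappa>]\<close> and both ends collapsed;
  otherwise radii range over \<open>[0, \<infinity>)\<close> and only the apex is collapsed. Points are equivalence classes.
\<close>
definition cone_pairs :: "real \<Rightarrow> (real \<times> ell2) set" where
  "cone_pairs \<kappa> = {r. 0 \<le> r \<and> (\<kappa> > 0 \<longrightarrow> r \<le> pi / sqrt \<kappa>)} \<times> sphere 0 1"

definition cone_rel :: "real \<Rightarrow> ((real \<times> ell2) \<times> (real \<times> ell2)) set" where
  "cone_rel \<kappa> = {((r, u), (s, v)). (r, u) \<in> cone_pairs \<kappa> \<and> (s, v) \<in> cone_pairs \<kappa> \<and> r = s \<and>
     (u = v \<or> r = 0 \<or> (\<kappa> > 0 \<and> r = pi / sqrt \<kappa>))}"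

definition cone_pair_dist :: "real \<Rightarrow> real \<times> ell2 \<Rightarrow> real \<times> ell2 \<Rightarrow> real" where
  "cone_pair_dist \<kappa> p q = cone_side \<kappa> (fst p) (fst q) (arccos (snd p \<bullet> snd q))"

definition model_points :: "real \<Rightarrow> (real \<times> ell2) set set" where
  "model_points \<kappa> = cone_pairs \<kappa> // cone_rel \<kappa>"

definition model_dist :: "real \<Rightarrow> (real \<times> ell2) set \<Rightarrow> (real \<times> ell2) set \<Rightarrow> real" where
  "model_dist \<kappa> P Q =
     (if P \<in> model_points \<kappa> \<and> Q \<in> model_points \<kappa>
      then cone_pair_dist \<kappa> (SOME p. p \<in> P) (SOME q. q \<in> Q) else 0)"

definition model_space :: "real \<Rightarrow> (real \<times> ell2) set metric" where
  "model_space \<kappa> = metric (model_points \<kappa>, model_dist \<kappa>)"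

text \<open>
  It remains to see that this is a metric, so that \<^const>\<open>mspace\<close> and \<^const>\<open>mdist\<close> recover the
  given data.
\<close>

lemma inner_unit_bounds:
  fixes u v :: "'a :: real_inner"
  assumes "norm u = 1" "norm v = 1"
  shows "-1 \<le> u \<bullet> v" "u \<bullet> v \<le> 1"
  using Cauchy_Schwarz_ineq2[of u v] assms by auto

lemma inner_unit_eq_1:
  fixes u v :: "'a :: real_inner"
  assumes "norm u = 1" "norm v = 1"
  shows "u \<bullet> v = 1 \<longleftrightarrow> u = v"
proof
  assume "u \<bullet> v = 1"
  then have "(norm (u - v))\<^sup>2 = 0"
    using assms by (simp add: power2_norm_eq_inner inner_diff inner_commute norm_eq_1)
  then show "u = v" by simp
qed (use assms in \<open>simp add: norm_eq_1\<close>)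

lemma arccos_inner_triangle:
  fixes a b c :: "'a :: real_inner"
  assumes n: "norm a = 1" "norm b = 1" "norm c = 1"
  shows "arccos (a \<bullet> c) \<le> arccos (a \<bullet> b) + arccos (b \<bullet> c)"
proof (cases "arccos (a \<bullet> b) + arccos (b \<bullet> c) \<le> pi")
  case False
  then show ?thesis using arccos_ubound inner_unit_bounds n by (metis linorder_linear order_trans)
next
  case True
  define x y where "x = a \<bullet> b" and "y = b \<bullet> c"
  have xy: "-1 \<le> x" "x \<le> 1" "-1 \<le> y" "y \<le> 1"
    using inner_unit_bounds n by (auto simp: x_def y_def)
  have nn: "a \<bullet> a = 1" "b \<bullet> b = 1" "c \<bullet> c = 1" using n by (simp_all add: norm_eq_1)
  have 1: "(a - x *\<^sub>R b) \<bullet> (c - y *\<^sub>R b) = a \<bullet> c - x * y"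
    by (simp add: inner_diff nn x_def y_def inner_commute[of c b] algebra_simps)
  have 2: "norm (a - x *\<^sub>R b) = sqrt (1 - x\<^sup>2)"
    by (simp add: norm_eq_sqrt_inner inner_diff nn x_def inner_commute[of b a] power2_eq_square)
  have 3: "norm (c - y *\<^sub>R b) = sqrt (1 - y\<^sup>2)"
    by (simp add: norm_eq_sqrt_inner inner_diff nn y_def inner_commute[of c b] power2_eq_square)
  have "cos (arccos x + arccos y) = x * y - sqrt (1 - x\<^sup>2) * sqrt (1 - y\<^sup>2)"
    using xy by (simp add: cos_add sin_arccos)
  also have "\<dots> \<le> a \<bullet> c"
    using Cauchy_Schwarz_ineq2[of "a - x *\<^sub>R b" "c - y *\<^sub>R b"] unfolding 1 2 3 by linarith
  finally have "arccos (a \<bullet> c) \<le> arccos (cos (arccos x + arccos y))"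
    using inner_unit_bounds[OF n(1) n(3)] by (intro arccos_le_arccos) auto
  also have "\<dots> = arccos x + arccos y"
    using True xy by (intro arccos_cos) (auto simp: x_def y_def intro!: add_nonneg_nonneg arccos_lbound)
  finally show ?thesis by (simp add: x_def y_def)
qed

lemma quadratic_form_Cauchy_Schwarz:
  fixes A B C :: real
  assumes nonneg: "\<And>x y. 0 \<le> x\<^sup>2 * A + 2 * x * y * B + y\<^sup>2 * C"
  shows "\<bar>B\<bar> \<le> sqrt A * sqrt C"
proof -
  have A: "0 \<le> A" using nonneg[of 1 0] by simp
  have C: "0 \<le> C" using nonneg[of 0 1] by simp
  have "0 \<le> C * (A * C - B\<^sup>2)"
    using nonneg[of C "- B"] by (simp add: power2_eq_square algebra_simps)
  moreover have "B = 0" if "C = 0"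
  proof (rule ccontr)
    assume "B \<noteq> 0"
    then show False using nonneg[of 1 "- (A + 1) / (2 * B)"] that by (simp add: field_simps)
  qed
  ultimately have "B\<^sup>2 \<le> A * C"
    using C A by (cases "C = 0") (auto simp: zero_le_mult_iff)
  then show ?thesis
    by (metis real_sqrt_abs real_sqrt_le_iff real_sqrt_mult)
qed

lemma hyperboloid_triangle:
  fixes a' b' c' :: "'a :: real_inner"
  assumes pos: "a > 0" "b > 0" "c > 0"
    and hyp: "a\<^sup>2 = 1 + (norm a')\<^sup>2" "b\<^sup>2 = 1 + (norm b')\<^sup>2" "c\<^sup>2 = 1 + (norm c')\<^sup>2"
  shows "1 \<le> a * b - a' \<bullet> b'"
    and "arcosh (a * c - a' \<bullet> c') \<le> arcosh (a * b - a' \<bullet> b') + arcosh (b * c - b' \<bullet> c')"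
proof -
  have ge1: "1 \<le> x * y - x' \<bullet> y'"
    if "x > 0" "y > 0" "x\<^sup>2 = 1 + (norm x')\<^sup>2" "y\<^sup>2 = 1 + (norm y')\<^sup>2" for x y and x' y' :: 'a
  proof -
    have "(1 + norm x' * norm y')\<^sup>2 \<le> (x * y)\<^sup>2"
      using sum_squares_bound[of "norm x'" "norm y'"]
      by (simp add: power_mult_distrib that(3,4)) (simp add: power2_eq_square algebra_simps
          del: zero_le_power2 zero_le_square)
    then have "1 + norm x' * norm y' \<le> x * y"
      by (rule power2_le_imp_le) (use that in simp)
    then show ?thesis using norm_cauchy_schwarz[of x' y'] by linarith
  qed
  show "1 \<le> a * b - a' \<bullet> b'" by (rule ge1) (use pos hyp in auto)
  define \<alpha> \<beta> \<gamma> where "\<alpha> = a * b - a' \<bullet> b'" and "\<beta> = b * c - b' \<bullet> c'" and "\<gamma> = a * c - a' \<bullet> c'"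
  have g: "1 \<le> \<alpha>" "1 \<le> \<beta>" "1 \<le> \<gamma>"
    unfolding \<alpha>_def \<beta>_def \<gamma>_def by (rule ge1; use pos hyp in auto)+
  have sq: "a' \<bullet> a' = a\<^sup>2 - 1" "b' \<bullet> b' = b\<^sup>2 - 1" "c' \<bullet> c' = c\<^sup>2 - 1"
    using hyp by (simp_all add: power2_norm_eq_inner)
  have psd: "0 \<le> v' \<bullet> v' - v\<^sup>2" if "v * b = v' \<bullet> b'" for v and v' :: 'a
  proof -
    have "v\<^sup>2 * b\<^sup>2 \<le> (v' \<bullet> v') * (b' \<bullet> b')"
      using Cauchy_Schwarz_ineq[of v' b'] that by (metis power_mult_distrib)
    also have "\<dots> \<le> (v' \<bullet> v') * b\<^sup>2"
      by (intro mult_left_mono) (auto simp: sq)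
    finally show ?thesis using pos by simp
  qed
  define p p' q q' where "p = a - \<alpha> * b" and "p' = a' - \<alpha> *\<^sub>R b'"
    and "q = c - \<beta> * b" and "q' = c' - \<beta> *\<^sub>R b'"
  have ip: "a' \<bullet> b' = a * b - \<alpha>" "b' \<bullet> c' = b * c - \<beta>" "a' \<bullet> c' = a * c - \<gamma>"
    by (simp_all add: \<alpha>_def \<beta>_def \<gamma>_def)
  have comm: "b' \<bullet> a' = a' \<bullet> b'" "c' \<bullet> b' = b' \<bullet> c'" "c' \<bullet> a' = a' \<bullet> c'"
    by (simp_all add: inner_commute)
  have pb: "p * b = p' \<bullet> b'" "q * b = q' \<bullet> b'"
    unfolding p_def p'_def q_def q'_def
    by (simp_all add: inner_diff comm ip sq power2_eq_square algebra_simps)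
  have pp: "p' \<bullet> p' - p\<^sup>2 = \<alpha>\<^sup>2 - 1" and qq: "q' \<bullet> q' - q\<^sup>2 = \<beta>\<^sup>2 - 1"
    and pq: "p' \<bullet> q' - p * q = \<alpha> * \<beta> - \<gamma>"
    unfolding p_def p'_def q_def q'_def
    by (simp_all add: inner_diff comm ip sq power2_eq_square algebra_simps)
  have "\<bar>p' \<bullet> q' - p * q\<bar> \<le> sqrt (p' \<bullet> p' - p\<^sup>2) * sqrt (q' \<bullet> q' - q\<^sup>2)"
  proof (rule quadratic_form_Cauchy_Schwarz)
    fix x y :: real
    have "0 \<le> (x *\<^sub>R p' + y *\<^sub>R q') \<bullet> (x *\<^sub>R p' + y *\<^sub>R q') - (x * p + y * q)\<^sup>2"
      by (rule psd) (simp add: inner_add_left flip: pb, simp add: algebra_simps)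
    then show "0 \<le> x\<^sup>2 * (p' \<bullet> p' - p\<^sup>2) + 2 * x * y * (p' \<bullet> q' - p * q) + y\<^sup>2 * (q' \<bullet> q' - q\<^sup>2)"
      by (simp add: inner_add inner_commute[of q' p'] power2_eq_square algebra_simps)
  qed
  then have "\<gamma> \<le> \<alpha> * \<beta> + sqrt (\<alpha>\<^sup>2 - 1) * sqrt (\<beta>\<^sup>2 - 1)" unfolding pp qq pq by linarith
  also have "\<dots> = cosh (arcosh \<alpha> + arcosh \<beta>)"
    using g by (simp add: cosh_add sinh_arcosh_real)
  finally have "cosh (arcosh \<gamma>) \<le> cosh (arcosh \<alpha> + arcosh \<beta>)" using g by simp
  then show "arcosh (a * c - a' \<bullet> c') \<le> arcosh (a * b - a' \<bullet> b') + arcosh (b * c - b' \<bullet> c')"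
    unfolding \<alpha>_def[symmetric] \<beta>_def[symmetric] \<gamma>_def[symmetric]
    using g by (subst (asm) cosh_real_nonneg_le_iff) auto
qed

lemma cone_pair_dist_pos:
  assumes "\<kappa> > 0" "p \<in> cone_pairs \<kappa>" "q \<in> cone_pairs \<kappa>"
  shows "cone_pair_dist \<kappa> p q =
    arccos ((cos (sqrt \<kappa> * fst p), sin (sqrt \<kappa> * fst p) *\<^sub>R snd p) \<bullet>
            (cos (sqrt \<kappa> * fst q), sin (sqrt \<kappa> * fst q) *\<^sub>R snd q)) / sqrt \<kappa>"
  using assms inner_unit_bounds[of "snd p" "snd q"]
  by (auto simp: cone_pair_dist_def cone_side_def cone_pairs_def mult_ac)

lemma cone_pair_dist_0:
  assumes "p \<in> cone_pairs 0" "q \<in> cone_pairs 0"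
  shows "cone_pair_dist 0 p q = norm (fst p *\<^sub>R snd p - fst q *\<^sub>R snd q)"
  using assms inner_unit_bounds[of "snd p" "snd q"]
  by (auto simp: cone_pair_dist_def cone_side_def cone_pairs_def norm_eq_sqrt_inner[of "_ - _"]
      inner_diff inner_commute[of "snd q" "snd p"] norm_eq_1 power2_eq_square algebra_simps)

lemma cone_pair_dist_neg:
  assumes "\<kappa> < 0" "p \<in> cone_pairs \<kappa>" "q \<in> cone_pairs \<kappa>"
  shows "cone_pair_dist \<kappa> p q =
    arcosh (cosh (sqrt (- \<kappa>) * fst p) * cosh (sqrt (- \<kappa>) * fst q) -
            (sinh (sqrt (- \<kappa>) * fst p) *\<^sub>R snd p) \<bullet> (sinh (sqrt (- \<kappa>) * fst q) *\<^sub>R snd q))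
      / sqrt (- \<kappa>)"
  using assms inner_unit_bounds[of "snd p" "snd q"]
  by (auto simp: cone_pair_dist_def cone_side_def cone_pairs_def mult_ac)

lemma suspension_unit:
  fixes u :: "'a :: real_inner"
  assumes "norm u = 1"
  shows "norm (cos t, sin t *\<^sub>R u) = 1"
  using assms by (simp add: norm_Pair)

lemma cosh_sinh_hyperboloid:
  fixes u :: "'a :: real_inner"
  assumes "norm u = 1"
  shows "(cosh t)\<^sup>2 = 1 + (norm (sinh t *\<^sub>R u))\<^sup>2"
  using assms by (simp add: cosh_square_eq)

lemma cone_pair_dist_commute: "cone_pair_dist \<kappa> p q = cone_pair_dist \<kappa> q p"
  by (simp add: cone_pair_dist_def cone_side_def inner_commute mult.commute mult.left_commute
      add.commute)

lemma cone_pair_dist_nonneg: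
  assumes "p \<in> cone_pairs \<kappa>" "q \<in> cone_pairs \<kappa>"
  shows "0 \<le> cone_pair_dist \<kappa> p q"
proof -
  have n: "norm (snd p) = 1" "norm (snd q) = 1" using assms by (auto simp: cone_pairs_def)
  consider "\<kappa> > 0" | "\<kappa> = 0" | "\<kappa> < 0" by linarith
  then show ?thesis
  proof cases
    case 1
    then show ?thesis
      using inner_unit_bounds[OF suspension_unit[OF n(1)] suspension_unit[OF n(2)]]
      by (simp only: cone_pair_dist_pos[OF 1 assms]) (auto intro!: divide_nonneg_nonneg arccos_lbound)
  next
    case 2
    then show ?thesis using cone_pair_dist_0 assms by simp
  next
    case 3
    then show ?thesis
      using hyperboloid_triangle(1)[OF _ _ _ cosh_sinh_hyperboloid[OF n(1)]
          cosh_sinh_hyperboloid[OF n(2)] cosh_sinh_hyperboloid[OF n(2)]]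
      by (simp only: cone_pair_dist_neg[OF 3 assms])
        (auto intro!: divide_nonneg_nonneg)
  qed
qed

lemma cone_pair_dist_triangle:
  assumes "p \<in> cone_pairs \<kappa>" "q \<in> cone_pairs \<kappa>" "z \<in> cone_pairs \<kappa>"
  shows "cone_pair_dist \<kappa> p z \<le> cone_pair_dist \<kappa> p q + cone_pair_dist \<kappa> q z"
proof -
  have n: "norm (snd p) = 1" "norm (snd q) = 1" "norm (snd z) = 1"
    using assms by (auto simp: cone_pairs_def)
  consider "\<kappa> > 0" | "\<kappa> = 0" | "\<kappa> < 0" by linarith
  then show ?thesis
  proof cases
    case 1
    then show ?thesis
      using arccos_inner_triangle[OF suspension_unit[OF n(1)] suspension_unit[OF n(2)]
          suspension_unit[OF n(3)]]
      by (simp only: cone_pair_dist_pos[OF 1] assms flip: add_divide_distrib)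
        (auto intro!: divide_right_mono)
  next
    case 2
    then show ?thesis
      using cone_pair_dist_0 assms
        norm_triangle_ineq[of "fst p *\<^sub>R snd p - fst q *\<^sub>R snd q" "fst q *\<^sub>R snd q - fst z *\<^sub>R snd z"]
      by simp
  next
    case 3
    then show ?thesis
      using hyperboloid_triangle(2)[OF _ _ _ cosh_sinh_hyperboloid[OF n(1)]
          cosh_sinh_hyperboloid[OF n(2)] cosh_sinh_hyperboloid[OF n(3)]]
      by (simp only: cone_pair_dist_neg[OF 3] assms flip: add_divide_distrib)
        (auto intro!: divide_right_mono)
  qed
qed

lemma cone_pair_dist_eq_0_iff:
  assumes "p \<in> cone_pairs \<kappa>" "q \<in> cone_pairs \<kappa>"
  shows "cone_pair_dist \<kappa> p q = 0 \<longleftrightarrow> (p, q) \<in> cone_rel \<kappa>"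
proof -
  obtain r u s v where pq: "p = (r, u)" "q = (s, v)" by fastforce
  have n: "norm u = 1" "norm v = 1" and rs: "0 \<le> r" "0 \<le> s"
    using assms by (auto simp: cone_pairs_def pq)
  have rel: "(p, q) \<in> cone_rel \<kappa> \<longleftrightarrow> r = s \<and> (u = v \<or> r = 0 \<or> (\<kappa> > 0 \<and> r = pi / sqrt \<kappa>))"
    using assms by (auto simp: cone_rel_def pq)
  consider "\<kappa> > 0" | "\<kappa> = 0" | "\<kappa> < 0" by linarith
  then show ?thesis
  proof cases
    case 1
    define k where "k = sqrt \<kappa>"
    have k: "k > 0" using 1 by (simp add: k_def)
    have le: "k * r \<le> pi" "k * s \<le> pi"
      using assms 1 k by (auto simp: cone_pairs_def pq k_def[symmetric] field_simps)
    let ?a = "(cos (k * r), sin (k * r) *\<^sub>R u)" and ?b = "(cos (k * s), sin (k * s) *\<^sub>R v)"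
    have "cone_pair_dist \<kappa> p q = 0 \<longleftrightarrow> arccos (?a \<bullet> ?b) = arccos 1"
      using k by (simp only: cone_pair_dist_pos[OF 1 assms]) (simp add: pq k_def[symmetric])
    also have "\<dots> \<longleftrightarrow> ?a \<bullet> ?b = 1"
      using inner_unit_bounds[OF suspension_unit[OF n(1), of "k * r"] suspension_unit[OF n(2), of "k * s"]]
      by (intro arccos_eq_iff) auto
    also have "\<dots> \<longleftrightarrow> ?a = ?b"
      by (intro inner_unit_eq_1 suspension_unit n)
    also have "\<dots> \<longleftrightarrow> r = s \<and> (u = v \<or> sin (k * r) = 0)"
    proof -
      have "cos (k * r) = cos (k * s) \<longleftrightarrow> r = s"
        using k rs le cos_inj_pi[of "k * r" "k * s"] by auto
      then show ?thesis by auto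
    qed
    also have "sin (k * r) = 0 \<longleftrightarrow> r = 0 \<or> r = pi / k"
    proof
      assume "sin (k * r) = 0"
      then have "\<not> (0 < k * r \<and> k * r < pi)" using sin_gt_zero by fastforce
      then show "r = 0 \<or> r = pi / k" using k rs le
        by (auto simp: field_simps not_less zero_less_mult_iff)
    qed (use k in auto)
    finally show ?thesis using rel 1 by (simp add: k_def)
  next
    case 2
    have "r = s" if "r *\<^sub>R u = s *\<^sub>R v"
      using arg_cong[OF that, of norm] n rs by simp
    then show ?thesis using 2 rel assms by (auto simp: cone_pair_dist_0 pq)
  next
    case 3
    define k where "k = sqrt (- \<kappa>)"
    have k: "k > 0" using 3 by (simp add: k_def)
    let ?c = "cosh (k * r) * cosh (k * s) - (sinh (k * r) *\<^sub>R u) \<bullet> (sinh (k * s) *\<^sub>R v)"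
    have c1: "1 \<le> ?c"
      by (rule hyperboloid_triangle(1)[OF _ _ _ cosh_sinh_hyperboloid cosh_sinh_hyperboloid
            cosh_sinh_hyperboloid, OF _ _ _ n n(2)]) auto
    have "cone_pair_dist \<kappa> p q = 0 \<longleftrightarrow> arcosh ?c = 0"
      using k by (simp only: cone_pair_dist_neg[OF 3 assms]) (simp add: pq k_def[symmetric])
    also have "\<dots> \<longleftrightarrow> ?c = 1"
      using c1 by (metis arcosh_1 cosh_0 cosh_arcosh_real)
    also have "\<dots> \<longleftrightarrow> cosh (k * r - k * s) + sinh (k * r) * sinh (k * s) * (1 - u \<bullet> v) = 1"
      by (simp add: cosh_diff algebra_simps)
    also have "\<dots> \<longleftrightarrow> cosh (k * r - k * s) = 1 \<and> sinh (k * r) * sinh (k * s) * (1 - u \<bullet> v) = 0"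
    proof -
      have "0 \<le> sinh (k * r) * sinh (k * s) * (1 - u \<bullet> v)"
        using k rs inner_unit_bounds[OF n] by (intro mult_nonneg_nonneg) auto
      then show ?thesis using cosh_real_ge_1[of "k * r - k * s"] by linarith
    qed
    also have "\<dots> \<longleftrightarrow> r = s \<and> (u = v \<or> r = 0)"
    proof -
      have "cosh (k * r - k * s) = 1 \<longleftrightarrow> r = s"
        using k by (auto simp: cosh_real_one_iff simp flip: right_diff_distrib)
      then show ?thesis using k inner_unit_eq_1[OF n] by auto
    qed
    finally show ?thesis using rel 3 by simp
  qed
qed

lemma equiv_cone_rel: "equiv (cone_pairs \<kappa>) (cone_rel \<kappa>)"
  by (rule equivI) (auto simp: cone_rel_def refl_on_def sym_def trans_def)

lemma model_dist_class:
  assumes "p \<in> cone_pairs \<kappa>" "q \<in> cone_pairs \<kappa>"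
  shows "model_dist \<kappa> (cone_rel \<kappa> `` {p}) (cone_rel \<kappa> `` {q}) = cone_pair_dist \<kappa> p q"
proof -
  define p' q' where "p' = (SOME x. x \<in> cone_rel \<kappa> `` {p})" and "q' = (SOME x. x \<in> cone_rel \<kappa> `` {q})"
  have "p' \<in> cone_rel \<kappa> `` {p}" "q' \<in> cone_rel \<kappa> `` {q}"
    unfolding p'_def q'_def using assms equiv_class_self[OF equiv_cone_rel] by (metis someI)+
  then have rel: "(p, p') \<in> cone_rel \<kappa>" "(q, q') \<in> cone_rel \<kappa>" by auto
  then have mem: "p' \<in> cone_pairs \<kappa>" "q' \<in> cone_pairs \<kappa>" by (auto simp: cone_rel_def)
  have z: "cone_pair_dist \<kappa> p p' = 0" "cone_pair_dist \<kappa> q q' = 0"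
    using rel mem assms cone_pair_dist_eq_0_iff by auto
  have "cone_pair_dist \<kappa> p' q' = cone_pair_dist \<kappa> p q"
    using cone_pair_dist_triangle[of p' \<kappa> p q'] cone_pair_dist_triangle[of p \<kappa> q q']
      cone_pair_dist_triangle[of p \<kappa> p' q] cone_pair_dist_triangle[of p' \<kappa> q' q]
      z mem assms cone_pair_dist_commute[of \<kappa> p p'] cone_pair_dist_commute[of \<kappa> q q'] by linarith
  then show ?thesis
    using assms by (simp add: model_dist_def p'_def q'_def model_points_def quotientI)
qed

lemma model_points_cases:
  assumes "P \<in> model_points \<kappa>"
  obtains p where "p \<in> cone_pairs \<kappa>" "P = cone_rel \<kappa> `` {p}"
  using assms unfolding model_points_def by (rule quotientE)

lemma Metric_space_model: "Metric_space (model_points \<kappa>) (model_dist \<kappa>)"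
proof
  show "0 \<le> model_dist \<kappa> P Q" for P Q
  proof (cases "P \<in> model_points \<kappa> \<and> Q \<in> model_points \<kappa>")
    case True
    then show ?thesis by (metis model_points_cases model_dist_class cone_pair_dist_nonneg)
  qed (auto simp: model_dist_def)
  show "model_dist \<kappa> P Q = model_dist \<kappa> Q P" for P Q
    by (simp add: model_dist_def cone_pair_dist_commute)
  fix P Q assume P: "P \<in> model_points \<kappa>" and Q: "Q \<in> model_points \<kappa>"
  obtain p where p: "p \<in> cone_pairs \<kappa>" "P = cone_rel \<kappa> `` {p}"
    using P by (rule model_points_cases)
  obtain q where q: "q \<in> cone_pairs \<kappa>" "Q = cone_rel \<kappa> `` {q}"
    using Q by (rule model_points_cases)
  show "model_dist \<kappa> P Q = 0 \<longleftrightarrow> P = Q"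
    using p q by (simp add: model_dist_class cone_pair_dist_eq_0_iff eq_equiv_class_iff[OF equiv_cone_rel])
  fix R assume R: "R \<in> model_points \<kappa>"
  obtain r where r: "r \<in> cone_pairs \<kappa>" "R = cone_rel \<kappa> `` {r}"
    using R by (rule model_points_cases)
  show "model_dist \<kappa> P R \<le> model_dist \<kappa> P Q + model_dist \<kappa> Q R"
    using p q r by (simp add: model_dist_class cone_pair_dist_triangle)
qed

lemma mspace_model_space [simp]: "mspace (model_space \<kappa>) = model_points \<kappa>"
  unfolding model_space_def by (rule Metric_space.mspace_metric[OF Metric_space_model])

lemma mdist_model_space [simp]: "mdist (model_space \<kappa>) = model_dist \<kappa>"
  unfolding model_space_def by (rule Metric_space.mdist_metric[OF Metric_space_model])

end

theory Submission
  imports Defs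
begin

text \<open>
  Put \<open>\<Phi>(y, z) = sn d(p, y) sn d(p, z) cos \<angle>(p; y, z)\<close>. For nonnegative weights the quadratic form
  \<open>\<Sum> \<mu>\<^sub>i \<mu>\<^sub>j \<Phi>(x\<^sub>i, x\<^sub>j)\<close> is nonnegative (Lang, Schroeder and Sturm), and it vanishes for the positive weights
  \<open>\<mu>\<^sub>i = l\<^sub>i d(p, x\<^sub>i) / sn d(p, x\<^sub>i)\<close>. Moving the weights slightly, the matrix \<open>\<Phi>(x\<^sub>i, x\<^sub>j)\<close> is
  positive semidefinite, hence the Gram matrix of vectors of Hilbert space with \<open>\<Sum> \<mu>\<^sub>i V\<^sub>i = 0\<close>; these give the
  directions of the embedded segments \<open>p x\<^sub>i\<close>. As the \<open>V\<^sub>i\<close> are balanced, an inequality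
  \<open>\<Phi>(z, x\<^sub>i) \<le> v \<bullet> V\<^sub>i\<close> for all \<open>i\<close> forces equality. Therefore a point whose distances to the segments
  \<open>p x\<^sub>i\<close> near \<open>p\<close> are those of a model point is determined by them, points between two such points are
  again of this kind as long as their triangle with \<open>p\<close> has perimeter less than \<open>2 pi / sqrt \<kappa>\<close>, and a
  maximal isometric correspondence containing the segments contains everything they generate.

  Since \<open>X\<close> need not be geodesic, the argument takes place in an ultrapower of \<open>X\<close>. A point of the
  ultrapower between two points of the complete space \<open>X\<close> lies in \<open>X\<close> whenever it is unique.
\<close>

text \<open>The proof is a sandwich. \<open>comp\<close> bounds the distances from a point of a
  segment from below by those of the model. The bound from above comes from the Lang-Schroeder-Sturm
  inequality for two points with model vectors v and v', when the weights of the base points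
  represent -(v + v'). Such weights can be taken nonnegative because the base vectors satisfy a
  relation with positive coefficients and v, v' stay in their span; this is why span membership is
  carried along everywhere. Both bounds need triangles of perimeter less than 2 pi / sqrt \<kappa>,
  and for \<kappa> > 0 this restriction shapes most of the work: points are compared with base
  points close to p only, triangles that are too large are avoided by moving a vertex slightly, and
  the set generated by the admissible pairs is convex only after taking its closure. That closure is
  the hull on both sides: it contains the hull because it is closed and convex, and it is contained
  in it because between-points of admissible pairs are unique, so that the geodesic segments used in
  the hull are unique too.\<close>

section \<open>Trigonometry of constant curvature\<close>

text \<open>This is \<open>(1 - cs \<kappa> r) / \<kappa>\<close>, written so that it makes sense for \<open>\<kappa> = 0\<close>.\<close>
definition md :: "real \<Rightarrow> real \<Rightarrow> real" where
  "md \<kappa> r = 2 * (sn \<kappa> (r / 2))\<^sup>2"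

text \<open>All three conditions are void for \<kappa> \<le> 0. Below \<open>rad\<close> the
  function \<open>sn\<close> is positive; up to \<open>radc\<close>, which every distance of the
  model satisfies, \<open>md\<close> is increasing; \<open>small\<close> is the condition on
  perimeters. Twice a side is at most the perimeter, so by \<open>small_double\<close> the sides of
  a small triangle satisfy \<open>rad\<close>.\<close>

definition rad :: "real \<Rightarrow> real \<Rightarrow> bool" where
  "rad \<kappa> r \<longleftrightarrow> (\<kappa> > 0 \<longrightarrow> r < pi / sqrt \<kappa>)"

definition radc :: "real \<Rightarrow> real \<Rightarrow> bool" where
  "radc \<kappa> r \<longleftrightarrow> (\<kappa> > 0 \<longrightarrow> r \<le> pi / sqrt \<kappa>)"

definition small :: "real \<Rightarrow> real \<Rightarrow> bool" where
  "small \<kappa> r \<longleftrightarrow> (\<kappa> > 0 \<longrightarrow> r < 2 * pi / sqrt \<kappa>)"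

lemma small_mono: "small \<kappa> r \<Longrightarrow> s \<le> r \<Longrightarrow> small \<kappa> s"
  and rad_mono: "rad \<kappa> r \<Longrightarrow> s \<le> r \<Longrightarrow> rad \<kappa> s"
  and radc_mono: "radc \<kappa> r \<Longrightarrow> s \<le> r \<Longrightarrow> radc \<kappa> s"
  and rad_radc: "rad \<kappa> r \<Longrightarrow> radc \<kappa> r"
  and small_double [simp]: "small \<kappa> (2 * r) \<longleftrightarrow> rad \<kappa> r"
  by (auto simp: small_def rad_def radc_def)

lemma sn_pos: "\<kappa> > 0 \<Longrightarrow> sn \<kappa> r = sin (sqrt \<kappa> * r) / sqrt \<kappa>"
  and sn_neg: "\<kappa> < 0 \<Longrightarrow> sn \<kappa> r = sinh (sqrt (- \<kappa>) * r) / sqrt (- \<kappa>)"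
  and sn_zero: "sn 0 r = r"
  by (auto simp: sn_def)

lemma md_pos:
  assumes "\<kappa> > 0"
  shows "md \<kappa> r = (1 - cos (sqrt \<kappa> * r)) / \<kappa>"
  using assms cos_double_sin[of "sqrt \<kappa> * r / 2"]
  by (simp add: md_def sn_def power_divide field_simps)

lemma md_neg:
  assumes "\<kappa> < 0"
  shows "md \<kappa> r = (1 - cosh (sqrt (- \<kappa>) * r)) / \<kappa>"
proof -
  have "cosh (sqrt (- \<kappa>) * r) = 2 * (sinh (sqrt (- \<kappa>) * r / 2))\<^sup>2 + 1"
    using cosh_double[of "sqrt (- \<kappa>) * r / 2"] by (simp add: cosh_square_eq)
  then show ?thesis using assms by (simp add: md_def sn_def power_divide field_simps)
qed

lemma md_zero: "md 0 r = r\<^sup>2 / 2"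
  by (simp add: md_def sn_def power_divide)

lemma sn_0 [simp]: "sn \<kappa> 0 = 0" and md_0 [simp]: "md \<kappa> 0 = 0"
  by (auto simp: sn_def md_def)

lemma sn_minus [simp]: "sn \<kappa> (- r) = - sn \<kappa> r" and md_minus [simp]: "md \<kappa> (- r) = md \<kappa> r"
  by (auto simp: sn_def md_def)

lemma md_nonneg [simp]: "0 \<le> md \<kappa> r"
  by (simp add: md_def)

lemma cs_eq: "\<kappa> \<noteq> 0 \<Longrightarrow> cs \<kappa> r = 1 - \<kappa> * md \<kappa> r"
  by (cases "\<kappa> > 0") (auto simp: cs_pos cs_neg md_pos md_neg)

text \<open>The addition theorem with 1 - \<kappa> \<open>md\<close> in the role of
  \<open>cs\<close>. In this form it includes \<kappa> = 0, so that together with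
  \<open>sn_sq\<close> and \<open>md_add\<close> it spares most later computations a case split on
  the sign of \<kappa>.\<close>

lemma sn_add: "sn \<kappa> (a + b) = sn \<kappa> a * (1 - \<kappa> * md \<kappa> b) + (1 - \<kappa> * md \<kappa> a) * sn \<kappa> b"
proof -
  consider "\<kappa> > 0" | "\<kappa> = 0" | "\<kappa> < 0" by linarith
  then show ?thesis
    by cases (auto simp: sn_pos sn_neg sn_zero md_pos md_neg sin_add sinh_add distrib_left add_divide_distrib)
qed

lemma sn_sq: "(sn \<kappa> a)\<^sup>2 = md \<kappa> a * (2 - \<kappa> * md \<kappa> a)"
proof -
  consider "\<kappa> > 0" | "\<kappa> = 0" | "\<kappa> < 0" by linarith
  then show ?thesis
  proof cases
    case 1
    then show ?thesis
      by (simp add: sn_pos md_pos power_divide sin_squared_eq) (simp add: power2_eq_square field_simps)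
  next
    case 2
    then show ?thesis by (simp add: sn_zero md_zero)
  next
    case 3
    then show ?thesis
      by (simp add: sn_neg md_neg power_divide sinh_square_eq) (simp add: power2_eq_square field_simps)
  qed
qed

lemma md_add: "md \<kappa> (a + b) = md \<kappa> a + md \<kappa> b - \<kappa> * md \<kappa> a * md \<kappa> b + sn \<kappa> a * sn \<kappa> b"
proof -
  consider "\<kappa> > 0" | "\<kappa> = 0" | "\<kappa> < 0" by linarith
  then show ?thesis
  proof cases
    case 1
    then show ?thesis
      by (simp add: sn_pos md_pos cos_add distrib_left) (simp add: field_simps)
  next
    case 2
    then show ?thesis by (simp add: sn_zero md_zero power2_eq_square field_simps)
  next
    case 3
    then show ?thesis
      by (simp add: sn_neg md_neg cosh_add distrib_left) (simp add: field_simps)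
  qed
qed

lemma sn_diff: "sn \<kappa> (a - b) = sn \<kappa> a * (1 - \<kappa> * md \<kappa> b) - (1 - \<kappa> * md \<kappa> a) * sn \<kappa> b"
  using sn_add[of \<kappa> a "- b"] by simp

lemma md_diff: "md \<kappa> (a - b) = md \<kappa> a + md \<kappa> b - \<kappa> * md \<kappa> a * md \<kappa> b - sn \<kappa> a * sn \<kappa> b"
  using md_add[of \<kappa> a "- b"] by simp

lemma sn_gt_0: assumes "0 < r" "rad \<kappa> r" shows "0 < sn \<kappa> r"
proof -
  consider "\<kappa> > 0" | "\<kappa> = 0" | "\<kappa> < 0" by linarith
  then show ?thesis
  proof cases
    case 1
    then have "0 < sqrt \<kappa> * r" "sqrt \<kappa> * r < pi"
      using assms by (auto simp: rad_def field_simps)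
    then show ?thesis using 1 by (simp add: sn_pos sin_gt_zero)
  qed (use assms in \<open>auto simp: sn_zero sn_neg\<close>)
qed

lemma sn_ge_0: assumes "0 \<le> r" "radc \<kappa> r" shows "0 \<le> sn \<kappa> r"
proof -
  consider "\<kappa> > 0" | "\<kappa> = 0" | "\<kappa> < 0" by linarith
  then show ?thesis
  proof cases
    case 1
    then have "0 \<le> sqrt \<kappa> * r" "sqrt \<kappa> * r \<le> pi"
      using assms by (auto simp: radc_def field_simps)
    then show ?thesis using 1 by (simp add: sn_pos sin_ge_zero)
  qed (use assms in \<open>auto simp: sn_zero sn_neg\<close>)
qed

lemma md_strict_mono: assumes "0 \<le> r" "r < s" "radc \<kappa> s" shows "md \<kappa> r < md \<kappa> s"
proof -
  consider "\<kappa> > 0" | "\<kappa> = 0" | "\<kappa> < 0" by linarith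
  then show ?thesis
  proof cases
    case 1
    then have "0 \<le> sqrt \<kappa> * r" "sqrt \<kappa> * r < sqrt \<kappa> * s" "sqrt \<kappa> * s \<le> pi"
      using assms by (auto simp: radc_def field_simps)
    then have "cos (sqrt \<kappa> * s) < cos (sqrt \<kappa> * r)" by (intro cos_monotone_0_pi) auto
    then show ?thesis using 1 by (simp add: md_pos divide_strict_right_mono)
  next
    case 2
    then show ?thesis using assms by (simp add: md_zero power_strict_mono)
  next
    case 3
    then have "cosh (sqrt (-\<kappa>) * r) < cosh (sqrt (-\<kappa>) * s)"
      using assms by (intro cosh_real_strict_mono) auto
    then show ?thesis using 3 by (simp add: md_neg divide_strict_right_mono_neg)
  qed
qed

lemma md_mono: "0 \<le> r \<Longrightarrow> r \<le> s \<Longrightarrow> radc \<kappa> s \<Longrightarrow> md \<kappa> r \<le> md \<kappa> s"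
  using md_strict_mono[of r s \<kappa>] by (cases "r = s") auto

lemma md_le_imp_le: "md \<kappa> r \<le> md \<kappa> s \<Longrightarrow> radc \<kappa> r \<Longrightarrow> 0 \<le> s \<Longrightarrow> r \<le> s"
  using md_strict_mono[of s r \<kappa>] by fastforce

lemma md_inj: "md \<kappa> r = md \<kappa> s \<Longrightarrow> radc \<kappa> r \<Longrightarrow> radc \<kappa> s \<Longrightarrow> 0 \<le> r \<Longrightarrow> 0 \<le> s \<Longrightarrow> r = s"
  using md_le_imp_le[of \<kappa> r s] md_le_imp_le[of \<kappa> s r] by auto

lemma md_eq_0_iff: "radc \<kappa> r \<Longrightarrow> 0 \<le> r \<Longrightarrow> md \<kappa> r = 0 \<longleftrightarrow> r = 0"
  using md_inj[of \<kappa> r 0] by (auto simp: radc_def)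

lemma md_gt_0: "0 < r \<Longrightarrow> radc \<kappa> r \<Longrightarrow> 0 < md \<kappa> r"
  using md_strict_mono[of 0 r \<kappa>] by simp

lemma md_reflect: "\<kappa> > 0 \<Longrightarrow> md \<kappa> (2 * pi / sqrt \<kappa> - r) = md \<kappa> r"
  by (simp add: md_pos right_diff_distrib cos_diff)

lemma continuous_on_sn: "continuous_on A (sn \<kappa>)"
proof -
  consider "\<kappa> > 0" | "\<kappa> = 0" | "\<kappa> < 0" by linarith
  then show ?thesis
    by cases (auto simp: sn_def[abs_def] intro!: continuous_intros)
qed

lemma tendsto_sn [tendsto_intros]: "(f \<longlongrightarrow> a) F \<Longrightarrow> ((\<lambda>x. sn \<kappa> (f x)) \<longlongrightarrow> sn \<kappa> a) F"
  using continuous_on_tendsto_compose[OF continuous_on_sn[of UNIV \<kappa>]] by simp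

lemma tendsto_md [tendsto_intros]: "(f \<longlongrightarrow> a) F \<Longrightarrow> ((\<lambda>x. md \<kappa> (f x)) \<longlongrightarrow> md \<kappa> a) F"
  unfolding md_def by (intro tendsto_intros) auto

lemma sn_over_id: "((\<lambda>r. sn \<kappa> r / r) \<longlongrightarrow> 1) (at 0)"
proof -
  consider "\<kappa> > 0" | "\<kappa> = 0" | "\<kappa> < 0" by linarith
  then have "(sn \<kappa> has_real_derivative 1) (at 0)"
    by cases (auto simp: sn_def[abs_def] intro!: derivative_eq_intros)
  then show ?thesis by (simp add: DERIV_def)
qed

text \<open>With the denominator cleared this says that the cosine of a comparison angle has modulus
  at most 1. By \<open>md_diff\<close> and \<open>md_add\<close> it amounts to \<open>md \<kappa> (a
  - b) \<le> md \<kappa> c \<le> md \<kappa> (a + b)\<close>. The perimeter enters in the second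
  inequality: past pi / sqrt \<kappa> the function \<open>md\<close> decreases, but then c is less
  than 2 pi / sqrt \<kappa> - (a + b), where \<open>md\<close> has the value it has at a +
  b.\<close>

lemma cone_angle_bounds:
  assumes "0 \<le> a" "0 \<le> b" "\<bar>a - b\<bar> \<le> c" "c \<le> a + b" "small \<kappa> (a + b + c)"
  shows "\<bar>md \<kappa> a + md \<kappa> b - md \<kappa> c - \<kappa> * md \<kappa> a * md \<kappa> b\<bar> \<le> sn \<kappa> a * sn \<kappa> b"
proof -
  have "small \<kappa> (2 * c)" by (rule small_mono[OF assms(5)]) (use assms in auto)
  then have c: "radc \<kappa> c" by (simp add: rad_radc)
  have "md \<kappa> (a - b) = md \<kappa> \<bar>a - b\<bar>" by (simp add: abs_if) (metis md_minus minus_diff_eq)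
  also have "\<dots> \<le> md \<kappa> c" using c assms by (intro md_mono) auto
  finally have 1: "md \<kappa> (a - b) \<le> md \<kappa> c" .
  have 2: "md \<kappa> c \<le> md \<kappa> (a + b)"
  proof (cases "radc \<kappa> (a + b)")
    case True
    then show ?thesis using assms by (intro md_mono) auto
  next
    case False
    then have k: "\<kappa> > 0" "a + b > pi / sqrt \<kappa>" by (auto simp: radc_def)
    have "md \<kappa> c \<le> md \<kappa> (2 * pi / sqrt \<kappa> - (a + b))"
      using assms k by (intro md_mono) (auto simp: small_def radc_def)
    then show ?thesis using md_reflect k by simp
  qed
  show ?thesis using 1 2 by (simp add: md_add md_diff abs_le_iff)
qed

section \<open>The Lang--Schroeder--Sturm inequality\<close>

text \<open>The axiom \<open>comp\<close> compares the distance from \<open>c\<close> to a point \<open>z\<close> of the segment \<open>ab\<close> with the distance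
  in the \<open>\<kappa>\<close>-plane, where equality holds. Only a pseudometric is required, so that
  sequences can be used in place of their classes modulo an ultrafilter.\<close>
locale cbb =
  fixes \<kappa> :: real and S :: "'b set" and d :: "'b \<Rightarrow> 'b \<Rightarrow> real"
  assumes nonneg [simp]: "0 \<le> d x y"
    and sym: "d x y = d y x"
    and refl0 [simp]: "d x x = 0"
    and tri: "x \<in> S \<Longrightarrow> y \<in> S \<Longrightarrow> z \<in> S \<Longrightarrow> d x z \<le> d x y + d y z"
    and betw: "x \<in> S \<Longrightarrow> y \<in> S \<Longrightarrow> 0 \<le> s \<Longrightarrow> s \<le> d x y \<Longrightarrow> \<exists>z\<in>S. d x z = s \<and> d z y = d x y - s"
    and comp: "a \<in> S \<Longrightarrow> b \<in> S \<Longrightarrow> c \<in> S \<Longrightarrow> z \<in> S \<Longrightarrow> d a z + d z b = d a b \<Longrightarrow>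
      small \<kappa> (d a b + d b c + d c a) \<Longrightarrow>
      sn \<kappa> (d z b) * md \<kappa> (d a c) + sn \<kappa> (d a z) * md \<kappa> (d b c)
      \<le> sn \<kappa> (d a b) * md \<kappa> (d z c) + sn \<kappa> (d z b) * md \<kappa> (d a z) + sn \<kappa> (d a z) * md \<kappa> (d z b)"
begin

text \<open>The law of cosines solved for the product \<open>sn\<close> \<open>sn\<close>
  \<open>cos\<close>, without the division: it stays meaningful when x or y coincides with p, and it
  is the quantity that becomes an inner product of vectors.\<close>

definition Phi :: "'b \<Rightarrow> 'b \<Rightarrow> 'b \<Rightarrow> real" where
  "Phi p x y = md \<kappa> (d p x) + md \<kappa> (d p y) - md \<kappa> (d x y) - \<kappa> * md \<kappa> (d p x) * md \<kappa> (d p y)"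

lemma Phi_sym: "Phi p x y = Phi p y x"
  using sym[of x y] by (simp add: Phi_def)

lemma Phi_self: "Phi p x x = (sn \<kappa> (d p x))\<^sup>2"
  by (simp add: Phi_def sn_sq) (simp add: power2_eq_square algebra_simps)

lemma dist_eq_of_zero:
  assumes "x \<in> S" "y \<in> S" "z \<in> S" "d x y = 0"
  shows "d x z = d y z"
  using tri[of x y z] tri[of y x z] assms sym[of x y] by linarith

lemma Phi_zero: "p \<in> S \<Longrightarrow> x \<in> S \<Longrightarrow> y \<in> S \<Longrightarrow> d p x = 0 \<Longrightarrow> Phi p x y = 0"
  using dist_eq_of_zero[of p x y] by (simp add: Phi_def)

lemma Phi_bound:
  assumes "p \<in> S" "x \<in> S" "y \<in> S" "small \<kappa> (d p x + d p y + d x y)"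
  shows "\<bar>Phi p x y\<bar> \<le> sn \<kappa> (d p x) * sn \<kappa> (d p y)"
  unfolding Phi_def
  using tri[of p x y] tri[of p y x] tri[of x p y] sym[of x y] sym[of x p] assms
  by (intro cone_angle_bounds) auto

text \<open>Monotonicity of comparison angles: the cosine of the angle at p grows as a point moves
  away from p along a segment. It is \<open>comp\<close> for z between p and x seen from y,
  rewritten by two trigonometric identities, and kept free of denominators.\<close>

lemma Phi_ray_mono:
  assumes S: "p \<in> S" "x \<in> S" "y \<in> S" "z \<in> S"
    and z: "d p z + d z x = d p x" and sm: "small \<kappa> (d p x + d p y + d x y)"
  shows "sn \<kappa> (d p x) * Phi p z y \<le> sn \<kappa> (d p z) * Phi p x y"
proof -
  define s t where "s = d p z" and "t = d z x"
  have a: "d p x = s + t" using z by (simp add: s_def t_def)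
  have "small \<kappa> (d p x + d x y + d y p)" using sm sym[of y p] by (simp add: add_ac)
  from comp[OF S(1,2,3,4) z this]
  have *: "sn \<kappa> t * md \<kappa> (d p y) + sn \<kappa> s * md \<kappa> (d x y)
      \<le> sn \<kappa> (s + t) * md \<kappa> (d z y) + sn \<kappa> t * md \<kappa> s + sn \<kappa> s * md \<kappa> t"
    by (simp only: a s_def[symmetric] t_def[symmetric])
  have 1: "sn \<kappa> (s + t) * (1 - \<kappa> * md \<kappa> s) - sn \<kappa> t = sn \<kappa> s * (1 - \<kappa> * md \<kappa> (s + t))"
    using sn_diff[of \<kappa> "s + t" s] by (simp add: algebra_simps)
  \<comment> \<open>This is \<open>comp\<close> with equality for a degenerate triangle whose third
    vertex is an end point of the segment.\<close>
  have 2: "sn \<kappa> (s + t) * md \<kappa> s + sn \<kappa> t * md \<kappa> s + sn \<kappa> s * md \<kappa> t = sn \<kappa> s * md \<kappa> (s + t)"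
  proof -
    have "sn \<kappa> (s + t) * md \<kappa> s + sn \<kappa> t * md \<kappa> s + sn \<kappa> s * md \<kappa> t - sn \<kappa> s * md \<kappa> (s + t)
      = sn \<kappa> t * (md \<kappa> s * (2 - \<kappa> * md \<kappa> s) - (sn \<kappa> s)\<^sup>2)"
      by (simp add: sn_add md_add power2_eq_square algebra_simps)
    then show ?thesis by (simp only: sn_sq) simp
  qed
  have "sn \<kappa> (s + t) * Phi p z y - sn \<kappa> s * Phi p x y =
    (sn \<kappa> t * md \<kappa> (d p y) + sn \<kappa> s * md \<kappa> (d x y)) - sn \<kappa> (s + t) * md \<kappa> (d z y)
    + (sn \<kappa> (s + t) * md \<kappa> s - sn \<kappa> s * md \<kappa> (s + t))
    + md \<kappa> (d p y) * (sn \<kappa> (s + t) * (1 - \<kappa> * md \<kappa> s) - sn \<kappa> t - sn \<kappa> s * (1 - \<kappa> * md \<kappa> (s + t)))"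
    unfolding Phi_def a s_def[symmetric] by (simp add: algebra_simps)
  also have "\<dots> \<le> 0" using * 1 2 by simp
  finally show ?thesis by (simp add: a s_def)
qed

text \<open>\<open>comp\<close> at a midpoint, divided by 2 \<open>sn \<kappa> h\<close>; the factor
  on the right comes from the double angle formula for \<open>sn \<kappa> (2 * h)\<close>.\<close>

lemma midpoint_comp:
  assumes S: "u \<in> S" "v \<in> S" "m \<in> S" "z \<in> S" and m: "d u m = h" "d m v = h" "d u v = 2 * h"
    and sm: "small \<kappa> (d u v + d v z + d z u)"
  shows "(md \<kappa> (d u z) + md \<kappa> (d v z)) / 2 \<le> (1 - \<kappa> * md \<kappa> h) * md \<kappa> (d m z) + md \<kappa> h"
proof (cases "h = 0")
  case True
  then have "d u z = d m z" "d m z = d v z" using dist_eq_of_zero[of u m z] dist_eq_of_zero[of m v z] m S by simp_all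
  then show ?thesis using True by simp
next
  case False
  have h: "0 < h" using False m nonneg[of u m] by simp
  have "2 * d u v \<le> d u v + d v z + d z u" using tri[of u z v] S sym[of v z] sym[of u z] by linarith
  then have "small \<kappa> (2 * d u v)" by (rule small_mono[OF sm])
  then have "rad \<kappa> (d u v)" by simp
  then have "rad \<kappa> h" using h m by (elim rad_mono) simp
  then have s: "0 < sn \<kappa> h" using h sn_gt_0 by simp
  have "sn \<kappa> h * md \<kappa> (d u z) + sn \<kappa> h * md \<kappa> (d v z)
      \<le> sn \<kappa> (h + h) * md \<kappa> (d m z) + sn \<kappa> h * md \<kappa> h + sn \<kappa> h * md \<kappa> h"
    using comp[OF S(1,2,4,3)] m sm by simp
  then have "sn \<kappa> h * ((md \<kappa> (d u z) + md \<kappa> (d v z)) / 2)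
      \<le> sn \<kappa> h * ((1 - \<kappa> * md \<kappa> h) * md \<kappa> (d m z) + md \<kappa> h)"
    by (simp only: sn_add) (simp add: field_simps)
  then show ?thesis using s by simp
qed

text \<open>Up to an error, \<open>Phi\<close> at a midpoint is at most the mean of its values at
  the ends. The error depends on z through a bounded factor only, and it is of second order when u,
  v, m approach p, whereas \<open>Phi\<close> is of first order there.\<close>

lemma Phi_midpoint:
  assumes S: "p \<in> S" "u \<in> S" "v \<in> S" "m \<in> S" "z \<in> S" and m: "d u m = h" "d m v = h" "d u v = 2 * h"
    and sm: "small \<kappa> (d u v + d v z + d z u)"
  shows "(1 - \<kappa> * md \<kappa> h) * Phi p m z \<le> (Phi p u z + Phi p v z) / 2 +
    (1 - \<kappa> * md \<kappa> (d p z)) * ((1 - \<kappa> * md \<kappa> h) * md \<kappa> (d p m) + md \<kappa> h - (md \<kappa> (d p u) + md \<kappa> (d p v)) / 2)"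
  using midpoint_comp[OF S(2-5) m sm] unfolding Phi_def by (simp add: field_simps)

lemma small_shrink:
  assumes "p \<in> S" "x \<in> S" "y \<in> S" "z \<in> S" "d p z + d z x = d p x" "small \<kappa> (d p x + d p y + d x y)"
  shows "small \<kappa> (d p z + d p y + d z y)"
  using small_mono[OF assms(6)] tri[of z x y] assms(1-5) by force

lemma Phi_ray_ratio:
  assumes S: "p \<in> S" "x \<in> S" "y \<in> S" "z \<in> S"
    and z: "d p z + d z x = d p x" and sm: "small \<kappa> (d p x + d p y + d x y)"
    and pos: "0 < d p z" "rad \<kappa> (d p x)"
  shows "Phi p z y / sn \<kappa> (d p z) \<le> Phi p x y / sn \<kappa> (d p x)"
proof -
  have "d p z \<le> d p x" using z nonneg[of z x] by linarith
  then have "0 < sn \<kappa> (d p z)" "0 < sn \<kappa> (d p x)"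
    using pos rad_mono by (auto intro!: sn_gt_0)
  then show ?thesis using Phi_ray_mono[OF S z sm] by (simp add: field_simps)
qed

text \<open>Segments need not be unique, so every point is chosen between p and the preceding one.
  This keeps \<open>Phi_ray_mono\<close> applicable from each point to the next.\<close>

lemma halving_sequence:
  assumes "p \<in> S" "x \<in> S" "0 \<le> a" "a \<le> d p x"
  obtains u where "\<And>n. u n \<in> S" "\<And>n. d p (u n) = a / 2 ^ n" "\<And>n. d p (u n) + d (u n) x = d p x"
    "\<And>n. d p (u (Suc n)) + d (u (Suc n)) (u n) = d p (u n)"
proof -
  define P where "P = (\<lambda>n z. z \<in> S \<and> d p z = a / 2 ^ n \<and> d p z + d z x = d p x)"
  have "\<exists>u. \<forall>n. P n (u n) \<and> d p (u (Suc n)) + d (u (Suc n)) (u n) = d p (u n)"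
  proof (rule dependent_nat_choice)
    show "\<exists>z. P 0 z" using betw[OF assms] assms by (auto simp: P_def)
  next
    fix z n assume z: "P n z"
    have "a / 2 ^ Suc n \<le> a / 2 ^ n" using assms by (simp add: field_simps)
    then obtain w where w: "w \<in> S" "d p w = a / 2 ^ Suc n" "d w z = d p z - a / 2 ^ Suc n"
      using betw[of p z "a / 2 ^ Suc n"] assms z by (auto simp: P_def)
    have "d p w + d w x = d p x"
      using tri[of p w x] tri[of w z x] assms w z by (auto simp: P_def)
    then show "\<exists>w. P (Suc n) w \<and> d p w + d w z = d p z"
      using w by (auto simp: P_def)
  qed
  then obtain u where u: "\<And>n. P n (u n)" "\<And>n. d p (u (Suc n)) + d (u (Suc n)) (u n) = d p (u n)"
    by blast
  have A: "u n \<in> S" "d p (u n) = a / 2 ^ n" "d p (u n) + d (u n) x = d p x" for n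
    using u(1)[of n] unfolding P_def by blast+
  show ?thesis by (rule that[OF A u(2)])
qed

end

section \<open>First and second order behaviour at small scales\<close>

lemma eventually_small:
  assumes "(f \<longlongrightarrow> L) F" "small \<kappa> L"
  shows "\<forall>\<^sub>F x in F. small \<kappa> (f x)"
  using assms order_tendstoD(2)[OF assms(1)] by (cases "\<kappa> > 0") (auto simp: small_def)

lemma sn_scaled:
  assumes "(a \<longlongrightarrow> 0) F" "((\<lambda>k. a k / r k) \<longlongrightarrow> A) F"
  shows "((\<lambda>k. sn \<kappa> (a k) / r k) \<longlongrightarrow> A) F"
proof -
  \<comment> \<open>The continuous extension of the quotient is used because \<open>a k\<close> may
    vanish.\<close>
  define g where "g = (\<lambda>x. if x = 0 then 1 else sn \<kappa> x / x)"
  have "(g \<longlongrightarrow> 1) (at 0)"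
    by (rule Lim_transform_eventually[OF sn_over_id[of \<kappa>]]) (auto simp: eventually_at_filter g_def)
  then have "isCont g 0" by (simp add: isCont_def g_def)
  then have "((\<lambda>k. g (a k)) \<longlongrightarrow> 1) F"
    using isCont_tendsto_compose[OF _ assms(1)] by (fastforce simp: g_def)
  from tendsto_mult[OF this assms(2)] have "((\<lambda>k. g (a k) * (a k / r k)) \<longlongrightarrow> A) F" by simp
  moreover have "g (a k) * (a k / r k) = sn \<kappa> (a k) / r k" for k by (auto simp: g_def)
  ultimately show ?thesis by (simp only:)
qed

lemma md_scaled:
  assumes "(a \<longlongrightarrow> 0) F" "((\<lambda>k. a k / r k) \<longlongrightarrow> A) F"
  shows "((\<lambda>k. md \<kappa> (a k) / (r k)\<^sup>2) \<longlongrightarrow> A\<^sup>2 / 2) F"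
proof -
  have "((\<lambda>k. sn \<kappa> (a k / 2) / r k) \<longlongrightarrow> A / 2) F"
    using tendsto_divide[OF assms(1) tendsto_const[of "2::real"]]
      tendsto_divide[OF assms(2) tendsto_const[of "2::real"]]
    by (intro sn_scaled) (auto simp: field_simps)
  then have "((\<lambda>k. 2 * (sn \<kappa> (a k / 2) / r k)\<^sup>2) \<longlongrightarrow> 2 * (A / 2)\<^sup>2) F"
    by (intro tendsto_mult[OF tendsto_const] tendsto_power)
  then show ?thesis by (simp add: md_def power_divide)
qed

context cbb
begin

lemma midpoint_size:
  assumes S: "p \<in> S" "u \<in> S" "v \<in> S" "m \<in> S" and m: "d u m = h" "d m v = h" "d u v = 2 * h"
  shows "2 * h \<le> d p u + d p v" "d p m \<le> 2 * (d p u + d p v)"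
proof -
  show 1: "2 * h \<le> d p u + d p v" using tri[of u p v] sym[of u p] S m by simp
  show "d p m \<le> 2 * (d p u + d p v)"
    using 1 tri[of p u m] S m(1) nonneg[of p u] nonneg[of p v] by (simp del: nonneg)
qed

text \<open>Replaces two weighted points by a single one: midpoints of points on the ways to \<open>x1\<close> and \<open>x2\<close> whose
  distances from \<open>p\<close> are proportional to \<open>\<mu>1 sn d(p, x1)\<close> and \<open>\<mu>2 sn d(p, x2)\<close>, rescaled as both tend to 0.\<close>
lemma LSS_merge:
  fixes z :: "nat \<Rightarrow> 'b"
  assumes S: "p \<in> S" "x1 \<in> S" "x2 \<in> S" "\<And>i. i < n \<Longrightarrow> z i \<in> S"
    and nu: "\<And>i. i < n \<Longrightarrow> 0 \<le> \<nu> i"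
    and mu: "0 < \<mu>1" "0 < \<mu>2" and pos: "0 < d p x1" "0 < d p x2"
    and sm: "rad \<kappa> (d p x1)" "rad \<kappa> (d p x2)" "small \<kappa> (d p x1 + d p x2 + d x1 x2)"
      "\<And>i. i < n \<Longrightarrow> rad \<kappa> (d p (z i))"
      "\<And>i. i < n \<Longrightarrow> small \<kappa> (d p x1 + d p (z i) + d x1 (z i))"
      "\<And>i. i < n \<Longrightarrow> small \<kappa> (d p x2 + d p (z i) + d x2 (z i))"
    and H: "\<And>m \<omega>. m \<in> S \<Longrightarrow> 0 \<le> \<omega> \<Longrightarrow> rad \<kappa> (d p m) \<Longrightarrow>
        (\<And>i. i < n \<Longrightarrow> small \<kappa> (d p m + d p (z i) + d m (z i))) \<Longrightarrow>
        0 \<le> Q + 2 * \<omega> * (\<Sum>i<n. \<nu> i * Phi p (z i) m) + \<omega>\<^sup>2 * Phi p m m"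
  shows "0 \<le> Q + 2 * (\<Sum>i<n. \<nu> i * (\<mu>1 * Phi p (z i) x1 + \<mu>2 * Phi p (z i) x2)) +
    (\<mu>1\<^sup>2 * Phi p x1 x1 + \<mu>2\<^sup>2 * Phi p x2 x2 + 2 * \<mu>1 * \<mu>2 * Phi p x1 x2)"
proof -
  define a1 a2 where "a1 = d p x1" and "a2 = d p x2"
  have s1: "0 < sn \<kappa> a1" and s2: "0 < sn \<kappa> a2"
    using pos sm by (auto simp: a1_def a2_def intro: sn_gt_0)
  define \<alpha> \<beta> where "\<alpha> = \<mu>1 * sn \<kappa> a1" and "\<beta> = \<mu>2 * sn \<kappa> a2"
  have ab: "0 < \<alpha>" "0 < \<beta>" using s1 s2 mu by (auto simp: \<alpha>_def \<beta>_def)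
  \<comment> \<open>The largest scale at which both points still lie on their segments.\<close>
  define \<rho> where "\<rho> = min (a1 / \<alpha>) (a2 / \<beta>)"
  have rho: "0 < \<rho>" "\<alpha> * \<rho> \<le> a1" "\<beta> * \<rho> \<le> a2"
    using ab pos by (auto simp: \<rho>_def a1_def a2_def min_def field_simps)
  obtain u where u: "\<And>n. u n \<in> S" "\<And>n. d p (u n) = \<alpha> * \<rho> / 2 ^ n" "\<And>n. d p (u n) + d (u n) x1 = d p x1"
    "\<And>n. d p (u (Suc n)) + d (u (Suc n)) (u n) = d p (u n)"
    using halving_sequence[of p x1 "\<alpha> * \<rho>"] S ab rho a1_def by (metis mult_nonneg_nonneg less_imp_le)
  obtain v where v: "\<And>n. v n \<in> S" "\<And>n. d p (v n) = \<beta> * \<rho> / 2 ^ n" "\<And>n. d p (v n) + d (v n) x2 = d p x2"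
    "\<And>n. d p (v (Suc n)) + d (v (Suc n)) (v n) = d p (v n)"
    using halving_sequence[of p x2 "\<beta> * \<rho>"] S ab rho a2_def by (metis mult_nonneg_nonneg less_imp_le)
  define r where "r = (\<lambda>k::nat. \<rho> / 2 ^ Suc k)"
  have r0: "0 < r k" for k using rho by (simp add: r_def)
  have rlim: "r \<longlonglongrightarrow> 0"
    using LIMSEQ_divide_realpow_zero[of 2 \<rho>] LIMSEQ_Suc[of "\<lambda>k. \<rho> / 2 ^ k" 0] by (simp add: r_def)
  have du0: "d p (u (Suc k)) = \<alpha> * r k" "d p (u k) = 2 * (\<alpha> * r k)"
    and dv: "d p (v (Suc k)) = \<beta> * r k" for k
    using u(2)[of k] u(2)[of "Suc k"] v(2)[of "Suc k"] by (auto simp: r_def)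
  \<comment> \<open>As \<open>r k\<close> is \<rho> / 2 ^ (k + 1), the point
    \<open>u (Suc k)\<close> is a midpoint of p and \<open>u k\<close>. This midpoint provides the
    upper bound on the distance from p to \<open>m k\<close> below.\<close>
  have du: "d p (u (Suc k)) = \<alpha> * r k" "d p (u k) = 2 * (\<alpha> * r k)" "d (u (Suc k)) (u k) = \<alpha> * r k" for k
    using u(4)[of k] du0[of k] by linarith+
  have dpos: "0 < d p (u k)" "0 < d p (v k)" for k
    using u(2)[of k] v(2)[of k] ab rho by simp_all
  have drad: "rad \<kappa> (d p (u k))" "rad \<kappa> (d p (v k))" for k
  proof -
    have "d p (u k) \<le> d p x1" using u(3)[of k] nonneg[of "u k" x1] by linarith
    then show "rad \<kappa> (d p (u k))" by (rule rad_mono[OF sm(1)])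
    have "d p (v k) \<le> d p x2" using v(3)[of k] nonneg[of "v k" x2] by linarith
    then show "rad \<kappa> (d p (v k))" by (rule rad_mono[OF sm(2)])
  qed
  have duv_small: "small \<kappa> (d p (u k) + d p x2 + d (u k) x2)" for k
    by (rule small_shrink[OF S(1,2,3) u(1,3) sm(3)])
  have duv_small': "small \<kappa> (d p (v l) + d p (u k) + d (v l) (u k))" for k l
    by (rule small_shrink[OF S(1,3) u(1) v(1,3)]) (use duv_small[of k] sym in \<open>simp add: add_ac\<close>)

  \<comment> \<open>The cosine of the comparison angle at p. It decreases as either point moves
    towards p, hence has a limit along the diagonal.\<close>
  define G where "G = (\<lambda>x y. Phi p x y / (sn \<kappa> (d p x) * sn \<kappa> (d p y)))"
  have sn_u: "0 < sn \<kappa> (d p (u k))" and sn_v: "0 < sn \<kappa> (d p (v k))" for k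
    using dpos drad by (auto intro: sn_gt_0)
  have G_u: "G (u (Suc k)) (v l) \<le> G (u k) (v l)" for k l
    using Phi_ray_ratio[OF S(1) u(1)[of k] v(1)[of l] u(1)[of "Suc k"] u(4)[of k] _ dpos(1) drad(1)]
      duv_small'[of l k] sym[of "u k" "v l"] sn_v[of l]
    by (simp add: G_def add_ac divide_right_mono flip: divide_divide_eq_left)
  have G_v: "G (u k) (v (Suc l)) \<le> G (u k) (v l)" for k l
  proof -
    have "Phi p (v (Suc l)) (u k) / sn \<kappa> (d p (v (Suc l))) / sn \<kappa> (d p (u k))
      \<le> Phi p (v l) (u k) / sn \<kappa> (d p (v l)) / sn \<kappa> (d p (u k))"
      using sn_u[of k]
      by (intro divide_right_mono Phi_ray_ratio[OF S(1) v(1)[of l] u(1)[of k] v(1)[of "Suc l"] v(4)[of l]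
            duv_small' dpos(2) drad(2)]) simp
    then show ?thesis by (simp add: G_def Phi_sym[of p "u k"] mult.commute)
  qed
  have G_x: "G (u k) (v k) \<le> Phi p x1 x2 / (sn \<kappa> a1 * sn \<kappa> a2)" for k
  proof -
    have "Phi p (v k) (u k) / sn \<kappa> (d p (v k)) \<le> Phi p x2 (u k) / sn \<kappa> (d p x2)"
      by (rule Phi_ray_ratio[OF S(1,3) u(1) v(1) v(3) _ dpos(2) sm(2)])
        (use duv_small[of k] sym in \<open>simp add: add_ac\<close>)
    then have "Phi p (v k) (u k) / sn \<kappa> (d p (v k)) / sn \<kappa> (d p (u k)) \<le> Phi p x2 (u k) / sn \<kappa> (d p x2) / sn \<kappa> (d p (u k))"
      using sn_u[of k] by (intro divide_right_mono) simp_all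
    then have "G (u k) (v k) \<le> (Phi p (u k) x2 / sn \<kappa> (d p (u k))) / sn \<kappa> a2"
      by (simp add: G_def a2_def Phi_sym[of p "u k"] mult.commute)
    also have "\<dots> \<le> (Phi p x1 x2 / sn \<kappa> a1) / sn \<kappa> a2"
      unfolding a1_def using s2
      by (intro divide_right_mono Phi_ray_ratio[OF S(1,2,3) u(1) u(3) sm(3) dpos(1) sm(1)]) simp
    finally show ?thesis by simp
  qed
  define c where "c = (\<lambda>k. G (u k) (v k))"
  have dec: "decseq c"
    unfolding decseq_Suc_iff c_def using G_u G_v order_trans by blast
  have "\<bar>c k\<bar> \<le> 1" for k
    using Phi_bound[OF S(1) u(1)[of k] v(1)[of k]] duv_small'[of k k] sym[of "u k" "v k"] sn_u[of k] sn_v[of k]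
    by (simp add: c_def G_def abs_mult add_ac)
  then have "-1 \<le> c k" for k by (simp add: abs_le_iff minus_le_iff)
  then obtain c0 where c0: "c \<longlonglongrightarrow> c0" "\<And>k. c0 \<le> c k"
    using decseq_convergent[OF dec, of "-1"] by blast
  have c1: "(\<lambda>k. c (Suc k)) \<longlonglongrightarrow> c0" using c0(1) by (rule LIMSEQ_Suc)
  \<comment> \<open>The shifted pairs lie between two consecutive diagonal values and have the same
    limit.\<close>
  have c2: "(\<lambda>k. G (u k) (v (Suc k))) \<longlonglongrightarrow> c0"
    by (rule tendsto_sandwich[OF _ _ c1 c0(1)]) (use G_u G_v in \<open>auto simp: c_def\<close>)
  \<comment> \<open>The limit of the cosines is at most the cosine at the original points. This lets
    the limit \<open>c0\<close> be exchanged for \<open>Phi p x1 x2\<close> at the very end.\<close>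
  have c0_le: "\<alpha> * \<beta> * c0 \<le> \<mu>1 * \<mu>2 * Phi p x1 x2"
  proof -
    have "\<alpha> * \<beta> * c0 \<le> \<alpha> * \<beta> * (Phi p x1 x2 / (sn \<kappa> a1 * sn \<kappa> a2))"
      using c0(2)[of 0] G_x[of 0] ab by (intro mult_left_mono) (auto simp: c_def)
    then show ?thesis using s1 s2 by (simp add: \<alpha>_def \<beta>_def)
  qed

  have "\<exists>m\<in>S. d (u (Suc k)) m = d (u (Suc k)) (v (Suc k)) / 2 \<and> d m (v (Suc k)) = d (u (Suc k)) (v (Suc k)) / 2" for k
    using betw[OF u(1)[of "Suc k"] v(1)[of "Suc k"], of "d (u (Suc k)) (v (Suc k)) / 2"] by force
  then obtain m where m: "\<And>k. m k \<in> S" "\<And>k. d (u (Suc k)) (m k) = d (u (Suc k)) (v (Suc k)) / 2"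
    "\<And>k. d (m k) (v (Suc k)) = d (u (Suc k)) (v (Suc k)) / 2" by metis
  define h where "h = (\<lambda>k. d (u (Suc k)) (v (Suc k)) / 2)"
  have mh: "d (u (Suc k)) (m k) = h k" "d (m k) (v (Suc k)) = h k" "d (u (Suc k)) (v (Suc k)) = 2 * h k" for k
    using m by (auto simp: h_def)
  define K where "K = 2 * (\<alpha> + \<beta>)"
  have hK: "0 \<le> h k" "h k \<le> K * r k" "d p (m k) \<le> K * r k" for k
    using midpoint_size[OF S(1) u(1) v(1) m(1) mh(1-3), of k] du(1)[of k] dv[of k]
      mult_pos_pos[OF ab(1) r0[of k]] mult_pos_pos[OF ab(2) r0[of k]]
    by (auto simp: K_def h_def algebra_simps)
  have Klim: "(\<lambda>k. K * r k) \<longlonglongrightarrow> 0" for K :: real using tendsto_mult_right_zero[OF rlim] .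
  have Kr: "(\<lambda>k. K * r k / r k) \<longlonglongrightarrow> K" for K :: real using r0 by (simp add: less_imp_neq[symmetric])
  have hlim: "h \<longlonglongrightarrow> 0"
    by (rule tendsto_sandwich[OF _ _ tendsto_const Klim[of K]]) (use hK in auto)
  have mlim: "(\<lambda>k. d p (m k)) \<longlonglongrightarrow> 0"
    by (rule tendsto_sandwich[OF _ _ tendsto_const Klim[of K]]) (use hK in auto)
  have mdlim: "(\<lambda>k. md \<kappa> (K * r k) / (r k)\<^sup>2) \<longlonglongrightarrow> K\<^sup>2 / 2" for K
    by (rule md_scaled[OF Klim Kr])
  have snlim: "(\<lambda>k. sn \<kappa> (K * r k) / r k) \<longlonglongrightarrow> K" for K
    by (rule sn_scaled[OF Klim Kr])
  have md0: "(\<lambda>k. md \<kappa> (f k)) \<longlonglongrightarrow> 0" if "f \<longlonglongrightarrow> 0" for f :: "nat \<Rightarrow> real"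
    using tendsto_md[OF that, of \<kappa>] by simp

  \<comment> \<open>The limit of \<open>Duv k\<close> / (r k) ^ 2 is half the squared side of a
    Euclidean triangle with sides \<alpha>, \<beta> and angle cosine \<open>c0\<close>;
    \<open>Dvu\<close> is treated likewise with the side 2 \<alpha>.\<close>
  define Duv where "Duv = (\<lambda>k. md \<kappa> (2 * h k))"
  have "(\<lambda>k. md \<kappa> (\<alpha> * r k) / (r k)\<^sup>2 + md \<kappa> (\<beta> * r k) / (r k)\<^sup>2
        - \<kappa> * (md \<kappa> (\<alpha> * r k) * (md \<kappa> (\<beta> * r k) / (r k)\<^sup>2))
        - c (Suc k) * ((sn \<kappa> (\<alpha> * r k) / r k) * (sn \<kappa> (\<beta> * r k) / r k)))
     \<longlonglongrightarrow> \<alpha>\<^sup>2 / 2 + \<beta>\<^sup>2 / 2 - \<kappa> * (0 * (\<beta>\<^sup>2 / 2)) - c0 * (\<alpha> * \<beta>)"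
    by (intro tendsto_intros mdlim snlim c1 md0 Klim)
  moreover have "md \<kappa> (\<alpha> * r k) / (r k)\<^sup>2 + md \<kappa> (\<beta> * r k) / (r k)\<^sup>2
        - \<kappa> * (md \<kappa> (\<alpha> * r k) * (md \<kappa> (\<beta> * r k) / (r k)\<^sup>2))
        - c (Suc k) * ((sn \<kappa> (\<alpha> * r k) / r k) * (sn \<kappa> (\<beta> * r k) / r k)) = Duv k / (r k)\<^sup>2" for k
  proof -
    have "c (Suc k) * (sn \<kappa> (\<alpha> * r k) * sn \<kappa> (\<beta> * r k)) = Phi p (u (Suc k)) (v (Suc k))"
      using sn_u[of "Suc k"] sn_v[of "Suc k"] by (simp add: c_def G_def du(1) dv)
    then have "Duv k = md \<kappa> (\<alpha> * r k) + md \<kappa> (\<beta> * r k)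
        - \<kappa> * (md \<kappa> (\<alpha> * r k) * md \<kappa> (\<beta> * r k)) - c (Suc k) * (sn \<kappa> (\<alpha> * r k) * sn \<kappa> (\<beta> * r k))"
      by (simp add: Phi_def du(1) dv mh Duv_def)
    then show ?thesis by (simp add: power2_eq_square diff_divide_distrib add_divide_distrib)
  qed
  ultimately have Duv: "(\<lambda>k. Duv k / (r k)\<^sup>2) \<longlonglongrightarrow> \<alpha>\<^sup>2 / 2 + \<beta>\<^sup>2 / 2 - c0 * (\<alpha> * \<beta>)" by simp

  define Dvu where "Dvu = (\<lambda>k. md \<kappa> (d (v (Suc k)) (u k)))"
  have "(\<lambda>k. md \<kappa> ((2 * \<alpha>) * r k) / (r k)\<^sup>2 + md \<kappa> (\<beta> * r k) / (r k)\<^sup>2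
        - \<kappa> * (md \<kappa> ((2 * \<alpha>) * r k) * (md \<kappa> (\<beta> * r k) / (r k)\<^sup>2))
        - G (u k) (v (Suc k)) * ((sn \<kappa> ((2 * \<alpha>) * r k) / r k) * (sn \<kappa> (\<beta> * r k) / r k)))
     \<longlonglongrightarrow> (2 * \<alpha>)\<^sup>2 / 2 + \<beta>\<^sup>2 / 2 - \<kappa> * (0 * (\<beta>\<^sup>2 / 2)) - c0 * ((2 * \<alpha>) * \<beta>)"
    by (intro tendsto_intros mdlim snlim c2 md0 Klim)
  moreover have "md \<kappa> ((2 * \<alpha>) * r k) / (r k)\<^sup>2 + md \<kappa> (\<beta> * r k) / (r k)\<^sup>2
        - \<kappa> * (md \<kappa> ((2 * \<alpha>) * r k) * (md \<kappa> (\<beta> * r k) / (r k)\<^sup>2))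
        - G (u k) (v (Suc k)) * ((sn \<kappa> ((2 * \<alpha>) * r k) / r k) * (sn \<kappa> (\<beta> * r k) / r k)) = Dvu k / (r k)\<^sup>2" for k
  proof -
    have "G (u k) (v (Suc k)) * (sn \<kappa> (2 * (\<alpha> * r k)) * sn \<kappa> (\<beta> * r k)) = Phi p (u k) (v (Suc k))"
      using sn_u[of "k"] sn_v[of "Suc k"] by (simp add: G_def du(2) dv)
    then have "Dvu k = md \<kappa> (2 * (\<alpha> * r k)) + md \<kappa> (\<beta> * r k)
        - \<kappa> * (md \<kappa> (2 * (\<alpha> * r k)) * md \<kappa> (\<beta> * r k)) - G (u k) (v (Suc k)) * (sn \<kappa> (2 * (\<alpha> * r k)) * sn \<kappa> (\<beta> * r k))"
      using sym[of "u k" "v (Suc k)"] by (simp add: Phi_def du(2) dv Dvu_def)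
    then show ?thesis by (simp add: power2_eq_square diff_divide_distrib add_divide_distrib mult.assoc)
  qed
  ultimately have Dvu: "(\<lambda>k. Dvu k / (r k)\<^sup>2) \<longlonglongrightarrow> (2 * \<alpha>)\<^sup>2 / 2 + \<beta>\<^sup>2 / 2 - c0 * ((2 * \<alpha>) * \<beta>)" by simp

  define mh' where "mh' = (\<lambda>k. md \<kappa> (h k))"
  have mh'0: "mh' \<longlonglongrightarrow> 0" unfolding mh'_def by (rule md0[OF hlim])
  have C1: "(\<lambda>k. 1 - \<kappa> * mh' k) \<longlonglongrightarrow> 1" using tendsto_intros(1)[of 1]
    using tendsto_diff[OF tendsto_const tendsto_mult_right_zero[OF mh'0], of 1 \<kappa>] by simp
  have ev: "\<forall>\<^sub>F k in sequentially. 0 < 1 - \<kappa> * mh' k"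
    using order_tendstoD(1)[OF C1, of 0] by simp
  define \<delta> where "\<delta> = \<alpha>\<^sup>2 / 2 + \<beta>\<^sup>2 / 2 - c0 * (\<alpha> * \<beta>)"
  have mh'lim: "(\<lambda>k. mh' k / (r k)\<^sup>2) \<longlonglongrightarrow> \<delta> / 4"
  proof -
    have "(\<lambda>k. (Duv k / (r k)\<^sup>2) / (2 * (1 + (1 - \<kappa> * mh' k)))) \<longlonglongrightarrow> \<delta> / (2 * (1 + 1))"
      unfolding \<delta>_def by (intro tendsto_intros Duv C1) auto
    moreover have "\<forall>\<^sub>F k in sequentially. (Duv k / (r k)\<^sup>2) / (2 * (1 + (1 - \<kappa> * mh' k))) = mh' k / (r k)\<^sup>2"
      using ev
    proof eventually_elim
      case (elim k)
      have "Duv k = mh' k * (2 * (1 + (1 - \<kappa> * mh' k)))"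
        using md_add[of \<kappa> "h k" "h k"] sn_sq[of \<kappa> "h k"]
        by (simp add: Duv_def mh'_def power2_eq_square algebra_simps)
      then show ?case using elim by simp
    qed
    ultimately show ?thesis by (auto intro: Lim_transform_eventually)
  qed
  \<comment> \<open>An upper bound for \<open>md\<close> of the distance from p to
    \<open>m k\<close>. Comparison at a midpoint gives only lower bounds on distances from that
    midpoint, so it is used twice: at \<open>m k\<close> seen from \<open>u k\<close>, to bound
    their distance from below, and at the midpoint \<open>u (Suc k)\<close> of p and
    \<open>u k\<close> seen from \<open>m k\<close>, solved for the distance from p. The limit after
    rescaling is half the squared length of the Euclidean midpoint vector.\<close>
  define X where "X = (\<lambda>k. 2 * (1 - \<kappa> * md \<kappa> (\<alpha> * r k)) * mh' k + 2 * md \<kappa> (\<alpha> * r k)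
     - ((md \<kappa> (\<alpha> * r k) + Dvu k) / 2 - mh' k) / (1 - \<kappa> * mh' k))"
  have "(\<lambda>k. 2 * (1 - \<kappa> * md \<kappa> (\<alpha> * r k)) * (mh' k / (r k)\<^sup>2) + 2 * (md \<kappa> (\<alpha> * r k) / (r k)\<^sup>2)
     - ((md \<kappa> (\<alpha> * r k) / (r k)\<^sup>2 + Dvu k / (r k)\<^sup>2) / 2 - mh' k / (r k)\<^sup>2) / (1 - \<kappa> * mh' k))
    \<longlonglongrightarrow> 2 * (1 - \<kappa> * 0) * (\<delta> / 4) + 2 * (\<alpha>\<^sup>2 / 2)
     - ((\<alpha>\<^sup>2 / 2 + ((2 * \<alpha>)\<^sup>2 / 2 + \<beta>\<^sup>2 / 2 - c0 * ((2 * \<alpha>) * \<beta>))) / 2 - \<delta> / 4) / 1"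
    by (intro tendsto_intros mh'lim Dvu C1 mdlim md0 Klim) auto
  moreover have "2 * (1 - \<kappa> * md \<kappa> (\<alpha> * r k)) * (mh' k / (r k)\<^sup>2) + 2 * (md \<kappa> (\<alpha> * r k) / (r k)\<^sup>2)
     - ((md \<kappa> (\<alpha> * r k) / (r k)\<^sup>2 + Dvu k / (r k)\<^sup>2) / 2 - mh' k / (r k)\<^sup>2) / (1 - \<kappa> * mh' k) = X k / (r k)\<^sup>2" for k
  proof -
    have "2 * (1 - \<kappa> * a) * (b / R) + 2 * (a / R) - ((a / R + D / R) / 2 - b / R) / C
      = (2 * (1 - \<kappa> * a) * b + 2 * a - ((a + D) / 2 - b) / C) / R" for a b R D C :: real
      by (simp add: diff_divide_distrib add_divide_distrib mult_ac)
    then show ?thesis unfolding X_def .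
  qed
  moreover have "2 * (1 - \<kappa> * 0) * (\<delta> / 4) + 2 * (\<alpha>\<^sup>2 / 2)
     - ((\<alpha>\<^sup>2 / 2 + ((2 * \<alpha>)\<^sup>2 / 2 + \<beta>\<^sup>2 / 2 - c0 * ((2 * \<alpha>) * \<beta>))) / 2 - \<delta> / 4) / 1
     = (\<alpha>\<^sup>2 + \<beta>\<^sup>2 + 2 * (\<alpha> * \<beta> * c0)) / 8"
    by (simp add: \<delta>_def power2_eq_square field_simps)
  ultimately have Xlim: "(\<lambda>k. X k / (r k)\<^sup>2) \<longlonglongrightarrow> (\<alpha>\<^sup>2 + \<beta>\<^sup>2 + 2 * (\<alpha> * \<beta> * c0)) / 8" by (simp only:)

  have small0: "\<forall>\<^sub>F k in sequentially. small \<kappa> (f k)" if "f \<longlonglongrightarrow> 0" for f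
    by (rule eventually_small[OF that]) (auto simp: small_def)
  have lim_u: "(\<lambda>k. d p (u (Suc k))) \<longlonglongrightarrow> 0" "(\<lambda>k. d p (v (Suc k))) \<longlonglongrightarrow> 0" "(\<lambda>k. d p (u k)) \<longlonglongrightarrow> 0"
    using Klim[of \<alpha>] Klim[of \<beta>] Klim[of "2 * \<alpha>"] by (simp add: du(1), simp add: dv, simp add: du(2) mult.assoc)
  \<comment> \<open>A crude bound of order (r k) ^ 2. It controls the term -\<kappa>
    \<open>md\<close> ^ 2 in \<open>sn_sq\<close>, which is positive for \<kappa> < 0.\<close>
  define B where "B = (\<lambda>k. md \<kappa> (K * r k))"
  have evm: "\<forall>\<^sub>F k in sequentially. md \<kappa> (d p (m k)) \<le> X k \<and> md \<kappa> (d p (m k)) \<le> B k \<and>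
      rad \<kappa> (d p (m k))"
  proof -
    have 1: "(\<lambda>k. 2 * (d p (u k) + d p (m k))) \<longlonglongrightarrow> 0"
      using tendsto_mult_right_zero[OF tendsto_add_zero[OF lim_u(3) mlim], of 2] by simp
    have 2: "(\<lambda>k. 2 * (d p (u (Suc k)) + d p (v (Suc k)) + d p (u k))) \<longlonglongrightarrow> 0"
      using tendsto_mult_right_zero[OF tendsto_add_zero[OF tendsto_add_zero[OF lim_u(1,2)] lim_u(3)], of 2]
      by simp
    show ?thesis using small0[OF 1] small0[OF 2] small0[OF tendsto_mult_right_zero[OF mlim, of 2]]
      small0[OF tendsto_mult_right_zero[OF Klim[of K], of 2]] ev
    proof eventually_elim
      case (elim k)
      have uu: "d p (u (Suc k)) = \<alpha> * r k" "d (u (Suc k)) (u k) = \<alpha> * r k" "d p (u k) = 2 * (\<alpha> * r k)"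
        using du[of k] by auto
      have a: "(md \<kappa> (d p (m k)) + md \<kappa> (d (u k) (m k))) / 2 \<le> (1 - \<kappa> * md \<kappa> (\<alpha> * r k)) * md \<kappa> (d (u (Suc k)) (m k)) + md \<kappa> (\<alpha> * r k)"
        by (rule midpoint_comp[OF S(1) u(1) u(1) m(1) uu])
          (use small_mono[OF elim(1)] tri[OF u(1)[of k] S(1) m(1)[of k]] sym[of "u k" p] sym[of "m k" p] in auto)
      have b: "(md \<kappa> (d (u (Suc k)) (u k)) + md \<kappa> (d (v (Suc k)) (u k))) / 2
         \<le> (1 - \<kappa> * md \<kappa> (h k)) * md \<kappa> (d (m k) (u k)) + md \<kappa> (h k)"
        by (rule midpoint_comp[OF u(1) v(1) m(1) u(1) mh])
          (use small_mono[OF elim(2)] tri[OF u(1)[of "Suc k"] S(1) v(1)[of "Suc k"]]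
            tri[OF v(1)[of "Suc k"] S(1) u(1)[of "k"]] tri[OF u(1)[of k] S(1) u(1)[of "Suc k"]]
            sym[of "u k" p] sym[of "u (Suc k)" p] sym[of "v (Suc k)" p] in auto)
      have "((md \<kappa> (\<alpha> * r k) + Dvu k) / 2 - mh' k) / (1 - \<kappa> * mh' k) \<le> md \<kappa> (d (u k) (m k))"
        using b elim(5) sym[of "m k" "u k"] uu by (subst pos_divide_le_eq) (simp_all add: Dvu_def mh'_def field_simps)
      then have "md \<kappa> (d p (m k)) \<le> X k"
        using a mh(1)[of k] by (simp add: X_def mh'_def field_simps)
      moreover have "md \<kappa> (d p (m k)) \<le> B k"
        unfolding B_def using elim(4) hK(3)[of k] by (intro md_mono) (auto simp: rad_radc)
      ultimately show ?case using elim(3) by simp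
    qed
  qed
  have evz: "\<forall>\<^sub>F k in sequentially. small \<kappa> (d p (m k) + d p (z i) + d (m k) (z i)) \<and>
      small \<kappa> (d (u (Suc k)) (v (Suc k)) + d (v (Suc k)) (z i) + d (z i) (u (Suc k)))" if i: "i < n" for i
  proof -
    have 1: "(\<lambda>k. 2 * d p (z i) + 2 * d p (m k)) \<longlonglongrightarrow> 2 * d p (z i) + 2 * 0"
      by (intro tendsto_intros mlim)
    have 2: "(\<lambda>k. 2 * d p (z i) + 2 * (d p (u (Suc k)) + d p (v (Suc k)))) \<longlonglongrightarrow> 2 * d p (z i) + 2 * (0 + 0)"
      by (intro tendsto_intros lim_u)
    have "\<forall>\<^sub>F k in sequentially. small \<kappa> (2 * d p (z i) + 2 * d p (m k))"
      "\<forall>\<^sub>F k in sequentially. small \<kappa> (2 * d p (z i) + 2 * (d p (u (Suc k)) + d p (v (Suc k))))"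
      using eventually_small[OF 1, of \<kappa>] eventually_small[OF 2, of \<kappa>] sm(4)[OF i] by simp_all
    then show ?thesis
    proof eventually_elim
      case (elim k)
      have "small \<kappa> (d p (m k) + d p (z i) + d (m k) (z i))"
        using tri[OF m(1)[of k] S(1) S(4)[OF i]] sym[of "m k" p] by (intro small_mono[OF elim(1)]) auto
      moreover have "small \<kappa> (d (u (Suc k)) (v (Suc k)) + d (v (Suc k)) (z i) + d (z i) (u (Suc k)))"
        using tri[OF u(1)[of "Suc k"] S(1) v(1)[of "Suc k"]] tri[OF v(1)[of "Suc k"] S(1) S(4)[OF i]]
          tri[OF S(4)[OF i] S(1) u(1)[of "Suc k"]] sym[of "u (Suc k)" p] sym[of "v (Suc k)" p] sym[of "z i" p]
        by (intro small_mono[OF elim(2)]) auto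
      ultimately show ?case ..
    qed
  qed
  then have evz: "\<forall>\<^sub>F k in sequentially. \<forall>i\<in>{..<n}. small \<kappa> (d p (m k) + d p (z i) + d (m k) (z i)) \<and>
      small \<kappa> (d (u (Suc k)) (v (Suc k)) + d (v (Suc k)) (z i) + d (z i) (u (Suc k)))"
    by (intro eventually_ball_finite) auto

  \<comment> \<open>The error of \<open>Phi_midpoint\<close> divided by \<open>r k\<close>; its
    terms are of order (r k) ^ 2 before the division.\<close>
  define E where "E = (\<lambda>k. ((1 - \<kappa> * mh' k) * md \<kappa> (d p (m k)) + mh' k - (md \<kappa> (\<alpha> * r k) + md \<kappa> (\<beta> * r k)) / 2) / r k)"
  have sq_lim: "(\<lambda>k. f k / r k) \<longlonglongrightarrow> 0" if "(\<lambda>k. f k / (r k)\<^sup>2) \<longlonglongrightarrow> L" for f L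
    using tendsto_mult[OF that rlim] r0 by (simp add: power2_eq_square less_imp_neq[symmetric])
  have Bl: "(\<lambda>k. B k / r k) \<longlonglongrightarrow> 0" unfolding B_def by (rule sq_lim[OF mdlim])
  have mrlim: "(\<lambda>k. md \<kappa> (d p (m k)) / r k) \<longlonglongrightarrow> 0"
  proof (rule tendsto_sandwich[OF _ _ tendsto_const Bl])
    show "\<forall>\<^sub>F k in sequentially. 0 \<le> md \<kappa> (d p (m k)) / r k" using r0 by (simp add: less_imp_le)
    show "\<forall>\<^sub>F k in sequentially. md \<kappa> (d p (m k)) / r k \<le> B k / r k"
      using evm by eventually_elim (use r0 in \<open>simp add: divide_right_mono less_imp_le\<close>)
  qed
  have "(\<lambda>k. (1 - \<kappa> * mh' k) * (md \<kappa> (d p (m k)) / r k) + mh' k / r k - (md \<kappa> (\<alpha> * r k) / r k + md \<kappa> (\<beta> * r k) / r k) / 2)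
     \<longlonglongrightarrow> 1 * 0 + 0 - (0 + 0) / 2"
    by (intro tendsto_intros C1 mrlim sq_lim[OF mh'lim] sq_lim[OF mdlim]) auto
  then have Elim: "E \<longlonglongrightarrow> 0" by (simp add: E_def diff_divide_distrib add_divide_distrib add.commute mult.commute)

  \<comment> \<open>Bounds the product of \<omega> and \<open>Phi p (z i) (m k)\<close>: first
    \<open>Phi_midpoint\<close>, then \<open>Phi_ray_ratio\<close> from the points near p out to
    \<open>x1\<close> and \<open>x2\<close>.\<close>
  define T where "T = (\<lambda>k i. (sn \<kappa> (\<alpha> * r k) / r k) * (Phi p (z i) x1 / sn \<kappa> a1)
     + (sn \<kappa> (\<beta> * r k) / r k) * (Phi p (z i) x2 / sn \<kappa> a2) + 2 * (1 - \<kappa> * md \<kappa> (d p (z i))) * E k)"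
  have Tlim: "(\<lambda>k. T k i) \<longlonglongrightarrow> \<alpha> * (Phi p (z i) x1 / sn \<kappa> a1) + \<beta> * (Phi p (z i) x2 / sn \<kappa> a2)
      + 2 * (1 - \<kappa> * md \<kappa> (d p (z i))) * 0" for i
    unfolding T_def by (intro tendsto_intros snlim Elim)
  then have Tlim: "(\<lambda>k. T k i) \<longlonglongrightarrow> \<mu>1 * Phi p (z i) x1 + \<mu>2 * Phi p (z i) x2" for i
    using s1 s2 by (simp add: \<alpha>_def \<beta>_def)
  define U where "U = (\<lambda>k. Q + 2 * (\<Sum>i<n. \<nu> i * T k i) +
     4 * (1 - \<kappa> * mh' k)\<^sup>2 * (2 * (X k / (r k)\<^sup>2) + \<bar>\<kappa>\<bar> * (B k * (B k / (r k)\<^sup>2))))"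
  have "U \<longlonglongrightarrow> Q + 2 * (\<Sum>i<n. \<nu> i * (\<mu>1 * Phi p (z i) x1 + \<mu>2 * Phi p (z i) x2)) +
     4 * 1\<^sup>2 * (2 * ((\<alpha>\<^sup>2 + \<beta>\<^sup>2 + 2 * (\<alpha> * \<beta> * c0)) / 8) + \<bar>\<kappa>\<bar> * (0 * (K\<^sup>2 / 2)))"
    unfolding U_def B_def by (intro tendsto_intros Tlim C1 Xlim mdlim md0 Klim)
  moreover have "4 * 1\<^sup>2 * (2 * (A / 8) + b * (0 * c)) = A" for A b c :: real by simp
  ultimately have Ulim: "U \<longlonglongrightarrow> Q + 2 * (\<Sum>i<n. \<nu> i * (\<mu>1 * Phi p (z i) x1 + \<mu>2 * Phi p (z i) x2)) +
     (\<alpha>\<^sup>2 + \<beta>\<^sup>2 + 2 * (\<alpha> * \<beta> * c0))" by (simp only:)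
  have "\<forall>\<^sub>F k in sequentially. 0 \<le> U k"
    using evm evz ev
  proof eventually_elim
    case (elim k)
    define C where "C = 1 - \<kappa> * mh' k"
    \<comment> \<open>The factor 2 / \<open>r k\<close> undoes the rescaling and the halving by the
      midpoint; C is the factor on the left of \<open>Phi_midpoint\<close>.\<close>
    define \<omega> where "\<omega> = 2 * C / r k"
    have C: "0 < C" using elim(3) by (simp add: C_def)
    have om: "0 \<le> \<omega>" using C r0[of k] by (simp add: \<omega>_def)
    have 1: "0 \<le> Q + 2 * \<omega> * (\<Sum>i<n. \<nu> i * Phi p (z i) (m k)) + \<omega>\<^sup>2 * Phi p (m k) (m k)"
      by (rule H[OF m(1) om]) (use elim in auto)
    have 2: "\<omega> * Phi p (z i) (m k) \<le> T k i" if i: "i < n" for i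
    proof -
      have "C * Phi p (m k) (z i) \<le> (Phi p (u (Suc k)) (z i) + Phi p (v (Suc k)) (z i)) / 2
          + (1 - \<kappa> * md \<kappa> (d p (z i))) * (E k * r k)"
        using Phi_midpoint[OF S(1) u(1) v(1) m(1) S(4)[OF i] mh] elim(2) i r0[of k]
        by (simp add: C_def mh'_def E_def du(1) dv less_imp_neq[symmetric])
      from mult_left_mono[OF this, of "2 / r k"] have "\<omega> * Phi p (m k) (z i)
        \<le> (2 / r k) * ((Phi p (u (Suc k)) (z i) + Phi p (v (Suc k)) (z i)) / 2 + (1 - \<kappa> * md \<kappa> (d p (z i))) * (E k * r k))"
        using r0[of k] by (simp add: \<omega>_def)
      also have "\<dots> = Phi p (u (Suc k)) (z i) / r k + Phi p (v (Suc k)) (z i) / r k + 2 * (1 - \<kappa> * md \<kappa> (d p (z i))) * E k"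
        using r0[of k] by (simp add: field_simps)
      also have "\<dots> \<le> T k i"
      proof -
        have "Phi p (u (Suc k)) (z i) / sn \<kappa> (\<alpha> * r k) \<le> Phi p x1 (z i) / sn \<kappa> a1"
          using Phi_ray_ratio[OF S(1,2) S(4)[OF i] u(1,3) sm(5)[OF i] dpos(1) sm(1), of "Suc k"]
          by (simp add: du(1) a1_def)
        then have "Phi p (u (Suc k)) (z i) \<le> sn \<kappa> (\<alpha> * r k) * (Phi p x1 (z i) / sn \<kappa> a1)"
          using sn_u[of "Suc k"] by (simp add: du(1) pos_divide_le_eq mult.commute)
        from divide_right_mono[OF this, of "r k"]
        have 1: "Phi p (u (Suc k)) (z i) / r k \<le> sn \<kappa> (\<alpha> * r k) / r k * (Phi p (z i) x1 / sn \<kappa> a1)"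
          using r0[of k] Phi_sym[of p "z i" x1] by (simp add: less_imp_le mult.commute)
        have "Phi p (v (Suc k)) (z i) / sn \<kappa> (\<beta> * r k) \<le> Phi p x2 (z i) / sn \<kappa> a2"
          using Phi_ray_ratio[OF S(1,3) S(4)[OF i] v(1,3) sm(6)[OF i] dpos(2) sm(2), of "Suc k"]
          by (simp add: dv a2_def)
        then have "Phi p (v (Suc k)) (z i) \<le> sn \<kappa> (\<beta> * r k) * (Phi p x2 (z i) / sn \<kappa> a2)"
          using sn_v[of "Suc k"] by (simp add: dv pos_divide_le_eq mult.commute)
        from divide_right_mono[OF this, of "r k"]
        have 2: "Phi p (v (Suc k)) (z i) / r k \<le> sn \<kappa> (\<beta> * r k) / r k * (Phi p (z i) x2 / sn \<kappa> a2)"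
          using r0[of k] Phi_sym[of p "z i" x2] by (simp add: less_imp_le mult.commute)
        show ?thesis using 1 2 by (simp add: T_def)
      qed
      finally show ?thesis by (simp add: Phi_sym)
    qed
    have 3: "2 * \<omega> * (\<Sum>i<n. \<nu> i * Phi p (z i) (m k)) \<le> 2 * (\<Sum>i<n. \<nu> i * T k i)"
    proof -
      have "\<omega> * (\<Sum>i<n. \<nu> i * Phi p (z i) (m k)) = (\<Sum>i<n. \<nu> i * (\<omega> * Phi p (z i) (m k)))"
        by (simp add: sum_distrib_left algebra_simps)
      also have "\<dots> \<le> (\<Sum>i<n. \<nu> i * T k i)"
        using 2 nu by (intro sum_mono mult_left_mono) auto
      finally show ?thesis by simp
    qed
    have 4: "\<omega>\<^sup>2 * Phi p (m k) (m k) \<le> 4 * C\<^sup>2 * (2 * (X k / (r k)\<^sup>2) + \<bar>\<kappa>\<bar> * (B k * (B k / (r k)\<^sup>2)))"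
    proof -
      define w where "w = md \<kappa> (d p (m k))"
      have w: "0 \<le> w" "w \<le> X k" "w \<le> B k" using elim(1) by (auto simp: w_def)
      have "- \<kappa> * (w * w) \<le> \<bar>\<kappa>\<bar> * (B k * B k)"
        using w by (intro mult_mono) auto
      then have "Phi p (m k) (m k) \<le> 2 * X k + \<bar>\<kappa>\<bar> * (B k * B k)"
        using w by (simp add: Phi_self sn_sq w_def[symmetric] algebra_simps)
      then have "\<omega>\<^sup>2 * Phi p (m k) (m k) \<le> \<omega>\<^sup>2 * (2 * X k + \<bar>\<kappa>\<bar> * (B k * B k))"
        by (intro mult_left_mono) auto
      also have "\<dots> = 4 * C\<^sup>2 * (2 * (X k / (r k)\<^sup>2) + \<bar>\<kappa>\<bar> * (B k * (B k / (r k)\<^sup>2)))"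
        by (simp add: \<omega>_def power_divide power_mult_distrib add_divide_distrib distrib_left)
      finally show ?thesis .
    qed
    show ?case using 1 3 4 unfolding U_def C_def[symmetric] by linarith
  qed
  then have "0 \<le> Q + 2 * (\<Sum>i<n. \<nu> i * (\<mu>1 * Phi p (z i) x1 + \<mu>2 * Phi p (z i) x2)) +
     (\<alpha>\<^sup>2 + \<beta>\<^sup>2 + 2 * (\<alpha> * \<beta> * c0))"
    by (intro tendsto_lowerbound[OF Ulim]) auto
  moreover have "\<alpha>\<^sup>2 = \<mu>1\<^sup>2 * Phi p x1 x1" "\<beta>\<^sup>2 = \<mu>2\<^sup>2 * Phi p x2 x2"
    by (auto simp: Phi_self \<alpha>_def \<beta>_def a1_def a2_def power_mult_distrib)
  ultimately show ?thesis using c0_le by linarith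
qed

lemma double_sum_Suc:
  fixes f :: "nat \<Rightarrow> nat \<Rightarrow> real"
  assumes "\<And>i j. f i j = f j i"
  shows "(\<Sum>i<Suc n. \<Sum>j<Suc n. f i j) = (\<Sum>i<n. \<Sum>j<n. f i j) + 2 * (\<Sum>i<n. f i n) + f n n"
proof -
  have "(\<Sum>j<n. f n j) = (\<Sum>i<n. f i n)" by (intro sum.cong refl assms)
  then show ?thesis by (simp add: sum.distrib)
qed

text \<open>Induction on the number of points: \<open>LSS_merge\<close> exchanges the last two for a
  single point near p. Its perimeters with the other points are small just because it is near p, so
  the induction hypothesis applies to the new family.\<close>

lemma LSS_nat:
  fixes x :: "nat \<Rightarrow> 'b"
  assumes "p \<in> S" "\<And>i. i < n \<Longrightarrow> x i \<in> S" "\<And>i. i < n \<Longrightarrow> 0 \<le> \<mu> i"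
    and "\<And>i j. i < n \<Longrightarrow> j < n \<Longrightarrow> small \<kappa> (d p (x i) + d p (x j) + d (x i) (x j))"
  shows "0 \<le> (\<Sum>i<n. \<Sum>j<n. \<mu> i * \<mu> j * Phi p (x i) (x j))"
  using assms
proof (induction n arbitrary: x \<mu>)
  case 0
  then show ?case by simp
next
  case (Suc n)
  note S = Suc.prems(2) and nonneg = Suc.prems(3) and sm = Suc.prems(4)
  have E: "(\<Sum>i<Suc k. \<Sum>j<Suc k. \<nu> i * \<nu> j * Phi p (y i) (y j)) =
    (\<Sum>i<k. \<Sum>j<k. \<nu> i * \<nu> j * Phi p (y i) (y j)) + 2 * (\<Sum>i<k. \<nu> i * \<nu> k * Phi p (y i) (y k)) + \<nu> k * \<nu> k * Phi p (y k) (y k)"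
    for k \<nu> y by (rule double_sum_Suc) (metis Phi_sym mult.commute)
  show ?case
  proof (cases n)
    case 0
    then show ?thesis using nonneg by (simp add: Phi_self)
  next
    case (Suc m)
    define x1 x2 \<mu>1 \<mu>2 where "x1 = x m" and "x2 = x (Suc m)" and "\<mu>1 = \<mu> m" and "\<mu>2 = \<mu> (Suc m)"
    define Q where "Q = (\<Sum>i<m. \<Sum>j<m. \<mu> i * \<mu> j * Phi p (x i) (x j))"
    define L where "L = (\<lambda>z. \<Sum>i<m. \<mu> i * Phi p (x i) z)"
    have rd: "rad \<kappa> (d p (x i))" if "i < Suc n" for i
      using sm[OF that that] by simp
    have xS: "x1 \<in> S" "x2 \<in> S" using S Suc by (auto simp: x1_def x2_def)
    have mu: "0 \<le> \<mu>1" "0 \<le> \<mu>2" using nonneg Suc by (auto simp: \<mu>1_def \<mu>2_def)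
    have sums: "(\<Sum>i<m. \<mu> i * c * Phi p (x i) z) = c * L z" for c z
      by (simp add: L_def sum_distrib_left algebra_simps)
    have tot: "(\<Sum>i<Suc n. \<Sum>j<Suc n. \<mu> i * \<mu> j * Phi p (x i) (x j)) =
        Q + 2 * \<mu>1 * L x1 + \<mu>1\<^sup>2 * Phi p x1 x1 + 2 * \<mu>2 * L x2 + 2 * \<mu>1 * \<mu>2 * Phi p x1 x2 + \<mu>2\<^sup>2 * Phi p x2 x2"
    proof -
      have 1: "(\<Sum>i<m. \<mu> i * \<mu> m * Phi p (x i) (x m)) = \<mu> m * L (x m)"
        "(\<Sum>i<Suc m. \<mu> i * \<mu> (Suc m) * Phi p (x i) (x (Suc m))) = \<mu> (Suc m) * L (x (Suc m)) + \<mu> m * \<mu> (Suc m) * Phi p (x m) (x (Suc m))"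
        by (simp_all only: sum.lessThan_Suc sums)
      show ?thesis
        unfolding Suc E[where k = "Suc m"] E[where k = m] 1
        by (simp only: Q_def x1_def x2_def \<mu>1_def \<mu>2_def power2_eq_square) (simp only: algebra_simps)
    qed
    \<comment> \<open>There are m + 2 points in all, and the induction hypothesis covers m + 1: the
      first m and one point z at choice.\<close>
    have IH: "0 \<le> Q + 2 * \<omega> * L z + \<omega>\<^sup>2 * Phi p z z"
      if z: "z \<in> S" "0 \<le> \<omega>" "rad \<kappa> (d p z)" "\<And>i. i < m \<Longrightarrow> small \<kappa> (d p z + d p (x i) + d z (x i))" for z \<omega>
    proof -
      define y \<nu> where "y = x(m := z)" and "\<nu> = \<mu>(m := \<omega>)"
      have "0 \<le> (\<Sum>i<n. \<Sum>j<n. \<nu> i * \<nu> j * Phi p (y i) (y j))"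
      proof (rule Suc.IH[OF Suc.prems(1)])
        fix i assume i: "i < n"
        show "y i \<in> S" "0 \<le> \<nu> i" using i z S[of i] nonneg[of i] by (auto simp: y_def \<nu>_def)
        fix j assume j: "j < n"
        show "small \<kappa> (d p (y i) + d p (y j) + d (y i) (y j))"
        proof (cases "i = m"; cases "j = m")
          assume "i = m" "j = m"
          then show ?thesis using z(3) by (simp add: y_def)
        next
          assume "i = m" "j \<noteq> m"
          then show ?thesis using z(4)[of j] j Suc by (simp add: y_def)
        next
          assume "i \<noteq> m" "j = m"
          then show ?thesis using z(4)[of i] i Suc sym[of z "x i"] by (simp add: y_def add_ac)
        next
          assume "i \<noteq> m" "j \<noteq> m"
          then show ?thesis using sm[of i j] i j by (simp add: y_def)
        qed
      qed
      also have "\<dots> = Q + 2 * \<omega> * L z + \<omega>\<^sup>2 * Phi p z z"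
        unfolding Suc E by (simp add: y_def \<nu>_def Q_def sums power2_eq_square)
      finally show ?thesis .
    qed
    have IH1: "0 \<le> Q + 2 * \<mu>1 * L x1 + \<mu>1\<^sup>2 * Phi p x1 x1"
      by (rule IH[OF xS(1) mu(1)], use Suc rd[of m] sm[of m] in \<open>simp_all add: x1_def\<close>)
    have IH2: "0 \<le> Q + 2 * \<mu>2 * L x2 + \<mu>2\<^sup>2 * Phi p x2 x2"
      by (rule IH[OF xS(2) mu(2)], use Suc rd[of "Suc m"] sm[of "Suc m"] in \<open>simp_all add: x2_def\<close>)
    \<comment> \<open>A point of weight 0 or at distance 0 from p contributes nothing and has no
      direction to follow, so it is dropped instead of merged.\<close>
    consider "\<mu>1 = 0 \<or> d p x1 = 0" | "\<mu>2 = 0 \<or> d p x2 = 0" | "0 < \<mu>1" "0 < \<mu>2" "0 < d p x1" "0 < d p x2"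
    proof -
      have "0 \<le> d p x1" "0 \<le> d p x2" by simp_all
      then show thesis using mu that
        by (cases "\<mu>1 = 0 \<or> d p x1 = 0"; cases "\<mu>2 = 0 \<or> d p x2 = 0") (simp_all add: less_le)
    qed
    then show ?thesis
    proof cases
      case 1
      have 0: "\<mu>1 = 0 \<or> Phi p x1 z = 0" "\<mu>1 = 0 \<or> Phi p z x1 = 0" if "z \<in> S" for z
        using 1 Phi_zero[OF Suc.prems(1) xS(1) that] Phi_sym[of p z x1] by auto
      have "\<mu>1 = 0 \<or> L x1 = 0"
        using S Suc 0(2) by (auto simp: L_def intro!: sum.neutral)
      then have "\<mu>1 * L x1 = 0" "\<mu>1\<^sup>2 * Phi p x1 x1 = 0" "\<mu>1 * \<mu>2 * Phi p x1 x2 = 0"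
        using 0(1)[OF xS(1)] 0(1)[OF xS(2)] 0(2)[OF xS(1)] by auto
      then show ?thesis using IH2 unfolding tot by (cases "\<mu>1 = 0") auto
    next
      case 2
      have 0: "\<mu>2 = 0 \<or> Phi p x2 z = 0" "\<mu>2 = 0 \<or> Phi p z x2 = 0" if "z \<in> S" for z
        using 2 Phi_zero[OF Suc.prems(1) xS(2) that] Phi_sym[of p z x2] by auto
      have "\<mu>2 = 0 \<or> L x2 = 0"
        using S Suc 0(2) by (auto simp: L_def intro!: sum.neutral)
      then have "\<mu>2 * L x2 = 0" "\<mu>2\<^sup>2 * Phi p x2 x2 = 0" "\<mu>1 * \<mu>2 * Phi p x1 x2 = 0"
        using 0(1)[OF xS(2)] 0(1)[OF xS(2)] 0(2)[OF xS(1)] by auto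
      then show ?thesis using IH1 unfolding tot by (cases "\<mu>2 = 0") auto
    next
      case 3
      have "0 \<le> Q + 2 * (\<Sum>i<m. \<mu> i * (\<mu>1 * Phi p (x i) x1 + \<mu>2 * Phi p (x i) x2)) +
         (\<mu>1\<^sup>2 * Phi p x1 x1 + \<mu>2\<^sup>2 * Phi p x2 x2 + 2 * \<mu>1 * \<mu>2 * Phi p x1 x2)"
      proof (rule LSS_merge[OF Suc.prems(1) xS _ _ 3])
        show "0 \<le> Q + 2 * \<omega> * (\<Sum>i<m. \<mu> i * Phi p (x i) z) + \<omega>\<^sup>2 * Phi p z z"
          if "z \<in> S" "0 \<le> \<omega>" "rad \<kappa> (d p z)" "\<And>i. i < m \<Longrightarrow> small \<kappa> (d p z + d p (x i) + d z (x i))" for z \<omega>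
          using IH[OF that] by (simp add: L_def)
              show "x i \<in> S" "0 \<le> \<mu> i" "rad \<kappa> (d p (x i))" if "i < m" for i
          using that Suc S[of i] nonneg[of i] rd[of i] by simp_all
        show "rad \<kappa> (d p x1)" "rad \<kappa> (d p x2)" "small \<kappa> (d p x1 + d p x2 + d x1 x2)"
          using rd[of m] rd[of "Suc m"] sm[of m "Suc m"] Suc by (simp_all add: x1_def x2_def)
        show "small \<kappa> (d p x1 + d p (x i) + d x1 (x i))" "small \<kappa> (d p x2 + d p (x i) + d x2 (x i))"
          if "i < m" for i
          using that sm[of m i] sm[of "Suc m" i] Suc by (simp_all add: x1_def x2_def)
      qed
      also have "(\<Sum>i<m. \<mu> i * (\<mu>1 * Phi p (x i) x1 + \<mu>2 * Phi p (x i) x2)) = \<mu>1 * L x1 + \<mu>2 * L x2"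
        by (simp add: L_def sum_distrib_left sum.distrib algebra_simps)
      finally show ?thesis unfolding tot by (simp add: algebra_simps)
    qed
  qed
qed

theorem LSS:
  assumes "finite I" "p \<in> S" "\<And>i. i \<in> I \<Longrightarrow> x i \<in> S" "\<And>i. i \<in> I \<Longrightarrow> 0 \<le> \<mu> i"
    and "\<And>i j. i \<in> I \<Longrightarrow> j \<in> I \<Longrightarrow> small \<kappa> (d p (x i) + d p (x j) + d (x i) (x j))"
  shows "0 \<le> (\<Sum>i\<in>I. \<Sum>j\<in>I. \<mu> i * \<mu> j * Phi p (x i) (x j))"
proof -
  obtain f where f: "bij_betw f {..<card I} I"
    using ex_bij_betw_nat_finite[OF assms(1)] by (auto simp: lessThan_atLeast0)
  have fI: "f k \<in> I" if "k < card I" for k using f that by (auto simp: bij_betw_def)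
  have "0 \<le> (\<Sum>i<card I. \<Sum>j<card I. \<mu> (f i) * \<mu> (f j) * Phi p (x (f i)) (x (f j)))"
    using LSS_nat[where n = "card I" and x = "\<lambda>i. x (f i)" and \<mu> = "\<lambda>i. \<mu> (f i)", OF assms(2)] assms fI
    by simp
  then show ?thesis by (simp add: sum.reindex_bij_betw[OF f, symmetric])
qed

end

section \<open>Balanced families of vectors and points matched to them\<close>

definition lin :: "'i set \<Rightarrow> ('i \<Rightarrow> 'v::real_vector) \<Rightarrow> 'v set" where
  "lin I \<beta> = range (\<lambda>a. \<Sum>i\<in>I. a i *\<^sub>R \<beta> i)"

lemma lin_add: "u \<in> lin I \<beta> \<Longrightarrow> v \<in> lin I \<beta> \<Longrightarrow> u + v \<in> lin I \<beta>"
  unfolding lin_def by (auto simp flip: sum.distrib scaleR_left_distrib)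

lemma lin_scale: "u \<in> lin I \<beta> \<Longrightarrow> c *\<^sub>R u \<in> lin I \<beta>"
proof -
  have "c *\<^sub>R (\<Sum>i\<in>I. a i *\<^sub>R \<beta> i) = (\<Sum>i\<in>I. (c * a i) *\<^sub>R \<beta> i)" for a
    by (simp add: scaleR_right.sum)
  then show "u \<in> lin I \<beta> \<Longrightarrow> c *\<^sub>R u \<in> lin I \<beta>" unfolding lin_def by auto
qed

lemma lin_0: "0 \<in> lin I \<beta>"
  unfolding lin_def by (auto intro!: image_eqI[of _ _ "\<lambda>_. 0"])

lemma lin_base: "finite I \<Longrightarrow> i \<in> I \<Longrightarrow> \<beta> i \<in> lin I \<beta>"
  unfolding lin_def by (auto intro!: image_eqI[of _ _ "\<lambda>j. if j = i then 1 else 0"] simp: if_distrib[of "\<lambda>c. c *\<^sub>R _"] cong: if_cong)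

text \<open>Adding a large multiple of the positive relation makes all coefficients nonnegative, so
  the convex cone of a balanced family is its whole span. This removes the sign restriction of
  \<open>LSS\<close> on the base points.\<close>

lemma lin_positive:
  assumes "finite I" "\<And>i. i \<in> I \<Longrightarrow> 0 < \<nu> i" "(\<Sum>i\<in>I. \<nu> i *\<^sub>R \<beta> i) = 0" "v \<in> lin I \<beta>"
  obtains c where "\<And>i. i \<in> I \<Longrightarrow> 0 \<le> c i" "v = (\<Sum>i\<in>I. c i *\<^sub>R \<beta> i)"
proof -
  obtain a where a: "v = (\<Sum>i\<in>I. a i *\<^sub>R \<beta> i)" using assms(4) by (auto simp: lin_def)
  define t where "t = (\<Sum>i\<in>I. \<bar>a i\<bar> / \<nu> i)"
  have "0 \<le> a i + t * \<nu> i" if i: "i \<in> I" for i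
  proof -
    have "\<bar>a i\<bar> / \<nu> i \<le> t"
      unfolding t_def using assms(1,2) i by (intro member_le_sum) (auto simp: less_imp_le)
    then have "\<bar>a i\<bar> \<le> t * \<nu> i" using assms(2)[OF i] by (simp add: pos_divide_le_eq)
    then show ?thesis by linarith
  qed
  moreover have "(\<Sum>i\<in>I. (a i + t * \<nu> i) *\<^sub>R \<beta> i) = v + t *\<^sub>R (\<Sum>i\<in>I. \<nu> i *\<^sub>R \<beta> i)"
    by (simp add: a scaleR_left_distrib sum.distrib scaleR_right.sum)
  ultimately show ?thesis using that[of "\<lambda>i. a i + t * \<nu> i"] assms(3) by simp
qed

context cbb
begin

text \<open>The base points look from p like the vectors \<beta>. The positive relation says that
  their directions surround p inside the span of \<beta>.\<close>

definition base_at :: "'b \<Rightarrow> 'i set \<Rightarrow> ('i \<Rightarrow> 'b) \<Rightarrow> ('i \<Rightarrow> 'v::real_inner) \<Rightarrow> bool" where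
  "base_at p I b \<beta> \<longleftrightarrow> finite I \<and> p \<in> S \<and> (\<forall>i\<in>I. b i \<in> S) \<and>
    (\<forall>i\<in>I. \<forall>j\<in>I. small \<kappa> (d p (b i) + d p (b j) + d (b i) (b j)) \<and> Phi p (b i) (b j) = \<beta> i \<bullet> \<beta> j) \<and>
    (\<exists>\<nu>. (\<forall>i\<in>I. 0 < \<nu> i) \<and> (\<Sum>i\<in>I. \<nu> i *\<^sub>R \<beta> i) = 0)"

text \<open>\<open>LSS\<close> for the base and two more points, indexed by the two truth values.
  The base part of the sum collapses to a squared norm, which later choices of c make
  explicit.\<close>

lemma LSS2:
  fixes I :: "'i set"
  assumes b: "base_at p I b \<beta>" and z: "z \<in> S" "z' \<in> S"
    and sm: "\<And>i. i \<in> I \<Longrightarrow> small \<kappa> (d p z + d p (b i) + d z (b i))"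
      "\<And>i. i \<in> I \<Longrightarrow> small \<kappa> (d p z' + d p (b i) + d z' (b i))"
      "rad \<kappa> (d p z)" "rad \<kappa> (d p z')" "small \<kappa> (d p z + d p z' + d z z')"
    and c: "0 \<le> a" "0 \<le> a'" "\<And>i. i \<in> I \<Longrightarrow> 0 \<le> c i"
  shows "0 \<le> a\<^sup>2 * Phi p z z + a'\<^sup>2 * Phi p z' z' + 2 * a * a' * Phi p z z'
    + 2 * a * (\<Sum>i\<in>I. c i * Phi p z (b i)) + 2 * a' * (\<Sum>i\<in>I. c i * Phi p z' (b i))
    + (\<Sum>i\<in>I. c i *\<^sub>R \<beta> i) \<bullet> (\<Sum>i\<in>I. c i *\<^sub>R \<beta> i)"
proof -
  have fin: "finite I" and p: "p \<in> S" and bS: "\<And>i. i \<in> I \<Longrightarrow> b i \<in> S"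
    and bsm: "\<And>i j. i \<in> I \<Longrightarrow> j \<in> I \<Longrightarrow> small \<kappa> (d p (b i) + d p (b j) + d (b i) (b j))"
    and bP: "\<And>i j. i \<in> I \<Longrightarrow> j \<in> I \<Longrightarrow> Phi p (b i) (b j) = \<beta> i \<bullet> \<beta> j"
    using b by (auto simp: base_at_def)
  define J where "J = (UNIV :: bool set) <+> I"
  define y where "y = case_sum (\<lambda>t. if t then z else z') b"
  define \<mu> where "\<mu> = case_sum (\<lambda>t. if t then a else a') c"
  have y [simp]: "y (Inl True) = z" "y (Inl False) = z'" "\<And>i. y (Inr i) = b i"
    and mu [simp]: "\<mu> (Inl True) = a" "\<mu> (Inl False) = a'" "\<And>i. \<mu> (Inr i) = c i"
    by (auto simp: y_def \<mu>_def)
  have sumJ: "(\<Sum>i\<in>J. f i) = f (Inl True) + f (Inl False) + (\<Sum>i\<in>I. f (Inr i))" for f :: "bool + 'i \<Rightarrow> real"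
    unfolding J_def using fin by (simp add: sum.Plus UNIV_bool)
  have "0 \<le> (\<Sum>i\<in>J. \<Sum>j\<in>J. \<mu> i * \<mu> j * Phi p (y i) (y j))"
  proof (rule LSS)
    show "finite J" using fin by (simp add: J_def)
    show "p \<in> S" by (rule p)
    fix i assume i: "i \<in> J"
    show "y i \<in> S" "0 \<le> \<mu> i" using i z bS c by (auto simp: J_def y_def \<mu>_def)
    fix j assume j: "j \<in> J"
    have refl: "small \<kappa> (d p z + d p z + d z z)" "small \<kappa> (d p z' + d p z' + d z' z')"
      using sm(3,4) by (simp_all flip: mult_2)
    have swap: "small \<kappa> (d p u + d p w + d u w) \<Longrightarrow> small \<kappa> (d p w + d p u + d w u)" for u w
      by (simp only: add.commute[of "d p u" "d p w"] sym[of u w])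
    note rev = swap[OF sm(5)] swap[OF sm(1)] swap[OF sm(2)]
    show "small \<kappa> (d p (y i) + d p (y j) + d (y i) (y j))"
      using i j by (auto simp: J_def y_def refl rev sm bsm)
  qed
  also have "\<dots> = a\<^sup>2 * Phi p z z + a'\<^sup>2 * Phi p z' z' + 2 * a * a' * Phi p z z'
    + 2 * a * (\<Sum>i\<in>I. c i * Phi p z (b i)) + 2 * a' * (\<Sum>i\<in>I. c i * Phi p z' (b i))
    + (\<Sum>i\<in>I. \<Sum>j\<in>I. c i * c j * Phi p (b i) (b j))"
  proof -
    have 1: "(\<Sum>i\<in>I. \<mu>0 * c i * Phi p x (b i)) = \<mu>0 * (\<Sum>i\<in>I. c i * Phi p x (b i))"
      "(\<Sum>i\<in>I. c i * \<mu>0 * Phi p (b i) x) = \<mu>0 * (\<Sum>i\<in>I. c i * Phi p x (b i))" for x \<mu>0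
      by (simp_all add: sum_distrib_left mult_ac Phi_sym)
    show ?thesis
      by (simp only: sumJ y mu sum.distrib 1 Phi_sym[of p z' z]) (simp add: power2_eq_square algebra_simps)
  qed
  also have "(\<Sum>i\<in>I. \<Sum>j\<in>I. c i * c j * Phi p (b i) (b j)) = (\<Sum>i\<in>I. c i *\<^sub>R \<beta> i) \<bullet> (\<Sum>i\<in>I. c i *\<^sub>R \<beta> i)"
    unfolding inner_sum_left inner_sum_right by (intro sum.cong refl) (simp add: bP inner_commute)
  finally show ?thesis .
qed

text \<open>Give the base points the weights of the relation, so that their squared norm vanishes,
  and z a weight e. The first order term in e must then be nonnegative. The corresponding sum for v
  is 0, so the nonnegative differences have a nonpositive weighted sum and all vanish.\<close>

lemma half_match:
  assumes b: "base_at p I b \<beta>" and z: "z \<in> S" "rad \<kappa> (d p z)"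
    and sm: "\<And>i. i \<in> I \<Longrightarrow> small \<kappa> (d p z + d p (b i) + d z (b i))"
    and le: "\<And>i. i \<in> I \<Longrightarrow> Phi p z (b i) \<le> v \<bullet> \<beta> i" and i: "i \<in> I"
  shows "Phi p z (b i) = v \<bullet> \<beta> i"
proof -
  obtain \<nu> where nu: "\<And>i. i \<in> I \<Longrightarrow> 0 < \<nu> i" "(\<Sum>i\<in>I. \<nu> i *\<^sub>R \<beta> i) = 0" and fin: "finite I"
    using b unfolding base_at_def by blast
  define A B where "A = Phi p z z" and "B = (\<Sum>i\<in>I. \<nu> i * Phi p z (b i))"
  have pos: "0 \<le> e\<^sup>2 * A + 2 * e * B" if "0 < e" for e
    using LSS2[OF b z(1) z(1) sm sm z(2) z(2), of e 0 \<nu>] that nu z(2)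
    by (simp add: A_def B_def less_imp_le flip: mult_2)
  have A: "0 \<le> A" by (simp add: A_def Phi_self)
  have B: "0 \<le> B"
  proof (rule ccontr)
    assume neg: "\<not> 0 \<le> B"
    \<comment> \<open>Small enough for the linear term to outweigh the quadratic one; the summand 1
      keeps the denominator positive if A = 0.\<close>
    define e where "e = - B / (A + 1)"
    have e: "0 < e" unfolding e_def using neg A by (intro divide_pos_pos) auto
    have "e * A + 2 * B < 0"
    proof -
      have "e * A \<le> - B" using A neg by (simp add: e_def pos_divide_le_eq) (simp add: field_simps)
      then show ?thesis using neg by simp
    qed
    then have "e * (e * A + 2 * B) < 0" using e by (simp add: mult_less_0_iff)
    then show False using pos[OF e] by (simp add: power2_eq_square algebra_simps)
  qed
  have "0 = v \<bullet> (\<Sum>i\<in>I. \<nu> i *\<^sub>R \<beta> i)" by (simp add: nu)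
  also have "\<dots> = (\<Sum>i\<in>I. \<nu> i * (v \<bullet> \<beta> i))" by (simp add: inner_sum_right)
  finally have "(\<Sum>i\<in>I. \<nu> i * (v \<bullet> \<beta> i - Phi p z (b i))) \<le> 0"
    using B by (simp add: B_def right_diff_distrib sum_subtractf)
  moreover have nonneg': "0 \<le> \<nu> i * (v \<bullet> \<beta> i - Phi p z (b i))" if "i \<in> I" for i
    using le nu that by (simp add: less_imp_le)
  ultimately have "(\<Sum>i\<in>I. \<nu> i * (v \<bullet> \<beta> i - Phi p z (b i))) = 0"
    by (intro antisym sum_nonneg)
  then have "\<nu> i * (v \<bullet> \<beta> i - Phi p z (b i)) = 0"
    using sum_nonneg_eq_0_iff[of I "\<lambda>i. \<nu> i * (v \<bullet> \<beta> i - Phi p z (b i))"] fin nonneg' i by blast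
  then show ?thesis using nu(1)[OF i] by simp
qed

text \<open>The base weights represent -(v + v'). Then \<open>LSS2\<close> with unit weights at z
  and z' reads 0 \<le> |v|^2 + |v'|^2 + 2 Phi - 2 |v + v'|^2 + |v + v'|^2, which is twice the
  claim.\<close>

lemma match_inner:
  assumes b: "base_at p I b \<beta>" and z: "z \<in> S" "rad \<kappa> (d p z)" "z' \<in> S" "rad \<kappa> (d p z')"
    and sm: "\<And>i. i \<in> I \<Longrightarrow> small \<kappa> (d p z + d p (b i) + d z (b i))"
      "\<And>i. i \<in> I \<Longrightarrow> small \<kappa> (d p z' + d p (b i) + d z' (b i))"
      "small \<kappa> (d p z + d p z' + d z z')"
    and v: "v \<in> lin I \<beta>" "v \<bullet> v = (sn \<kappa> (d p z))\<^sup>2" "\<And>i. i \<in> I \<Longrightarrow> Phi p z (b i) = v \<bullet> \<beta> i"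
    and v': "v' \<in> lin I \<beta>" "v' \<bullet> v' = (sn \<kappa> (d p z'))\<^sup>2" "\<And>i. i \<in> I \<Longrightarrow> Phi p z' (b i) = v' \<bullet> \<beta> i"
  shows "v \<bullet> v' \<le> Phi p z z'"
proof -
  obtain \<nu> where nu: "\<And>i. i \<in> I \<Longrightarrow> 0 < \<nu> i" "(\<Sum>i\<in>I. \<nu> i *\<^sub>R \<beta> i) = 0" and fin: "finite I"
    using b unfolding base_at_def by blast
  have "(- 1) *\<^sub>R (v + v') \<in> lin I \<beta>" by (intro lin_scale lin_add v v')
  then obtain c where c: "\<And>i. i \<in> I \<Longrightarrow> 0 \<le> c i" "(- 1) *\<^sub>R (v + v') = (\<Sum>i\<in>I. c i *\<^sub>R \<beta> i)"
    using lin_positive[OF fin nu] by blast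
  have 1: "(\<Sum>i\<in>I. c i * Phi p z (b i)) = v \<bullet> ((- 1) *\<^sub>R (v + v'))"
    and 2: "(\<Sum>i\<in>I. c i * Phi p z' (b i)) = v' \<bullet> ((- 1) *\<^sub>R (v + v'))"
    unfolding c(2) inner_sum_right using v(3) v'(3) by (auto intro!: sum.cong)
  have "0 \<le> Phi p z z + Phi p z' z' + 2 * Phi p z z' + 2 * (v \<bullet> ((- 1) *\<^sub>R (v + v'))) + 2 * (v' \<bullet> ((- 1) *\<^sub>R (v + v')))
     + ((- 1) *\<^sub>R (v + v')) \<bullet> ((- 1) *\<^sub>R (v + v'))"
    using LSS2[OF b z(1,3) sm(1,2) z(2,4) sm(3), of 1 1 c] c by (simp add: 1 2)
  also have "\<dots> = 2 * Phi p z z' - 2 * (v \<bullet> v')"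
    using v(2) v'(2) by (simp add: Phi_self inner_add inner_diff inner_commute[of v' v])
  finally show ?thesis by simp
qed

text \<open>The form is nonnegative on nonnegative weights and vanishes at a weight with all entries
  positive. Both \<mu> + t y and \<mu> - t y are admissible for small t, and adding the two
  inequalities cancels the linear term.\<close>

lemma Phi_psd:
  assumes "finite I" "p \<in> S" "\<And>i. i \<in> I \<Longrightarrow> x i \<in> S" "\<And>i. i \<in> I \<Longrightarrow> 0 < \<mu> i"
    and "\<And>i j. i \<in> I \<Longrightarrow> j \<in> I \<Longrightarrow> small \<kappa> (d p (x i) + d p (x j) + d (x i) (x j))"
    and zero: "(\<Sum>i\<in>I. \<Sum>j\<in>I. \<mu> i * \<mu> j * Phi p (x i) (x j)) = 0"
  shows "0 \<le> (\<Sum>i\<in>I. \<Sum>j\<in>I. y i * y j * Phi p (x i) (x j))"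
proof -
  define q where "q = (\<lambda>f g. \<Sum>i\<in>I. \<Sum>j\<in>I. f i * g j * Phi p (x i) (x j))"
  define t where "t = 1 / (1 + (\<Sum>i\<in>I. \<bar>y i\<bar> / \<mu> i))"
  have s0: "0 \<le> (\<Sum>i\<in>I. \<bar>y i\<bar> / \<mu> i)" using assms(4) by (intro sum_nonneg) (simp add: less_imp_le)
  have t0: "0 < t" using s0 by (simp add: t_def)
  have bound: "t * \<bar>y i\<bar> \<le> \<mu> i" if i: "i \<in> I" for i
  proof -
    have "\<bar>y i\<bar> / \<mu> i \<le> 1 + (\<Sum>i\<in>I. \<bar>y i\<bar> / \<mu> i)"
      using member_le_sum[of i I "\<lambda>i. \<bar>y i\<bar> / \<mu> i"] assms(1,4) i by (simp add: less_imp_le add_increasing)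
    then show ?thesis using assms(4)[OF i] s0 by (simp add: t_def divide_le_eq mult.commute)
  qed
  have 1: "0 \<le> q (\<lambda>i. \<mu> i + s * y i) (\<lambda>i. \<mu> i + s * y i)" if s: "\<bar>s\<bar> = t" for s
    unfolding q_def
  proof (rule LSS[OF assms(1-3) _ assms(5)])
    fix i assume i: "i \<in> I"
    have "\<bar>s * y i\<bar> \<le> \<mu> i" using bound[OF i] s by (simp add: abs_mult)
    then show "0 \<le> \<mu> i + s * y i" by linarith
  qed auto
  have 2: "q (\<lambda>i. \<mu> i + s * y i) (\<lambda>i. \<mu> i + s * y i) = q \<mu> \<mu> + s * (q \<mu> y + q y \<mu>) + s\<^sup>2 * q y y" for s
    unfolding q_def sum_distrib_left sum.distrib[symmetric]
    by (intro sum.cong refl) (simp add: power2_eq_square algebra_simps)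
  have "q \<mu> \<mu> = 0" using zero by (simp add: q_def)
  then have "0 \<le> t * (q \<mu> y + q y \<mu>) + t\<^sup>2 * q y y" "0 \<le> - (t * (q \<mu> y + q y \<mu>)) + t\<^sup>2 * q y y"
    using 1[of t] 1[of "- t"] t0 unfolding 2 by simp_all
  then have "0 \<le> t\<^sup>2 * q y y" by linarith
  then show ?thesis using t0 by (simp add: q_def zero_le_mult_iff)
qed

end

section \<open>Alexandrov spaces and their ultrapowers\<close>

text \<open>Zorn's lemma for families of sets all of whose finite intersections are infinite. Asking
  for infinite instead of nonempty intersections makes the resulting ultrafilter free.\<close>

lemma ultrafilter_exists:
  "\<exists>F :: nat filter. F \<noteq> bot \<and> F \<le> sequentially \<and>
     (\<forall>P. eventually P F \<or> eventually (\<lambda>n. \<not> P n) F)"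
proof -
  define A :: "nat set set set" where
    "A = {U. \<forall>V\<subseteq>U. finite V \<longrightarrow> infinite (\<Inter>V)}"
  have "\<exists>M\<in>A. \<forall>U\<in>A. M \<subseteq> U \<longrightarrow> U = M"
  proof (rule subset_Zorn')
    fix C assume C: "subset.chain A C"
    show "\<Union>C \<in> A" unfolding A_def
    proof (intro CollectI allI impI)
      fix V assume V: "V \<subseteq> \<Union>C" "finite V"
      show "infinite (\<Inter>V)"
      proof (cases "C = {}")
        case False
        then obtain U where "U \<in> C" "V \<subseteq> U"
          using finite_subset_Union_chain[OF V(2,1) _ C] by blast
        moreover have "U \<in> A" using C \<open>U \<in> C\<close> by (auto simp: subset.chain_def)
        ultimately show ?thesis using V(2) by (auto simp: A_def)
      qed (use V in auto)
    qed
  qed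
  then obtain M where M: "M \<in> A" "\<And>U. U \<in> A \<Longrightarrow> M \<subseteq> U \<Longrightarrow> U = M" by blast
  \<comment> \<open>The filter generated by M and the cofinite sets.\<close>
  define Q where "Q = (\<lambda>P. \<exists>V\<subseteq>M. finite V \<and> finite (\<Inter>V - Collect P))"
  have Qf: "is_filter Q"
  proof
    show "Q (\<lambda>_. True)" unfolding Q_def by (intro exI[of _ "{}"]) auto
  next
    fix P P' assume "Q P" "Q P'"
    then obtain V V' where V: "V \<subseteq> M" "finite V" "finite (\<Inter>V - Collect P)"
      and V': "V' \<subseteq> M" "finite V'" "finite (\<Inter>V' - Collect P')" unfolding Q_def by blast
    have "\<Inter>(V \<union> V') - Collect (\<lambda>x. P x \<and> P' x) \<subseteq> (\<Inter>V - Collect P) \<union> (\<Inter>V' - Collect P')" by auto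
    then have "finite (\<Inter>(V \<union> V') - Collect (\<lambda>x. P x \<and> P' x))"
      using V V' by (meson finite_UnI finite_subset)
    then show "Q (\<lambda>x. P x \<and> P' x)" unfolding Q_def using V V' by (intro exI[of _ "V \<union> V'"]) auto
  next
    fix P P' :: "nat \<Rightarrow> bool" assume *: "\<forall>x. P x \<longrightarrow> P' x" and "Q P"
    then obtain V where V: "V \<subseteq> M" "finite V" "finite (\<Inter>V - Collect P)" unfolding Q_def by blast
    have "\<Inter>V - Collect P' \<subseteq> \<Inter>V - Collect P" using * by auto
    then have "finite (\<Inter>V - Collect P')" using V(3) by (rule finite_subset)
    then show "Q P'" unfolding Q_def using V by blast
  qed
  define F where "F = Abs_filter Q"
  have ev: "eventually P F \<longleftrightarrow> Q P" for P
    unfolding F_def using Qf by (rule eventually_Abs_filter)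
  have "\<not> Q (\<lambda>_. False)" using M(1) by (auto simp: Q_def A_def)
  then have "F \<noteq> bot" using ev by (auto simp: trivial_limit_def)
  moreover have "F \<le> sequentially"
  proof (rule filter_leI)
    fix P :: "nat \<Rightarrow> bool" assume "eventually P sequentially"
    then have "finite (- Collect P)" by (simp add: eventually_cofinite Compl_eq flip: cofinite_eq_sequentially)
    then show "eventually P F" unfolding ev Q_def by (intro exI[of _ "{}"]) (simp add: Compl_eq_Diff_UNIV)
  qed
  moreover have "eventually P F \<or> eventually (\<lambda>n. \<not> P n) F" for P
  proof (cases "Collect P \<in> M")
    case True
    then have "Q P" unfolding Q_def by (intro exI[of _ "{Collect P}"]) auto
    then show ?thesis by (simp add: ev)
  next
    case False
    then have "insert (Collect P) M \<notin> A" using M(2) by blast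
    then obtain W where W: "W \<subseteq> insert (Collect P) M" "finite W" "finite (\<Inter>W)" by (auto simp: A_def)
    have "\<Inter>(W - {Collect P}) - Collect (\<lambda>n. \<not> P n) \<subseteq> \<Inter>W" by auto
    then have "finite (\<Inter>(W - {Collect P}) - Collect (\<lambda>n. \<not> P n))" using W(3) by (rule finite_subset)
    then have "Q (\<lambda>n. \<not> P n)" unfolding Q_def using W by (intro exI[of _ "W - {Collect P}"]) auto
    then show ?thesis by (simp add: ev)
  qed
  ultimately show ?thesis by blast
qed

definition om :: "nat filter" where
  "om = (SOME F. F \<noteq> bot \<and> F \<le> sequentially \<and> (\<forall>P. eventually P F \<or> eventually (\<lambda>n. \<not> P n) F))"

lemma om: "om \<noteq> bot" "om \<le> sequentially" "eventually P om \<or> eventually (\<lambda>n. \<not> P n) om"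
  using someI_ex[OF ultrafilter_exists] unfolding om_def by blast+

text \<open>A bounded sequence has a cluster point by compactness, and along an ultrafilter a
  cluster point is a limit.\<close>

lemma om_bounded_convergent:
  fixes f :: "nat \<Rightarrow> real"
  assumes "\<And>n. \<bar>f n\<bar> \<le> B"
  shows "\<exists>L. (f \<longlongrightarrow> L) om"
proof -
  have "compact {- B..B}" by simp
  moreover have "filtermap f om \<noteq> bot" using om(1) by (simp add: filtermap_bot_iff)
  moreover have "eventually (\<lambda>x. x \<in> {- B..B}) (filtermap f om)"
    using assms by (simp add: eventually_filtermap abs_le_iff minus_le_iff)
  ultimately obtain L where L: "inf (nhds L) (filtermap f om) \<noteq> bot"
    unfolding compact_filter by blast
  have "(f \<longlongrightarrow> L) om"
  proof (rule topological_tendstoI)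
    fix S assume S: "open S" "L \<in> S"
    show "\<forall>\<^sub>F x in om. f x \<in> S"
    proof (rule ccontr)
      assume "\<not> ?thesis"
      then have "eventually (\<lambda>x. x \<notin> S) (filtermap f om)"
        using om(3)[of "\<lambda>x. f x \<in> S"] by (simp add: eventually_filtermap)
      moreover have "eventually (\<lambda>x. x \<in> S) (nhds L)" using S by (rule eventually_nhds_in_open)
      ultimately have "eventually (\<lambda>_. False) (inf (nhds L) (filtermap f om))"
        by (auto simp: eventually_inf)
      then show False using L by (simp add: trivial_limit_def)
    qed
  qed
  then show ?thesis ..
qed

section \<open>The curvature condition in terms of \<open>md\<close>\<close>

definition cang :: "real \<Rightarrow> real \<Rightarrow> real \<Rightarrow> real \<Rightarrow> real" where
  "cang \<kappa> a b c = (md \<kappa> a + md \<kappa> b - md \<kappa> c - \<kappa> * md \<kappa> a * md \<kappa> b) / (sn \<kappa> a * sn \<kappa> b)"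

text \<open>A factor \<kappa> cancels between numerator and denominator, which leaves one formula
  for all \<kappa>.\<close>

lemma comparison_angle_eq:
  "comparison_angle \<kappa> X x y z = arccos (cang \<kappa> (mdist X x y) (mdist X x z) (mdist X y z))"
proof (cases "\<kappa> = 0")
  case True
  then show ?thesis
    by (simp add: comparison_angle_def cang_def md_zero sn_zero field_simps flip: diff_divide_distrib add_divide_distrib)
next
  case False
  have "(1 - \<kappa> * c - (1 - \<kappa> * a) * (1 - \<kappa> * b)) / (\<kappa> * s * t) = (a + b - c - \<kappa> * a * b) / (s * t)" for a b c s t
  proof -
    have "1 - \<kappa> * c - (1 - \<kappa> * a) * (1 - \<kappa> * b) = \<kappa> * (a + b - c - \<kappa> * a * b)" by (simp add: algebra_simps)
    then show ?thesis using False by (simp add: mult.assoc)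
  qed
  then show ?thesis using False by (simp add: comparison_angle_def cang_def cs_eq)
qed

definition tri_ok :: "real \<Rightarrow> real \<Rightarrow> real \<Rightarrow> real \<Rightarrow> bool" where
  "tri_ok \<kappa> a b c \<longleftrightarrow> 0 < a \<and> 0 < b \<and> \<bar>a - b\<bar> \<le> c \<and> c \<le> a + b \<and> small \<kappa> (a + b + c)"

lemma tri_ok_sn: assumes "tri_ok \<kappa> a b c" shows "0 < sn \<kappa> a" "0 < sn \<kappa> b"
proof -
  have "2 * a \<le> a + b + c" "2 * b \<le> a + b + c" "small \<kappa> (a + b + c)"
    using assms unfolding tri_ok_def by auto
  then have "small \<kappa> (2 * a)" "small \<kappa> (2 * b)" using small_mono by blast+
  then show "0 < sn \<kappa> a" "0 < sn \<kappa> b" using assms by (auto simp: tri_ok_def intro: sn_gt_0)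
qed

lemma cang_bounds: assumes "tri_ok \<kappa> a b c" shows "cang \<kappa> a b c \<in> {- 1..1}"
proof -
  have "\<bar>md \<kappa> a + md \<kappa> b - md \<kappa> c - \<kappa> * md \<kappa> a * md \<kappa> b\<bar> \<le> sn \<kappa> a * sn \<kappa> b"
    using assms by (intro cone_angle_bounds) (auto simp: tri_ok_def)
  moreover have "0 < sn \<kappa> a * sn \<kappa> b" using tri_ok_sn[OF assms] by simp
  ultimately have "\<bar>cang \<kappa> a b c\<bar> \<le> 1" by (simp add: cang_def abs_divide pos_divide_le_eq del: zero_less_mult_iff)
  then show ?thesis by (simp add: abs_le_iff minus_le_iff)
qed

lemma tendsto_arccos_cang:
  assumes "(a \<longlongrightarrow> A) F" "(b \<longlongrightarrow> B) F" "(c \<longlongrightarrow> C) F" "tri_ok \<kappa> A B C"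
    and "\<forall>\<^sub>F n in F. tri_ok \<kappa> (a n) (b n) (c n)"
  shows "((\<lambda>n. arccos (cang \<kappa> (a n) (b n) (c n))) \<longlongrightarrow> arccos (cang \<kappa> A B C)) F"
proof (rule continuous_on_tendsto_compose[OF continuous_on_arccos'])
  show "((\<lambda>n. cang \<kappa> (a n) (b n) (c n)) \<longlongrightarrow> cang \<kappa> A B C) F"
    unfolding cang_def using tri_ok_sn[OF assms(4)]
    by (intro tendsto_intros assms) auto
  show "\<forall>\<^sub>F n in F. cang \<kappa> (a n) (b n) (c n) \<in> {- 1..1}"
    using assms(5) by eventually_elim (rule cang_bounds)
qed (use cang_bounds assms in blast)

lemma cang_same: "tri_ok \<kappa> a a 0 \<Longrightarrow> cang \<kappa> a a 0 = 1"
  using tri_ok_sn[of \<kappa> a a 0] sn_sq[of \<kappa> a]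
  by (simp add: cang_def power2_eq_square algebra_simps)

text \<open>The four-point condition with y, z, w allowed to coincide, as terms of sequences may. If
  two of them agree, one angle is 0 and the other two are at most pi each.\<close>

lemma quad_X:
  fixes X :: "'a metric"
  defines "\<delta> \<equiv> mdist X"
  assumes curv: "curvature_ge \<kappa> X" and S: "x \<in> mspace X" "y \<in> mspace X" "z \<in> mspace X" "w \<in> mspace X"
    and ne: "x \<noteq> y" "x \<noteq> z" "x \<noteq> w"
    and sm: "small \<kappa> (\<delta> x y + \<delta> x z + \<delta> y z)" "small \<kappa> (\<delta> x z + \<delta> x w + \<delta> z w)"
      "small \<kappa> (\<delta> x w + \<delta> x y + \<delta> w y)" "small \<kappa> (\<delta> y z + \<delta> z w + \<delta> w y)"
  shows "arccos (cang \<kappa> (\<delta> x y) (\<delta> x z) (\<delta> y z)) + arccos (cang \<kappa> (\<delta> x z) (\<delta> x w) (\<delta> z w))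
     + arccos (cang \<kappa> (\<delta> x w) (\<delta> x y) (\<delta> w y)) \<le> 2 * pi"
proof -
  have pos: "0 < \<delta> x y" "0 < \<delta> x z" "0 < \<delta> x w"
    using ne S mdist_nonneg[of X] mdist_zero[of x X] unfolding \<delta>_def by (metis order_le_less)+
  have ok: "tri_ok \<kappa> (\<delta> x y) (\<delta> x z) (\<delta> y z)" "tri_ok \<kappa> (\<delta> x z) (\<delta> x w) (\<delta> z w)"
    "tri_ok \<kappa> (\<delta> x w) (\<delta> x y) (\<delta> w y)"
    using pos sm S mdist_triangle[of x X y z] mdist_triangle[of x X z y] mdist_triangle[of y X x z]
      mdist_triangle[of x X w z] mdist_triangle[of x X z w] mdist_triangle[of z X x w]
      mdist_triangle[of x X w y] mdist_triangle[of x X y w] mdist_triangle[of w X x y]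
    unfolding tri_ok_def \<delta>_def by (auto simp: abs_le_iff mdist_commute[of X z x] mdist_commute[of X y x] mdist_commute[of X w x]
        mdist_commute[of X w z] mdist_commute[of X z y] mdist_commute[of X y w])
  have le_pi: "arccos (cang \<kappa> (\<delta> x y) (\<delta> x z) (\<delta> y z)) \<le> pi" "arccos (cang \<kappa> (\<delta> x z) (\<delta> x w) (\<delta> z w)) \<le> pi"
    "arccos (cang \<kappa> (\<delta> x w) (\<delta> x y) (\<delta> w y)) \<le> pi"
    using cang_bounds[OF ok(1)] cang_bounds[OF ok(2)] cang_bounds[OF ok(3)] by (auto intro!: arccos_ubound)
 have zz: "mdist X y y = 0" "mdist X z z = 0" "mdist X w w = 0" using S by simp_all
  consider "y = z" | "z = w" | "w = y" | "distinct [x, y, z, w]" using ne by auto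
  then show ?thesis
  proof cases
    case 1
    then show ?thesis using zz ok(1) S le_pi(2,3) cang_same[of \<kappa> "\<delta> x y"] by (simp add: \<delta>_def del: mdist_zero)
  next
    case 2
    then show ?thesis using zz ok(2) S le_pi(1,3) cang_same[of \<kappa> "\<delta> x z"] by (simp add: \<delta>_def del: mdist_zero)
  next
    case 3
    then show ?thesis using zz ok(3) S le_pi(1,2) cang_same[of \<kappa> "\<delta> x y"] by (simp add: \<delta>_def del: mdist_zero)
  next
    case 4
    have "quadruple_size X x y z w < 2 * pi / sqrt \<kappa>" if "\<kappa> > 0"
      unfolding quadruple_size_def peri_def using sm that
      by (simp add: small_def \<delta>_def mdist_commute[of X z x] mdist_commute[of X w x]
        mdist_commute[of X w z] mdist_commute[of X z y] mdist_commute[of X w y] add_ac)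
    then show ?thesis using curv S 4 unfolding curvature_ge_def comparison_angle_eq \<delta>_def by blast
  qed
qed

text \<open>The intermediate value theorem along an almost shortest curve makes the distance from x
  exact; the whole error falls on the distance to y.\<close>

lemma almost_between:
  assumes X: "length_space X" "x \<in> mspace X" "y \<in> mspace X" and s: "0 \<le> s" "s \<le> mdist X x y" and e: "0 < e"
  obtains z where "z \<in> mspace X" "mdist X x z = s" "mdist X z y < mdist X x y - s + e"
proof -
  have "ereal (mdist X x y) = (INF \<gamma> \<in> {\<gamma>. pathin (mtopology_of X) \<gamma> \<and> \<gamma> 0 = x \<and> \<gamma> 1 = y}. curve_length X \<gamma> 0 1)"
    using X by (auto simp: length_space_def)
  moreover have "ereal (mdist X x y) < ereal (mdist X x y + e)" using e by simp
  ultimately obtain \<gamma> where g: "pathin (mtopology_of X) \<gamma>" "\<gamma> 0 = x" "\<gamma> 1 = y"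
    "curve_length X \<gamma> 0 1 < ereal (mdist X x y + e)"
    by (auto simp: INF_less_iff)
  have cont: "continuous_map (top_of_set {0..1}) (mtopology_of X) \<gamma>"
    using g(1) by (simp add: pathin_def)
  have gS: "\<gamma> t \<in> mspace X" if "t \<in> {0..1}" for t
    using continuous_map_funspace[OF cont] that by auto
  have "continuous_map (top_of_set {0..1::real}) euclideanreal (\<lambda>t. mdist X x (\<gamma> t))"
    by (intro continuous_map_mdist cont) (use X in auto)
  then have "continuous_on {0..1} (\<lambda>t. mdist X x (\<gamma> t))" by simp
  moreover have xx: "mdist X x x = 0" using X by simp
  ultimately obtain t where t: "0 \<le> t" "t \<le> 1" "mdist X x (\<gamma> t) = s"
    using IVT'[of "\<lambda>t. mdist X x (\<gamma> t)" 0 s 1] s g(2,3) xx by (auto simp del: mdist_zero)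
  have "ereal (\<Sum>i<length [0,t,1] - 1. mdist X (\<gamma> ([0,t,1] ! i)) (\<gamma> ([0,t,1] ! Suc i))) \<le> curve_length X \<gamma> 0 1"
    unfolding curve_length_def by (rule SUP_upper) (use t in auto)
  then have "ereal (s + mdist X (\<gamma> t) y) \<le> curve_length X \<gamma> 0 1"
    using g t by (simp add: numeral_2_eq_2)
  then have "ereal (s + mdist X (\<gamma> t) y) < ereal (mdist X x y + e)"
    using g(4) by (rule le_less_trans)
  then show ?thesis using that[of "\<gamma> t"] t gS by simp
qed

section \<open>The ultrapower as a pseudometric space of bounded sequences\<close>

definition seqs :: "'a metric \<Rightarrow> (nat \<Rightarrow> 'a) set" where
  "seqs X = {f. range f \<subseteq> mspace X \<and> (\<exists>B. \<forall>n. mdist X (f 0) (f n) \<le> B)}"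

text \<open>The default 0 makes it nonnegative, symmetric and zero on the diagonal for arbitrary
  arguments, as \<open>cbb\<close> demands.\<close>

definition udist :: "'a metric \<Rightarrow> (nat \<Rightarrow> 'a) \<Rightarrow> (nat \<Rightarrow> 'a) \<Rightarrow> real" where
  "udist X f g = (if f \<in> seqs X \<and> g \<in> seqs X then Lim om (\<lambda>n. mdist X (f n) (g n)) else 0)"

lemma seqs_mspace: "f \<in> seqs X \<Longrightarrow> f n \<in> mspace X"
  by (auto simp: seqs_def)

lemma seqsI:
  assumes "\<And>n. f n \<in> mspace X" "a \<in> mspace X" "\<And>n. mdist X a (f n) \<le> B"
  shows "f \<in> seqs X"
proof -
  have "mdist X (f 0) (f n) \<le> mdist X a (f 0) + B" for n
    using mdist_triangle[of "f 0" X a "f n"] assms mdist_commute[of X "f 0" a] by (smt (verit))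
  then show ?thesis using assms(1) by (auto simp: seqs_def)
qed

lemma udist_tendsto:
  assumes "f \<in> seqs X" "g \<in> seqs X"
  shows "((\<lambda>n. mdist X (f n) (g n)) \<longlongrightarrow> udist X f g) om"
proof -
  obtain A B where A: "\<And>n. mdist X (f 0) (f n) \<le> A" and B: "\<And>n. mdist X (g 0) (g n) \<le> B"
    using assms by (auto simp: seqs_def)
  have "\<bar>mdist X (f n) (g n)\<bar> \<le> A + mdist X (f 0) (g 0) + B" for n
    using mdist_triangle[of "f n" X "f 0" "g n"] mdist_triangle[of "f 0" X "g 0" "g n"]
      A[of n] B[of n] mdist_commute[of X "f n" "f 0"] seqs_mspace[OF assms(1)] seqs_mspace[OF assms(2)]
    by (simp add: abs_le_iff)
  then obtain L where L: "((\<lambda>n. mdist X (f n) (g n)) \<longlongrightarrow> L) om"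
    using om_bounded_convergent[of "\<lambda>n. mdist X (f n) (g n)"] by blast
  then show ?thesis using tendsto_Lim[OF om(1) L] assms by (simp add: udist_def)
qed

lemma udist_eqI:
  assumes "f \<in> seqs X" "g \<in> seqs X" "((\<lambda>n. mdist X (f n) (g n)) \<longlongrightarrow> L) om"
  shows "udist X f g = L"
  using tendsto_unique[OF om(1) udist_tendsto[OF assms(1,2)] assms(3)] .

lemma const_seqs: "x \<in> mspace X \<Longrightarrow> (\<lambda>_. x) \<in> seqs X"
  by (auto simp: seqs_def)

lemma udist_const: "x \<in> mspace X \<Longrightarrow> y \<in> mspace X \<Longrightarrow> udist X (\<lambda>_. x) (\<lambda>_. y) = mdist X x y"
  by (intro udist_eqI const_seqs) auto

lemma udist_nonneg: "0 \<le> udist X f g"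
proof (cases "f \<in> seqs X \<and> g \<in> seqs X")
  case True
  then show ?thesis
    by (intro tendsto_lowerbound[OF udist_tendsto _ om(1)]) auto
qed (auto simp: udist_def)

lemma udist_commute: "udist X f g = udist X g f"
  by (simp add: udist_def mdist_commute)

lemma udist_same: "udist X f f = 0"
proof (cases "f \<in> seqs X")
  case True
  have "(\<lambda>n. mdist X (f n) (f n)) = (\<lambda>n. 0)" using seqs_mspace[OF True] by auto
  then show ?thesis using udist_eqI[OF True True, of 0] by simp
qed (auto simp: udist_def)

lemma udist_triangle:
  assumes "f \<in> seqs X" "g \<in> seqs X" "h \<in> seqs X"
  shows "udist X f h \<le> udist X f g + udist X g h"
  using assms seqs_mspace
  by (intro tendsto_le[OF om(1) tendsto_add[OF udist_tendsto udist_tendsto] udist_tendsto])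
    (auto intro!: always_eventually mdist_triangle)

lemma om_inverse: "((\<lambda>n. inverse (real (Suc n))) \<longlongrightarrow> 0) om"
  using LIMSEQ_inverse_real_of_nat om(2) tendsto_mono by blast

lemma udist_betw:
  assumes X: "length_space X" and f: "f \<in> seqs X" "g \<in> seqs X" and s: "0 \<le> s" "s \<le> udist X f g"
  shows "\<exists>z\<in>seqs X. udist X f z = s \<and> udist X z g = udist X f g - s"
proof -
  \<comment> \<open>The minimum is taken because s, though at most the limit, may exceed some of the
    distances.\<close>
  have "\<exists>z. z \<in> mspace X \<and> mdist X (f n) z = min s (mdist X (f n) (g n)) \<and>
     mdist X z (g n) < mdist X (f n) (g n) - min s (mdist X (f n) (g n)) + inverse (real (Suc n))" for n
    using almost_between[OF X seqs_mspace[OF f(1)] seqs_mspace[OF f(2)], of "min s (mdist X (f n) (g n))" n n "inverse (real (Suc n))"] s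
    by (metis inverse_positive_iff_positive min.boundedI min.cobounded2 mdist_nonneg of_nat_0_less_iff zero_less_Suc)
  then obtain z where z: "\<And>n. z n \<in> mspace X" "\<And>n. mdist X (f n) (z n) = min s (mdist X (f n) (g n))"
    "\<And>n. mdist X (z n) (g n) < mdist X (f n) (g n) - min s (mdist X (f n) (g n)) + inverse (real (Suc n))"
    by metis
  obtain B where B: "\<And>n. mdist X (f 0) (f n) \<le> B" using f(1) by (auto simp: seqs_def)
  have zS: "z \<in> seqs X"
  proof (rule seqsI[OF z(1) seqs_mspace[OF f(1), of 0]])
    fix n
    show "mdist X (f 0) (z n) \<le> B + s"
      using mdist_triangle[of "f 0" X "f n" "z n"] z B[of n] seqs_mspace[OF f(1)]
      by (smt (verit) min.cobounded1)
  qed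
  have "((\<lambda>n. min s (mdist X (f n) (g n))) \<longlongrightarrow> min s (udist X f g)) om"
    by (intro tendsto_min tendsto_const udist_tendsto f)
  then have 1: "udist X f z = s" using udist_eqI[OF f(1) zS, of s] z(2) s by simp
  have "((\<lambda>n. mdist X (f n) (g n) - min s (mdist X (f n) (g n)) + inverse (real (Suc n))) \<longlongrightarrow> udist X f g - min s (udist X f g) + 0) om"
    by (intro tendsto_add tendsto_diff tendsto_min tendsto_const udist_tendsto f om_inverse)
  then have "udist X z g \<le> udist X f g - min s (udist X f g) + 0"
    by (rule tendsto_le[OF om(1) _ udist_tendsto[OF zS f(2)]])
      (use z(3) in \<open>auto intro!: always_eventually less_imp_le\<close>)
  moreover have "udist X f g \<le> udist X f z + udist X z g" by (intro udist_triangle f zS)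
  ultimately show ?thesis using zS 1 s by auto
qed

text \<open>In the four-point condition at z the comparison angle between a and b is pi, so the
  other two angles add up to at most pi and their cosines to at least 0. Clearing denominators gives
  \<open>comp\<close>. The condition is applied to the terms of the sequences and passed to the
  limit.\<close>

lemma udist_comp:
  assumes curv: "curvature_ge \<kappa> X" and S: "a \<in> seqs X" "b \<in> seqs X" "c \<in> seqs X" "z \<in> seqs X"
    and z: "udist X a z + udist X z b = udist X a b"
    and sm: "small \<kappa> (udist X a b + udist X b c + udist X c a)"
  defines "\<delta> \<equiv> udist X"
  shows "sn \<kappa> (\<delta> z b) * md \<kappa> (\<delta> a c) + sn \<kappa> (\<delta> a z) * md \<kappa> (\<delta> b c)
      \<le> sn \<kappa> (\<delta> a b) * md \<kappa> (\<delta> z c) + sn \<kappa> (\<delta> z b) * md \<kappa> (\<delta> a z) + sn \<kappa> (\<delta> a z) * md \<kappa> (\<delta> z b)"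
proof -
  note z = z[folded \<delta>_def] and sm = sm[folded \<delta>_def]
  note tri = udist_triangle[where X = X, folded \<delta>_def]
  have comm: "\<delta> f g = \<delta> g f" for f g by (simp add: \<delta>_def udist_commute)
  define s t e where "s = \<delta> z a" and "t = \<delta> z b" and "e = \<delta> z c"
  have az: "\<delta> a z = s" "\<delta> b z = t" "\<delta> c z = e" "\<delta> z a = s" "\<delta> z b = t" "\<delta> z c = e"
    using comm by (auto simp: s_def t_def e_def)
  have ab: "\<delta> a b = s + t" "\<delta> b a = s + t" using z comm[of b a] az by simp_all
  have nn: "0 \<le> s" "0 \<le> t" "0 \<le> e" by (auto simp: s_def t_def e_def \<delta>_def udist_nonneg)
  have lim: "((\<lambda>n. mdist X (f n) (g n)) \<longlongrightarrow> \<delta> f g) om" if "f \<in> seqs X" "g \<in> seqs X" for f g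
    unfolding \<delta>_def by (rule udist_tendsto[OF that])
  \<comment> \<open>The angles at z exist only when z is apart from a, b and c. In the other cases
    both sides of the inequality agree.\<close>
  consider "s = 0" | "t = 0" | "e = 0" | "0 < s" "0 < t" "0 < e" using nn by linarith
  then show ?thesis
  proof cases
    case 1
    then have "\<delta> a c = \<delta> z c" using tri[OF S(1,4,3)] tri[OF S(4,1,3)] az by simp
    then show ?thesis using 1 az ab by simp
  next
    case 2
    then have "\<delta> b c = \<delta> z c" using tri[OF S(2,4,3)] tri[OF S(4,2,3)] az by simp
    then show ?thesis using 2 az ab by simp
  next
    case 3
    then have "\<delta> b c = t" "\<delta> a c = s"
      using tri[OF S(2,4,3)] tri[OF S(2,3,4)] tri[OF S(1,4,3)] tri[OF S(1,3,4)] az by simp_all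
    then show ?thesis using 3 az ab by simp
  next
    case 4
    have sms: "small \<kappa> (\<delta> z a + \<delta> z b + \<delta> a b)" "small \<kappa> (\<delta> z b + \<delta> z c + \<delta> b c)"
      "small \<kappa> (\<delta> z c + \<delta> z a + \<delta> c a)" "small \<kappa> (\<delta> a b + \<delta> b c + \<delta> c a)"
      using tri[OF S(1,3,2)] tri[OF S(4,1,3)] tri[OF S(4,2,3)] comm[of a c] comm[of c b] az ab
      by (intro small_mono[OF sm]; linarith)+
    have nen: "\<forall>\<^sub>F n in om. z n \<noteq> f n" if "f \<in> seqs X" "0 < \<delta> z f" for f
      using order_tendstoD(1)[OF lim[OF S(4) that(1)] that(2)]
      by eventually_elim (metis seqs_mspace[OF S(4)] mdist_zero less_irrefl)
    have ok_lim: "tri_ok \<kappa> (\<delta> z f) (\<delta> z g) (\<delta> f g)"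
      if "f \<in> seqs X" "g \<in> seqs X" "0 < \<delta> z f" "0 < \<delta> z g" "small \<kappa> (\<delta> z f + \<delta> z g + \<delta> f g)" for f g
      using tri[OF S(4) that(1,2)] tri[OF S(4) that(2,1)] tri[OF that(1) S(4) that(2)] that comm[of f g] comm[of f z]
      by (auto simp: tri_ok_def)
    have ok_ev: "\<forall>\<^sub>F n in om. tri_ok \<kappa> (mdist X (z n) (f n)) (mdist X (z n) (g n)) (mdist X (f n) (g n))"
      if "f \<in> seqs X" "g \<in> seqs X" "0 < \<delta> z f" "0 < \<delta> z g" "small \<kappa> (\<delta> z f + \<delta> z g + \<delta> f g)" for f g
    proof -
      have "\<forall>\<^sub>F n in om. small \<kappa> (mdist X (z n) (f n) + mdist X (z n) (g n) + mdist X (f n) (g n))"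
        by (rule eventually_small[OF _ that(5)]) (intro tendsto_add lim S that)
      then show ?thesis
        using order_tendstoD(1)[OF lim[OF S(4) that(1)] that(3)] order_tendstoD(1)[OF lim[OF S(4) that(2)] that(4)]
      proof eventually_elim
        case (elim n)
        note m = seqs_mspace[OF S(4), of n] seqs_mspace[OF that(1), of n] seqs_mspace[OF that(2), of n]
        show ?case
          using elim mdist_triangle[OF m(1,2,3)] mdist_triangle[OF m(1,3,2)] mdist_triangle[OF m(2,1,3)]
            mdist_commute[of X "f n" "g n"] mdist_commute[of X "f n" "z n"]
          by (auto simp: tri_ok_def)
      qed
    qed
    have ang_lim: "((\<lambda>n. arccos (cang \<kappa> (mdist X (z n) (f n)) (mdist X (z n) (g n)) (mdist X (f n) (g n))))
         \<longlongrightarrow> arccos (cang \<kappa> (\<delta> z f) (\<delta> z g) (\<delta> f g))) om"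
      if "f \<in> seqs X" "g \<in> seqs X" "0 < \<delta> z f" "0 < \<delta> z g" "small \<kappa> (\<delta> z f + \<delta> z g + \<delta> f g)" for f g
      by (rule tendsto_arccos_cang[OF lim lim lim ok_lim[OF that] ok_ev[OF that]]) (use S that in auto)
    have pos: "0 < \<delta> z a" "0 < \<delta> z b" "0 < \<delta> z c" using 4 az by auto
    have ev_small: "\<forall>\<^sub>F n in om. small \<kappa> (mdist X (f n) (g n) + mdist X (g n) (h n) + mdist X (h n) (f n))"
      if "f \<in> seqs X" "g \<in> seqs X" "h \<in> seqs X" "small \<kappa> (\<delta> f g + \<delta> g h + \<delta> h f)" for f g h
      by (rule eventually_small[OF _ that(4)]) (intro tendsto_add lim that)
    have "\<forall>\<^sub>F n in om. arccos (cang \<kappa> (mdist X (z n) (a n)) (mdist X (z n) (b n)) (mdist X (a n) (b n)))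
      + arccos (cang \<kappa> (mdist X (z n) (b n)) (mdist X (z n) (c n)) (mdist X (b n) (c n)))
      + arccos (cang \<kappa> (mdist X (z n) (c n)) (mdist X (z n) (a n)) (mdist X (c n) (a n))) \<le> 2 * pi"
      using nen[OF S(1) pos(1)] nen[OF S(2) pos(2)] nen[OF S(3) pos(3)]
        ok_ev[OF S(1,2) pos(1,2) sms(1)] ok_ev[OF S(2,3) pos(2,3) sms(2)] ok_ev[OF S(3,1) pos(3,1) sms(3)]
        ev_small[OF S(1,2,3) sms(4)]
    proof eventually_elim
      case (elim n)
      show ?case
        by (rule quad_X[OF curv]) (use elim S seqs_mspace in \<open>auto simp: tri_ok_def\<close>)
    qed
    moreover have "((\<lambda>n. arccos (cang \<kappa> (mdist X (z n) (a n)) (mdist X (z n) (b n)) (mdist X (a n) (b n)))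
      + arccos (cang \<kappa> (mdist X (z n) (b n)) (mdist X (z n) (c n)) (mdist X (b n) (c n)))
      + arccos (cang \<kappa> (mdist X (z n) (c n)) (mdist X (z n) (a n)) (mdist X (c n) (a n)))) \<longlongrightarrow>
        arccos (cang \<kappa> (\<delta> z a) (\<delta> z b) (\<delta> a b)) + arccos (cang \<kappa> (\<delta> z b) (\<delta> z c) (\<delta> b c))
        + arccos (cang \<kappa> (\<delta> z c) (\<delta> z a) (\<delta> c a))) om"
      by (intro tendsto_add ang_lim S pos sms)
    ultimately have sum: "arccos (cang \<kappa> s t (s + t)) + arccos (cang \<kappa> t e (\<delta> b c)) + arccos (cang \<kappa> e s (\<delta> c a)) \<le> 2 * pi"
      using tendsto_upperbound[OF _ _ om(1)] by (simp add: az ab)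
    have ok: "tri_ok \<kappa> s t (s + t)" "tri_ok \<kappa> t e (\<delta> b c)" "tri_ok \<kappa> e s (\<delta> c a)"
      using ok_lim[OF S(1,2) pos(1,2) sms(1)] ok_lim[OF S(2,3) pos(2,3) sms(2)] ok_lim[OF S(3,1) pos(3,1) sms(3)]
      by (simp_all add: az ab)
    note snp = tri_ok_sn[OF ok(1)] tri_ok_sn(2)[OF ok(2)]
    have "cang \<kappa> s t (s + t) = - 1" using snp by (simp add: cang_def md_add)
    then have "arccos (cang \<kappa> t e (\<delta> b c)) \<le> pi - arccos (cang \<kappa> e s (\<delta> c a))" using sum by simp
    moreover have "0 \<le> arccos (cang \<kappa> t e (\<delta> b c))" "0 \<le> arccos (cang \<kappa> e s (\<delta> c a))"
      using cang_bounds[OF ok(2)] cang_bounds[OF ok(3)] by (auto intro: arccos_lbound)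
    ultimately have "cos (pi - arccos (cang \<kappa> e s (\<delta> c a))) \<le> cos (arccos (cang \<kappa> t e (\<delta> b c)))"
      by (intro cos_monotone_0_pi_le) auto
    then have "0 \<le> cang \<kappa> t e (\<delta> b c) + cang \<kappa> e s (\<delta> c a)"
      using cang_bounds[OF ok(2)] cang_bounds[OF ok(3)] by simp
    then have "0 \<le> (sn \<kappa> s * sn \<kappa> t * sn \<kappa> e) * (cang \<kappa> t e (\<delta> b c) + cang \<kappa> e s (\<delta> c a))"
      by (intro mult_nonneg_nonneg less_imp_le[OF snp(1)] less_imp_le[OF snp(2)] less_imp_le[OF snp(3)])
    also have "\<dots> = sn \<kappa> s * (md \<kappa> t + md \<kappa> e - md \<kappa> (\<delta> b c) - \<kappa> * md \<kappa> t * md \<kappa> e)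
        + sn \<kappa> t * (md \<kappa> e + md \<kappa> s - md \<kappa> (\<delta> c a) - \<kappa> * md \<kappa> e * md \<kappa> s)"
    proof -
      have "(x * y * w) * (A / (y * w) + B / (w * x)) = x * A + y * B" if "x \<noteq> 0" "y \<noteq> 0" "w \<noteq> 0" for x y w A B :: real
        using that by (simp add: field_simps)
      then show ?thesis unfolding cang_def using snp by (metis less_irrefl)
    qed
    finally show ?thesis
      unfolding ab(1) az comm[of a c] sn_add by argo
  qed
qed

theorem cbb_ultrapower:
  assumes "alexandrov_space \<kappa> X"
  shows "cbb \<kappa> (seqs X) (udist X)"
proof
  show "\<And>a b c z. a \<in> seqs X \<Longrightarrow> b \<in> seqs X \<Longrightarrow> c \<in> seqs X \<Longrightarrow> z \<in> seqs X \<Longrightarrow>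
      udist X a z + udist X z b = udist X a b \<Longrightarrow>
      small \<kappa> (udist X a b + udist X b c + udist X c a) \<Longrightarrow>
      sn \<kappa> (udist X z b) * md \<kappa> (udist X a c) + sn \<kappa> (udist X a z) * md \<kappa> (udist X b c)
      \<le> sn \<kappa> (udist X a b) * md \<kappa> (udist X z c) + sn \<kappa> (udist X z b) * md \<kappa> (udist X a z) + sn \<kappa> (udist X a z) * md \<kappa> (udist X z b)"
    using assms by (intro udist_comp) (auto simp: alexandrov_space_def)
qed (use assms in \<open>auto simp: udist_nonneg udist_same alexandrov_space_def intro: udist_commute udist_triangle udist_betw\<close>)

text \<open>If a sequence of almost-between points were not Cauchy, two of its subsequences would be distinct
  between-points in the ultrapower.\<close>
lemma between_realized:
  assumes X: "alexandrov_space \<kappa> X" and ab: "a \<in> mspace X" "b \<in> mspace X" and s: "0 \<le> s" "s \<le> mdist X a b"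
    and uniq: "\<And>z z'. z \<in> seqs X \<Longrightarrow> z' \<in> seqs X \<Longrightarrow>
      udist X (\<lambda>_. a) z = s \<Longrightarrow> udist X z (\<lambda>_. b) = mdist X a b - s \<Longrightarrow>
      udist X (\<lambda>_. a) z' = s \<Longrightarrow> udist X z' (\<lambda>_. b) = mdist X a b - s \<Longrightarrow> udist X z z' = 0"
  shows "\<exists>z\<in>mspace X. mdist X a z = s \<and> mdist X z b = mdist X a b - s"
proof -
  have L: "length_space X" and C: "mcomplete_of X" using X by (auto simp: alexandrov_space_def)
  have "\<exists>z. z \<in> mspace X \<and> mdist X a z = s \<and> mdist X z b < mdist X a b - s + inverse (real (Suc n))" for n
    using almost_between[OF L ab s, of "inverse (real (Suc n))"]
    by (metis inverse_positive_iff_positive of_nat_0_less_iff zero_less_Suc)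
  then obtain y where y: "\<And>n. y n \<in> mspace X" "\<And>n. mdist X a (y n) = s"
    "\<And>n. mdist X (y n) b < mdist X a b - s + inverse (real (Suc n))" by metis
  have lower: "mdist X a b - s \<le> mdist X (y n) b" for n
    using mdist_triangle[of a X "y n" b] ab y(1,2)[of n] by simp
  \<comment> \<open>Any choice of later indices again represents a between-point, since the errors
    still tend to 0.\<close>
  have sub: "(\<lambda>n. y (r n)) \<in> seqs X \<and> udist X (\<lambda>_. a) (\<lambda>n. y (r n)) = s \<and> udist X (\<lambda>n. y (r n)) (\<lambda>_. b) = mdist X a b - s"
    if r: "\<And>n. n \<le> r n" for r
  proof -
    have S: "(\<lambda>n. y (r n)) \<in> seqs X" by (rule seqsI[of _ X a s]) (use y(1,2) ab in simp_all)
    have upper: "mdist X (y (r n)) b \<le> mdist X a b - s + inverse (real (Suc n))" for n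
    proof -
      have "inverse (real (Suc (r n))) \<le> inverse (real (Suc n))" using r[of n] by (simp add: le_imp_inverse_le)
      then show ?thesis using y(3)[of "r n"] by linarith
    qed
    have "((\<lambda>n. mdist X a b - s + inverse (real (Suc n))) \<longlongrightarrow> mdist X a b - s + 0) om"
      by (intro tendsto_add tendsto_const om_inverse)
    then have lim: "((\<lambda>n. mdist X a b - s + inverse (real (Suc n))) \<longlongrightarrow> mdist X a b - s) om" by simp
    have "((\<lambda>n. mdist X (y (r n)) b) \<longlongrightarrow> mdist X a b - s) om"
    proof (rule tendsto_sandwich[OF _ _ tendsto_const lim])
      show "\<forall>\<^sub>F n in om. mdist X a b - s \<le> mdist X (y (r n)) b"
        using lower by (intro always_eventually allI)
      show "\<forall>\<^sub>F n in om. mdist X (y (r n)) b \<le> mdist X a b - s + inverse (real (Suc n))"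
        using upper by (intro always_eventually allI)
    qed
    then have "udist X (\<lambda>n. y (r n)) (\<lambda>_. b) = mdist X a b - s" by (rule udist_eqI[OF S const_seqs[OF ab(2)]])
    moreover have "udist X (\<lambda>_. a) (\<lambda>n. y (r n)) = s"
      by (rule udist_eqI[OF const_seqs[OF ab(1)] S]) (simp add: y(2))
    ultimately show ?thesis using S by blast
  qed
  interpret Metric_space "mspace X" "mdist X" by simp
  have "MCauchy y"
  proof (rule ccontr)
    assume "\<not> MCauchy y"
    moreover have "range y \<subseteq> mspace X" using y(1) by blast
    ultimately have "\<exists>e>0. \<forall>N. \<exists>n n'. N \<le> n \<and> N \<le> n' \<and> \<not> mdist X (y n) (y n') < e"
      unfolding MCauchy_def by blast
    then obtain e where e: "0 < e" "\<And>N. \<exists>n n'. N \<le> n \<and> N \<le> n' \<and> e \<le> mdist X (y n) (y n')"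
      unfolding not_less by blast
    then obtain f where f: "\<And>N. N \<le> fst (f N) \<and> N \<le> snd (f N) \<and> e \<le> mdist X (y (fst (f N))) (y (snd (f N)))"
      using choice[of "\<lambda>N q. N \<le> fst q \<and> N \<le> snd q \<and> e \<le> mdist X (y (fst q)) (y (snd q))"] by auto
    define r r' where "r = (\<lambda>N. fst (f N))" and "r' = (\<lambda>N. snd (f N))"
    have r: "\<And>N. N \<le> r N" "\<And>N. N \<le> r' N" "\<And>N. e \<le> mdist X (y (r N)) (y (r' N))"
      using f by (auto simp: r_def r'_def)
    have "udist X (\<lambda>n. y (r n)) (\<lambda>n. y (r' n)) = 0"
      using sub[OF r(1)] sub[OF r(2)] by (intro uniq) simp_all
    moreover have "e \<le> udist X (\<lambda>n. y (r n)) (\<lambda>n. y (r' n))"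
      by (rule tendsto_lowerbound[OF udist_tendsto _ om(1)])
        (use sub[OF r(1)] sub[OF r(2)] r(3) in simp_all)
    ultimately show False using e by simp
  qed
  then obtain z where z: "limitin mtopology y z sequentially"
    using C by (auto simp: mcomplete_of_def mcomplete_def)
  then have zX: "z \<in> mspace X" and zlim: "(\<lambda>n. mdist X (y n) z) \<longlonglongrightarrow> 0"
    by (auto simp: limit_metric_sequentially limitin_metric_dist_null)
  have lim: "(\<lambda>n. mdist X (y n) c) \<longlonglongrightarrow> mdist X z c" if c: "c \<in> mspace X" for c
  proof -
    have "\<bar>mdist X (y n) c - mdist X z c\<bar> \<le> mdist X (y n) z" for n
      using mdist_triangle[of "y n" X z c] mdist_triangle[of z X "y n" c] y(1)[of n] zX c mdist_commute[of X "y n" z]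
      by linarith
    then have "(\<lambda>n. mdist X (y n) c - mdist X z c) \<longlonglongrightarrow> 0"
      by (intro Lim_null_comparison[OF _ zlim]) auto
    then show ?thesis by (simp add: LIM_zero_iff)
  qed
  have "mdist X z a = s"
    using LIMSEQ_unique[OF lim[OF ab(1)], of s] y(2) by (simp add: mdist_commute[of X _ a])
  moreover have "(\<lambda>n. mdist X (y n) b) \<longlonglongrightarrow> mdist X a b - s"
  proof (rule tendsto_sandwich[OF _ _ tendsto_const])
    show "(\<lambda>n. mdist X a b - s + inverse (real (Suc n))) \<longlonglongrightarrow> mdist X a b - s"
      using tendsto_add[OF tendsto_const LIMSEQ_inverse_real_of_nat, of "mdist X a b - s"] by simp
    show "\<forall>\<^sub>F n in sequentially. mdist X a b - s \<le> mdist X (y n) b"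
      using lower by (intro always_eventually allI)
    show "\<forall>\<^sub>F n in sequentially. mdist X (y n) b \<le> mdist X a b - s + inverse (real (Suc n))"
      using y(3) by (intro always_eventually allI less_imp_le)
  qed
  then have "mdist X z b = mdist X a b - s" using LIMSEQ_unique[OF lim[OF ab(2)]] by blast
  ultimately show ?thesis using zX mdist_commute[of X a z] by auto
qed

section \<open>Gram matrices and completeness of \<open>ell2\<close>\<close>

lift_definition shift_ell2 :: "ell2 \<Rightarrow> ell2" is "\<lambda>x n. case n of 0 \<Rightarrow> 0 | Suc k \<Rightarrow> x k"
  subgoal for x using summable_Suc_iff[of "\<lambda>n. (case n of 0 \<Rightarrow> 0 | Suc k \<Rightarrow> x k)\<^sup>2"] by simp
  done

lift_definition e0_ell2 :: ell2 is "\<lambda>n. if n = 0 then 1 else 0"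
  by (rule summable_finite[of "{0}"]) auto

lemma inner_shift_shift: "shift_ell2 x \<bullet> shift_ell2 y = x \<bullet> y"
proof transfer
  fix x y :: "nat \<Rightarrow> real"
  assume "summable (\<lambda>n. (x n)\<^sup>2)" "summable (\<lambda>n. (y n)\<^sup>2)"
  then have s: "summable (\<lambda>n. x n * y n)" by (rule summable_mult_ell2)
  let ?f = "\<lambda>n. (case n of 0 \<Rightarrow> 0 | Suc k \<Rightarrow> x k) * (case n of 0 \<Rightarrow> 0 | Suc k \<Rightarrow> y k)"
  have "summable ?f" using summable_Suc_iff[of ?f] s by simp
  from suminf_split_head[OF this] show "suminf ?f = (\<Sum>n. x n * y n)" by simp
qed

lemma inner_e0_shift: "e0_ell2 \<bullet> shift_ell2 x = 0"
proof transfer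
  fix x :: "nat \<Rightarrow> real"
  have "(\<lambda>n. (if n = 0 then 1 else 0) * (case n of 0 \<Rightarrow> 0 | Suc k \<Rightarrow> x k)) = (\<lambda>n. 0)"
    by (auto simp: fun_eq_iff split: nat.splits)
  then show "(\<Sum>n. (if n = 0 then 1 else 0) * (case n of 0 \<Rightarrow> 0 | Suc k \<Rightarrow> x k)) = 0" by simp
qed

lemma inner_shift_e0: "shift_ell2 x \<bullet> e0_ell2 = 0"
  by (simp only: inner_commute[of "shift_ell2 x"] inner_e0_shift)

lemma inner_e0_e0: "e0_ell2 \<bullet> e0_ell2 = 1"
proof transfer
  have "(\<lambda>n::nat. (if n = 0 then 1 else 0) * (if n = 0 then 1 else 0)) = (\<lambda>n. if n = 0 then 1 else (0::real))" by auto
  then show "(\<Sum>n::nat. (if n = 0 then 1 else 0) * (if n = 0 then 1 else 0)) = (1::real)"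
    using suminf_finite[of "{0}" "\<lambda>n::nat. if n = 0 then 1 else (0::real)"] by simp
qed

lemma norm_e0: "norm e0_ell2 = 1"
  by (simp add: norm_eq_sqrt_inner inner_e0_e0)

text \<open>Induction by one step of symmetric elimination. With a pivot A = G k k > 0 the Schur
  complement is realized by induction; \<open>shift_ell2\<close> frees the first coordinate, along
  which the removed part is added back. If A = 0 the whole row of k vanishes and k is sent to
  0.\<close>

lemma gram_realization:
  fixes G :: "'i \<Rightarrow> 'i \<Rightarrow> real"
  assumes "finite I" "\<And>i j. i \<in> I \<Longrightarrow> j \<in> I \<Longrightarrow> G i j = G j i"
    and "\<And>y. 0 \<le> (\<Sum>i\<in>I. \<Sum>j\<in>I. y i * y j * G i j)"
  shows "\<exists>V :: 'i \<Rightarrow> ell2. \<forall>i\<in>I. \<forall>j\<in>I. V i \<bullet> V j = G i j"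
  using assms
proof (induction I arbitrary: G rule: finite_induct)
  case empty
  then show ?case by simp
next
  case (insert k I)
  note sym = insert.prems(1) and psd = insert.prems(2)
  define q where "q = (\<lambda>y. \<Sum>i\<in>I. \<Sum>j\<in>I. y i * y j * G i j)"
  define b where "b = (\<lambda>y. \<Sum>i\<in>I. y i * G i k)"
  define A where "A = G k k"
  have ex: "0 \<le> t\<^sup>2 * A + 2 * t * b y + q y" for t y
  proof -
    have "0 \<le> (\<Sum>i\<in>insert k I. \<Sum>j\<in>insert k I. (y(k := t)) i * (y(k := t)) j * G i j)" by (rule psd)
    also have "\<dots> = t * t * A + (\<Sum>j\<in>I. t * y j * G k j) + (\<Sum>i\<in>I. y i * t * G i k) + q y"
    proof -
      have ne: "i \<noteq> k" if "i \<in> I" for i using that insert.hyps(2) by auto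
      have 1: "(\<Sum>j\<in>I. (y(k := t)) i * (y(k := t)) j * G i j) = (\<Sum>j\<in>I. (y(k := t)) i * y j * G i j)" for i
        using ne by (intro sum.cong) auto
      have 2: "(\<Sum>i\<in>I. (y(k := t)) i * f i) = (\<Sum>i\<in>I. y i * f i)" for f
        using ne by (intro sum.cong) auto
      have 3: "(\<Sum>i\<in>I. \<Sum>j\<in>I. (y(k := t)) i * y j * G i j) = q y"
        unfolding q_def using ne by (intro sum.cong) auto
      show ?thesis
        unfolding sum.insert[OF insert.hyps(1,2)] 1 sum.distrib 3
        by (simp add: A_def 2 mult.assoc fun_upd_same del: fun_upd_apply)
    qed
    also have "(\<Sum>j\<in>I. t * y j * G k j) = t * b y"
      unfolding b_def sum_distrib_left by (intro sum.cong) (auto simp: sym)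
    also have "(\<Sum>i\<in>I. y i * t * G i k) = t * b y"
      unfolding b_def sum_distrib_left by (intro sum.cong) auto
    finally show ?thesis by (simp add: power2_eq_square)
  qed
  have A0: "0 \<le> A" using ex[of 1 "\<lambda>_. 0"] by (simp add: b_def q_def)
  show ?case
  proof (cases "A = 0")
    case True
    have b0: "b y = 0" for y
    proof (rule ccontr)
      assume b: "b y \<noteq> 0"
      \<comment> \<open>At this t the quadratic polynomial, linear as A = 0, takes the value
        -1.\<close>
      show False using ex[of "- (q y + 1) / (2 * b y)" y] b True by (simp add: field_simps)
    qed
    have Gk: "G i k = 0" if "i \<in> I" for i
    proof -
      have "(\<Sum>j\<in>I. (if j = i then 1 else 0) * G j k) = (\<Sum>j\<in>I. if j = i then G j k else 0)"
        by (intro sum.cong) auto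
      then show ?thesis using b0[of "\<lambda>j. if j = i then 1 else 0"] that insert.hyps(1) by (simp add: b_def)
    qed
    have "\<exists>V :: 'i \<Rightarrow> ell2. \<forall>i\<in>I. \<forall>j\<in>I. V i \<bullet> V j = G i j"
    proof (rule insert.IH)
      show "0 \<le> (\<Sum>i\<in>I. \<Sum>j\<in>I. y i * y j * G i j)" for y using ex[of 0 y] by (simp add: q_def)
    qed (use sym in auto)
    then obtain V :: "'i \<Rightarrow> ell2" where V: "\<And>i j. i \<in> I \<Longrightarrow> j \<in> I \<Longrightarrow> V i \<bullet> V j = G i j" by blast
    show ?thesis
    proof (intro exI ballI)
      fix i j assume "i \<in> insert k I" "j \<in> insert k I"
      then show "(V(k := 0)) i \<bullet> (V(k := 0)) j = G i j"
        using V Gk sym[of k j] True insert.hyps(2) by (auto simp: A_def)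
    qed
  next
    case False
    with A0 have A: "0 < A" by simp
    have "\<exists>V :: 'i \<Rightarrow> ell2. \<forall>i\<in>I. \<forall>j\<in>I. V i \<bullet> V j = G i j - G i k * G j k / A"
    proof (rule insert.IH)
      fix y :: "'i \<Rightarrow> real"
      have "(\<Sum>i\<in>I. \<Sum>j\<in>I. y i * y j * (G i j - G i k * G j k / A)) = q y - b y * b y / A"
        unfolding q_def b_def sum_product sum_divide_distrib sum_subtractf[symmetric]
        by (intro sum.cong refl) (simp add: algebra_simps)
      moreover have "0 \<le> q y - b y * b y / A"
        \<comment> \<open>The minimizing t of the quadratic polynomial.\<close>
        using ex[of "- b y / A" y] A by (simp add: power2_eq_square field_simps)
      ultimately show "0 \<le> (\<Sum>i\<in>I. \<Sum>j\<in>I. y i * y j * (G i j - G i k * G j k / A))" by simp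
    qed (use sym in \<open>auto simp: mult.commute\<close>)
    then obtain V :: "'i \<Rightarrow> ell2" where V: "\<And>i j. i \<in> I \<Longrightarrow> j \<in> I \<Longrightarrow> V i \<bullet> V j = G i j - G i k * G j k / A" by blast
    define W where "W = (\<lambda>i. if i = k then sqrt A *\<^sub>R e0_ell2 else shift_ell2 (V i) + (G i k / sqrt A) *\<^sub>R e0_ell2)"
    have "W i \<bullet> W j = G i j" if "i \<in> I" "j \<in> I" for i j
    proof -
      have "W i \<bullet> W j = V i \<bullet> V j + (G i k / sqrt A) * (G j k / sqrt A)"
        using that insert.hyps(2)
        by (auto simp: W_def inner_add inner_shift_shift inner_e0_shift inner_e0_e0 inner_shift_e0)
      then show ?thesis using V[OF that] A by simp
    qed
    moreover have "W i \<bullet> W k = G i k" "W k \<bullet> W i = G i k" if "i \<in> I" for i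
      using that insert.hyps(2) A
      by (auto simp: W_def inner_add inner_e0_shift inner_e0_e0 inner_shift_e0)
    moreover have "W k \<bullet> W k = G k k" using A by (simp add: W_def inner_e0_e0 A_def)
    ultimately show ?thesis using sym by (intro exI[of _ W]) auto
  qed
qed

text \<open>Coordinates converge. The Cauchy estimate is passed to the limit on finite sections
  first, where this is harmless, and then to the whole series.\<close>

lemma ell2_complete:
  fixes f :: "nat \<Rightarrow> ell2"
  assumes "Cauchy f"
  shows "\<exists>L. f \<longlonglongrightarrow> L"
proof -
  define c where "c = (\<lambda>n k. Rep_ell2 (f n) k)"
  have nrm: "(norm x)\<^sup>2 = (\<Sum>k. (Rep_ell2 x k)\<^sup>2)" for x :: ell2
    unfolding power2_norm_eq_inner inner_ell2.rep_eq by (simp add: power2_eq_square)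
  have smb: "summable (\<lambda>k. (Rep_ell2 x k)\<^sup>2)" for x using Rep_ell2[of x] by simp
  have fin: "(\<Sum>k<K. (Rep_ell2 x k)\<^sup>2) \<le> (norm x)\<^sup>2" for K and x :: ell2
    unfolding nrm by (rule sum_le_suminf[OF smb]) auto
  have coord: "\<bar>Rep_ell2 x k\<bar> \<le> norm x" for k and x :: ell2
  proof -
    have "(Rep_ell2 x k)\<^sup>2 \<le> (\<Sum>k<Suc k. (Rep_ell2 x k)\<^sup>2)"
      by (intro member_le_sum) auto
    then have "\<bar>Rep_ell2 x k\<bar>\<^sup>2 \<le> (norm x)\<^sup>2" using fin[of x "Suc k"] by simp
    then show ?thesis by (rule power2_le_imp_le) simp
  qed
  have "Cauchy (\<lambda>n. c n k)" for k
  proof (rule metric_CauchyI)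
    fix e :: real assume "0 < e"
    then obtain M where M: "\<And>m n. M \<le> m \<Longrightarrow> M \<le> n \<Longrightarrow> dist (f m) (f n) < e" using metric_CauchyD[OF assms] by blast
    have "dist (c m k) (c n k) < e" if "M \<le> m" "M \<le> n" for m n
      using coord[of "f m - f n" k] M[OF that] by (simp add: c_def dist_norm minus_ell2.rep_eq)
    then show "\<exists>M. \<forall>m\<ge>M. \<forall>n\<ge>M. dist (c m k) (c n k) < e" by blast
  qed
  then have "\<exists>L. (\<lambda>n. c n k) \<longlonglongrightarrow> L" for k using Cauchy_convergent_iff convergent_def by blast
  then obtain l where l: "\<And>k. (\<lambda>n. c n k) \<longlonglongrightarrow> l k" by metis
  have tail: "(\<Sum>k<K. (c m k - l k)\<^sup>2) \<le> e\<^sup>2" if M: "\<And>m n. M \<le> m \<Longrightarrow> M \<le> n \<Longrightarrow> dist (f m) (f n) < e" and m: "M \<le> m" for M m e K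
  proof (rule tendsto_upperbound)
    show "(\<lambda>n. \<Sum>k<K. (c m k - c n k)\<^sup>2) \<longlonglongrightarrow> (\<Sum>k<K. (c m k - l k)\<^sup>2)"
      by (intro tendsto_intros l)
    show "\<forall>\<^sub>F n in sequentially. (\<Sum>k<K. (c m k - c n k)\<^sup>2) \<le> e\<^sup>2"
      unfolding eventually_sequentially
    proof (intro exI allI impI)
      fix n assume n: "M \<le> n"
      have "(\<Sum>k<K. (c m k - c n k)\<^sup>2) \<le> (norm (f m - f n))\<^sup>2"
        using fin[of "f m - f n" K] by (simp add: c_def minus_ell2.rep_eq)
      also have "\<dots> \<le> e\<^sup>2" using M[OF m n] by (intro power_mono) (auto simp: dist_norm)
      finally show "(\<Sum>k<K. (c m k - c n k)\<^sup>2) \<le> e\<^sup>2" .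
    qed
  qed simp
  have sq: "summable (\<lambda>k. (c m k - l k)\<^sup>2) \<and> (\<Sum>k. (c m k - l k)\<^sup>2) \<le> e\<^sup>2"
    if M: "\<And>m n. M \<le> m \<Longrightarrow> M \<le> n \<Longrightarrow> dist (f m) (f n) < e" and m: "M \<le> m" for M m e
  proof -
    have s: "summable (\<lambda>k. (c m k - l k)\<^sup>2)"
      by (rule bounded_imp_summable[of _ "e\<^sup>2"]) (use tail[OF that, of "Suc _"] in \<open>auto simp: lessThan_Suc_atMost\<close>)
    moreover have "(\<Sum>k. (c m k - l k)\<^sup>2) \<le> e\<^sup>2"
      by (rule suminf_le_const[OF s]) (use tail[OF that] in auto)
    ultimately show ?thesis ..
  qed
  obtain M1 where M1: "\<And>m n. M1 \<le> m \<Longrightarrow> M1 \<le> n \<Longrightarrow> dist (f m) (f n) < 1"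
    using metric_CauchyD[OF assms, of 1] by auto
  have "summable (\<lambda>k. (c M1 k - l k)\<^sup>2)" using sq[OF M1] by blast
  \<comment> \<open>The limit is square-summable as a sum of this difference and one term of the
    sequence.\<close>
  then have "summable (\<lambda>k. (l k - c M1 k)\<^sup>2)" by (simp add: power2_commute)
  from summable_add_ell2[OF this smb[of "f M1"]] have lsum: "summable (\<lambda>k. (l k)\<^sup>2)" by (simp add: c_def)
  define L where "L = Abs_ell2 l"
  have RL: "Rep_ell2 L = l" unfolding L_def using lsum by (simp add: Abs_ell2_inverse)
  have "f \<longlonglongrightarrow> L"
  proof (rule metric_LIMSEQ_I)
    fix r :: real assume r: "0 < r"
    then obtain M where M: "\<And>m n. M \<le> m \<Longrightarrow> M \<le> n \<Longrightarrow> dist (f m) (f n) < r / 2"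
      using metric_CauchyD[OF assms, of "r / 2"] by auto
    have "dist (f n) L < r" if "M \<le> n" for n
    proof -
      have "(norm (f n - L))\<^sup>2 \<le> (r / 2)\<^sup>2"
        unfolding nrm using sq[OF M that] by (simp add: minus_ell2.rep_eq RL c_def)
      then have "norm (f n - L) \<le> r / 2" by (rule power2_le_imp_le) (use r in simp)
      then show ?thesis using r by (simp add: dist_norm)
    qed
    then show "\<exists>no. \<forall>n\<ge>no. dist (f n) L < r" by blast
  qed
  then show ?thesis ..
qed

section \<open>Coordinates and segments in the model space\<close>

abbreviation MP :: "real \<Rightarrow> (real \<times> ell2) set set" where "MP \<equiv> model_points"
abbreviation dM :: "real \<Rightarrow> (real \<times> ell2) set \<Rightarrow> (real \<times> ell2) set \<Rightarrow> real" where "dM \<equiv> model_dist"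

definition pt :: "real \<Rightarrow> real \<Rightarrow> ell2 \<Rightarrow> (real \<times> ell2) set" where
  "pt \<kappa> r u = cone_rel \<kappa> `` {(r, u)}"

text \<open>In the coordinates \<open>mm\<close> and \<open>vv\<close> the distance is given by the single formula \<open>md_dM\<close> for all \<open>\<kappa>\<close>.\<close>
definition mm :: "real \<Rightarrow> (real \<times> ell2) set \<Rightarrow> real" where
  "mm \<kappa> P = md \<kappa> (fst (SOME p. p \<in> P))"

definition vv :: "real \<Rightarrow> (real \<times> ell2) set \<Rightarrow> ell2" where
  "vv \<kappa> P = (let p = SOME p. p \<in> P in sn \<kappa> (fst p) *\<^sub>R snd p)"

definition org :: "real \<Rightarrow> (real \<times> ell2) set" where
  "org \<kappa> = pt \<kappa> 0 e0_ell2"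

lemma in_cone_pairs: "(r, u) \<in> cone_pairs \<kappa> \<longleftrightarrow> 0 \<le> r \<and> radc \<kappa> r \<and> norm u = 1"
  by (auto simp: cone_pairs_def radc_def)

lemma pt_model: "0 \<le> r \<Longrightarrow> radc \<kappa> r \<Longrightarrow> norm u = 1 \<Longrightarrow> pt \<kappa> r u \<in> MP \<kappa>"
  unfolding pt_def model_points_def by (intro quotientI) (simp add: in_cone_pairs)

lemma model_cases:
  assumes "P \<in> MP \<kappa>"
  obtains r u where "0 \<le> r" "radc \<kappa> r" "norm u = 1" "P = pt \<kappa> r u"
  using model_points_cases[OF assms] unfolding pt_def by (metis in_cone_pairs prod.collapse)

lemma sn_at_pi: "\<kappa> > 0 \<Longrightarrow> sn \<kappa> (pi / sqrt \<kappa>) = 0"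
  by (simp add: sn_pos)

text \<open>The coordinates do not depend on the chosen representative: all representatives share
  the radius, and where the direction is ambiguous \<open>sn\<close> vanishes.\<close>

lemma mv_pt:
  assumes "0 \<le> r" "radc \<kappa> r" "norm u = 1"
  shows "mm \<kappa> (pt \<kappa> r u) = md \<kappa> r" "vv \<kappa> (pt \<kappa> r u) = sn \<kappa> r *\<^sub>R u"
proof -
  define q where "q = (SOME p. p \<in> pt \<kappa> r u)"
  have "(r, u) \<in> pt \<kappa> r u" using assms by (auto simp: pt_def cone_rel_def in_cone_pairs)
  then have "q \<in> pt \<kappa> r u" unfolding q_def by (rule someI)
  then obtain u' where q: "q = (r, u')" "u' = u \<or> r = 0 \<or> (\<kappa> > 0 \<and> r = pi / sqrt \<kappa>)"
    by (auto simp: pt_def cone_rel_def)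
  then have "sn \<kappa> r *\<^sub>R u' = sn \<kappa> r *\<^sub>R u" using sn_at_pi by auto
  then show "mm \<kappa> (pt \<kappa> r u) = md \<kappa> r" "vv \<kappa> (pt \<kappa> r u) = sn \<kappa> r *\<^sub>R u"
    using q by (auto simp: mm_def vv_def q_def[symmetric])
qed

lemma md_cone_dist:
  assumes p: "(r, u) \<in> cone_pairs \<kappa>" and q: "(s, v) \<in> cone_pairs \<kappa>"
  shows "md \<kappa> (cone_pair_dist \<kappa> (r, u) (s, v)) =
      md \<kappa> r + md \<kappa> s - \<kappa> * md \<kappa> r * md \<kappa> s - sn \<kappa> r * sn \<kappa> s * (u \<bullet> v)"
    and "radc \<kappa> (cone_pair_dist \<kappa> (r, u) (s, v))"
proof -
  have n: "norm u = 1" "norm v = 1" using p q by (auto simp: in_cone_pairs)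
  have alg: "(1 - (c * c' + t * w)) / \<kappa> = (1 - c) / \<kappa> + (1 - c') / \<kappa> - \<kappa> * ((1 - c) / \<kappa>) * ((1 - c') / \<kappa>) - t / \<kappa> * w"
    if "\<kappa> \<noteq> 0" for c c' t w :: real
    using that by (simp add: field_simps)
  consider "\<kappa> > 0" | "\<kappa> = 0" | "\<kappa> < 0" by linarith
  then have "md \<kappa> (cone_pair_dist \<kappa> (r, u) (s, v)) =
      md \<kappa> r + md \<kappa> s - \<kappa> * md \<kappa> r * md \<kappa> s - sn \<kappa> r * sn \<kappa> s * (u \<bullet> v) \<and>
      radc \<kappa> (cone_pair_dist \<kappa> (r, u) (s, v))"
  proof cases
    case 1
    define A where "A = (cos (sqrt \<kappa> * r), sin (sqrt \<kappa> * r) *\<^sub>R u) \<bullet> (cos (sqrt \<kappa> * s), sin (sqrt \<kappa> * s) *\<^sub>R v)"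
    have A: "-1 \<le> A" "A \<le> 1" unfolding A_def
      by (rule inner_unit_bounds; rule suspension_unit; rule n)+
    have d: "cone_pair_dist \<kappa> (r, u) (s, v) = arccos A / sqrt \<kappa>"
      using cone_pair_dist_pos[OF 1 p q] by (simp add: A_def)
    have "md \<kappa> (cone_pair_dist \<kappa> (r, u) (s, v)) = (1 - A) / \<kappa>"
      using 1 A by (simp add: d md_pos)
    also have "\<dots> = md \<kappa> r + md \<kappa> s - \<kappa> * md \<kappa> r * md \<kappa> s - sn \<kappa> r * sn \<kappa> s * (u \<bullet> v)"
    proof -
      have A': "A = cos (sqrt \<kappa> * r) * cos (sqrt \<kappa> * s) + (sin (sqrt \<kappa> * r) * sin (sqrt \<kappa> * s)) * (u \<bullet> v)"
        by (simp add: A_def mult.assoc)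
      have sn2: "sn \<kappa> r * sn \<kappa> s = (sin (sqrt \<kappa> * r) * sin (sqrt \<kappa> * s)) / \<kappa>" using 1 by (simp add: sn_pos)
      show ?thesis unfolding A' sn2 md_pos[OF 1] by (rule alg) (use 1 in simp)
    qed
    finally show ?thesis using 1 A arccos_ubound[of A] by (simp add: d radc_def divide_right_mono)
  next
    case 2
    have "cone_pair_dist 0 (r, u) (s, v) = norm (r *\<^sub>R u - s *\<^sub>R v)"
      using cone_pair_dist_0 p q 2 by simp
    moreover have "(norm (r *\<^sub>R u - s *\<^sub>R v))\<^sup>2 = r\<^sup>2 + s\<^sup>2 - 2 * (r * s * (u \<bullet> v))"
      unfolding power2_norm_eq_inner
      using n by (simp add: inner_diff inner_commute[of v u] norm_eq_1 power2_eq_square algebra_simps)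
    ultimately show ?thesis using 2 by (simp add: md_zero sn_zero radc_def field_simps)
  next
    case 3
    define k where "k = sqrt (- \<kappa>)"
    define A where "A = cosh (k * r) * cosh (k * s) - (sinh (k * r) *\<^sub>R u) \<bullet> (sinh (k * s) *\<^sub>R v)"
    have k: "0 < k" "k * k = - \<kappa>" using 3 by (auto simp: k_def)
    have A: "1 \<le> A" unfolding A_def
      by (rule hyperboloid_triangle(1)[OF _ _ _ cosh_sinh_hyperboloid cosh_sinh_hyperboloid
            cosh_sinh_hyperboloid, OF _ _ _ n n(2)]) auto
    have d: "cone_pair_dist \<kappa> (r, u) (s, v) = arcosh A / k"
      using cone_pair_dist_neg[OF 3 p q] by (simp add: A_def k_def)
    have "md \<kappa> (cone_pair_dist \<kappa> (r, u) (s, v)) = (1 - A) / \<kappa>"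
      using 3 A k by (simp add: d md_neg k_def[symmetric])
    also have "\<dots> = md \<kappa> r + md \<kappa> s - \<kappa> * md \<kappa> r * md \<kappa> s - sn \<kappa> r * sn \<kappa> s * (u \<bullet> v)"
    proof -
      have A': "A = cosh (k * r) * cosh (k * s) + (- (sinh (k * r) * sinh (k * s))) * (u \<bullet> v)"
        by (simp add: A_def mult.assoc)
      have "sn \<kappa> r * sn \<kappa> s = sinh (k * r) * sinh (k * s) / (k * k)"
        using 3 by (simp add: sn_neg k_def)
      then have sn2: "sn \<kappa> r * sn \<kappa> s = (- (sinh (k * r) * sinh (k * s))) / \<kappa>" unfolding k(2) by simp
      show ?thesis unfolding A' sn2 md_neg[OF 3] k_def[symmetric] by (rule alg) (use 3 in simp)
    qed
    finally show ?thesis using 3 by (simp add: radc_def)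
  qed
  then show "md \<kappa> (cone_pair_dist \<kappa> (r, u) (s, v)) =
      md \<kappa> r + md \<kappa> s - \<kappa> * md \<kappa> r * md \<kappa> s - sn \<kappa> r * sn \<kappa> s * (u \<bullet> v)"
    "radc \<kappa> (cone_pair_dist \<kappa> (r, u) (s, v))" by auto
qed

lemma dM_nonneg [simp]: "0 \<le> dM \<kappa> P Q"
  using Metric_space.nonneg[OF Metric_space_model] .

lemma dM_commute: "dM \<kappa> P Q = dM \<kappa> Q P"
  using Metric_space.commute[OF Metric_space_model] .

lemma dM_tri: "P \<in> MP \<kappa> \<Longrightarrow> Q \<in> MP \<kappa> \<Longrightarrow> R \<in> MP \<kappa> \<Longrightarrow> dM \<kappa> P R \<le> dM \<kappa> P Q + dM \<kappa> Q R"
  using Metric_space.triangle[OF Metric_space_model] .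

lemma dM_zero: "P \<in> MP \<kappa> \<Longrightarrow> Q \<in> MP \<kappa> \<Longrightarrow> dM \<kappa> P Q = 0 \<longleftrightarrow> P = Q"
  using Metric_space.zero[OF Metric_space_model] .

lemma dM_self [simp]: "P \<in> MP \<kappa> \<Longrightarrow> dM \<kappa> P P = 0"
  using dM_zero by simp

lemma md_dM:
  assumes "P \<in> MP \<kappa>" "Q \<in> MP \<kappa>"
  shows "md \<kappa> (dM \<kappa> P Q) = mm \<kappa> P + mm \<kappa> Q - \<kappa> * mm \<kappa> P * mm \<kappa> Q - vv \<kappa> P \<bullet> vv \<kappa> Q"
    and "radc \<kappa> (dM \<kappa> P Q)"
proof -
  obtain r u where P: "0 \<le> r" "radc \<kappa> r" "norm u = 1" "P = pt \<kappa> r u" using model_cases[OF assms(1)] .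
  obtain s v where Q: "0 \<le> s" "radc \<kappa> s" "norm v = 1" "Q = pt \<kappa> s v" using model_cases[OF assms(2)] .
  have c: "(r, u) \<in> cone_pairs \<kappa>" "(s, v) \<in> cone_pairs \<kappa>" using P Q by (auto simp: in_cone_pairs)
  have "dM \<kappa> P Q = cone_pair_dist \<kappa> (r, u) (s, v)"
    unfolding P(4) Q(4) pt_def by (rule model_dist_class[OF c])
  then show "md \<kappa> (dM \<kappa> P Q) = mm \<kappa> P + mm \<kappa> Q - \<kappa> * mm \<kappa> P * mm \<kappa> Q - vv \<kappa> P \<bullet> vv \<kappa> Q" "radc \<kappa> (dM \<kappa> P Q)"
    using md_cone_dist[OF c] mv_pt[OF P(1-3)] mv_pt[OF Q(1-3)] P(4) Q(4) by (auto simp: mult.assoc)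
qed

lemma org_model: "org \<kappa> \<in> MP \<kappa>"
  unfolding org_def by (rule pt_model) (auto simp: radc_def norm_e0)

lemma mv_org [simp]: "mm \<kappa> (org \<kappa>) = 0" "vv \<kappa> (org \<kappa>) = 0"
  using mv_pt[of 0 \<kappa> e0_ell2] by (auto simp: org_def radc_def norm_e0)

lemma md_org: "P \<in> MP \<kappa> \<Longrightarrow> md \<kappa> (dM \<kappa> (org \<kappa>) P) = mm \<kappa> P"
  using md_dM(1)[OF org_model] by simp

lemma dM_org_pt:
  assumes "0 \<le> r" "radc \<kappa> r" "norm u = 1"
  shows "dM \<kappa> (org \<kappa>) (pt \<kappa> r u) = r"
proof (rule md_inj)
  show "md \<kappa> (dM \<kappa> (org \<kappa>) (pt \<kappa> r u)) = md \<kappa> r"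
    using md_org[OF pt_model[OF assms]] mv_pt[OF assms] by simp
qed (use md_dM(2)[OF org_model pt_model[OF assms]] assms in simp_all)

lemma vv_norm: "P \<in> MP \<kappa> \<Longrightarrow> vv \<kappa> P \<bullet> vv \<kappa> P = mm \<kappa> P * (2 - \<kappa> * mm \<kappa> P)"
  using md_dM(1)[of P \<kappa> P] by (simp add: algebra_simps)

lemma vv_norm_sn: "P \<in> MP \<kappa> \<Longrightarrow> vv \<kappa> P \<bullet> vv \<kappa> P = (sn \<kappa> (dM \<kappa> (org \<kappa>) P))\<^sup>2"
  by (simp add: vv_norm sn_sq md_org)

lemma norm_vv: "P \<in> MP \<kappa> \<Longrightarrow> norm (vv \<kappa> P) = sn \<kappa> (dM \<kappa> (org \<kappa>) P)"
  using sn_ge_0[OF dM_nonneg md_dM(2)[OF org_model], of P \<kappa>] by (simp add: norm_eq_sqrt_inner vv_norm_sn)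

lemma mm_nonneg [simp]: "0 \<le> mm \<kappa> P"
  by (simp add: mm_def)

lemma mv_inj:
  assumes "P \<in> MP \<kappa>" "Q \<in> MP \<kappa>" "mm \<kappa> P = mm \<kappa> Q" "vv \<kappa> P = vv \<kappa> Q"
  shows "P = Q"
proof -
  have "md \<kappa> (dM \<kappa> P Q) = md \<kappa> 0"
    using md_dM(1)[OF assms(1,2)] assms(3,4) vv_norm[OF assms(2)] by (simp add: algebra_simps)
  then have "dM \<kappa> P Q = 0"
    by (rule md_inj) (use md_dM(2)[OF assms(1,2)] in \<open>auto simp: radc_def\<close>)
  then show ?thesis using dM_zero assms by simp
qed

lemma md_surj:
  assumes "0 \<le> m" "\<kappa> > 0 \<Longrightarrow> m \<le> 2 / \<kappa>"
  obtains r where "0 \<le> r" "radc \<kappa> r" "md \<kappa> r = m"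
proof -
  consider "\<kappa> > 0" | "\<kappa> = 0" | "\<kappa> < 0" by linarith
  then show thesis
  proof cases
    case 1
    define A where "A = 1 - \<kappa> * m"
    have "m * \<kappa> \<le> 2" using assms(2)[OF 1] 1 by (simp add: pos_le_divide_eq)
    moreover have "0 \<le> m * \<kappa>" using assms(1) 1 by simp
    ultimately have A: "-1 \<le> A" "A \<le> 1" by (simp_all add: A_def mult.commute)
    show thesis
    proof (rule that)
      show "0 \<le> arccos A / sqrt \<kappa>" using 1 A by (intro divide_nonneg_nonneg arccos_lbound) auto
      show "radc \<kappa> (arccos A / sqrt \<kappa>)"
        unfolding radc_def using 1 A by (intro impI divide_right_mono arccos_ubound) auto
      have "md \<kappa> (arccos A / sqrt \<kappa>) = (1 - A) / \<kappa>" using 1 A by (simp add: md_pos)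
      then show "md \<kappa> (arccos A / sqrt \<kappa>) = m" using 1 by (simp add: A_def)
    qed
  next
    case 2
    show thesis by (rule that[of "sqrt (2 * m)"]) (use 2 assms(1) in \<open>simp_all add: md_zero radc_def\<close>)
  next
    case 3
    have "\<kappa> * m \<le> 0" using 3 assms(1) by (intro mult_nonpos_nonneg) auto
    then have "1 \<le> 1 - \<kappa> * m" by simp
    then show thesis using 3 that[of "arcosh (1 - \<kappa> * m) / sqrt (- \<kappa>)"]
      by (simp add: radc_def md_neg)
  qed
qed

text \<open>The equation of \<open>vv_norm\<close> with 0 \<le> m is the only constraint on the
  coordinates. For \<kappa> > 0 it already forces m \<le> 2 / \<kappa>, since its right-hand side
  would otherwise be negative.\<close>

lemma mv_surj:
  assumes m: "0 \<le> m" "v \<bullet> v = m * (2 - \<kappa> * m)"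
  obtains P where "P \<in> MP \<kappa>" "mm \<kappa> P = m" "vv \<kappa> P = v"
proof -
  have "m \<le> 2 / \<kappa>" if "\<kappa> > 0"
  proof (rule ccontr)
    assume "\<not> m \<le> 2 / \<kappa>"
    then have *: "2 / \<kappa> < m" by simp
    then have "2 < \<kappa> * m" using that by (simp add: pos_divide_less_eq mult.commute)
    moreover have "0 < 2 / \<kappa>" using that by simp
    then have "0 < m" using * by (rule less_trans)
    ultimately have "m * (2 - \<kappa> * m) < 0" by (simp add: mult_pos_neg)
    then show False using m inner_ge_zero[of v] by linarith
  qed
  then obtain r where r: "0 \<le> r" "radc \<kappa> r" "md \<kappa> r = m" using md_surj[OF m(1)] by blast
  have nv: "norm v = sn \<kappa> r"
    unfolding norm_eq_sqrt_inner m(2) using sn_sq[of \<kappa> r] r(3) sn_ge_0[OF r(1,2)]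
    by (intro real_sqrt_unique) simp_all
  define u where "u = (if v = 0 then e0_ell2 else v /\<^sub>R norm v)"
  have u: "norm u = 1" by (auto simp: u_def norm_e0)
  have "sn \<kappa> r *\<^sub>R u = v" by (cases "v = 0") (simp_all add: u_def flip: nv)
  then show thesis using that[OF pt_model[OF r(1,2) u]] mv_pt[OF r(1,2) u] r by simp
qed

text \<open>The equation of \<open>segment_exists\<close> below in the case that c is the end point
  a.\<close>

lemma sn_md_split: "sn \<kappa> s * md \<kappa> (s + t) = sn \<kappa> (s + t) * md \<kappa> s + sn \<kappa> t * md \<kappa> s + sn \<kappa> s * md \<kappa> t"
proof -
  have "sn \<kappa> (s + t) * md \<kappa> s + sn \<kappa> t * md \<kappa> s + sn \<kappa> s * md \<kappa> t - sn \<kappa> s * md \<kappa> (s + t)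
      = sn \<kappa> t * (md \<kappa> s * (2 - \<kappa> * md \<kappa> s) - (sn \<kappa> s)\<^sup>2)"
    by (simp add: sn_add md_add power2_eq_square algebra_simps)
  then show ?thesis by (simp only: sn_sq) simp
qed

text \<open>The model is a quadric \<open>hq = 1\<close> in these coordinates, and segments are
  positive combinations of their end points.\<close>
definition hat :: "real \<Rightarrow> (real \<times> ell2) set \<Rightarrow> real \<times> ell2" where
  "hat \<kappa> P = (1 - \<kappa> * mm \<kappa> P, vv \<kappa> P)"

definition hq :: "real \<Rightarrow> real \<times> ell2 \<Rightarrow> real" where
  "hq \<kappa> x = (fst x)\<^sup>2 + \<kappa> * (snd x \<bullet> snd x)"

lemma hq_hat: "P \<in> MP \<kappa> \<Longrightarrow> hq \<kappa> (hat \<kappa> P) = 1"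
  by (simp add: hq_def hat_def vv_norm power2_eq_square algebra_simps)

lemma hq_scale: "hq \<kappa> (c *\<^sub>R x) = c\<^sup>2 * hq \<kappa> x"
  by (simp add: hq_def power2_eq_square algebra_simps)

lemma hat_inj:
  assumes "P \<in> MP \<kappa>" "Q \<in> MP \<kappa>" "hat \<kappa> P = hat \<kappa> Q"
  shows "P = Q"
proof -
  have v: "vv \<kappa> P = vv \<kappa> Q" and c: "\<kappa> * mm \<kappa> P = \<kappa> * mm \<kappa> Q" using assms(3) by (auto simp: hat_def)
  have "mm \<kappa> P = mm \<kappa> Q"
    using vv_norm[OF assms(1)] vv_norm[OF assms(2)] v c by (cases "\<kappa> = 0") auto
  then show ?thesis using mv_inj assms v by blast
qed

text \<open>The point is written down as a combination of a and b in the coordinates and then shown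
  to satisfy the equation of the model. The last conjunct is \<open>comp\<close> with
  equality.\<close>

lemma segment_exists:
  assumes ab: "a \<in> MP \<kappa>" "b \<in> MP \<kappa>" and st: "0 \<le> s" "0 \<le> t" "dM \<kappa> a b = s + t"
    and l: "0 < s + t" "rad \<kappa> (s + t)"
  shows "\<exists>w\<in>MP \<kappa>. dM \<kappa> a w = s \<and> dM \<kappa> w b = t \<and>
     sn \<kappa> (s + t) *\<^sub>R hat \<kappa> w = sn \<kappa> t *\<^sub>R hat \<kappa> a + sn \<kappa> s *\<^sub>R hat \<kappa> b \<and>
     (\<forall>c\<in>MP \<kappa>. sn \<kappa> (s + t) * md \<kappa> (dM \<kappa> w c) + sn \<kappa> t * md \<kappa> s + sn \<kappa> s * md \<kappa> t
        = sn \<kappa> t * md \<kappa> (dM \<kappa> a c) + sn \<kappa> s * md \<kappa> (dM \<kappa> b c))"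
proof -
  define L where "L = sn \<kappa> (s + t)"
  have L: "0 < L" unfolding L_def by (rule sn_gt_0[OF l])
  define K where "K = sn \<kappa> t * md \<kappa> s + sn \<kappa> s * md \<kappa> t"
  have LK: "L = sn \<kappa> t + sn \<kappa> s - \<kappa> * K" by (simp add: L_def K_def sn_add algebra_simps)
  define m where "m = (sn \<kappa> t * mm \<kappa> a + sn \<kappa> s * mm \<kappa> b - K) / L"
  define v where "v = (1 / L) *\<^sub>R (sn \<kappa> t *\<^sub>R vv \<kappa> a + sn \<kappa> s *\<^sub>R vv \<kappa> b)"
  have Lm: "L * m = sn \<kappa> t * mm \<kappa> a + sn \<kappa> s * mm \<kappa> b - K" using L by (simp add: m_def)
  have Lv: "L *\<^sub>R v = sn \<kappa> t *\<^sub>R vv \<kappa> a + sn \<kappa> s *\<^sub>R vv \<kappa> b" using L by (simp add: v_def)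
  \<comment> \<open>The expression of \<open>md_dM\<close> for arbitrary coordinates. It is affine
    in its first pair, so its values against a and b are known before m and v are known to come from
    a point; \<open>F m v m v = 0\<close> is the equation required by
    \<open>mv_surj\<close>.\<close>
  define F where "F = (\<lambda>m v m' v'. m + m' - \<kappa> * m * m' - v \<bullet> (v' :: ell2))"
  have FL: "L * F m v m' v' = sn \<kappa> t * F (mm \<kappa> a) (vv \<kappa> a) m' v' + sn \<kappa> s * F (mm \<kappa> b) (vv \<kappa> b) m' v' - K" for m' v'
  proof -
    have "L * F m v m' v' = L * m * (1 - \<kappa> * m') + L * m' - (L *\<^sub>R v) \<bullet> v'"
      by (simp add: F_def algebra_simps)
    also have "\<dots> = (sn \<kappa> t * mm \<kappa> a + sn \<kappa> s * mm \<kappa> b - K) * (1 - \<kappa> * m') + (sn \<kappa> t + sn \<kappa> s - \<kappa> * K) * m'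
        - (sn \<kappa> t * (vv \<kappa> a \<bullet> v') + sn \<kappa> s * (vv \<kappa> b \<bullet> v'))"
      unfolding Lm Lv by (simp add: inner_add_left LK)
    also have "\<dots> = sn \<kappa> t * F (mm \<kappa> a) (vv \<kappa> a) m' v' + sn \<kappa> s * F (mm \<kappa> b) (vv \<kappa> b) m' v' - K"
      by (simp add: F_def algebra_simps)
    finally show ?thesis .
  qed
  have Fd: "F (mm \<kappa> P) (vv \<kappa> P) (mm \<kappa> Q) (vv \<kappa> Q) = md \<kappa> (dM \<kappa> P Q)" if "P \<in> MP \<kappa>" "Q \<in> MP \<kappa>" for P Q
    using md_dM(1)[OF that] by (simp add: F_def)
  have comm: "F m v m' v' = F m' v' m v" for m v m' v' by (simp add: F_def inner_commute algebra_simps)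
  have Fa: "F m v (mm \<kappa> a) (vv \<kappa> a) = md \<kappa> s"
  proof -
    have "L * F m v (mm \<kappa> a) (vv \<kappa> a) = sn \<kappa> s * md \<kappa> (s + t) - K"
      unfolding FL using ab st by (simp add: Fd dM_commute[of \<kappa> b a])
    also have "\<dots> = L * md \<kappa> s" unfolding sn_md_split by (simp add: L_def K_def)
    finally show ?thesis using L by simp
  qed
  have Fb: "F m v (mm \<kappa> b) (vv \<kappa> b) = md \<kappa> t"
  proof -
    have "L * F m v (mm \<kappa> b) (vv \<kappa> b) = sn \<kappa> t * md \<kappa> (t + s) - K"
      unfolding FL using ab st by (simp add: Fd add.commute[of t s])
    also have "\<dots> = L * md \<kappa> t" unfolding sn_md_split by (simp add: L_def K_def add.commute[of t s])
    finally show ?thesis using L by simp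
  qed
  have "L * F m v m v = 0"
    unfolding FL comm[of "mm \<kappa> a" "vv \<kappa> a"] comm[of "mm \<kappa> b" "vv \<kappa> b"] Fa Fb by (simp add: K_def)
  then have "F m v m v = 0" using L by simp
  then have vvm: "v \<bullet> v = m * (2 - \<kappa> * m)" by (simp add: F_def algebra_simps)
  have Lc: "L * (1 - \<kappa> * m) = sn \<kappa> t * (1 - \<kappa> * mm \<kappa> a) + sn \<kappa> s * (1 - \<kappa> * mm \<kappa> b)"
  proof -
    have "L * (1 - \<kappa> * m) = L - \<kappa> * (L * m)" by (simp add: algebra_simps)
    also have "\<dots> = sn \<kappa> t * (1 - \<kappa> * mm \<kappa> a) + sn \<kappa> s * (1 - \<kappa> * mm \<kappa> b)"
      unfolding Lm by (simp add: LK algebra_simps)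
    finally show ?thesis .
  qed
  have rst: "radc \<kappa> s" "radc \<kappa> t"
    using rad_radc[OF rad_mono[OF l(2), of s]] rad_radc[OF rad_mono[OF l(2), of t]] st by simp_all
  \<comment> \<open>For \<kappa> < 0 this excludes the second sheet of the hyperboloid; the weights
    of the combination are nonnegative and both ends lie on the first sheet.\<close>
  have m0: "0 \<le> m"
  proof (rule ccontr)
    assume neg: "\<not> 0 \<le> m"
    have "0 < 2 - \<kappa> * m"
    proof (cases "\<kappa> \<ge> 0")
      case True
      then have "\<kappa> * m \<le> 0" using neg by (intro mult_nonneg_nonpos) auto
      then show ?thesis by simp
    next
      case False
      have "0 \<le> - \<kappa> * mm \<kappa> a" "0 \<le> - \<kappa> * mm \<kappa> b" using False by (intro mult_nonneg_nonneg; simp)+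
      then have "0 \<le> L * (1 - \<kappa> * m)"
        unfolding Lc using sn_ge_0[OF st(1) rst(1)] sn_ge_0[OF st(2) rst(2)] by (intro add_nonneg_nonneg mult_nonneg_nonneg) auto
      then have "0 \<le> 1 - \<kappa> * m" using L by (simp add: zero_le_mult_iff)
      then show ?thesis by simp
    qed
    then have "m * (2 - \<kappa> * m) < 0" using neg by (simp add: mult_neg_pos)
    then show False using vvm inner_ge_zero[of v] by linarith
  qed
  obtain w where w: "w \<in> MP \<kappa>" "mm \<kappa> w = m" "vv \<kappa> w = v" using mv_surj[OF m0 vvm] .
  have "md \<kappa> (dM \<kappa> a w) = md \<kappa> s" using Fa Fd[OF w(1) ab(1)] w dM_commute[of \<kappa> a w] by simp
  then have 1: "dM \<kappa> a w = s" by (rule md_inj) (use md_dM(2)[OF ab(1) w(1)] rst st in auto)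
  have "md \<kappa> (dM \<kappa> w b) = md \<kappa> t" using Fb Fd[OF w(1) ab(2)] w by simp
  then have 2: "dM \<kappa> w b = t" by (rule md_inj) (use md_dM(2)[OF w(1) ab(2)] rst st in auto)
  have 3: "L *\<^sub>R hat \<kappa> w = sn \<kappa> t *\<^sub>R hat \<kappa> a + sn \<kappa> s *\<^sub>R hat \<kappa> b"
    using Lc Lv by (simp add: hat_def w)
  have 4: "L * md \<kappa> (dM \<kappa> w c) + sn \<kappa> t * md \<kappa> s + sn \<kappa> s * md \<kappa> t
        = sn \<kappa> t * md \<kappa> (dM \<kappa> a c) + sn \<kappa> s * md \<kappa> (dM \<kappa> b c)" if "c \<in> MP \<kappa>" for c
    using FL[of "mm \<kappa> c" "vv \<kappa> c"] Fd[OF w(1) that] Fd[OF ab(1) that] Fd[OF ab(2) that]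
    by (simp add: w K_def)
  show ?thesis using w(1) 1 2 3 4 unfolding L_def by blast
qed

text \<open>Insert a competing point x for c in the equation of \<open>segment_exists\<close>:
  everything cancels except the term with the distance from \<open>w0\<close> to x, which is
  therefore 0.\<close>

lemma segment_unique:
  assumes S: "a \<in> MP \<kappa>" "b \<in> MP \<kappa>" "w \<in> MP \<kappa>" "w' \<in> MP \<kappa>"
    and w: "dM \<kappa> a w + dM \<kappa> w b = dM \<kappa> a b" "dM \<kappa> a w' = dM \<kappa> a w" "dM \<kappa> w' b = dM \<kappa> w b"
    and l: "rad \<kappa> (dM \<kappa> a b)"
  shows "w = w'"
proof (cases "dM \<kappa> a b = 0")
  case True
  then have "dM \<kappa> a w = 0" using w(1) dM_nonneg[of \<kappa> a w] dM_nonneg[of \<kappa> w b] by linarith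
  then show ?thesis using w(2) S dM_zero by metis
next
  case False
  define s t where "s = dM \<kappa> a w" and "t = dM \<kappa> w b"
  have st: "0 \<le> s" "0 \<le> t" "dM \<kappa> a b = s + t" using w by (auto simp: s_def t_def)
  have pos: "0 < s + t" using False st by linarith
  have l': "rad \<kappa> (s + t)" using l st by simp
  obtain w0 where w0: "w0 \<in> MP \<kappa>" "\<And>c. c \<in> MP \<kappa> \<Longrightarrow> sn \<kappa> (s + t) * md \<kappa> (dM \<kappa> w0 c) + sn \<kappa> t * md \<kappa> s + sn \<kappa> s * md \<kappa> t
        = sn \<kappa> t * md \<kappa> (dM \<kappa> a c) + sn \<kappa> s * md \<kappa> (dM \<kappa> b c)"
    using segment_exists[OF S(1,2) st pos l'] by blast
  have "w0 = x" if x: "x \<in> MP \<kappa>" "dM \<kappa> a x = s" "dM \<kappa> x b = t" for x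
  proof -
    have "sn \<kappa> (s + t) * md \<kappa> (dM \<kappa> w0 x) = 0" using w0(2)[OF x(1)] x dM_commute[of \<kappa> b x] by simp
    then have "md \<kappa> (dM \<kappa> w0 x) = 0" using sn_gt_0[OF pos l'] by simp
    then have "dM \<kappa> w0 x = 0" using md_eq_0_iff[OF md_dM(2)[OF w0(1) x(1)]] by simp
    then show ?thesis using dM_zero[OF w0(1) x(1)] by simp
  qed
  then show ?thesis using S w by (metis s_def t_def)
qed

lemma between_model:
  assumes S: "a \<in> MP \<kappa>" "b \<in> MP \<kappa>" "w \<in> MP \<kappa>"
    and w: "dM \<kappa> a w + dM \<kappa> w b = dM \<kappa> a b" and l: "rad \<kappa> (dM \<kappa> a b)"
  shows "sn \<kappa> (dM \<kappa> a b) *\<^sub>R hat \<kappa> w = sn \<kappa> (dM \<kappa> w b) *\<^sub>R hat \<kappa> a + sn \<kappa> (dM \<kappa> a w) *\<^sub>R hat \<kappa> b"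
    and "c \<in> MP \<kappa> \<Longrightarrow> sn \<kappa> (dM \<kappa> a b) * md \<kappa> (dM \<kappa> w c) + sn \<kappa> (dM \<kappa> w b) * md \<kappa> (dM \<kappa> a w) + sn \<kappa> (dM \<kappa> a w) * md \<kappa> (dM \<kappa> w b)
        = sn \<kappa> (dM \<kappa> w b) * md \<kappa> (dM \<kappa> a c) + sn \<kappa> (dM \<kappa> a w) * md \<kappa> (dM \<kappa> b c)"
proof -
  have "sn \<kappa> (dM \<kappa> a b) *\<^sub>R hat \<kappa> w = sn \<kappa> (dM \<kappa> w b) *\<^sub>R hat \<kappa> a + sn \<kappa> (dM \<kappa> a w) *\<^sub>R hat \<kappa> b \<and>
     (c \<in> MP \<kappa> \<longrightarrow> sn \<kappa> (dM \<kappa> a b) * md \<kappa> (dM \<kappa> w c) + sn \<kappa> (dM \<kappa> w b) * md \<kappa> (dM \<kappa> a w) + sn \<kappa> (dM \<kappa> a w) * md \<kappa> (dM \<kappa> w b)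
        = sn \<kappa> (dM \<kappa> w b) * md \<kappa> (dM \<kappa> a c) + sn \<kappa> (dM \<kappa> a w) * md \<kappa> (dM \<kappa> b c))"
  proof (cases "dM \<kappa> a b = 0")
    case True
    then have "dM \<kappa> a w = 0" "dM \<kappa> w b = 0" using w dM_nonneg[of \<kappa> a w] dM_nonneg[of \<kappa> w b] by linarith+
    then show ?thesis using True by simp
  next
    case False
    have ab: "dM \<kappa> a b = dM \<kappa> a w + dM \<kappa> w b" using w by simp
    have pos: "0 < dM \<kappa> a w + dM \<kappa> w b" using False w dM_nonneg[of \<kappa> a b] by linarith
    obtain w0 where w0: "w0 \<in> MP \<kappa>" "dM \<kappa> a w0 = dM \<kappa> a w" "dM \<kappa> w0 b = dM \<kappa> w b"
     "sn \<kappa> (dM \<kappa> a w + dM \<kappa> w b) *\<^sub>R hat \<kappa> w0 = sn \<kappa> (dM \<kappa> w b) *\<^sub>R hat \<kappa> a + sn \<kappa> (dM \<kappa> a w) *\<^sub>R hat \<kappa> b"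
     "\<forall>c\<in>MP \<kappa>. sn \<kappa> (dM \<kappa> a w + dM \<kappa> w b) * md \<kappa> (dM \<kappa> w0 c) + sn \<kappa> (dM \<kappa> w b) * md \<kappa> (dM \<kappa> a w) + sn \<kappa> (dM \<kappa> a w) * md \<kappa> (dM \<kappa> w b)
        = sn \<kappa> (dM \<kappa> w b) * md \<kappa> (dM \<kappa> a c) + sn \<kappa> (dM \<kappa> a w) * md \<kappa> (dM \<kappa> b c)"
      using segment_exists[OF S(1,2) dM_nonneg dM_nonneg ab pos] l ab by auto
    have "w = w0" by (rule segment_unique[OF S w0(1) w w0(2,3) l])
    then show ?thesis using w0 ab by simp
  qed
  then show "sn \<kappa> (dM \<kappa> a b) *\<^sub>R hat \<kappa> w = sn \<kappa> (dM \<kappa> w b) *\<^sub>R hat \<kappa> a + sn \<kappa> (dM \<kappa> a w) *\<^sub>R hat \<kappa> b"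
    "c \<in> MP \<kappa> \<Longrightarrow> sn \<kappa> (dM \<kappa> a b) * md \<kappa> (dM \<kappa> w c) + sn \<kappa> (dM \<kappa> w b) * md \<kappa> (dM \<kappa> a w) + sn \<kappa> (dM \<kappa> a w) * md \<kappa> (dM \<kappa> w b)
        = sn \<kappa> (dM \<kappa> w b) * md \<kappa> (dM \<kappa> a c) + sn \<kappa> (dM \<kappa> a w) * md \<kappa> (dM \<kappa> b c)" by blast+
qed

lemma point_between:
  assumes "a \<in> MP \<kappa>" "b \<in> MP \<kappa>" "0 \<le> s" "s \<le> dM \<kappa> a b" "rad \<kappa> (dM \<kappa> a b)"
  obtains w where "w \<in> MP \<kappa>" "dM \<kappa> a w = s" "dM \<kappa> w b = dM \<kappa> a b - s"
proof (cases "dM \<kappa> a b = 0")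
  case True
  then have "s = 0" using assms by simp
  then show thesis using that[of a] assms by simp
next
  case False
  then have "0 < dM \<kappa> a b" by (simp add: less_le)
  then show thesis
    using segment_exists[of a \<kappa> b s "dM \<kappa> a b - s"] assms that by auto
qed

text \<open>The coefficients of a point of the segment are proportional to
  \<open>sn \<kappa> (l - s)\<close> and \<open>sn \<kappa> s\<close>. By the intermediate value
  theorem their ratio takes the prescribed value; \<theta> is the positive factor of the central
  projection to the quadric.\<close>

lemma hat_combination:
  assumes S: "a \<in> MP \<kappa>" "b \<in> MP \<kappa>" and l: "rad \<kappa> (dM \<kappa> a b)" and c: "0 \<le> \<alpha>" "0 \<le> \<beta>" "0 < \<alpha> + \<beta>"
  obtains w \<theta> where "w \<in> MP \<kappa>" "0 < \<theta>" "dM \<kappa> a w + dM \<kappa> w b = dM \<kappa> a b" "hat \<kappa> w = \<theta> *\<^sub>R (\<alpha> *\<^sub>R hat \<kappa> a + \<beta> *\<^sub>R hat \<kappa> b)"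
proof (cases "dM \<kappa> a b = 0")
  case True
  then have "b = a" using dM_zero[OF S] by simp
  then show thesis using that[of a "1 / (\<alpha> + \<beta>)"] S c by (simp flip: scaleR_add_left add_divide_distrib)
next
  case False
  define l where "l = dM \<kappa> a b"
  have pos: "0 < l" and rl: "rad \<kappa> l" using False l by (auto simp: l_def less_le)
  have sl: "0 < sn \<kappa> l" by (rule sn_gt_0[OF pos rl])
  have "\<exists>s\<ge>0. s \<le> l \<and> \<alpha> * sn \<kappa> s - \<beta> * sn \<kappa> (l - s) = 0"
  proof (rule IVT')
    show "\<alpha> * sn \<kappa> 0 - \<beta> * sn \<kappa> (l - 0) \<le> 0" "0 \<le> \<alpha> * sn \<kappa> l - \<beta> * sn \<kappa> (l - l)" "0 \<le> l"
      using sl c pos by auto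
    show "continuous_on {0..l} (\<lambda>s. \<alpha> * sn \<kappa> s - \<beta> * sn \<kappa> (l - s))"
      by (intro continuous_intros continuous_on_compose2[OF continuous_on_sn[of UNIV]]) auto
  qed
  then obtain s where s: "0 \<le> s" "s \<le> l" "\<alpha> * sn \<kappa> s = \<beta> * sn \<kappa> (l - s)" by auto
  obtain w where w: "w \<in> MP \<kappa>" "dM \<kappa> a w = s" "dM \<kappa> w b = l - s"
    using point_between[OF S s(1)] s rl by (auto simp: l_def)
  have bt: "dM \<kappa> a w + dM \<kappa> w b = dM \<kappa> a b" using w by (simp add: l_def)
  have h: "sn \<kappa> l *\<^sub>R hat \<kappa> w = sn \<kappa> (l - s) *\<^sub>R hat \<kappa> a + sn \<kappa> s *\<^sub>R hat \<kappa> b"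
    using between_model(1)[OF S w(1) bt l] w by (simp add: l_def[symmetric])
  have nn: "0 \<le> sn \<kappa> s" "0 \<le> sn \<kappa> (l - s)"
    using s sn_ge_0[OF s(1) rad_radc[OF rad_mono[OF rl s(2)]]] sn_ge_0[of "l - s" \<kappa>] rad_radc[OF rad_mono[OF rl, of "l - s"]]
    by simp_all
  have pos': "0 < sn \<kappa> s + sn \<kappa> (l - s)"
  proof (rule ccontr)
    assume "\<not> ?thesis"
    then have "sn \<kappa> s = 0" "sn \<kappa> (l - s) = 0" using nn by auto
    then have "sn \<kappa> (s + (l - s)) = 0" unfolding sn_add by simp
    then show False using sl by simp
  qed
  define \<mu> where "\<mu> = (sn \<kappa> s + sn \<kappa> (l - s)) / (\<alpha> + \<beta>)"
  have mu: "0 < \<mu>" using pos' c by (simp add: \<mu>_def)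
  have "sn \<kappa> (l - s) = \<mu> * \<alpha>" "sn \<kappa> s = \<mu> * \<beta>"
    using s(3) c by (simp_all add: \<mu>_def field_simps)
  then have h: "sn \<kappa> l *\<^sub>R hat \<kappa> w = \<mu> *\<^sub>R (\<alpha> *\<^sub>R hat \<kappa> a + \<beta> *\<^sub>R hat \<kappa> b)"
    using h by (simp add: scaleR_add_right)
  have "hat \<kappa> w = (1 / sn \<kappa> l) *\<^sub>R (sn \<kappa> l *\<^sub>R hat \<kappa> w)" using sl by simp
  also have "\<dots> = (\<mu> / sn \<kappa> l) *\<^sub>R (\<alpha> *\<^sub>R hat \<kappa> a + \<beta> *\<^sub>R hat \<kappa> b)" unfolding h by simp
  finally show thesis using that[OF w(1) _ bt, of "\<mu> / sn \<kappa> l"] mu sl by simp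
qed

text \<open>Both P and the point of \<open>hat_combination\<close> are on the quadric, so the factor
  \<theta> has square 1, and it is positive.\<close>

lemma hat_between:
  assumes S: "a \<in> MP \<kappa>" "b \<in> MP \<kappa>" "P \<in> MP \<kappa>" and l: "rad \<kappa> (dM \<kappa> a b)" and c: "0 \<le> \<alpha>" "0 \<le> \<beta>"
    and P: "hat \<kappa> P = \<alpha> *\<^sub>R hat \<kappa> a + \<beta> *\<^sub>R hat \<kappa> b"
  shows "dM \<kappa> a P + dM \<kappa> P b = dM \<kappa> a b"
proof -
  have "0 < \<alpha> + \<beta>"
  proof (rule ccontr)
    assume "\<not> ?thesis"
    then have "\<alpha> = 0" "\<beta> = 0" using c by auto
    then show False using P hq_hat[OF S(3)] by (simp add: hq_def)
  qed
  then obtain w \<theta> where w: "w \<in> MP \<kappa>" "0 < \<theta>" "dM \<kappa> a w + dM \<kappa> w b = dM \<kappa> a b" "hat \<kappa> w = \<theta> *\<^sub>R (\<alpha> *\<^sub>R hat \<kappa> a + \<beta> *\<^sub>R hat \<kappa> b)"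
    using hat_combination[OF S(1,2) l c] by metis
  have "1 = \<theta>\<^sup>2 * hq \<kappa> (hat \<kappa> P)" using hq_hat[OF w(1)] unfolding w(4) P hq_scale by simp
  then have "\<theta>\<^sup>2 = 1" using hq_hat[OF S(3)] by simp
  then have "\<theta> = 1" using w(2) by (simp add: power2_eq_1_iff)
  then have "w = P" using w P S by (intro hat_inj[of w \<kappa> P]) auto
  then show ?thesis using w by simp
qed

lemma inner_opposite:
  fixes x y :: "'v::real_inner"
  assumes "x \<bullet> y \<le> - (norm x * norm y)"
  shows "norm y *\<^sub>R x + norm x *\<^sub>R y = 0"
proof -
  have "(norm (norm y *\<^sub>R x + norm x *\<^sub>R y))\<^sup>2 = 2 * (norm x * norm y) * (norm x * norm y + x \<bullet> y)"
    unfolding power2_norm_eq_inner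
    by (simp only: inner_add inner_scaleR_left inner_scaleR_right)
      (simp add: inner_commute[of y x] dot_square_norm power2_eq_square algebra_simps)
  also have "\<dots> \<le> 0" using assms by (intro mult_nonneg_nonpos) auto
  finally show ?thesis by simp
qed

text \<open>A model triangle of perimeter at least 2 pi / sqrt \<kappa> lies on a great circle. Seen
  from the apex, the reflected bound on the third side says that the angle there is pi, which is
  equality in the Cauchy-Schwarz inequality. No division occurs, so points with \<open>vv\<close>
  equal to 0 are allowed.\<close>

lemma not_small_opposite:
  assumes S: "P \<in> MP \<kappa>" "Q \<in> MP \<kappa>" and ns: "\<not> small \<kappa> (dM \<kappa> (org \<kappa>) P + dM \<kappa> (org \<kappa>) Q + dM \<kappa> P Q)"
  shows "norm (vv \<kappa> Q) *\<^sub>R vv \<kappa> P + norm (vv \<kappa> P) *\<^sub>R vv \<kappa> Q = 0"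
proof (rule inner_opposite)
  define a b e where "a = dM \<kappa> (org \<kappa>) P" and "b = dM \<kappa> (org \<kappa>) Q" and "e = dM \<kappa> P Q"
  have k: "\<kappa> > 0" "2 * pi / sqrt \<kappa> \<le> a + b + e" using ns by (auto simp: small_def a_def b_def e_def)
  have r: "radc \<kappa> a" "radc \<kappa> b" "radc \<kappa> e" unfolding a_def b_def e_def using S by (auto intro: md_dM(2) org_model)
  have "md \<kappa> (2 * pi / sqrt \<kappa> - (a + b)) \<le> md \<kappa> e"
    by (rule md_mono) (use r k in \<open>auto simp: radc_def\<close>)
  then have "md \<kappa> (a + b) \<le> md \<kappa> e" using md_reflect[OF k(1)] by simp
  then show "vv \<kappa> P \<bullet> vv \<kappa> Q \<le> - (norm (vv \<kappa> P) * norm (vv \<kappa> Q))"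
    using md_dM(1)[OF S] norm_vv[OF S(1)] norm_vv[OF S(2)] md_org[OF S(1)] md_org[OF S(2)]
    by (simp add: md_add a_def b_def e_def)
qed

text \<open>The same fact without the apex as a vertex: all three points lie in one plane through
  the centre of the sphere. It is read off at b, where the tangential parts of a and c are
  opposite.\<close>

lemma not_small_coplanar:
  assumes S: "a \<in> MP \<kappa>" "b \<in> MP \<kappa>" "c \<in> MP \<kappa>" and ab: "0 < dM \<kappa> a b" "rad \<kappa> (dM \<kappa> a b)"
    and ns: "\<not> small \<kappa> (dM \<kappa> a b + dM \<kappa> b c + dM \<kappa> c a)"
  obtains \<alpha> \<beta> where "hat \<kappa> c = \<alpha> *\<^sub>R hat \<kappa> a + \<beta> *\<^sub>R hat \<kappa> b"
proof -
  have k: "\<kappa> > 0" using ns by (auto simp: small_def)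
  define h where "h = (\<lambda>P. (fst (hat \<kappa> P), sqrt \<kappa> *\<^sub>R snd (hat \<kappa> P)))"
  have hh: "h P \<bullet> h Q = 1 - \<kappa> * md \<kappa> (dM \<kappa> P Q)" if "P \<in> MP \<kappa>" "Q \<in> MP \<kappa>" for P Q
  proof -
    have "h P \<bullet> h Q = (1 - \<kappa> * mm \<kappa> P) * (1 - \<kappa> * mm \<kappa> Q) + \<kappa> * (vv \<kappa> P \<bullet> vv \<kappa> Q)"
      using k by (simp add: h_def hat_def flip: mult.assoc)
    then show ?thesis unfolding md_dM(1)[OF that] by (simp add: algebra_simps)
  qed
  have h1: "h P \<bullet> h P = 1" if "P \<in> MP \<kappa>" for P using hh[OF that that] that by simp
  define x where "x = (\<lambda>P Q. sqrt \<kappa> * dM \<kappa> P Q)"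
  have cosx: "h P \<bullet> h Q = cos (x P Q)" if "P \<in> MP \<kappa>" "Q \<in> MP \<kappa>" for P Q
    using hh[OF that] k by (simp add: md_pos x_def)
  have xr: "0 \<le> x P Q" "x P Q \<le> pi" if "P \<in> MP \<kappa>" "Q \<in> MP \<kappa>" for P Q
    using md_dM(2)[OF that] k by (auto simp: x_def radc_def field_simps)
  have sum: "2 * pi \<le> x a b + x b c + x a c"
    using ns k by (auto simp: small_def x_def field_simps dM_commute[of \<kappa> c a])
  \<comment> \<open>A and C are the parts of \<open>h a\<close> and \<open>h c\<close> orthogonal to
    \<open>h b\<close>; their norms are sines of sides.\<close>
  define A where "A = h a - cos (x a b) *\<^sub>R h b"
  define C where "C = h c - cos (x b c) *\<^sub>R h b"
  have comm: "h b \<bullet> h a = cos (x a b)" "h c \<bullet> h b = cos (x b c)"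
    using cosx S by (simp_all add: inner_commute[of "h b" "h a"] inner_commute[of "h c" "h b"])
  have xx: "cos (x P P) = 1" if "P \<in> MP \<kappa>" for P using h1[OF that] cosx[OF that that] by simp
  have AC: "A \<bullet> C = cos (x a c) - cos (x a b) * cos (x b c)"
    using S by (simp add: A_def C_def inner_diff cosx comm xx)
  have "A \<bullet> A = 1 - (cos (x a b))\<^sup>2" "C \<bullet> C = 1 - (cos (x b c))\<^sup>2"
    using S by (simp_all add: A_def C_def inner_diff cosx comm xx power2_eq_square)
  then have nA: "norm A = sin (x a b)" and nC: "norm C = sin (x b c)"
    using xr S by (simp_all add: norm_eq_sqrt_inner sin_ge_zero flip: sin_squared_eq)
  have "cos (x a c) \<le> cos (2 * pi - (x a b + x b c))"
    using xr[OF S(1,2)] xr[OF S(2,3)] xr[OF S(1,3)] sum by (intro cos_monotone_0_pi_le) auto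
  also have "\<dots> = cos (x a b) * cos (x b c) - sin (x a b) * sin (x b c)"
    by (simp add: cos_diff cos_add)
  finally have "norm C *\<^sub>R A + norm A *\<^sub>R C = 0"
    by (intro inner_opposite) (simp add: AC nA nC)
  moreover have "0 < norm A"
    unfolding nA using ab k by (intro sin_gt_zero) (auto simp: x_def rad_def field_simps)
  ultimately have "C = (- (norm C / norm A)) *\<^sub>R A"
  proof -
    assume 1: "norm C *\<^sub>R A + norm A *\<^sub>R C = 0" and 2: "0 < norm A"
    have "norm A *\<^sub>R C = - (norm C *\<^sub>R A)" using 1 by (simp add: eq_neg_iff_add_eq_0 add.commute)
    then have "(1 / norm A) *\<^sub>R (norm A *\<^sub>R C) = (1 / norm A) *\<^sub>R (- (norm C *\<^sub>R A))" by simp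
    then show ?thesis using 2 by simp
  qed
  then have "h c = (- (norm C / norm A)) *\<^sub>R h a + (cos (x b c) + norm C / norm A * cos (x a b)) *\<^sub>R h b"
    by (simp add: C_def A_def algebra_simps eq_diff_eq diff_eq_eq)
  then obtain \<alpha> \<beta> where hc: "h c = \<alpha> *\<^sub>R h a + \<beta> *\<^sub>R h b" by blast
  have "hat \<kappa> c = \<alpha> *\<^sub>R hat \<kappa> a + \<beta> *\<^sub>R hat \<kappa> b"
  proof (rule prod_eqI)
    show "fst (hat \<kappa> c) = fst (\<alpha> *\<^sub>R hat \<kappa> a + \<beta> *\<^sub>R hat \<kappa> b)"
      using arg_cong[OF hc, of fst] by (simp add: h_def)
    have "sqrt \<kappa> *\<^sub>R snd (hat \<kappa> c) = sqrt \<kappa> *\<^sub>R snd (\<alpha> *\<^sub>R hat \<kappa> a + \<beta> *\<^sub>R hat \<kappa> b)"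
      using arg_cong[OF hc, of snd] by (simp add: h_def scaleR_add_right mult.commute)
    then show "snd (hat \<kappa> c) = snd (\<alpha> *\<^sub>R hat \<kappa> a + \<beta> *\<^sub>R hat \<kappa> b)" using k by simp
  qed
  then show thesis by (rule that)
qed

lemma dM_ray:
  assumes "0 \<le> t" "t \<le> r" "radc \<kappa> r" "norm u = 1"
  shows "dM \<kappa> (pt \<kappa> t u) (pt \<kappa> r u) = r - t"
proof (rule md_inj)
  have t: "0 \<le> r" "radc \<kappa> t" using assms radc_mono by auto
  note P = pt_model[OF assms(1) t(2) assms(4)] and Q = pt_model[OF t(1) assms(3,4)]
  show "radc \<kappa> (dM \<kappa> (pt \<kappa> t u) (pt \<kappa> r u))" by (rule md_dM(2)[OF P Q])
  show "md \<kappa> (dM \<kappa> (pt \<kappa> t u) (pt \<kappa> r u)) = md \<kappa> (r - t)"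
    using md_dM(1)[OF P Q] mv_pt[OF assms(1) t(2) assms(4)] mv_pt[OF t(1) assms(3,4)] assms(4)
    by (simp add: md_diff norm_eq_1 algebra_simps)
  show "radc \<kappa> (r - t)" using assms by (elim radc_mono) simp
qed (use assms in auto)

lemma ray_between:
  assumes "0 \<le> r" "rad \<kappa> r" "norm u = 1" "w \<in> MP \<kappa>" "dM \<kappa> (org \<kappa>) w + dM \<kappa> w (pt \<kappa> r u) = r"
  shows "w = pt \<kappa> (dM \<kappa> (org \<kappa>) w) u"
proof -
  define t where "t = dM \<kappa> (org \<kappa>) w"
  have t: "0 \<le> t" "t \<le> r" "radc \<kappa> t" "radc \<kappa> r"
  proof -
    show 1: "0 \<le> t" by (simp add: t_def)
    show 2: "t \<le> r" using assms(5) dM_nonneg[of \<kappa> w "pt \<kappa> r u"] unfolding t_def by linarith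
    show "radc \<kappa> t" "radc \<kappa> r" using rad_radc[OF rad_mono[OF assms(2) 2]] rad_radc[OF assms(2)] .
  qed
  have d: "dM \<kappa> (org \<kappa>) (pt \<kappa> r u) = r" "dM \<kappa> (org \<kappa>) (pt \<kappa> t u) = t" "dM \<kappa> (pt \<kappa> t u) (pt \<kappa> r u) = r - t"
    using assms t by (auto intro: dM_org_pt dM_ray)
  show ?thesis unfolding t_def[symmetric]
    by (rule segment_unique[OF org_model pt_model[OF assms(1) t(4) assms(3)] assms(4) pt_model[OF t(1,3) assms(3)]])
      (use assms d in \<open>simp_all add: t_def[symmetric]\<close>)
qed

lemma small_gap: assumes "small \<kappa> x" obtains e where "0 < e" "small \<kappa> (x + e)"
proof (cases "\<kappa> > 0")
  case True
  then have "x < 2 * pi / sqrt \<kappa>" using assms by (simp add: small_def)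
  then obtain y where "x < y" "y < 2 * pi / sqrt \<kappa>" using dense by blast
  then show thesis using that[of "y - x"] by (simp add: small_def)
next
  case False
  then show thesis using that[of 1] by (simp add: small_def)
qed

lemma pt_0: assumes "norm u = 1" shows "pt \<kappa> 0 u = org \<kappa>"
proof (rule mv_inj)
  have z: "radc \<kappa> 0" by (simp add: radc_def)
  show "pt \<kappa> 0 u \<in> MP \<kappa>" by (rule pt_model) (use z assms in auto)
  show "org \<kappa> \<in> MP \<kappa>" by (rule org_model)
  show "mm \<kappa> (pt \<kappa> 0 u) = mm \<kappa> (org \<kappa>)" "vv \<kappa> (pt \<kappa> 0 u) = vv \<kappa> (org \<kappa>)"
    using mv_pt[OF _ z assms] by simp_all
qed

section \<open>Points determined by their distances to the base segments\<close>

text \<open>Here \<open>XS\<close> is the image of \<open>X\<close> in its ultrapower \<open>S\<close>, and \<open>bpt i t\<close> is the point at distance \<open>t\<close> from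
  \<open>p\<close> on the \<open>i\<close>-th base segment, which has length \<open>\<rho> i\<close>.\<close>
locale rigid = cbb \<kappa> S d for \<kappa> and S :: "'b set" and d +
  fixes XS :: "'b set" and p :: 'b and I :: "'i set" and \<xi> :: "'i \<Rightarrow> ell2" and \<rho> :: "'i \<Rightarrow> real"
    and bpt :: "'i \<Rightarrow> real \<Rightarrow> 'b"
  assumes XS: "XS \<subseteq> S" and pX: "p \<in> XS"
    and realize: "\<And>a b s. a \<in> XS \<Longrightarrow> b \<in> XS \<Longrightarrow> 0 \<le> s \<Longrightarrow> s \<le> d a b \<Longrightarrow>
      (\<And>z z'. z \<in> S \<Longrightarrow> z' \<in> S \<Longrightarrow> d a z = s \<Longrightarrow> d z b = d a b - s \<Longrightarrow> d a z' = s \<Longrightarrow> d z' b = d a b - s \<Longrightarrow> d z z' = 0) \<Longrightarrow>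
      \<exists>z\<in>XS. d a z = s \<and> d z b = d a b - s"
    and finI: "finite I"
    and unit: "\<And>i. i \<in> I \<Longrightarrow> norm (\<xi> i) = 1"
    and balanced: "\<exists>\<nu>. (\<forall>i\<in>I. 0 < \<nu> i) \<and> (\<Sum>i\<in>I. \<nu> i *\<^sub>R \<xi> i) = 0"
    and rho: "\<And>i. i \<in> I \<Longrightarrow> 0 < \<rho> i" "\<And>i. i \<in> I \<Longrightarrow> rad \<kappa> (\<rho> i)"
    and bptX: "\<And>i t. i \<in> I \<Longrightarrow> 0 < t \<Longrightarrow> t < \<rho> i \<Longrightarrow> bpt i t \<in> XS"
    and bpt_p: "\<And>i t. i \<in> I \<Longrightarrow> 0 < t \<Longrightarrow> t < \<rho> i \<Longrightarrow> d p (bpt i t) = t"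
    and bpt_iso: "\<And>i j s t. i \<in> I \<Longrightarrow> j \<in> I \<Longrightarrow> 0 < s \<Longrightarrow> s < \<rho> i \<Longrightarrow> 0 < t \<Longrightarrow> t < \<rho> j \<Longrightarrow>
      d (bpt i s) (bpt j t) = dM \<kappa> (pt \<kappa> s (\<xi> i)) (pt \<kappa> t (\<xi> j))"
begin

abbreviation ab :: "(real \<times> ell2) set \<Rightarrow> real" where "ab P \<equiv> dM \<kappa> (org \<kappa>) P"

lemma pS: "p \<in> S" using pX XS by blast

lemma XS_S: "z \<in> XS \<Longrightarrow> z \<in> S" using XS by blast

text \<open>\<open>comp\<close> in the space against the equality of \<open>between_model\<close>:
  all terms but the distance from the between-point to the third point agree.\<close>

lemma comp_lower:
  assumes S: "za \<in> S" "zb \<in> S" "z \<in> S" "zc \<in> S" and M: "a \<in> MP \<kappa>" "b \<in> MP \<kappa>" "w \<in> MP \<kappa>" "c \<in> MP \<kappa>"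
    and ab: "d za zb = dM \<kappa> a b" "d za z = dM \<kappa> a w" "d z zb = dM \<kappa> w b" "dM \<kappa> a w + dM \<kappa> w b = dM \<kappa> a b"
    and c: "d za zc = dM \<kappa> a c" "d zb zc = dM \<kappa> b c" and sm: "small \<kappa> (d za zb + d zb zc + d zc za)"
  shows "dM \<kappa> w c \<le> d z zc"
proof (cases "dM \<kappa> a b = 0")
  case True
  then have "dM \<kappa> a w = 0" using ab(4) dM_nonneg[of \<kappa> a w] dM_nonneg[of \<kappa> w b] by linarith
  then have "a = w" "d za z = 0" using M ab dM_zero by auto
  then show ?thesis using dist_eq_of_zero[OF S(1,3,4)] c by simp
next
  case False
  have "2 * d za zb \<le> d za zb + d zb zc + d zc za" using tri[OF S(1,4,2)] sym[of za zc] sym[of zc zb] by linarith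
  then have "small \<kappa> (2 * d za zb)" by (rule small_mono[OF sm])
  then have rl: "rad \<kappa> (dM \<kappa> a b)" using ab by simp
  have "0 < dM \<kappa> a b" using False by (simp add: less_le)
  then have L: "0 < sn \<kappa> (dM \<kappa> a b)" using rl by (rule sn_gt_0)
  have "sn \<kappa> (dM \<kappa> a b) * md \<kappa> (dM \<kappa> w c) \<le> sn \<kappa> (dM \<kappa> a b) * md \<kappa> (d z zc)"
    using comp[OF S(1,2,4,3) _ sm] between_model(2)[OF M(1,2,3) ab(4) rl M(4)] ab c by simp
  then have "md \<kappa> (dM \<kappa> w c) \<le> md \<kappa> (d z zc)" using L by simp
  then show ?thesis by (rule md_le_imp_le) (use md_dM(2)[OF M(3,4)] in auto)
qed

text \<open>At radius t every triangle formed with p has perimeter at most 4 t, whatever the angle.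
  This is the origin of the bound on 2 t.\<close>

lemma base_small:
  assumes "0 < t" "rad \<kappa> (2 * t)" "\<And>i. i \<in> I \<Longrightarrow> t < \<rho> i"
  shows "base_at p I (\<lambda>i. bpt i t) (\<lambda>i. sn \<kappa> t *\<^sub>R \<xi> i)"
  unfolding base_at_def
proof (intro conjI ballI)
  show "finite I" "p \<in> S" by (rule finI, rule pS)
  show "bpt i t \<in> S" if "i \<in> I" for i using bptX[OF that assms(1) assms(3)[OF that]] XS_S by blast
  have rt: "rad \<kappa> t" using assms by (intro rad_mono[OF assms(2)]) simp
  fix i j assume i: "i \<in> I" and j: "j \<in> I"
  have S: "bpt i t \<in> S" "bpt j t \<in> S" using bptX i j assms XS_S by blast+
  have D: "d p (bpt i t) = t" "d p (bpt j t) = t" using bpt_p i j assms by auto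
  have "d (bpt i t) (bpt j t) \<le> 2 * t" using tri[OF S(1) pS S(2)] D sym[of "bpt i t" p] by simp
  moreover have "small \<kappa> (2 * (2 * t))" using assms(2) by (simp only: small_double)
  ultimately show "small \<kappa> (d p (bpt i t) + d p (bpt j t) + d (bpt i t) (bpt j t))"
    using D by (elim small_mono) simp
  note P = pt_model[OF less_imp_le[OF assms(1)] rad_radc[OF rt] unit]
  note mv = mv_pt[OF less_imp_le[OF assms(1)] rad_radc[OF rt] unit]
  show "Phi p (bpt i t) (bpt j t) = (sn \<kappa> t *\<^sub>R \<xi> i) \<bullet> (sn \<kappa> t *\<^sub>R \<xi> j)"
    using md_dM(1)[OF P[OF i] P[OF j]] bpt_iso[OF i j assms(1) assms(3)[OF i] assms(1) assms(3)[OF j]] D mv[OF i] mv[OF j]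
    by (simp add: Phi_def)
next
  obtain \<nu> where nu: "\<And>i. i \<in> I \<Longrightarrow> 0 < \<nu> i" "(\<Sum>i\<in>I. \<nu> i *\<^sub>R \<xi> i) = 0" using balanced by blast
  have "(\<Sum>i\<in>I. \<nu> i *\<^sub>R sn \<kappa> t *\<^sub>R \<xi> i) = sn \<kappa> t *\<^sub>R (\<Sum>i\<in>I. \<nu> i *\<^sub>R \<xi> i)"
    by (simp add: scaleR_right.sum mult.commute)
  then show "\<exists>\<nu>. (\<forall>i\<in>I. 0 < \<nu> i) \<and> (\<Sum>i\<in>I. \<nu> i *\<^sub>R sn \<kappa> t *\<^sub>R \<xi> i) = 0" using nu by auto
qed

text \<open>Distances are prescribed to base points near p only. There the perimeters are close to
  twice the distance of z from p, hence small, and \<open>LSS\<close> is available. The span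
  condition provides the weights in \<open>match_inner\<close>.\<close>

definition matched :: "'b \<Rightarrow> (real \<times> ell2) set \<Rightarrow> bool" where
  "matched z P \<longleftrightarrow> z \<in> S \<and> P \<in> MP \<kappa> \<and> d p z = ab P \<and> rad \<kappa> (ab P) \<and> vv \<kappa> P \<in> lin I \<xi> \<and>
    (\<exists>t0>0. \<forall>i\<in>I. \<forall>t. 0 < t \<and> t < t0 \<and> t < \<rho> i \<longrightarrow> d z (bpt i t) = dM \<kappa> P (pt \<kappa> t (\<xi> i)))"

lemma pt_xi: "i \<in> I \<Longrightarrow> 0 < t \<Longrightarrow> t < \<rho> i \<Longrightarrow> pt \<kappa> t (\<xi> i) \<in> MP \<kappa>"
  and mv_xi: "i \<in> I \<Longrightarrow> 0 < t \<Longrightarrow> t < \<rho> i \<Longrightarrow> mm \<kappa> (pt \<kappa> t (\<xi> i)) = md \<kappa> t"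
    "i \<in> I \<Longrightarrow> 0 < t \<Longrightarrow> t < \<rho> i \<Longrightarrow> vv \<kappa> (pt \<kappa> t (\<xi> i)) = sn \<kappa> t *\<^sub>R \<xi> i"
  and ab_xi: "i \<in> I \<Longrightarrow> 0 < t \<Longrightarrow> t < \<rho> i \<Longrightarrow> ab (pt \<kappa> t (\<xi> i)) = t"
proof -
  assume i: "i \<in> I" "0 < t" "t < \<rho> i"
  have "radc \<kappa> t" using rad_radc[OF rad_mono[OF rho(2)[OF i(1)]]] i by simp
  then show "pt \<kappa> t (\<xi> i) \<in> MP \<kappa>" "mm \<kappa> (pt \<kappa> t (\<xi> i)) = md \<kappa> t" "vv \<kappa> (pt \<kappa> t (\<xi> i)) = sn \<kappa> t *\<^sub>R \<xi> i" "ab (pt \<kappa> t (\<xi> i)) = t"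
    using pt_model mv_pt dM_org_pt unit i less_imp_le by simp_all
qed

lemma small_scale: obtains t1 where "0 < t1" "rad \<kappa> (2 * t1)" "\<And>i. i \<in> I \<Longrightarrow> t1 < \<rho> i"
proof -
  obtain e where e: "0 < e" "small \<kappa> (0 + e)" using small_gap[of \<kappa> 0] by (auto simp: small_def)
  define t1 where "t1 = Min (insert (e / 4) ((\<lambda>i. \<rho> i / 2) ` I))"
  have "t1 \<in> insert (e / 4) ((\<lambda>i. \<rho> i / 2) ` I)" unfolding t1_def by (rule Min_in) (use finI in auto)
  then have pos: "0 < t1" using e rho(1) by auto
  have "t1 \<le> e / 4" unfolding t1_def using finI by (intro Min_le) auto
  then have "small \<kappa> (2 * (2 * t1))" by (intro small_mono[OF e(2)]) simp
  then have "rad \<kappa> (2 * t1)" by (simp only: small_double)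
  moreover have "t1 < \<rho> i" if "i \<in> I" for i
  proof -
    have "t1 \<le> \<rho> i / 2" unfolding t1_def using finI that by (intro Min_le) auto
    then show ?thesis using rho(1)[OF that] by simp
  qed
  ultimately show thesis using that[of t1] pos by blast
qed

lemma Phi_model:
  assumes "P \<in> MP \<kappa>" "Q \<in> MP \<kappa>" "d p z = ab P" "d p z' = ab Q"
  shows "Phi p z z' = vv \<kappa> P \<bullet> vv \<kappa> Q + (md \<kappa> (dM \<kappa> P Q) - md \<kappa> (d z z'))"
  using md_dM(1)[OF assms(1,2)] md_org[OF assms(1)] md_org[OF assms(2)] assms(3,4)
  by (simp add: Phi_def)

lemma radc_of_small:
  assumes "x \<in> S" "y \<in> S" "z \<in> S" "small \<kappa> (d x y + d x z + d y z)"
  shows "rad \<kappa> (d y z)"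
proof -
  have "2 * d y z \<le> d x y + d x z + d y z" using tri[OF assms(2,1,3)] sym[of x y] by simp
  then have "small \<kappa> (2 * d y z)" by (rule small_mono[OF assms(4)])
  then show ?thesis by simp
qed

text \<open>Lower bounds on the distances to base points are upper bounds on \<open>Phi\<close>,
  which \<open>half_match\<close> turns into equalities at each small radius t separately.\<close>

lemma matchedI:
  assumes z: "z \<in> S" "P \<in> MP \<kappa>" "d p z = ab P" "rad \<kappa> (ab P)" "vv \<kappa> P \<in> lin I \<xi>" and t0: "0 < t0"
    and le: "\<And>i t. i \<in> I \<Longrightarrow> 0 < t \<Longrightarrow> t < t0 \<Longrightarrow> t < \<rho> i \<Longrightarrow> dM \<kappa> P (pt \<kappa> t (\<xi> i)) \<le> d z (bpt i t)"
  shows "matched z P"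
proof -
  obtain t1 where t1: "0 < t1" "rad \<kappa> (2 * t1)" "\<And>i. i \<in> I \<Longrightarrow> t1 < \<rho> i" using small_scale by blast
  have "small \<kappa> (2 * ab P)" using z(4) by simp
  then obtain e where e: "0 < e" "small \<kappa> (2 * ab P + e)" using small_gap by blast
  \<comment> \<open>For t below e / 2 the perimeter of p, z and a base point is at most 2
    \<open>ab P\<close> + e.\<close>
  define t2 where "t2 = min (min t0 t1) (e / 2)"
  have t2: "0 < t2" "t2 \<le> t0" "t2 \<le> t1" "t2 \<le> e / 2" using t0 t1 e by (auto simp: t2_def)
  have "d z (bpt i t) = dM \<kappa> P (pt \<kappa> t (\<xi> i))" if i: "i \<in> I" and t: "0 < t" "t < t2" "t < \<rho> i" for i t
  proof -
    have tr: "t < \<rho> j" if "j \<in> I" for j using t1(3)[OF that] t t2 by simp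
    have b: "base_at p I (\<lambda>i. bpt i t) (\<lambda>i. sn \<kappa> t *\<^sub>R \<xi> i)"
      by (rule base_small[OF t(1) rad_mono[OF t1(2)] tr]) (use t t2 in auto)
    have bS: "bpt j t \<in> S" if "j \<in> I" for j using bptX[OF that t(1) tr[OF that]] XS_S by blast
    have sm: "small \<kappa> (d p z + d p (bpt j t) + d z (bpt j t))" if "j \<in> I" for j
    proof (rule small_mono[OF e(2)])
      show "d p z + d p (bpt j t) + d z (bpt j t) \<le> 2 * ab P + e"
        using tri[OF z(1) pS bS[OF that]] bpt_p[OF that t(1) tr[OF that]] sym[of z p] z(3) t t2 by simp
    qed
    have rz: "radc \<kappa> (d z (bpt j t))" if "j \<in> I" for j
      using radc_of_small[OF pS z(1) bS[OF that] sm[OF that]] by (rule rad_radc)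
    have ph: "Phi p z (bpt j t) = vv \<kappa> P \<bullet> (sn \<kappa> t *\<^sub>R \<xi> j) + (md \<kappa> (dM \<kappa> P (pt \<kappa> t (\<xi> j))) - md \<kappa> (d z (bpt j t)))" if j: "j \<in> I" for j
      using Phi_model[OF z(2) pt_xi[OF j t(1) tr[OF j]] z(3), of "bpt j t"] bpt_p[OF j t(1) tr[OF j]]
        ab_xi[OF j t(1) tr[OF j]] mv_xi(2)[OF j t(1) tr[OF j]] by simp
    have mdle: "md \<kappa> (dM \<kappa> P (pt \<kappa> t (\<xi> j))) \<le> md \<kappa> (d z (bpt j t))" if j: "j \<in> I" for j
      by (rule md_mono[OF dM_nonneg le[OF j t(1) _ tr[OF j]] rz[OF j]]) (use t t2 in auto)
    have "Phi p z (bpt i t) = vv \<kappa> P \<bullet> (sn \<kappa> t *\<^sub>R \<xi> i)"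
    proof (rule half_match[OF b z(1) _ sm _ i])
      show "rad \<kappa> (d p z)" using z by simp
      show "Phi p z (bpt j t) \<le> vv \<kappa> P \<bullet> (sn \<kappa> t *\<^sub>R \<xi> j)" if "j \<in> I" for j
        unfolding ph[OF that] using mdle[OF that] by simp
    qed
    then have "md \<kappa> (d z (bpt i t)) = md \<kappa> (dM \<kappa> P (pt \<kappa> t (\<xi> i)))" using ph[OF i] by simp
    then show ?thesis
      by (rule md_inj) (use rz[OF i] md_dM(2)[OF z(2) pt_xi[OF i t(1) t(3)]] in auto)
  qed
  then show ?thesis unfolding matched_def using z t2(1) by blast
qed

text \<open>\<open>match_inner\<close> over the base at one common small radius t. A lower bound on
  \<open>Phi\<close> is an upper bound on the distance.\<close>

lemma match_small:
  assumes m: "matched z P" "matched z' P'" and sm: "small \<kappa> (d p z + d p z' + d z z')"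
  shows "d z z' \<le> dM \<kappa> P P'"
proof -
  have z: "z \<in> S" "P \<in> MP \<kappa>" "d p z = ab P" "rad \<kappa> (ab P)" "vv \<kappa> P \<in> lin I \<xi>"
    and z': "z' \<in> S" "P' \<in> MP \<kappa>" "d p z' = ab P'" "rad \<kappa> (ab P')" "vv \<kappa> P' \<in> lin I \<xi>"
    using m by (auto simp: matched_def)
  obtain t0 where t0: "0 < t0" "\<And>i t. i \<in> I \<Longrightarrow> 0 < t \<Longrightarrow> t < t0 \<Longrightarrow> t < \<rho> i \<Longrightarrow> d z (bpt i t) = dM \<kappa> P (pt \<kappa> t (\<xi> i))"
    using m(1) unfolding matched_def by blast
  obtain t0' where t0': "0 < t0'" "\<And>i t. i \<in> I \<Longrightarrow> 0 < t \<Longrightarrow> t < t0' \<Longrightarrow> t < \<rho> i \<Longrightarrow> d z' (bpt i t) = dM \<kappa> P' (pt \<kappa> t (\<xi> i))"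
    using m(2) unfolding matched_def by blast
  obtain t1 where t1: "0 < t1" "rad \<kappa> (2 * t1)" "\<And>i. i \<in> I \<Longrightarrow> t1 < \<rho> i" using small_scale by blast
  have "small \<kappa> (2 * ab P)" "small \<kappa> (2 * ab P')" using z(4) z'(4) by simp_all
  then obtain e e' where e: "0 < e" "small \<kappa> (2 * ab P + e)" and e': "0 < e'" "small \<kappa> (2 * ab P' + e')" using small_gap by metis
  define t where "t = Min {t0 / 2, t0' / 2, t1 / 2, e / 2, e' / 2}"
  have t: "0 < t" "t < t0" "t < t0'" "t < t1" "t \<le> e / 2" "t \<le> e' / 2"
    using t0(1) t0'(1) t1(1) e(1) e'(1) by (auto simp: t_def min_def)
  have tr: "t < \<rho> j" if "j \<in> I" for j using t1(3)[OF that] t by simp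
  have b: "base_at p I (\<lambda>i. bpt i t) (\<lambda>i. sn \<kappa> t *\<^sub>R \<xi> i)"
    by (rule base_small[OF t(1) rad_mono[OF t1(2)] tr]) (use t in auto)
  have bS: "bpt j t \<in> S" if "j \<in> I" for j using bptX[OF that t(1) tr[OF that]] XS_S by blast
  have rt: "rad \<kappa> t" by (rule rad_mono[OF t1(2)]) (use t in auto)
  have st: "0 < sn \<kappa> t" using t rt by (intro sn_gt_0)
  have linE: "v \<in> lin I \<xi> \<Longrightarrow> v \<in> lin I (\<lambda>i. sn \<kappa> t *\<^sub>R \<xi> i)" for v
  proof -
    assume "v \<in> lin I \<xi>"
    then obtain a where "v = (\<Sum>i\<in>I. a i *\<^sub>R \<xi> i)" by (auto simp: lin_def)
    also have "\<dots> = (\<Sum>i\<in>I. (a i / sn \<kappa> t) *\<^sub>R sn \<kappa> t *\<^sub>R \<xi> i)" using st by (intro sum.cong) auto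
    finally show ?thesis unfolding lin_def by (intro range_eqI)
  qed
  have "vv \<kappa> P \<bullet> vv \<kappa> P' \<le> Phi p z z'"
  proof (rule match_inner[OF b z(1) _ z'(1) _ _ _ sm linE[OF z(5)] _ _ linE[OF z'(5)]])
    show "rad \<kappa> (d p z)" "rad \<kappa> (d p z')" using z z' by simp_all
    show "vv \<kappa> P \<bullet> vv \<kappa> P = (sn \<kappa> (d p z))\<^sup>2" "vv \<kappa> P' \<bullet> vv \<kappa> P' = (sn \<kappa> (d p z'))\<^sup>2"
      using vv_norm_sn z z' by simp_all
    fix i assume i: "i \<in> I"
    show "small \<kappa> (d p z + d p (bpt i t) + d z (bpt i t))"
      by (rule small_mono[OF e(2)])
        (use tri[OF z(1) pS bS[OF i]] bpt_p[OF i t(1) tr[OF i]] sym[of z p] z(3) t in simp)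
    show "small \<kappa> (d p z' + d p (bpt i t) + d z' (bpt i t))"
      by (rule small_mono[OF e'(2)])
        (use tri[OF z'(1) pS bS[OF i]] bpt_p[OF i t(1) tr[OF i]] sym[of z' p] z'(3) t in simp)
    show "Phi p z (bpt i t) = vv \<kappa> P \<bullet> (sn \<kappa> t *\<^sub>R \<xi> i)"
      using Phi_model[OF z(2) pt_xi[OF i t(1) tr[OF i]] z(3), of "bpt i t"] bpt_p[OF i t(1) tr[OF i]]
        ab_xi[OF i t(1) tr[OF i]] mv_xi(2)[OF i t(1) tr[OF i]] t0(2)[OF i t(1,2) tr[OF i]] by simp
    show "Phi p z' (bpt i t) = vv \<kappa> P' \<bullet> (sn \<kappa> t *\<^sub>R \<xi> i)"
      using Phi_model[OF z'(2) pt_xi[OF i t(1) tr[OF i]] z'(3), of "bpt i t"] bpt_p[OF i t(1) tr[OF i]]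
        ab_xi[OF i t(1) tr[OF i]] mv_xi(2)[OF i t(1) tr[OF i]] t0'(2)[OF i t(1,3) tr[OF i]] by simp
  qed
  then have "md \<kappa> (d z z') \<le> md \<kappa> (dM \<kappa> P P')" using Phi_model[OF z(2) z'(2) z(3) z'(3)] by simp
  then show ?thesis
    by (rule md_le_imp_le) (use rad_radc[OF radc_of_small[OF pS z(1) z'(1) sm]] in auto)
qed

text \<open>The lower bounds asked for by \<open>matchedI\<close> come from
  \<open>comp_lower\<close> on a segment from p to z.\<close>

lemma matched_ray:
  assumes m: "matched z (pt \<kappa> r u)" and u: "norm u = 1" "0 \<le> r" "radc \<kappa> r" and y: "y \<in> S" "d p y = s" "d y z = r - s" "0 \<le> s" "s \<le> r"
  shows "matched y (pt \<kappa> s u)"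
proof (cases "r = 0")
  case True
  then have s: "s = 0" using y by simp
  have "z \<in> S" using m by (simp add: matched_def)
  have e: "d y x = d p x" if "x \<in> S" for x using dist_eq_of_zero[OF pS y(1) that] y s by simp
  show ?thesis unfolding s pt_0[OF u(1)]
  proof (rule matchedI[OF y(1) org_model])
    show "d p y = ab (org \<kappa>)" "rad \<kappa> (ab (org \<kappa>))" using y s org_model by (auto simp: rad_def)
    show "vv \<kappa> (org \<kappa>) \<in> lin I \<xi>" by (simp add: lin_0)
    show "0 < (1::real)" by simp
    show "dM \<kappa> (org \<kappa>) (pt \<kappa> t (\<xi> i)) \<le> d y (bpt i t)" if "i \<in> I" "0 < t" "t < 1" "t < \<rho> i" for i t
      using that ab_xi bpt_p e[OF XS_S[OF bptX[OF that(1,2,4)]]] by simp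
  qed
next
  case False
  then have r: "0 < r" using u by simp
  have z: "z \<in> S" "pt \<kappa> r u \<in> MP \<kappa>" "d p z = ab (pt \<kappa> r u)" "rad \<kappa> (ab (pt \<kappa> r u))" "vv \<kappa> (pt \<kappa> r u) \<in> lin I \<xi>"
    using m by (auto simp: matched_def)
  obtain t0 where t0: "0 < t0" "\<And>i t. i \<in> I \<Longrightarrow> 0 < t \<Longrightarrow> t < t0 \<Longrightarrow> t < \<rho> i \<Longrightarrow> d z (bpt i t) = dM \<kappa> (pt \<kappa> r u) (pt \<kappa> t (\<xi> i))"
    using m unfolding matched_def by blast
  have rr: "ab (pt \<kappa> r u) = r" using dM_org_pt u by simp
  then have rad_r: "rad \<kappa> r" using z by simp
  have rs: "radc \<kappa> s" using rad_radc[OF rad_mono[OF rad_r y(5)]] .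
  have P: "pt \<kappa> s u \<in> MP \<kappa>" "ab (pt \<kappa> s u) = s" using pt_model dM_org_pt u rs y by simp_all
  have dr: "dM \<kappa> (pt \<kappa> s u) (pt \<kappa> r u) = r - s" using dM_ray y u by simp
  have "small \<kappa> (2 * r)" using rad_r by simp
  then obtain e where e: "0 < e" "small \<kappa> (2 * r + e)" using small_gap by blast
  show ?thesis
  proof (rule matchedI[OF y(1) P(1)])
    show "d p y = ab (pt \<kappa> s u)" "rad \<kappa> (ab (pt \<kappa> s u))" using P y rad_mono[OF rad_r y(5)] by auto
    have "vv \<kappa> (pt \<kappa> s u) = (sn \<kappa> s / sn \<kappa> r) *\<^sub>R vv \<kappa> (pt \<kappa> r u)"
      using mv_pt(2)[OF y(4) rs u(1)] mv_pt(2)[OF u(2,3,1)] sn_gt_0[OF r rad_r] by simp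
    then show "vv \<kappa> (pt \<kappa> s u) \<in> lin I \<xi>" using lin_scale[OF z(5)] by simp
    show "0 < min t0 (e / 2)" using t0 e by simp
    fix i t assume i: "i \<in> I" "0 < t" "t < min t0 (e / 2)" "t < \<rho> i"
    note b = XS_S[OF bptX[OF i(1,2,4)]]
    show "dM \<kappa> (pt \<kappa> s u) (pt \<kappa> t (\<xi> i)) \<le> d y (bpt i t)"
    proof (rule comp_lower[OF pS z(1) y(1) b org_model z(2) P(1) pt_xi[OF i(1,2,4)] z(3)])
      show "d p y = ab (pt \<kappa> s u)" "d y z = dM \<kappa> (pt \<kappa> s u) (pt \<kappa> r u)" "ab (pt \<kappa> s u) + dM \<kappa> (pt \<kappa> s u) (pt \<kappa> r u) = ab (pt \<kappa> r u)"
        using P y dr rr by simp_all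
      show "d p (bpt i t) = ab (pt \<kappa> t (\<xi> i))" using ab_xi bpt_p i by simp
      show "d z (bpt i t) = dM \<kappa> (pt \<kappa> r u) (pt \<kappa> t (\<xi> i))" using t0 i by simp
      show "small \<kappa> (d p z + d z (bpt i t) + d (bpt i t) p)"
        by (rule small_mono[OF e(2)])
          (use tri[OF z(1) pS b] bpt_p[OF i(1,2,4)] i(3) z(3) rr sym[of z p] sym[of "bpt i t" p] in simp)
    qed
  qed
qed

text \<open>Moves the perimeter condition from the space, where it is not known, to the model. The
  bound is propagated along a segment from p to z in short steps: each step changes the perimeter so
  little that \<open>match_small\<close> remains applicable.\<close>

lemma match_le:
  assumes m: "matched z P" "matched z' P'" and sm: "small \<kappa> (ab P + ab P' + dM \<kappa> P P')"
  shows "d z z' \<le> dM \<kappa> P P'"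
proof -
  have z: "z \<in> S" "P \<in> MP \<kappa>" "d p z = ab P" "rad \<kappa> (ab P)"
    and z': "z' \<in> S" "P' \<in> MP \<kappa>" "d p z' = ab P'"
    using m by (auto simp: matched_def)
  obtain r u where ru: "0 \<le> r" "radc \<kappa> r" "norm u = 1" "P = pt \<kappa> r u" using model_cases[OF z(2)] .
  have rr: "ab P = r" using dM_org_pt ru by simp
  obtain e where e: "0 < e" "small \<kappa> (ab P + ab P' + dM \<kappa> P P' + e)" using small_gap[OF sm] .
  \<comment> \<open>A step of length \<delta> costs the perimeter at most 2 \<delta> = e.\<close>
  define \<delta> where "\<delta> = e / 2"
  have claim: "\<forall>s y. 0 \<le> s \<and> s \<le> r \<and> s \<le> real n * \<delta> \<and> y \<in> S \<and> d p y = s \<and> d y z = r - s \<longrightarrow> d y z' \<le> dM \<kappa> (pt \<kappa> s u) P'" for n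
  proof (induction n)
    case 0
    have "d y z' \<le> dM \<kappa> (pt \<kappa> 0 u) P'" if "y \<in> S" "d p y = 0" for y
      using dist_eq_of_zero[OF pS that(1) z'(1) that(2)] z'(3) pt_0[OF ru(3)] by simp
    then show ?case by (metis mult_zero_left of_nat_0 order_antisym)
  next
    case (Suc n)
    show ?case
    proof (intro allI impI, elim conjE)
      fix s y assume s: "0 \<le> s" "s \<le> r" "s \<le> real (Suc n) * \<delta>" and y: "y \<in> S" "d p y = s" "d y z = r - s"
      define s0 where "s0 = max 0 (s - \<delta>)"
      have s0: "0 \<le> s0" "s0 \<le> s" "s0 \<le> r" "s - s0 \<le> \<delta>" "s0 \<le> real n * \<delta>"
      proof -
        have "0 < \<delta>" "0 \<le> real n * \<delta>" using e by (simp_all add: \<delta>_def)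
        moreover have "s \<le> real n * \<delta> + \<delta>" using s(3) by (simp add: distrib_right)
        ultimately show "0 \<le> s0" "s0 \<le> s" "s0 \<le> r" "s - s0 \<le> \<delta>" "s0 \<le> real n * \<delta>"
          using s(1,2) by (auto simp: s0_def max_def)
      qed
      obtain y0 where y0: "y0 \<in> S" "d p y0 = s0" "d y0 y = s - s0"
        using betw[OF pS y(1) s0(1)] s0 y(2) by auto
      have "d y0 z = r - s0"
        using tri[OF y0(1) y(1) z(1)] tri[OF pS y0(1) z(1)] y y0 z(3) rr by linarith
      then have IH: "d y0 z' \<le> dM \<kappa> (pt \<kappa> s0 u) P'" using Suc s0 y0 by blast
      have P0: "pt \<kappa> s0 u \<in> MP \<kappa>" using s0 ru radc_mono[OF ru(2)] by (intro pt_model) auto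
      have "d y z' \<le> (s - s0) + dM \<kappa> (pt \<kappa> s0 u) P'"
        using tri[OF y(1) y0(1) z'(1)] IH y0(3) sym[of y y0] by simp
      moreover have "dM \<kappa> (pt \<kappa> s0 u) P' \<le> (r - s0) + dM \<kappa> P P'"
        using dM_tri[OF P0 z(2) z'(2)] dM_ray[OF s0(1,3) ru(2,3)] ru(4) by simp
      ultimately have "small \<kappa> (d p y + d p z' + d y z')"
        using y(2) z'(3) rr s0 e(1) by (intro small_mono[OF e(2)]) (simp add: \<delta>_def)
      then show "d y z' \<le> dM \<kappa> (pt \<kappa> s u) P'"
        using m ru y s by (intro match_small[OF matched_ray m(2)]) auto
    qed
  qed
  obtain n where "r / \<delta> < real n" using reals_Archimedean2 by blast
  then have "r \<le> real n * \<delta>" using e by (simp add: \<delta>_def pos_divide_less_eq)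
  then show ?thesis using claim[of n] ru z rr by auto
qed

lemma match_unique: "matched z P \<Longrightarrow> matched z' P \<Longrightarrow> d z z' = 0"
  using match_le[of z P z' P] nonneg[of z z'] by (simp add: matched_def mult_2[symmetric] del: nonneg)

end

lemma le_by_slack:
  fixes x y E :: real
  assumes "0 < E" "\<And>e. 0 < e \<Longrightarrow> e < E \<Longrightarrow> x \<le> y + 2 * e"
  shows "x \<le> y"
proof (rule field_le_epsilon)
  fix e :: real assume "0 < e"
  then show "x \<le> y + e"
    using assms(2)[of "e / 2"] assms(2)[of "E / 2"] assms(1) by (cases "e \<le> E") auto
qed

lemma pt_inj:
  assumes "0 < r" "rad \<kappa> r" "norm u = 1" "0 \<le> t" "radc \<kappa> t" "norm v = 1" "pt \<kappa> r u = pt \<kappa> t v"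
  shows "r = t" "u = v"
proof -
  show rt: "r = t"
    using dM_org_pt[OF less_imp_le[OF assms(1)] rad_radc[OF assms(2)] assms(3)] dM_org_pt[OF assms(4-6)] assms(7) by simp
  have "sn \<kappa> r *\<^sub>R u = sn \<kappa> r *\<^sub>R v"
    using mv_pt(2)[OF _ rad_radc[OF assms(2)] assms(3)] mv_pt(2)[OF assms(4-6)] assms(1,7) rt by auto
  then show "u = v" using sn_gt_0[OF assms(1,2)] by simp
qed

lemma dM_opposite:
  assumes "0 \<le> x" "0 \<le> y" "radc \<kappa> (x + y)" "norm u = 1"
  shows "dM \<kappa> (pt \<kappa> x u) (pt \<kappa> y (- u)) = x + y"
proof (rule md_inj)
  have r: "radc \<kappa> x" "radc \<kappa> y" using radc_mono[OF assms(3)] assms by auto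
  have n: "norm (- u) = 1" using assms by simp
  note P = pt_model[OF assms(1) r(1) assms(4)] and Q = pt_model[OF assms(2) r(2) n]
  show "radc \<kappa> (dM \<kappa> (pt \<kappa> x u) (pt \<kappa> y (- u)))" by (rule md_dM(2)[OF P Q])
  show "md \<kappa> (dM \<kappa> (pt \<kappa> x u) (pt \<kappa> y (- u))) = md \<kappa> (x + y)"
    using md_dM(1)[OF P Q] mv_pt[OF assms(1) r(1) assms(4)] mv_pt[OF assms(2) r(2) n] assms(4)
    by (simp add: md_add norm_eq_1)
qed (use assms in auto)

context rigid
begin

section \<open>Isometric correspondences with the model\<close>

text \<open>By the last conjunct every point has a continuation beyond it on its ray from \<open>p\<close>. This is what makes
  the points between \<open>a\<close> and \<open>b\<close> interior, so that their comparison inequalities become equalities.\<close>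
definition good :: "('b \<times> (real \<times> ell2) set) set \<Rightarrow> bool" where
  "good R \<longleftrightarrow> R \<subseteq> XS \<times> MP \<kappa> \<and> (\<forall>q\<in>R. \<forall>q'\<in>R. d (fst q) (fst q') = dM \<kappa> (snd q) (snd q')) \<and>
    (p, org \<kappa>) \<in> R \<and> (\<forall>i\<in>I. \<forall>t. 0 < t \<and> t < \<rho> i \<longrightarrow> (bpt i t, pt \<kappa> t (\<xi> i)) \<in> R) \<and>
    (\<forall>q\<in>R. vv \<kappa> (snd q) \<in> lin I \<xi>) \<and>
    (\<forall>z r u. norm u = 1 \<and> 0 < r \<and> radc \<kappa> r \<and> (z, pt \<kappa> r u) \<in> R \<longrightarrow>
       (\<exists>r'>r. rad \<kappa> r' \<and> (\<forall>t. 0 \<le> t \<and> t < r' \<longrightarrow> (\<exists>z'. (z', pt \<kappa> t u) \<in> R))))"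

text \<open>Generic pairs: their triangle with the apex is small, so the segment between them is
  unique. For \<kappa> \<le> 0 every pair is generic.\<close>

definition gen :: "(real \<times> ell2) set \<Rightarrow> (real \<times> ell2) set \<Rightarrow> bool" where
  "gen a b \<longleftrightarrow> small \<kappa> (ab a + ab b + dM \<kappa> a b)"

text \<open>The pair and the apex do not lie on one line or great circle.\<close>

definition indep :: "(real \<times> ell2) set \<Rightarrow> (real \<times> ell2) set \<Rightarrow> bool" where
  "indep a b \<longleftrightarrow> (\<forall>\<alpha> \<beta>. \<alpha> *\<^sub>R vv \<kappa> a + \<beta> *\<^sub>R vv \<kappa> b = 0 \<longrightarrow> \<alpha> = 0 \<and> \<beta> = 0)"

lemma gen_sym: "gen a b \<longleftrightarrow> gen b a"
  by (simp add: gen_def add.commute[of "ab a" "ab b"] dM_commute[of \<kappa> a b])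

lemma good_in:
  assumes "good R" "(z, P) \<in> R"
  shows "z \<in> XS" "z \<in> S" "P \<in> MP \<kappa>"
proof -
  have "R \<subseteq> XS \<times> MP \<kappa>" using assms(1) unfolding good_def by (rule conjunct1)
  then show "z \<in> XS" "P \<in> MP \<kappa>" using assms(2) by blast+
  then show "z \<in> S" using XS by blast
qed

lemma good_iso:
  assumes "good R" "(z, P) \<in> R" "(z', P') \<in> R"
  shows "d z z' = dM \<kappa> P P'"
proof -
  have "\<forall>q\<in>R. \<forall>q'\<in>R. d (fst q) (fst q') = dM \<kappa> (snd q) (snd q')"
    using assms(1) unfolding good_def by (elim conjE)
  from bspec[OF bspec[OF this assms(2)] assms(3)] show ?thesis by simp
qed

lemma good_org: "good R \<Longrightarrow> (p, org \<kappa>) \<in> R"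
  unfolding good_def by (elim conjE)

lemma good_base: "good R \<Longrightarrow> i \<in> I \<Longrightarrow> 0 < t \<Longrightarrow> t < \<rho> i \<Longrightarrow> (bpt i t, pt \<kappa> t (\<xi> i)) \<in> R"
  unfolding good_def by (elim conjE) blast

lemma good_ext:
  assumes "good R" "(z, pt \<kappa> r u) \<in> R" "norm u = 1" "0 < r" "radc \<kappa> r"
  obtains r' where "r < r'" "rad \<kappa> r'" "\<And>t. 0 \<le> t \<Longrightarrow> t < r' \<Longrightarrow> \<exists>z'. (z', pt \<kappa> t u) \<in> R"
proof -
  have "\<forall>z r u. norm u = 1 \<and> 0 < r \<and> radc \<kappa> r \<and> (z, pt \<kappa> r u) \<in> R \<longrightarrow>
       (\<exists>r'>r. rad \<kappa> r' \<and> (\<forall>t. 0 \<le> t \<and> t < r' \<longrightarrow> (\<exists>z'. (z', pt \<kappa> t u) \<in> R)))"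
    using assms(1) unfolding good_def by (elim conjE)
  then show thesis using assms(2-5) that by blast
qed

lemma good_p: "good R \<Longrightarrow> (z, P) \<in> R \<Longrightarrow> d p z = ab P"
  by (rule good_iso[OF _ good_org])

lemma good_rad:
  assumes "good R" "(z, P) \<in> R"
  shows "rad \<kappa> (ab P)"
proof -
  obtain r u where ru: "0 \<le> r" "radc \<kappa> r" "norm u = 1" "P = pt \<kappa> r u" using model_cases[OF good_in(3)[OF assms]] .
  have abP: "ab P = r" unfolding ru(4) by (rule dM_org_pt[OF ru(1-3)])
  show ?thesis
  proof (cases "r = 0")
    case True
    then show ?thesis using abP by (simp add: rad_def)
  next
    case False
    then have r: "0 < r" using ru(1) by simp
    obtain r' where r': "r < r'" "rad \<kappa> r'"
      by (rule good_ext[OF assms(1) assms(2)[unfolded ru(4)] ru(3) r ru(2)])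
    show ?thesis unfolding abP by (rule rad_mono[OF r'(2)]) (use r' in simp)
  qed
qed

lemma good_lin: "good R \<Longrightarrow> (z, P) \<in> R \<Longrightarrow> vv \<kappa> P \<in> lin I \<xi>"
proof -
  assume R: "good R" "(z, P) \<in> R"
  have "\<forall>q\<in>R. vv \<kappa> (snd q) \<in> lin I \<xi>" using R(1) unfolding good_def by (elim conjE)
  from bspec[OF this R(2)] show ?thesis by simp
qed

lemma good_matched:
  assumes "good R" "(z, P) \<in> R"
  shows "matched z P"
proof -
  have "d z (bpt i t) = dM \<kappa> P (pt \<kappa> t (\<xi> i))" if "i \<in> I" "0 < t" "t < \<rho> i" for i t
    by (rule good_iso[OF assms good_base[OF assms(1) that]])
  then have "\<exists>t0>0. \<forall>i\<in>I. \<forall>t. 0 < t \<and> t < t0 \<and> t < \<rho> i \<longrightarrow> d z (bpt i t) = dM \<kappa> P (pt \<kappa> t (\<xi> i))"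
    by (intro exI[of _ 1]) simp
  then show ?thesis
    unfolding matched_def using good_in[OF assms] good_p[OF assms] good_rad[OF assms] good_lin[OF assms] by blast
qed

lemma good_polar:
  assumes "good R" "(z, P) \<in> R" "P \<noteq> org \<kappa>"
  obtains r u r' where "P = pt \<kappa> r u" "norm u = 1" "0 < r" "rad \<kappa> r" "r = ab P" "r < r'" "rad \<kappa> r'"
    "\<forall>t. 0 \<le> t \<longrightarrow> t < r' \<longrightarrow> (\<exists>z'. (z', pt \<kappa> t u) \<in> R)"
proof -
  obtain r u where ru: "0 \<le> r" "radc \<kappa> r" "norm u = 1" "P = pt \<kappa> r u" using model_cases[OF good_in(3)[OF assms(1,2)]] .
  have "r \<noteq> 0" using ru(4) pt_0[OF ru(3)] assms(3) by metis
  then have r: "0 < r" using ru(1) by simp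
  have rr: "r = ab P" unfolding ru(4) by (rule dM_org_pt[OF ru(1-3), symmetric])
  obtain r' where r': "r < r'" "rad \<kappa> r'" "\<And>t. 0 \<le> t \<Longrightarrow> t < r' \<Longrightarrow> \<exists>z'. (z', pt \<kappa> t u) \<in> R"
    using good_ext[OF assms(1) assms(2)[unfolded ru(4)] ru(3) r ru(2)] by blast
  have "rad \<kappa> r" using good_rad[OF assms(1,2)] rr by simp
  then show thesis using that[OF ru(4,3) r _ rr r'(1,2)] r'(3) by blast
qed

lemma gen_rad:
  assumes "a \<in> MP \<kappa>" "b \<in> MP \<kappa>" "gen a b"
  shows "rad \<kappa> (dM \<kappa> a b)"
proof -
  have "2 * dM \<kappa> a b \<le> ab a + ab b + dM \<kappa> a b"
    using dM_tri[OF assms(1) org_model assms(2)] dM_commute[of \<kappa> a "org \<kappa>"] by simp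
  then have "small \<kappa> (2 * dM \<kappa> a b)" using assms(3) unfolding gen_def by (rule small_mono[rotated])
  then show ?thesis by simp
qed

lemma gen_between:
  assumes "a \<in> MP \<kappa>" "b \<in> MP \<kappa>" "w \<in> MP \<kappa>" "gen a b" "dM \<kappa> a w + dM \<kappa> w b = dM \<kappa> a b"
  shows "gen a w" "rad \<kappa> (ab w)"
proof -
  have 1: "ab w \<le> ab b + dM \<kappa> w b" "ab w \<le> ab a + dM \<kappa> a w"
    using dM_tri[OF org_model assms(2,3)] dM_tri[OF org_model assms(1,3)] dM_commute[of \<kappa> b w] by simp_all
  show "gen a w" using assms(4) unfolding gen_def by (rule small_mono) (use 1 assms(5) in linarith)
  have "2 * ab w \<le> ab a + ab b + dM \<kappa> a b" using 1 assms(5) by linarith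
  then have "small \<kappa> (2 * ab w)" using assms(4) unfolding gen_def by (rule small_mono[rotated])
  then show "rad \<kappa> (ab w)" by simp
qed

text \<open>From below by \<open>comp_lower\<close> with third point p. From above, a is continued
  on its ray to \<open>ap\<close>, and \<open>comp\<close> is applied to the segment from p to
  \<open>zp\<close>, which contains \<open>za\<close>, seen from z: as z is not too close to
  \<open>zp\<close>, it cannot be too far from p.\<close>

lemma between_radius:
  assumes R: "good R" "(za, a) \<in> R" "(zb, b) \<in> R" and g: "gen a b" and z: "z \<in> S" and w: "w \<in> MP \<kappa>"
    and bt: "d za z = dM \<kappa> a w" "d z zb = dM \<kappa> w b" "dM \<kappa> a w + dM \<kappa> w b = dM \<kappa> a b"
  shows "d p z = ab w"
proof (cases "a = org \<kappa>")
  case True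
  then have "d p za = 0" using good_p[OF R(1,2)] org_model by simp
  then show ?thesis using dist_eq_of_zero[OF pS good_in(2)[OF R(1,2)] z] bt True by simp
next
  case False
  obtain r u r' where a: "a = pt \<kappa> r u" "norm u = 1" "0 < r" "rad \<kappa> r" "r = ab a" "r < r'" "rad \<kappa> r'"
    "\<forall>t. 0 \<le> t \<longrightarrow> t < r' \<longrightarrow> (\<exists>z'. (z', pt \<kappa> t u) \<in> R)" by (rule good_polar[OF R(1,2) False])
  obtain e where e: "0 < e" "small \<kappa> (ab a + ab b + dM \<kappa> a b + e)" using small_gap g unfolding gen_def by blast
  \<comment> \<open>Keeps \<open>ap\<close> within reach of the correspondence and lets perimeters
    grow by at most e.\<close>
  define h where "h = min (e / 2) ((r' - r) / 2)"
  have h: "0 < h" "r + h < r'" "2 * h \<le> e" using e a(6) by (auto simp: h_def min_def field_simps)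
  obtain zp where zp: "(zp, pt \<kappa> (r + h) u) \<in> R" using a(8)[rule_format, of "r + h"] a(3) h(1,2) by (meson add_pos_pos less_imp_le)
  define ap where "ap = pt \<kappa> (r + h) u"
  have rh: "rad \<kappa> (r + h)" using rad_mono[OF a(7)] h by simp
  note zaS = good_in(2)[OF R(1,2)] and zbS = good_in(2)[OF R(1,3)] and zpS = good_in(2)[OF R(1) zp]
  note aM = good_in(3)[OF R(1,2)] and bM = good_in(3)[OF R(1,3)] and apM = good_in(3)[OF R(1) zp, folded ap_def]
  have abd: "d za zb = dM \<kappa> a b" by (rule good_iso[OF R])
  have "dM \<kappa> (pt \<kappa> r u) (pt \<kappa> (r + h) u) = h" using dM_ray[of r "r + h" \<kappa> u] a(2,3) h rad_radc[OF rh] by simp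
  then have aap: "dM \<kappa> a ap = h" by (simp only: ap_def a(1))
  have zazp: "d za zp = h" using good_iso[OF R(1,2) zp] aap by (simp add: ap_def)
  have pzp: "d p zp = r + h" "ab ap = r + h"
    using good_p[OF R(1) zp] dM_org_pt[of "r + h" \<kappa> u] a(2,3) h rad_radc[OF rh] by (auto simp: ap_def)
  have pz: "d p za = r" "d p zb = ab b" using good_p[OF R(1,2)] good_p[OF R(1,3)] a(5) by simp_all
  have low: "ab w \<le> d p z"
  proof -
    have "dM \<kappa> w (org \<kappa>) \<le> d z p"
    proof (rule comp_lower[OF zaS zbS z pS aM bM w org_model abd bt])
      show "d za p = dM \<kappa> a (org \<kappa>)" "d zb p = dM \<kappa> b (org \<kappa>)"
        using good_iso[OF R(1,2) good_org[OF R(1)]] good_iso[OF R(1,3) good_org[OF R(1)]] by auto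
      show "small \<kappa> (d za zb + d zb p + d p za)"
        using g pz abd a(5) sym[of zb p] by (simp add: gen_def add_ac)
    qed
    then show ?thesis using sym[of z p] dM_commute[of \<kappa> w "org \<kappa>"] by simp
  qed
  have low': "dM \<kappa> w ap \<le> d z zp"
  proof (rule comp_lower[OF zaS zbS z zpS aM bM w apM abd bt])
    show "d za zp = dM \<kappa> a ap" "d zb zp = dM \<kappa> b ap"
      using good_iso[OF R(1,2) zp] good_iso[OF R(1,3) zp] by (auto simp: ap_def)
    have "dM \<kappa> a b \<le> ab a + ab b" using dM_tri[OF aM org_model bM] dM_commute[of \<kappa> a "org \<kappa>"] by simp
    moreover have "d zb zp \<le> dM \<kappa> a b + h" using tri[OF zbS zaS zpS] abd zazp sym[of zb za] by simp
    ultimately show "small \<kappa> (d za zb + d zb zp + d zp za)"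
      using abd zazp sym[of zp za] h by (intro small_mono[OF e(2)]) simp
  qed
  have sm: "small \<kappa> (d p zp + d zp z + d z p)"
  proof (rule small_mono[OF e(2)])
    have "d zp z \<le> h + dM \<kappa> a w" using tri[OF zpS zaS z] zazp bt sym[of zp za] by simp
    moreover have "d z p \<le> dM \<kappa> w b + ab b" using tri[OF z zbS pS] bt pz sym[of zb p] by simp
    ultimately show "d p zp + d zp z + d z p \<le> ab a + ab b + dM \<kappa> a b + e"
      using pzp h bt(3) a(5) by simp
  qed
  \<comment> \<open>Here \<open>za\<close> is the between-point and z the third vertex; the
    inequality is then solved for the distance from p to z.\<close>
  have c1: "sn \<kappa> h * md \<kappa> (d p z) + sn \<kappa> r * md \<kappa> (d zp z)
      \<le> sn \<kappa> (r + h) * md \<kappa> (d za z) + sn \<kappa> h * md \<kappa> r + sn \<kappa> r * md \<kappa> h"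
    using comp[OF pS zpS z zaS _ sm] pz pzp zazp by simp
  have c2: "sn \<kappa> (r + h) * md \<kappa> (dM \<kappa> a w) + sn \<kappa> h * md \<kappa> r + sn \<kappa> r * md \<kappa> h
      = sn \<kappa> h * md \<kappa> (ab w) + sn \<kappa> r * md \<kappa> (dM \<kappa> ap w)"
    using between_model(2)[OF org_model apM aM _ _ w] pzp aap a(5) rh by simp
  have "rad \<kappa> (d zp z)" using radc_of_small[OF pS zpS z] sm sym[of z p] by (simp add: add_ac)
  then have "md \<kappa> (dM \<kappa> ap w) \<le> md \<kappa> (d zp z)"
    using low' sym[of z zp] dM_commute[of \<kappa> w ap] by (intro md_mono) (auto simp: rad_radc)
  then have "sn \<kappa> r * md \<kappa> (dM \<kappa> ap w) \<le> sn \<kappa> r * md \<kappa> (d zp z)"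
    using sn_gt_0[OF a(3,4)] by simp
  then have "sn \<kappa> h * md \<kappa> (d p z) \<le> sn \<kappa> h * md \<kappa> (ab w)" using c1 c2 bt(1) by simp
  moreover have "0 < sn \<kappa> h" using h rad_mono[OF rh, of h] a(3) by (intro sn_gt_0) auto
  ultimately have "md \<kappa> (d p z) \<le> md \<kappa> (ab w)" by simp
  moreover have "rad \<kappa> (d p z)"
  proof -
    have "2 * d p z \<le> d p zp + d zp z + d z p" using tri[OF pS zpS z] sym[of z p] by simp
    then have "small \<kappa> (2 * d p z)" by (rule small_mono[OF sm])
    then show ?thesis by simp
  qed
  ultimately have "d p z \<le> ab w" by (intro md_le_imp_le[of \<kappa> "d p z"]) (auto simp: rad_radc)
  then show ?thesis using low by simp
qed

text \<open>With the radius known, \<open>comp_lower\<close> against base points near p supplies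
  what \<open>matchedI\<close> requires.\<close>

lemma between_matched:
  assumes R: "good R" "(za, a) \<in> R" "(zb, b) \<in> R" and g: "gen a b" and z: "z \<in> S" and w: "w \<in> MP \<kappa>"
    and bt: "d za z = dM \<kappa> a w" "d z zb = dM \<kappa> w b" "dM \<kappa> a w + dM \<kappa> w b = dM \<kappa> a b"
  shows "matched z w"
proof (cases "dM \<kappa> a b = 0")
  case True
  note zaS = good_in(2)[OF R(1,2)]
  have 0: "dM \<kappa> a w = 0" using True bt(3) dM_nonneg[of \<kappa> a w] dM_nonneg[of \<kappa> w b] by linarith
  then have aw: "a = w" "d za z = 0" using dM_zero[OF good_in(3)[OF R(1,2)] w] bt by auto
  have "matched za a" by (rule good_matched[OF R(1,2)])
  then show ?thesis unfolding matched_def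
    using aw z dist_eq_of_zero[OF zaS z] sym[of p za] sym[of p z] pS bptX XS_S by (metis (no_types, lifting))
next
  case False
  note zaS = good_in(2)[OF R(1,2)] and zbS = good_in(2)[OF R(1,3)]
  note aM = good_in(3)[OF R(1,2)] and bM = good_in(3)[OF R(1,3)]
  have abd: "d za zb = dM \<kappa> a b" by (rule good_iso[OF R])
  have rl: "rad \<kappa> (dM \<kappa> a b)" by (rule gen_rad[OF aM bM g])
  have L: "0 < sn \<kappa> (dM \<kappa> a b)" using False rl by (intro sn_gt_0) (auto simp: less_le)
  obtain e where e: "0 < e" "small \<kappa> (ab a + ab b + dM \<kappa> a b + e)" using small_gap g unfolding gen_def by blast
  have pz: "d p za = ab a" "d p zb = ab b" using good_p[OF R(1,2)] good_p[OF R(1,3)] by auto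
  show ?thesis
  proof (rule matchedI[OF z w between_radius[OF R g z w bt] gen_between(2)[OF aM bM w g bt(3)]])
    have va: "vv \<kappa> a \<in> lin I \<xi>" "vv \<kappa> b \<in> lin I \<xi>"
      using good_matched[OF R(1,2)] good_matched[OF R(1,3)] by (auto simp: matched_def)
    have "sn \<kappa> (dM \<kappa> a b) *\<^sub>R vv \<kappa> w = sn \<kappa> (dM \<kappa> w b) *\<^sub>R vv \<kappa> a + sn \<kappa> (dM \<kappa> a w) *\<^sub>R vv \<kappa> b"
      using arg_cong[OF between_model(1)[OF aM bM w bt(3) rl], of snd] by (simp add: hat_def)
    then have "sn \<kappa> (dM \<kappa> a b) *\<^sub>R vv \<kappa> w \<in> lin I \<xi>" using va by (simp add: lin_add lin_scale)
    from lin_scale[OF this, of "1 / sn \<kappa> (dM \<kappa> a b)"] show "vv \<kappa> w \<in> lin I \<xi>" using L by simp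
    show "0 < e / 2" using e by simp
    fix i t assume i: "i \<in> I" "0 < t" "t < e / 2" "t < \<rho> i"
    note b = good_base[OF R(1) i(1,2,4)]
    show "dM \<kappa> w (pt \<kappa> t (\<xi> i)) \<le> d z (bpt i t)"
    proof (rule comp_lower[OF zaS zbS z good_in(2)[OF R(1) b] aM bM w good_in(3)[OF R(1) b] abd bt])
      show "d za (bpt i t) = dM \<kappa> a (pt \<kappa> t (\<xi> i))" "d zb (bpt i t) = dM \<kappa> b (pt \<kappa> t (\<xi> i))"
        using good_iso[OF R(1,2) b] good_iso[OF R(1,3) b] by auto
      show "small \<kappa> (d za zb + d zb (bpt i t) + d (bpt i t) za)"
        using tri[OF zbS pS good_in(2)[OF R(1) b]] tri[OF good_in(2)[OF R(1) b] pS zaS] bpt_p[OF i(1,2,4)]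
          sym[of zb p] sym[of "bpt i t" p] pz abd i(3)
        by (intro small_mono[OF e(2)]) simp
    qed
  qed
qed

lemma between_unique:
  assumes R: "good R" "(za, a) \<in> R" "(zb, b) \<in> R" and g: "gen a b" and w: "w \<in> MP \<kappa>" "dM \<kappa> a w + dM \<kappa> w b = dM \<kappa> a b"
    and z: "z \<in> S" "d za z = dM \<kappa> a w" "d z zb = dM \<kappa> w b" and z': "z' \<in> S" "d za z' = dM \<kappa> a w" "d z' zb = dM \<kappa> w b"
  shows "d z z' = 0"
  by (rule match_unique[OF between_matched[OF R g z(1) w(1) z(2,3) w(2)] between_matched[OF R g z'(1) w(1) z'(2,3) w(2)]])

text \<open>All between-points in the ultrapower are matched to the same model point, hence at
  distance 0 from each other, and \<open>realize\<close> yields one in the space itself.\<close>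

lemma between_exists:
  assumes R: "good R" "(za, a) \<in> R" "(zb, b) \<in> R" and g: "gen a b" and w: "w \<in> MP \<kappa>" "dM \<kappa> a w + dM \<kappa> w b = dM \<kappa> a b"
  obtains z where "z \<in> XS" "d za z = dM \<kappa> a w" "d z zb = dM \<kappa> w b"
proof -
  have abd: "d za zb = dM \<kappa> a b" by (rule good_iso[OF R])
  have t: "dM \<kappa> w b = d za zb - dM \<kappa> a w" using w abd by simp
  have "\<exists>z\<in>XS. d za z = dM \<kappa> a w \<and> d z zb = d za zb - dM \<kappa> a w"
  proof (rule realize[OF good_in(1)[OF R(1,2)] good_in(1)[OF R(1,3)]])
    show "dM \<kappa> a w \<le> d za zb" using w(2) abd dM_nonneg[of \<kappa> w b] by linarith
    show "0 \<le> dM \<kappa> a w" by simp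
    fix z z'
    assume z: "z \<in> S" "z' \<in> S" "d za z = dM \<kappa> a w" "d z zb = d za zb - dM \<kappa> a w" "d za z' = dM \<kappa> a w" "d z' zb = d za zb - dM \<kappa> a w"
    show "d z z' = 0" by (rule between_unique[OF R g w z(1,3) _ z(2,5)]) (simp_all only: z t)
  qed
  then show thesis using that t by metis
qed

text \<open>From above by \<open>match_le\<close>, from below by \<open>comp_lower\<close>. Each
  needs a small triangle; when it is not small, a vertex is moved by e, and independence of a and b
  shows that the moved triangle is small.\<close>

lemma between_dist:
  assumes R: "good R" "(za, a) \<in> R" "(zb, b) \<in> R" and g: "gen a b" and ind: "indep a b" and z: "z \<in> S" and w: "w \<in> MP \<kappa>"
    and bt: "d za z = dM \<kappa> a w" "d z zb = dM \<kappa> w b" "dM \<kappa> a w + dM \<kappa> w b = dM \<kappa> a b" and c: "(zc, c) \<in> R"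
  shows "d z zc = dM \<kappa> w c"
proof -
  note zaS = good_in(2)[OF R(1,2)] and zbS = good_in(2)[OF R(1,3)] and zcS = good_in(2)[OF R(1) c]
  note aM = good_in(3)[OF R(1,2)] and bM = good_in(3)[OF R(1,3)] and cM = good_in(3)[OF R(1) c]
  have abd: "d za zb = dM \<kappa> a b" by (rule good_iso[OF R])
  have rl: "rad \<kappa> (dM \<kappa> a b)" by (rule gen_rad[OF aM bM g])
  have "a \<noteq> b"
  proof
    assume "a = b"
    then show False using ind[unfolded indep_def, rule_format, of 1 "-1"] by simp
  qed
  then have l: "0 < dM \<kappa> a b" using dM_zero[OF aM bM] by (simp add: less_le)
  have L: "0 < sn \<kappa> (dM \<kappa> a b)" using l rl by (rule sn_gt_0)
  have vvw: "vv \<kappa> x = (sn \<kappa> (dM \<kappa> x b) / sn \<kappa> (dM \<kappa> a b)) *\<^sub>R vv \<kappa> a + (sn \<kappa> (dM \<kappa> a x) / sn \<kappa> (dM \<kappa> a b)) *\<^sub>R vv \<kappa> b"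
    if "x \<in> MP \<kappa>" "dM \<kappa> a x + dM \<kappa> x b = dM \<kappa> a b" for x
  proof -
    have "sn \<kappa> (dM \<kappa> a b) *\<^sub>R vv \<kappa> x = sn \<kappa> (dM \<kappa> x b) *\<^sub>R vv \<kappa> a + sn \<kappa> (dM \<kappa> a x) *\<^sub>R vv \<kappa> b"
      using arg_cong[OF between_model(1)[OF aM bM that rl], of snd] by (simp add: hat_def)
    then have "(1 / sn \<kappa> (dM \<kappa> a b)) *\<^sub>R (sn \<kappa> (dM \<kappa> a b) *\<^sub>R vv \<kappa> x) = (1 / sn \<kappa> (dM \<kappa> a b)) *\<^sub>R (sn \<kappa> (dM \<kappa> x b) *\<^sub>R vv \<kappa> a + sn \<kappa> (dM \<kappa> a x) *\<^sub>R vv \<kappa> b)" by simp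
    then show ?thesis using L by (simp add: scaleR_add_right)
  qed
  have vv0: "vv \<kappa> x \<noteq> 0" if "x \<in> MP \<kappa>" "dM \<kappa> a x + dM \<kappa> x b = dM \<kappa> a b" for x
  proof
    assume "vv \<kappa> x = 0"
    then have "sn \<kappa> (dM \<kappa> x b) = 0" "sn \<kappa> (dM \<kappa> a x) = 0"
      using ind[unfolded indep_def, rule_format] vvw[OF that] L by (metis divide_eq_0_iff less_irrefl)+
    then have "sn \<kappa> (dM \<kappa> a x + dM \<kappa> x b) = 0" unfolding sn_add by simp
    then show False using L that by simp
  qed
  have radc': "rad \<kappa> (ab c)" by (rule good_rad[OF R(1) c])
  have radw: "rad \<kappa> (ab w)" by (rule gen_between(2)[OF aM bM w g bt(3)])
  have upper: "d z zc \<le> dM \<kappa> w c"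
  proof (cases "small \<kappa> (ab w + ab c + dM \<kappa> w c)")
    case True
    then show ?thesis by (rule match_le[OF between_matched[OF R g z w bt] good_matched[OF R(1) c]])
  next
    case bad: False
    show ?thesis
    proof (cases "dM \<kappa> a w = 0")
      case True
      then have "a = w" "d za z = 0" using dM_zero[OF aM w] bt by auto
      then show ?thesis using dist_eq_of_zero[OF zaS z zcS] good_iso[OF R(1,2) c] by simp
    next
      case False
      then have "0 < dM \<kappa> a w" by (simp add: less_le)
      then show ?thesis
      proof (rule le_by_slack)
        \<comment> \<open>Here w is moved towards a. If the triangle stayed large, w and the new
          point would both be opposite to c, hence on one ray from the apex, which meets the segment
          only once.\<close>
        fix e assume e: "0 < e" "e < dM \<kappa> a w"
        have "dM \<kappa> a w \<le> dM \<kappa> a b" using bt(3) dM_nonneg[of \<kappa> w b] by linarith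
        then have raw: "rad \<kappa> (dM \<kappa> a w)" by (rule rad_mono[OF rl])
        obtain w' where w': "w' \<in> MP \<kappa>" "dM \<kappa> a w' = dM \<kappa> a w - e" "dM \<kappa> w' w = e"
          using point_between[OF aM w _ _ raw, of "dM \<kappa> a w - e"] e by auto
        obtain z' where z': "z' \<in> S" "d za z' = dM \<kappa> a w - e" "d z' z = e"
          using betw[OF zaS z, of "dM \<kappa> a w - e"] e bt by auto
        have w'b: "dM \<kappa> w' b = e + dM \<kappa> w b"
          using dM_tri[OF w'(1) w bM] dM_tri[OF aM w'(1) bM] w' bt by simp
        have z'b: "d z' zb = e + dM \<kappa> w b"
          using tri[OF z'(1) z zbS] tri[OF zaS z'(1) zbS] z' bt abd by simp
        have bt': "d za z' = dM \<kappa> a w'" "d z' zb = dM \<kappa> w' b" "dM \<kappa> a w' + dM \<kappa> w' b = dM \<kappa> a b"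
          using w' z' w'b z'b bt by auto
        have "small \<kappa> (ab w' + ab c + dM \<kappa> w' c)"
        proof (rule ccontr)
          assume bad': "\<not> ?thesis"
          define nc where "nc = norm (vv \<kappa> c)"
          have opp: "nc *\<^sub>R vv \<kappa> w + norm (vv \<kappa> w) *\<^sub>R vv \<kappa> c = 0" "nc *\<^sub>R vv \<kappa> w' + norm (vv \<kappa> w') *\<^sub>R vv \<kappa> c = 0"
            unfolding nc_def by (rule not_small_opposite[OF w cM bad], rule not_small_opposite[OF w'(1) cM bad'])
          have "norm (vv \<kappa> w) *\<^sub>R vv \<kappa> c \<noteq> 0"
          proof
            assume "norm (vv \<kappa> w) *\<^sub>R vv \<kappa> c = 0"
            then have "vv \<kappa> c = 0" using vv0[OF w bt(3)] by simp
            then have "sn \<kappa> (ab c) = 0" using norm_vv[OF cM] by simp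
            then have "ab c = 0" using sn_gt_0[OF _ radc'] dM_nonneg[of \<kappa> "org \<kappa>" c] by (metis less_irrefl order_le_less)
            then have "c = org \<kappa>" using dM_zero[OF org_model cM] by simp
            then show False using bad radw \<open>ab c = 0\<close> dM_commute[of \<kappa> w "org \<kappa>"] by (simp flip: mult_2)
          qed
          then have nc: "nc \<noteq> 0" using opp(1) by auto
          have "nc *\<^sub>R (norm (vv \<kappa> w') *\<^sub>R vv \<kappa> w - norm (vv \<kappa> w) *\<^sub>R vv \<kappa> w') =
            norm (vv \<kappa> w') *\<^sub>R (nc *\<^sub>R vv \<kappa> w + norm (vv \<kappa> w) *\<^sub>R vv \<kappa> c) - norm (vv \<kappa> w) *\<^sub>R (nc *\<^sub>R vv \<kappa> w' + norm (vv \<kappa> w') *\<^sub>R vv \<kappa> c)"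
            by (simp add: algebra_simps)
          then have "norm (vv \<kappa> w') *\<^sub>R vv \<kappa> w - norm (vv \<kappa> w) *\<^sub>R vv \<kappa> w' = 0" unfolding opp using nc by simp
          then have *: "(norm (vv \<kappa> w') * (sn \<kappa> (dM \<kappa> w b) / sn \<kappa> (dM \<kappa> a b)) - norm (vv \<kappa> w) * (sn \<kappa> (dM \<kappa> w' b) / sn \<kappa> (dM \<kappa> a b))) *\<^sub>R vv \<kappa> a +
             (norm (vv \<kappa> w') * (sn \<kappa> (dM \<kappa> a w) / sn \<kappa> (dM \<kappa> a b)) - norm (vv \<kappa> w) * (sn \<kappa> (dM \<kappa> a w') / sn \<kappa> (dM \<kappa> a b))) *\<^sub>R vv \<kappa> b = 0"
          proof -
            assume 0: "norm (vv \<kappa> w') *\<^sub>R vv \<kappa> w - norm (vv \<kappa> w) *\<^sub>R vv \<kappa> w' = 0"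
            have gen_id: "n' *\<^sub>R x - n *\<^sub>R x' = 0 \<Longrightarrow> x = p1 *\<^sub>R y1 + p2 *\<^sub>R y2 \<Longrightarrow> x' = q1 *\<^sub>R y1 + q2 *\<^sub>R y2 \<Longrightarrow>
              (n' * p1 - n * q1) *\<^sub>R y1 + (n' * p2 - n * q2) *\<^sub>R y2 = 0" for n n' p1 p2 q1 q2 and x x' y1 y2 :: ell2
              by (simp add: algebra_simps)
            show ?thesis by (rule gen_id[OF 0 vvw[OF w bt(3)] vvw[OF w'(1) bt'(3)]])
          qed
          then have co: "norm (vv \<kappa> w') * sn \<kappa> (dM \<kappa> w b) = norm (vv \<kappa> w) * sn \<kappa> (dM \<kappa> w' b)"
            "norm (vv \<kappa> w') * sn \<kappa> (dM \<kappa> a w) = norm (vv \<kappa> w) * sn \<kappa> (dM \<kappa> a w')"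
          proof -
            assume *: "(norm (vv \<kappa> w') * (sn \<kappa> (dM \<kappa> w b) / sn \<kappa> (dM \<kappa> a b)) - norm (vv \<kappa> w) * (sn \<kappa> (dM \<kappa> w' b) / sn \<kappa> (dM \<kappa> a b))) *\<^sub>R vv \<kappa> a +
             (norm (vv \<kappa> w') * (sn \<kappa> (dM \<kappa> a w) / sn \<kappa> (dM \<kappa> a b)) - norm (vv \<kappa> w) * (sn \<kappa> (dM \<kappa> a w') / sn \<kappa> (dM \<kappa> a b))) *\<^sub>R vv \<kappa> b = 0"
            show "norm (vv \<kappa> w') * sn \<kappa> (dM \<kappa> w b) = norm (vv \<kappa> w) * sn \<kappa> (dM \<kappa> w' b)"
              using conjunct1[OF ind[unfolded indep_def, rule_format, OF *]] L by simp
            show "norm (vv \<kappa> w') * sn \<kappa> (dM \<kappa> a w) = norm (vv \<kappa> w) * sn \<kappa> (dM \<kappa> a w')"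
              using conjunct2[OF ind[unfolded indep_def, rule_format, OF *]] L by simp
          qed
          have nz: "norm (vv \<kappa> w) \<noteq> 0" "norm (vv \<kappa> w') \<noteq> 0" using vv0[OF w bt(3)] vv0[OF w'(1) bt'(3)] by auto
          define s s' l where "s = dM \<kappa> a w" and "s' = dM \<kappa> a w'" and "l = dM \<kappa> a b"
          have t: "dM \<kappa> w b = l - s" "dM \<kappa> w' b = l - s'" using bt(3) bt'(3) by (auto simp: s_def s'_def l_def)
          have "(norm (vv \<kappa> w) * norm (vv \<kappa> w')) * (sn \<kappa> s * sn \<kappa> (l - s') - sn \<kappa> s' * sn \<kappa> (l - s))
             = (norm (vv \<kappa> w') * sn \<kappa> s) * (norm (vv \<kappa> w) * sn \<kappa> (l - s')) - (norm (vv \<kappa> w) * sn \<kappa> s') * (norm (vv \<kappa> w') * sn \<kappa> (l - s))"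
            by (simp add: algebra_simps)
          also have "\<dots> = 0" using co t by (simp add: s_def s'_def)
          finally have "sn \<kappa> s * sn \<kappa> (l - s') - sn \<kappa> s' * sn \<kappa> (l - s) = 0" using nz by simp
          \<comment> \<open>The determinant of the coefficients of two points of the segment; it
            vanishes when they lie on one ray, and the difference of the parameters is e >
            0.\<close>
          moreover have "sn \<kappa> s * sn \<kappa> (l - s') - sn \<kappa> s' * sn \<kappa> (l - s) = sn \<kappa> l * sn \<kappa> (s - s')"
            by (simp add: sn_diff algebra_simps)
          ultimately have "sn \<kappa> e = 0" using L w'(2) by (simp add: s_def s'_def l_def)
          moreover have "0 < sn \<kappa> e" using e rad_mono[OF raw, of e] by (intro sn_gt_0) auto
          ultimately show False by simp
        qed
        then have "d z' zc \<le> dM \<kappa> w' c"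
          by (rule match_le[OF between_matched[OF R g z'(1) w'(1) bt'] good_matched[OF R(1) c]])
        moreover have "dM \<kappa> w' c \<le> e + dM \<kappa> w c" using dM_tri[OF w'(1) w cM] w' by simp
        moreover have "d z zc \<le> e + d z' zc" using tri[OF z z'(1) zcS] z'(3) sym[of z z'] by simp
        ultimately show "d z zc \<le> dM \<kappa> w c + 2 * e" by simp
      qed
    qed
  qed
  have lower_if: "dM \<kappa> w y \<le> d z zy" if y: "(zy, y) \<in> R" and sm: "small \<kappa> (dM \<kappa> a b + dM \<kappa> b y + dM \<kappa> y a)" for zy y
    using comp_lower[OF zaS zbS z good_in(2)[OF R(1) y] aM bM w good_in(3)[OF R(1) y] abd bt good_iso[OF R(1,2) y] good_iso[OF R(1,3) y]]
      sm abd good_iso[OF R(1,3) y] good_iso[OF R(1) y R(2)] by simp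
  have lower: "dM \<kappa> w c \<le> d z zc"
  proof (cases "small \<kappa> (dM \<kappa> a b + dM \<kappa> b c + dM \<kappa> c a)")
    case True
    then show ?thesis by (rule lower_if[OF c])
  next
    case bad: False
    have cne: "c \<noteq> org \<kappa>"
    proof
      assume c0: "c = org \<kappa>"
      have "dM \<kappa> a b + dM \<kappa> b c + dM \<kappa> c a = ab a + ab b + dM \<kappa> a b" unfolding c0 dM_commute[of \<kappa> b "org \<kappa>"] by simp
      then have "small \<kappa> (dM \<kappa> a b + dM \<kappa> b c + dM \<kappa> c a)" using g unfolding gen_def by (rule ssubst)
      with bad show False by contradiction
    qed
    obtain r u r' where cr: "c = pt \<kappa> r u" "norm u = 1" "0 < r" "rad \<kappa> r" "r < r'" "\<forall>t. 0 \<le> t \<longrightarrow> t < r' \<longrightarrow> (\<exists>z'. (z', pt \<kappa> t u) \<in> R)"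
      by (rule good_polar[OF R(1) c cne])
    show ?thesis
    proof (rule le_by_slack[OF cr(3)])
      fix e assume e: "0 < e" "e < r"
      obtain zy where zy: "(zy, pt \<kappa> (r - e) u) \<in> R" using cr(6)[rule_format, of "r - e"] cr(5) e by auto
      define y where "y = pt \<kappa> (r - e) u"
      note y = zy[folded y_def]
      note yM = good_in(3)[OF R(1) y]
      have yc: "dM \<kappa> y c = e" using dM_ray[of "r - e" r \<kappa> u] cr e rad_radc[OF cr(4)] by (simp add: y_def)
      have aby: "ab y = r - e" "ab c = r"
        using dM_org_pt[of "r - e" \<kappa> u] dM_org_pt[of r \<kappa> u] cr e rad_radc[OF rad_mono[OF cr(4), of "r - e"]] rad_radc[OF cr(4)] by (auto simp: y_def)
      \<comment> \<open>Here c is moved towards the apex. If the triangle stayed large, both c and y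
        would be combinations of a and b, and so would the apex, contrary to independence.\<close>
      have "small \<kappa> (dM \<kappa> a b + dM \<kappa> b y + dM \<kappa> y a)"
      proof (rule ccontr)
        assume bad': "\<not> ?thesis"
        obtain \<alpha> \<beta> where h1: "hat \<kappa> c = \<alpha> *\<^sub>R hat \<kappa> a + \<beta> *\<^sub>R hat \<kappa> b" using not_small_coplanar[OF aM bM cM l rl bad] .
        obtain \<alpha>' \<beta>' where h2: "hat \<kappa> y = \<alpha>' *\<^sub>R hat \<kappa> a + \<beta>' *\<^sub>R hat \<kappa> b" using not_small_coplanar[OF aM bM yM l rl bad'] .
        have "sn \<kappa> r *\<^sub>R hat \<kappa> y = sn \<kappa> e *\<^sub>R hat \<kappa> (org \<kappa>) + sn \<kappa> (r - e) *\<^sub>R hat \<kappa> c"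
          using between_model(1)[OF org_model cM yM] aby yc cr(4) by simp
        then have "sn \<kappa> e *\<^sub>R hat \<kappa> (org \<kappa>) = (sn \<kappa> r * \<alpha>' - sn \<kappa> (r - e) * \<alpha>) *\<^sub>R hat \<kappa> a + (sn \<kappa> r * \<beta>' - sn \<kappa> (r - e) * \<beta>) *\<^sub>R hat \<kappa> b"
          unfolding h1 h2 by (simp add: algebra_simps)
        then obtain x1 x2 where x: "sn \<kappa> e *\<^sub>R hat \<kappa> (org \<kappa>) = x1 *\<^sub>R hat \<kappa> a + x2 *\<^sub>R hat \<kappa> b" by blast
        have "x1 *\<^sub>R vv \<kappa> a + x2 *\<^sub>R vv \<kappa> b = 0" using arg_cong[OF x, of snd] by (simp add: hat_def)
        then have "x1 = 0" "x2 = 0" using ind[unfolded indep_def] by blast+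
        then have "sn \<kappa> e = 0" using arg_cong[OF x, of fst] by (simp add: hat_def)
        moreover have "0 < sn \<kappa> e" using e rad_mono[OF cr(4), of e] by (intro sn_gt_0) auto
        ultimately show False by simp
      qed
      then have "dM \<kappa> w y \<le> d z zy" by (rule lower_if[OF y])
      moreover have "dM \<kappa> w c \<le> dM \<kappa> w y + e" using dM_tri[OF w yM cM] yc by simp
      moreover have "d z zy \<le> d z zc + e" using tri[OF z zcS good_in(2)[OF R(1) y]] good_iso[OF R(1) c y] yc dM_commute[of \<kappa> c y] by simp
      ultimately show "dM \<kappa> w c \<le> d z zc + 2 * e" by simp
    qed
  qed
  show ?thesis using upper lower by simp
qed

lemma good_polar_ext:
  assumes R: "good R" "(z, P) \<in> R" "P \<noteq> org \<kappa>" and "0 < \<eta>"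
  obtains u h where "P = pt \<kappa> (ab P) u" "norm u = 1" "0 < ab P" "0 < h" "h < \<eta>" "rad \<kappa> (ab P + h)"
    "\<forall>t. 0 \<le> t \<longrightarrow> t \<le> ab P + h \<longrightarrow> (\<exists>z'. (z', pt \<kappa> t u) \<in> R)"
proof -
  obtain r u r' where a: "P = pt \<kappa> r u" "norm u = 1" "0 < r" "rad \<kappa> r" "r = ab P" "r < r'" "rad \<kappa> r'"
    "\<forall>t. 0 \<le> t \<longrightarrow> t < r' \<longrightarrow> (\<exists>z'. (z', pt \<kappa> t u) \<in> R)" by (rule good_polar[OF R])
  define h where "h = min (\<eta> / 2) ((r' - r) / 2)"
  have h: "0 < h" "h < \<eta>" "r + h < r'" using a(6) assms(4) by (auto simp: h_def min_def field_simps)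
  show thesis
  proof (rule that)
    show "P = pt \<kappa> (ab P) u" using a(1) unfolding a(5)[symmetric] .
    show "norm u = 1" "0 < h" "h < \<eta>" by (fact a(2) h(1) h(2))+
    show "0 < ab P" using a(3,5) by simp
    show "rad \<kappa> (ab P + h)" unfolding a(5)[symmetric] by (rule rad_mono[OF a(7)]) (use h in simp)
    show "\<forall>t. 0 \<le> t \<longrightarrow> t \<le> ab P + h \<longrightarrow> (\<exists>z'. (z', pt \<kappa> t u) \<in> R)"
      unfolding a(5)[symmetric] using a(8) h(3) by (meson le_less_trans)
  qed
qed

lemma indep_scale:
  assumes "indep a b" "vv \<kappa> a' = x *\<^sub>R vv \<kappa> a" "vv \<kappa> b' = y *\<^sub>R vv \<kappa> b" "x \<noteq> 0" "y \<noteq> 0"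
  shows "indep a' b'"
  unfolding indep_def
proof (intro allI impI)
  fix \<alpha> \<beta> assume "\<alpha> *\<^sub>R vv \<kappa> a' + \<beta> *\<^sub>R vv \<kappa> b' = 0"
  then have "(\<alpha> * x) *\<^sub>R vv \<kappa> a + (\<beta> * y) *\<^sub>R vv \<kappa> b = 0" using assms(2,3) by simp
  then have "\<alpha> * x = 0 \<and> \<beta> * y = 0" using assms(1) unfolding indep_def by blast
  then show "\<alpha> = 0 \<and> \<beta> = 0" using assms(4,5) by simp
qed

lemma indep_ne_org: "indep a b \<Longrightarrow> a \<noteq> org \<kappa>" "indep a b \<Longrightarrow> b \<noteq> org \<kappa>"
proof -
  assume i: "indep a b"
  show "a \<noteq> org \<kappa>"
  proof
    assume "a = org \<kappa>"
    then show False using i[unfolded indep_def, rule_format, of 1 0] by simp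
  qed
  show "b \<noteq> org \<kappa>"
  proof
    assume "b = org \<kappa>"
    then show False using i[unfolded indep_def, rule_format, of 0 1] by simp
  qed
qed

lemma step_point:
  assumes R: "good R" "(za, a) \<in> R" "(zb, b) \<in> R" and g: "gen a b" and ind: "indep a b" and w: "w \<in> MP \<kappa>" "dM \<kappa> a w + dM \<kappa> w b = dM \<kappa> a b"
  shows "\<exists>z\<in>XS. matched z w \<and> (\<forall>zc c. (zc, c) \<in> R \<longrightarrow> d z zc = dM \<kappa> w c)"
proof -
  obtain z where z: "z \<in> XS" "d za z = dM \<kappa> a w" "d z zb = dM \<kappa> w b" by (rule between_exists[OF R g w])
  show ?thesis
    using between_matched[OF R g XS_S[OF z(1)] w(1) z(2,3) w(2)] between_dist[OF R g ind XS_S[OF z(1)] w(1) z(2,3) w(2)] z(1) by blast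
qed

lemma hat_ray:
  assumes "0 < r" "rad \<kappa> r" "norm u = 1" "0 \<le> t" "t \<le> r"
  shows "hat \<kappa> (pt \<kappa> t u) = (sn \<kappa> t / sn \<kappa> r) *\<^sub>R hat \<kappa> (pt \<kappa> r u) + (sn \<kappa> (r - t) / sn \<kappa> r) *\<^sub>R hat \<kappa> (org \<kappa>)"
proof -
  have rt: "radc \<kappa> t" "radc \<kappa> r" using assms(2) rad_mono[OF assms(2,5)] rad_radc by blast+
  have P: "pt \<kappa> t u \<in> MP \<kappa>" "pt \<kappa> r u \<in> MP \<kappa>" using pt_model assms rt by simp_all
  have A: "ab (pt \<kappa> t u) = t" "ab (pt \<kappa> r u) = r" "dM \<kappa> (pt \<kappa> t u) (pt \<kappa> r u) = r - t"
    using dM_org_pt dM_ray assms rt by simp_all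
  have "sn \<kappa> r *\<^sub>R hat \<kappa> (pt \<kappa> t u) = sn \<kappa> (r - t) *\<^sub>R hat \<kappa> (org \<kappa>) + sn \<kappa> t *\<^sub>R hat \<kappa> (pt \<kappa> r u)"
    using between_model(1)[OF org_model P(2,1)] A assms(2) by simp
  then have "(1 / sn \<kappa> r) *\<^sub>R (sn \<kappa> r *\<^sub>R hat \<kappa> (pt \<kappa> t u)) = (1 / sn \<kappa> r) *\<^sub>R (sn \<kappa> (r - t) *\<^sub>R hat \<kappa> (org \<kappa>) + sn \<kappa> t *\<^sub>R hat \<kappa> (pt \<kappa> r u))" by simp
  then show ?thesis using sn_gt_0[OF assms(1,2)] by (simp add: scaleR_add_right add.commute)
qed

definition maxgood :: "('b \<times> (real \<times> ell2) set) set \<Rightarrow> bool" where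
  "maxgood R \<longleftrightarrow> good R \<and> (\<forall>R'. good R' \<longrightarrow> R \<subseteq> R' \<longrightarrow> R' = R)"

text \<open>Among the new points distances are bounded above by \<open>match_le\<close> and below by
  the triangle inequality through p, as all lie on one ray. Adding an open interval of radii keeps
  every new point continuable.\<close>

lemma good_add_ray:
  assumes R: "good R" and u: "norm u = 1" and r: "0 < r" "rad \<kappa> r"
  defines "N \<equiv> {(z, pt \<kappa> t u) | z t. 0 < t \<and> t < r \<and> z \<in> XS \<and> matched z (pt \<kappa> t u) \<and> (\<forall>zc c. (zc, c) \<in> R \<longrightarrow> d z zc = dM \<kappa> (pt \<kappa> t u) c)}"
  assumes ex: "\<And>t. 0 < t \<Longrightarrow> t < r \<Longrightarrow> \<exists>z\<in>XS. matched z (pt \<kappa> t u) \<and> (\<forall>zc c. (zc, c) \<in> R \<longrightarrow> d z zc = dM \<kappa> (pt \<kappa> t u) c)"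
  shows "good (R \<union> N)"
  unfolding good_def
proof (intro conjI)
  have N: "z \<in> XS" "z \<in> S" "matched z P" "P \<in> MP \<kappa>" "(zc, c) \<in> R \<Longrightarrow> d z zc = dM \<kappa> P c" "\<exists>t. P = pt \<kappa> t u \<and> 0 < t \<and> t < r \<and> radc \<kappa> t"
    if "(z, P) \<in> N" for z P zc c
    using that rad_mono[OF r(2)] by (auto simp: N_def matched_def rad_radc)
  have NN: "d z z' = dM \<kappa> P P'" if z: "(z, P) \<in> N" and z': "(z', P') \<in> N" for z P z' P'
  proof -
    have main: "d z z' = dM \<kappa> P P'" if z: "(z, P) \<in> N" and z': "(z', P') \<in> N" and t: "P = pt \<kappa> t u" "P' = pt \<kappa> t' u" "0 < t" "t \<le> t'" "t' < r" for z P z' P' t t'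
    proof -
      have rt: "rad \<kappa> t'" "radc \<kappa> t'" "radc \<kappa> t" using rad_mono[OF r(2), of t'] rad_mono[OF r(2), of t] t by (auto simp: rad_radc)
      have D: "dM \<kappa> P P' = t' - t" unfolding t(1,2) by (rule dM_ray) (use t rt u in auto)
      have A: "ab P = t" "ab P' = t'" unfolding t(1,2) by (rule dM_org_pt; use t rt u in simp)+
      have "small \<kappa> (ab P + ab P' + dM \<kappa> P P')" using rt(1) by (simp add: A D flip: mult_2)
      then have "d z z' \<le> t' - t" using match_le[OF N(3)[OF z] N(3)[OF z']] D by simp
      moreover have "d p z = t" "d p z' = t'" using N(3)[OF z] N(3)[OF z'] A by (auto simp: matched_def)
      then have "t' - t \<le> d z z'" using tri[OF pS N(2)[OF z] N(2)[OF z']] by simp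
      ultimately show ?thesis using D by simp
    qed
    obtain t where t: "P = pt \<kappa> t u" "0 < t" "t < r" using N(6)[OF z] by blast
    obtain t' where t': "P' = pt \<kappa> t' u" "0 < t'" "t' < r" using N(6)[OF z'] by blast
    show ?thesis
    proof (cases "t \<le> t'")
      case True
      then show ?thesis using main[OF z z' t(1) t'(1)] t t' by simp
    next
      case False
      then have "d z' z = dM \<kappa> P' P" using main[OF z' z t'(1) t(1)] t t' by simp
      then show ?thesis using sym[of z z'] dM_commute[of \<kappa> P P'] by simp
    qed
  qed
  show "R \<union> N \<subseteq> XS \<times> MP \<kappa>" using good_in[OF R] N by auto
  show "\<forall>q\<in>R \<union> N. \<forall>q'\<in>R \<union> N. d (fst q) (fst q') = dM \<kappa> (snd q) (snd q')"
  proof (intro ballI)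
    fix q q' assume q: "q \<in> R \<union> N" "q' \<in> R \<union> N"
    obtain z P z' P' where e: "q = (z, P)" "q' = (z', P')" by fastforce
    consider "(z, P) \<in> R" "(z', P') \<in> R" | "(z, P) \<in> N" "(z', P') \<in> R" | "(z, P) \<in> R" "(z', P') \<in> N" | "(z, P) \<in> N" "(z', P') \<in> N"
      using q e by blast
    then have "d z z' = dM \<kappa> P P'"
    proof cases
      case 1 then show ?thesis by (rule good_iso[OF R])
    next
      case 2 then show ?thesis by (rule N(5))
    next
      case 3
      then have "d z' z = dM \<kappa> P' P" by (intro N(5))
      then show ?thesis using sym[of z z'] dM_commute[of \<kappa> P P'] by simp
    next
      case 4 then show ?thesis by (rule NN)
    qed
    then show "d (fst q) (fst q') = dM \<kappa> (snd q) (snd q')" by (simp add: e)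
  qed
  show "(p, org \<kappa>) \<in> R \<union> N" using good_org[OF R] by blast
  show "\<forall>i\<in>I. \<forall>t. 0 < t \<and> t < \<rho> i \<longrightarrow> (bpt i t, pt \<kappa> t (\<xi> i)) \<in> R \<union> N" using good_base[OF R] by blast
  show "\<forall>q\<in>R \<union> N. vv \<kappa> (snd q) \<in> lin I \<xi>"
  proof
    fix q assume "q \<in> R \<union> N"
    then show "vv \<kappa> (snd q) \<in> lin I \<xi>"
      using good_lin[OF R, of "fst q" "snd q"] N(3)[of "fst q" "snd q"] by (auto simp: matched_def)
  qed
  show "\<forall>z s v. norm v = 1 \<and> 0 < s \<and> radc \<kappa> s \<and> (z, pt \<kappa> s v) \<in> R \<union> N \<longrightarrow>
       (\<exists>r'>s. rad \<kappa> r' \<and> (\<forall>t. 0 \<le> t \<and> t < r' \<longrightarrow> (\<exists>z'. (z', pt \<kappa> t v) \<in> R \<union> N)))"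
  proof (intro allI impI, elim conjE)
    fix z s v assume v: "norm v = 1" "0 < s" "radc \<kappa> s" and z: "(z, pt \<kappa> s v) \<in> R \<union> N"
    show "\<exists>r'>s. rad \<kappa> r' \<and> (\<forall>t. 0 \<le> t \<and> t < r' \<longrightarrow> (\<exists>z'. (z', pt \<kappa> t v) \<in> R \<union> N))"
    proof (cases "(z, pt \<kappa> s v) \<in> R")
      case True
      obtain r' where "s < r'" "rad \<kappa> r'" "\<And>t. 0 \<le> t \<Longrightarrow> t < r' \<Longrightarrow> \<exists>z'. (z', pt \<kappa> t v) \<in> R"
        using good_ext[OF R True v] by blast
      then show ?thesis by blast
    next
      case False
      then have zN: "(z, pt \<kappa> s v) \<in> N" using z by blast
      then obtain t where t: "pt \<kappa> s v = pt \<kappa> t u" "0 < t" "t < r" using N(6) by blast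
      have "t = s" "u = v" by (rule pt_inj[OF t(2) rad_mono[OF r(2)] u less_imp_le[OF v(2)] v(3,1) t(1)[symmetric]]; use t in simp)+
      then have sv: "s < r" "v = u" using t by auto
      have "\<exists>z'. (z', pt \<kappa> t v) \<in> R \<union> N" if t: "0 \<le> t" "t < r" for t
      proof (cases "t = 0")
        case True
        then show ?thesis using pt_0[OF v(1)] good_org[OF R] by auto
      next
        case False
        then have t': "0 < t" "t < r" using t by auto
        obtain z' where z': "z' \<in> XS" "matched z' (pt \<kappa> t u)" "\<And>zc c. (zc, c) \<in> R \<Longrightarrow> d z' zc = dM \<kappa> (pt \<kappa> t u) c"
          using ex[OF t'] by blast
        have "(z', pt \<kappa> t u) \<in> N" unfolding N_def using z' t' by blast
        then show ?thesis unfolding sv(2) by blast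
      qed
      then show ?thesis using sv(1) r(2) by blast
    qed
  qed
qed

text \<open>A little beyond \<open>w\<close> on its ray lies a point \<open>wp\<close> between points beyond \<open>a\<close> and \<open>b\<close>; the whole ray up to \<open>wp\<close>
  can be added to the correspondence.\<close>
lemma max_indep:
  assumes max: "maxgood R" and Rab: "(za, a) \<in> R" "(zb, b) \<in> R" and g: "gen a b" and ind: "indep a b"
    and w: "w \<in> MP \<kappa>" "dM \<kappa> a w + dM \<kappa> w b = dM \<kappa> a b"
  shows "\<exists>z. (z, w) \<in> R"
proof (cases "w = a \<or> w = b")
  case True
  then show ?thesis using Rab by blast
next
  case False
  have R: "good R" using max by (simp add: maxgood_def)
  note aM = good_in(3)[OF R Rab(1)] and bM = good_in(3)[OF R Rab(2)]
  obtain e where e: "0 < e" "small \<kappa> (ab a + ab b + dM \<kappa> a b + e)" using small_gap g unfolding gen_def by blast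
  \<comment> \<open>Continuing a and b by less than e / 4 each enlarges the perimeter by less than
    e, so the new pair is still generic.\<close>
  then have e4: "0 < e / 4" by simp
  obtain ua ha where A: "a = pt \<kappa> (ab a) ua" "norm ua = 1" "0 < ab a" "0 < ha" "ha < e / 4" "rad \<kappa> (ab a + ha)"
    "\<forall>t. 0 \<le> t \<longrightarrow> t \<le> ab a + ha \<longrightarrow> (\<exists>z'. (z', pt \<kappa> t ua) \<in> R)"
    by (rule good_polar_ext[OF R Rab(1) indep_ne_org(1)[OF ind] e4])
  obtain ub hb where B: "b = pt \<kappa> (ab b) ub" "norm ub = 1" "0 < ab b" "0 < hb" "hb < e / 4" "rad \<kappa> (ab b + hb)"
    "\<forall>t. 0 \<le> t \<longrightarrow> t \<le> ab b + hb \<longrightarrow> (\<exists>z'. (z', pt \<kappa> t ub) \<in> R)"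
    by (rule good_polar_ext[OF R Rab(2) indep_ne_org(2)[OF ind] e4])
  define ra rb where "ra = ab a" and "rb = ab b"
  note A = A[folded ra_def] and B = B[folded rb_def]
  define ap bp where "ap = pt \<kappa> (ra + ha) ua" and "bp = pt \<kappa> (rb + hb) ub"
  obtain zap where zap: "(zap, ap) \<in> R" using A(7)[rule_format, of "ra + ha"] A(3,4) by (auto simp: ap_def)
  obtain zbp where zbp: "(zbp, bp) \<in> R" using B(7)[rule_format, of "rb + hb"] B(3,4) by (auto simp: bp_def)
  note apM = good_in(3)[OF R zap] and bpM = good_in(3)[OF R zbp]
  have abp: "ab ap = ra + ha" "ab bp = rb + hb"
    using dM_org_pt[of "ra + ha" \<kappa> ua] dM_org_pt[of "rb + hb" \<kappa> ub] A(2-4,6) B(2-4,6) by (auto simp: ap_def bp_def rad_radc)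
  have aap: "dM \<kappa> a ap = ha" "dM \<kappa> b bp = hb"
    using dM_ray[of ra "ra + ha" \<kappa> ua] dM_ray[of rb "rb + hb" \<kappa> ub] A(2-4,6) B(2-4,6) A(1)[symmetric] B(1)[symmetric]
    by (auto simp: ap_def bp_def rad_radc)
  have dapbp: "dM \<kappa> ap bp \<le> dM \<kappa> a b + ha + hb"
    using dM_tri[OF apM aM bpM] dM_tri[OF aM bM bpM] aap dM_commute[of \<kappa> ap a] by simp
  have gp: "gen ap bp"
    unfolding gen_def abp by (rule small_mono[OF e(2)]) (use dapbp A(5) B(5) in \<open>simp add: ra_def[symmetric] rb_def[symmetric]\<close>)
  have sa: "0 < sn \<kappa> ra" "0 < sn \<kappa> (ra + ha)" using A(3,4) A(6) rad_mono[OF A(6), of ra] by (auto intro!: sn_gt_0)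
  have sb: "0 < sn \<kappa> rb" "0 < sn \<kappa> (rb + hb)" using B(3,4) B(6) rad_mono[OF B(6), of rb] by (auto intro!: sn_gt_0)
  have sha: "0 < sn \<kappa> ha" using A(3,4) rad_mono[OF A(6), of ha] by (intro sn_gt_0) auto
  have shb: "0 < sn \<kappa> hb" using B(3,4) rad_mono[OF B(6), of hb] by (intro sn_gt_0) auto
  define \<alpha>1 \<gamma>1 where "\<alpha>1 = sn \<kappa> ra / sn \<kappa> (ra + ha)" and "\<gamma>1 = sn \<kappa> ha / sn \<kappa> (ra + ha)"
  define \<beta>1 \<gamma>2 where "\<beta>1 = sn \<kappa> rb / sn \<kappa> (rb + hb)" and "\<gamma>2 = sn \<kappa> hb / sn \<kappa> (rb + hb)"
  have pos1: "0 < \<alpha>1" "0 < \<gamma>1" "0 < \<beta>1" "0 < \<gamma>2" using sa sb sha shb by (auto simp: \<alpha>1_def \<gamma>1_def \<beta>1_def \<gamma>2_def)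
  have ha1: "hat \<kappa> a = \<alpha>1 *\<^sub>R hat \<kappa> ap + \<gamma>1 *\<^sub>R hat \<kappa> (org \<kappa>)"
    using hat_ray[of "ra + ha" ua ra] A(2-4,6) A(1)[symmetric] by (simp add: ap_def \<alpha>1_def \<gamma>1_def)
  have hb1: "hat \<kappa> b = \<beta>1 *\<^sub>R hat \<kappa> bp + \<gamma>2 *\<^sub>R hat \<kappa> (org \<kappa>)"
    using hat_ray[of "rb + hb" ub rb] B(2-4,6) B(1)[symmetric] by (simp add: bp_def \<beta>1_def \<gamma>2_def)
  have va: "vv \<kappa> a = \<alpha>1 *\<^sub>R vv \<kappa> ap" using arg_cong[OF ha1, of snd] by (simp add: hat_def)
  have vb: "vv \<kappa> b = \<beta>1 *\<^sub>R vv \<kappa> bp" using arg_cong[OF hb1, of snd] by (simp add: hat_def)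
  have indp: "indep ap bp"
    by (rule indep_scale[OF ind, of _ "1 / \<alpha>1" _ "1 / \<beta>1"]) (use va vb pos1 in auto)
  have rl: "rad \<kappa> (dM \<kappa> a b)" by (rule gen_rad[OF aM bM g])
  have wa: "0 < dM \<kappa> a w" "0 < dM \<kappa> w b" using False dM_zero[OF aM w(1)] dM_zero[OF w(1) bM] by (auto simp: less_le)
  have l: "dM \<kappa> a w \<le> dM \<kappa> a b" "dM \<kappa> w b \<le> dM \<kappa> a b" "0 < dM \<kappa> a b" using wa w(2) by linarith+
  define \<alpha> \<beta> where "\<alpha> = sn \<kappa> (dM \<kappa> w b) / sn \<kappa> (dM \<kappa> a b)" and "\<beta> = sn \<kappa> (dM \<kappa> a w) / sn \<kappa> (dM \<kappa> a b)"
  have sl: "0 < sn \<kappa> (dM \<kappa> a b)" by (rule sn_gt_0[OF l(3) rl])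
  have pos2: "0 < \<alpha>" "0 < \<beta>"
    using sn_gt_0[OF wa(1) rad_mono[OF rl l(1)]] sn_gt_0[OF wa(2) rad_mono[OF rl l(2)]] sl by (auto simp: \<alpha>_def \<beta>_def)
  have hw: "hat \<kappa> w = \<alpha> *\<^sub>R hat \<kappa> a + \<beta> *\<^sub>R hat \<kappa> b"
  proof -
    have "(1 / sn \<kappa> (dM \<kappa> a b)) *\<^sub>R (sn \<kappa> (dM \<kappa> a b) *\<^sub>R hat \<kappa> w) = (1 / sn \<kappa> (dM \<kappa> a b)) *\<^sub>R (sn \<kappa> (dM \<kappa> w b) *\<^sub>R hat \<kappa> a + sn \<kappa> (dM \<kappa> a w) *\<^sub>R hat \<kappa> b)"
      unfolding between_model(1)[OF aM bM w rl] ..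
    then show ?thesis using sl by (simp add: scaleR_add_right \<alpha>_def \<beta>_def)
  qed
  define \<gamma> where "\<gamma> = \<alpha> * \<gamma>1 + \<beta> * \<gamma>2"
  have pos3: "0 < \<alpha> * \<alpha>1" "0 < \<beta> * \<beta>1" "0 < \<gamma>" using pos1 pos2 by (auto simp: \<gamma>_def intro!: add_pos_pos)
  \<comment> \<open>The coefficient \<gamma> of the apex is positive: w lies strictly on the apex
    side of the segment from \<open>ap\<close> to \<open>bp\<close>.\<close>
  have hw': "hat \<kappa> w = ((\<alpha> * \<alpha>1) *\<^sub>R hat \<kappa> ap + (\<beta> * \<beta>1) *\<^sub>R hat \<kappa> bp) + \<gamma> *\<^sub>R hat \<kappa> (org \<kappa>)"
    unfolding hw ha1 hb1 by (simp add: \<gamma>_def algebra_simps)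
  have rlp: "rad \<kappa> (dM \<kappa> ap bp)" by (rule gen_rad[OF apM bpM gp])
  \<comment> \<open>The projection of w from the apex onto the segment from \<open>ap\<close> to
    \<open>bp\<close>; it lies on the ray of w, beyond w.\<close>
  obtain wp \<theta> where wp: "wp \<in> MP \<kappa>" "0 < \<theta>" "dM \<kappa> ap wp + dM \<kappa> wp bp = dM \<kappa> ap bp"
    "hat \<kappa> wp = \<theta> *\<^sub>R ((\<alpha> * \<alpha>1) *\<^sub>R hat \<kappa> ap + (\<beta> * \<beta>1) *\<^sub>R hat \<kappa> bp)"
    using hat_combination[OF apM bpM rlp, of "\<alpha> * \<alpha>1" "\<beta> * \<beta>1"] pos3 by (metis add_pos_pos less_imp_le)
  have hw'': "hat \<kappa> w = \<gamma> *\<^sub>R hat \<kappa> (org \<kappa>) + (1 / \<theta>) *\<^sub>R hat \<kappa> wp"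
    unfolding hw' wp(4) using wp(2) by simp
  have rwp: "rad \<kappa> (ab wp)" by (rule gen_between(2)[OF apM bpM wp(1) gp wp(3)])
  have bw: "ab w + dM \<kappa> w wp = ab wp"
    by (rule hat_between[OF org_model wp(1) w(1) rwp _ _ hw'']) (use pos3 wp(2) in auto)
  have vw0: "vv \<kappa> w \<noteq> 0"
  proof
    assume "vv \<kappa> w = 0"
    then have "\<alpha> *\<^sub>R vv \<kappa> a + \<beta> *\<^sub>R vv \<kappa> b = 0" using arg_cong[OF hw, of snd] by (simp add: hat_def)
    then show False using ind pos2 unfolding indep_def by (metis less_irrefl)
  qed
  have wne: "w \<noteq> wp"
  proof
    assume eq: "w = wp"
    have "vv \<kappa> w = (1 / \<theta>) *\<^sub>R vv \<kappa> w" using arg_cong[OF hw'', of snd] by (simp add: hat_def eq)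
    then have "(1 - 1 / \<theta>) *\<^sub>R vv \<kappa> w = 0" by (simp add: scaleR_left_diff_distrib)
    then have "1 / \<theta> = 1" using vw0 by simp
    then have "\<gamma> *\<^sub>R hat \<kappa> (org \<kappa>) = 0" using hw'' by (simp add: eq)
    then show False using pos3 by (simp add: hat_def zero_prod_def)
  qed
  then have dw: "0 < dM \<kappa> w wp" using dM_zero[OF w(1) wp(1)] by (simp add: less_le)
  have abw: "0 < ab w"
  proof (rule ccontr)
    assume "\<not> ?thesis"
    then have "ab w = 0" by (simp add: less_le)
    then have "w = org \<kappa>" using dM_zero[OF org_model w(1)] by simp
    then show False using vw0 by simp
  qed
  obtain rp u where rp: "0 \<le> rp" "radc \<kappa> rp" "norm u = 1" "wp = pt \<kappa> rp u" using model_cases[OF wp(1)] .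
  have rpw: "rp = ab wp" unfolding rp(4) by (rule dM_org_pt[OF rp(1-3), symmetric])
  have rp': "ab w < rp" "0 < rp" "rad \<kappa> rp" using bw dw abw rwp rpw by auto
  have wpt: "w = pt \<kappa> (ab w) u"
  proof (rule ray_between[OF rp(1) rp'(3) rp(3) w(1)])
    show "ab w + dM \<kappa> w (pt \<kappa> rp u) = rp" unfolding rp(4)[symmetric] using bw rpw by simp
  qed
  have ex: "\<exists>z\<in>XS. matched z (pt \<kappa> t u) \<and> (\<forall>zc c. (zc, c) \<in> R \<longrightarrow> d z zc = dM \<kappa> (pt \<kappa> t u) c)" if t: "0 < t" "t < rp" for t
  proof -
    define y where "y = pt \<kappa> t u"
    have rt: "radc \<kappa> t" using rad_radc[OF rad_mono[OF rp'(3)]] t by simp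
    have yM: "y \<in> MP \<kappa>" unfolding y_def by (rule pt_model) (use t rt rp in auto)
    define c1 c2 where "c1 = sn \<kappa> t / sn \<kappa> rp" and "c2 = sn \<kappa> (rp - t) / sn \<kappa> rp"
    have c: "0 < c1" "0 < c2"
      using t rp' rad_mono[OF rp'(3), of t] rad_mono[OF rp'(3), of "rp - t"] by (auto simp: c1_def c2_def intro!: divide_pos_pos sn_gt_0)
    have hy: "hat \<kappa> y = c1 *\<^sub>R hat \<kappa> wp + c2 *\<^sub>R hat \<kappa> (org \<kappa>)"
      unfolding y_def rp(4) c1_def c2_def by (rule hat_ray[OF rp'(2,3) rp(3)]) (use t in auto)
    have hy': "hat \<kappa> y = (c1 * \<theta> * (\<alpha> * \<alpha>1)) *\<^sub>R hat \<kappa> ap + ((c1 * \<theta> * (\<beta> * \<beta>1)) *\<^sub>R hat \<kappa> bp + c2 *\<^sub>R hat \<kappa> (org \<kappa>))"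
      unfolding hy wp(4) by (simp add: scaleR_add_right mult.assoc)
    define B where "B = c1 * \<theta> * (\<beta> * \<beta>1)"
    have Bp: "0 < B" "0 < c1 * \<theta> * (\<alpha> * \<alpha>1)" using c wp(2) pos3 by (auto simp: B_def)
    have rbp: "rad \<kappa> (dM \<kappa> bp (org \<kappa>))" using good_rad[OF R zbp] dM_commute[of \<kappa> bp "org \<kappa>"] by simp
    \<comment> \<open>The point y is in the triangle of the apex, \<open>ap\<close> and
      \<open>bp\<close>. Grouping the last two terms finds q on the segment from the apex to
      \<open>bp\<close>, where the correspondence is already defined, with y between
      \<open>ap\<close> and q.\<close>
    obtain q \<theta>' where q: "q \<in> MP \<kappa>" "0 < \<theta>'" "dM \<kappa> bp q + dM \<kappa> q (org \<kappa>) = dM \<kappa> bp (org \<kappa>)"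
      "hat \<kappa> q = \<theta>' *\<^sub>R (B *\<^sub>R hat \<kappa> bp + c2 *\<^sub>R hat \<kappa> (org \<kappa>))"
      using hat_combination[OF bpM org_model rbp, of B c2] Bp c by (metis add_pos_pos less_imp_le)
    have bq: "ab q + dM \<kappa> q bp = rb + hb" using q(3) abp dM_commute[of \<kappa> bp q] dM_commute[of \<kappa> q "org \<kappa>"] dM_commute[of \<kappa> bp "org \<kappa>"] by simp
    have qle: "ab q \<le> rb + hb" using bq dM_nonneg[of \<kappa> q bp] by linarith
    have "q = pt \<kappa> (ab q) ub"
      by (rule ray_between[OF _ B(6,2) q(1)]) (use bq B(3,4) in \<open>simp_all add: bp_def[symmetric]\<close>)
    then obtain zq where zq: "(zq, q) \<in> R" using B(7)[rule_format, of "ab q"] qle by auto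
    have gq: "gen ap q"
      unfolding gen_def by (rule small_mono[OF gp[unfolded gen_def]]) (use dM_tri[OF apM bpM q(1)] bq abp dM_commute[of \<kappa> q bp] in simp)
    have vq: "vv \<kappa> q = (\<theta>' * B) *\<^sub>R vv \<kappa> bp" using arg_cong[OF q(4), of snd] by (simp add: hat_def)
    have indq: "indep ap q"
      by (rule indep_scale[OF indp, of _ 1 _ "\<theta>' * B"]) (use vq q(2) Bp in auto)
    have hyq: "hat \<kappa> y = (c1 * \<theta> * (\<alpha> * \<alpha>1)) *\<^sub>R hat \<kappa> ap + (1 / \<theta>') *\<^sub>R hat \<kappa> q"
      unfolding hy' q(4) B_def[symmetric] using q(2) by simp
    have "dM \<kappa> ap y + dM \<kappa> y q = dM \<kappa> ap q"
      by (rule hat_between[OF apM q(1) yM gen_rad[OF apM q(1) gq] _ _ hyq]) (use Bp q(2) in auto)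
    then show ?thesis using step_point[OF R zap zq gq indq yM] by (simp add: y_def)
  qed
  define N where "N = {(z, pt \<kappa> t u) | z t. 0 < t \<and> t < rp \<and> z \<in> XS \<and> matched z (pt \<kappa> t u) \<and> (\<forall>zc c. (zc, c) \<in> R \<longrightarrow> d z zc = dM \<kappa> (pt \<kappa> t u) c)}"
  have "good (R \<union> N)" unfolding N_def by (rule good_add_ray[OF R rp(3) rp'(2,3) ex])
  then have RN: "R \<union> N = R" using max by (simp add: maxgood_def)
  obtain z where z: "z \<in> XS" "matched z (pt \<kappa> (ab w) u)" "\<forall>zc c. (zc, c) \<in> R \<longrightarrow> d z zc = dM \<kappa> (pt \<kappa> (ab w) u) c"
    using ex[OF abw rp'(1)] by blast
  have "(z, pt \<kappa> (ab w) u) \<in> N" unfolding N_def using z abw rp'(1) by blast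
  then have "(z, w) \<in> N" by (subst wpt)
  then have "(z, w) \<in> R \<union> N" by (rule UnI2)
  then have "(z, w) \<in> R" by (subst (asm) RN)
  then show ?thesis by (rule exI)
qed

text \<open>The pair lies on one ray from the apex or on two opposite ones, and the segment runs
  inside these rays, where the correspondence is already defined. Maximality does not enter.\<close>

lemma good_dep:
  assumes R: "good R" and Rab: "(za, a) \<in> R" "(zb, b) \<in> R" and g: "gen a b" and dep: "\<not> indep a b"
    and w: "w \<in> MP \<kappa>" "dM \<kappa> a w + dM \<kappa> w b = dM \<kappa> a b"
  shows "\<exists>z. (z, w) \<in> R"
proof -
  note aM = good_in(3)[OF R Rab(1)] and bM = good_in(3)[OF R Rab(2)]
  have from_org: "\<exists>z. (z, w) \<in> R" if y: "(zy, y) \<in> R" and bt: "ab w + dM \<kappa> w y = ab y" for zy y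
  proof (cases "y = org \<kappa>")
    case True
    then have "ab w = 0" using bt org_model dM_nonneg[of \<kappa> w y] dM_nonneg[of \<kappa> "org \<kappa>" w] by (simp del: dM_nonneg)
    then have "w = org \<kappa>" using dM_zero[OF org_model w(1)] by simp
    then show ?thesis using good_org[OF R] by blast
  next
    case False
    obtain u h where A: "y = pt \<kappa> (ab y) u" "norm u = 1" "0 < ab y" "0 < h" "h < 1" "rad \<kappa> (ab y + h)"
      "\<forall>t. 0 \<le> t \<longrightarrow> t \<le> ab y + h \<longrightarrow> (\<exists>z'. (z', pt \<kappa> t u) \<in> R)"
      by (rule good_polar_ext[OF R y False, of 1]) auto
    have "w = pt \<kappa> (ab w) u"
      by (rule ray_between[OF _ good_rad[OF R y] A(2) w(1)]) (use bt in \<open>simp_all add: A(1)[symmetric]\<close>)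
    moreover have "ab w \<le> ab y + h" using bt A(4) dM_nonneg[of \<kappa> w y] by linarith
    moreover obtain z' where "(z', pt \<kappa> (ab w) u) \<in> R" using calculation(2) A(7) dM_nonneg by blast
    ultimately show ?thesis by metis
  qed
  have on_ray: "\<exists>z. (z, w) \<in> R" if y: "(zy, pt \<kappa> r u) \<in> R" and wt: "w = pt \<kappa> t u" and t: "0 \<le> t" "t \<le> r" "norm u = 1" "radc \<kappa> r" for zy r t u
  proof (rule from_org[OF y])
    show "ab w + dM \<kappa> w (pt \<kappa> r u) = ab (pt \<kappa> r u)"
      unfolding wt using dM_org_pt[OF t(1) radc_mono[OF t(4,2)] t(3)] dM_org_pt[of r \<kappa> u] dM_ray[OF t(1,2,4,3)] t by simp
  qed
  have rl: "rad \<kappa> (dM \<kappa> a b)" by (rule gen_rad[OF aM bM g])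
  show ?thesis
  proof (cases "a = org \<kappa> \<or> b = org \<kappa>")
    case True
    then show ?thesis
    proof
      assume "a = org \<kappa>"
      then show ?thesis using from_org[OF Rab(2)] w(2) by blast
    next
      assume b: "b = org \<kappa>"
      have "ab w + dM \<kappa> w a = ab a"
        using w(2)[unfolded b] dM_commute[of \<kappa> w "org \<kappa>"] dM_commute[of \<kappa> a w] dM_commute[of \<kappa> a "org \<kappa>"] by linarith
      then show ?thesis by (rule from_org[OF Rab(1)])
    qed
  next
    case False
    obtain ua ha where A: "a = pt \<kappa> (ab a) ua" "norm ua = 1" "0 < ab a" "0 < ha" "ha < 1" "rad \<kappa> (ab a + ha)"
      "\<forall>t. 0 \<le> t \<longrightarrow> t \<le> ab a + ha \<longrightarrow> (\<exists>z'. (z', pt \<kappa> t ua) \<in> R)"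
      by (rule good_polar_ext[OF R Rab(1), of 1]) (use False in auto)
    obtain ub hb where B: "b = pt \<kappa> (ab b) ub" "norm ub = 1" "0 < ab b" "0 < hb" "hb < 1" "rad \<kappa> (ab b + hb)"
      "\<forall>t. 0 \<le> t \<longrightarrow> t \<le> ab b + hb \<longrightarrow> (\<exists>z'. (z', pt \<kappa> t ub) \<in> R)"
      by (rule good_polar_ext[OF R Rab(2), of 1]) (use False in auto)
    define ra rb where "ra = ab a" and "rb = ab b"
    note A = A[folded ra_def] and B = B[folded rb_def]
    have rra: "rad \<kappa> ra" "radc \<kappa> ra" "rad \<kappa> rb" "radc \<kappa> rb"
      using good_rad[OF R Rab(1)] good_rad[OF R Rab(2)] rad_radc by (auto simp: ra_def rb_def)
    have sab: "0 < sn \<kappa> ra" "0 < sn \<kappa> rb" using A(3) B(3) rra by (auto intro: sn_gt_0)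
    have vab: "vv \<kappa> a = sn \<kappa> ra *\<^sub>R ua" "vv \<kappa> b = sn \<kappa> rb *\<^sub>R ub"
      using mv_pt(2)[OF less_imp_le[OF A(3)] rra(2) A(2)] mv_pt(2)[OF less_imp_le[OF B(3)] rra(4) B(2)] A(1)[symmetric] B(1)[symmetric] by simp_all
    obtain \<alpha> \<beta> where ab0: "\<alpha> *\<^sub>R vv \<kappa> a + \<beta> *\<^sub>R vv \<kappa> b = 0" "\<alpha> \<noteq> 0 \<or> \<beta> \<noteq> 0" using dep unfolding indep_def by blast
    define x y where "x = \<alpha> * sn \<kappa> ra" and "y = \<beta> * sn \<kappa> rb"
    have xy: "x *\<^sub>R ua = - (y *\<^sub>R ub)" using ab0(1) by (simp add: vab x_def y_def eq_neg_iff_add_eq_0)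
    have "\<bar>x\<bar> = \<bar>y\<bar>" using arg_cong[OF xy, of norm] A(2) B(2) by simp
    moreover have "x \<noteq> 0 \<or> y \<noteq> 0" using ab0(2) sab by (auto simp: x_def y_def)
    ultimately have "x \<noteq> 0" "x = y \<or> x = - y" by auto
    then have nz: "y \<noteq> 0" and xy': "x = y \<or> x = - y" by auto
    have "y *\<^sub>R (- ua) = y *\<^sub>R ub \<or> y *\<^sub>R ua = y *\<^sub>R ub" using xy xy' by auto
    then have uab: "ub = ua \<or> ub = - ua" using nz unfolding scaleR_cancel_left by blast
    define s t where "s = dM \<kappa> a w" and "t = dM \<kappa> w b"
    have st: "0 \<le> s" "0 \<le> t" "s + t = dM \<kappa> a b" using w(2) by (auto simp: s_def t_def)
    have uniq: "w = w'" if "w' \<in> MP \<kappa>" "dM \<kappa> a w' = s" "dM \<kappa> w' b = t" for w'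
      by (rule segment_unique[OF aM bM w(1) that(1) w(2) _ _ rl]) (use that in \<open>auto simp: s_def t_def\<close>)
    note Ra = Rab(1)[unfolded A(1)] and Rb = Rab(2)[unfolded B(1)]
    show ?thesis
    proof (cases "ub = ua")
      case True
      show ?thesis
      proof (cases "ra \<le> rb")
        case le: True
        have D: "s + t = rb - ra"
          unfolding st(3) using dM_ray[OF less_imp_le[OF A(3)] le rra(4) A(2)] A(1)[symmetric] B(1)[symmetric] True by simp
        have rs: "0 \<le> ra + s" "ra + s \<le> rb" using A(3) st D by linarith+
        have "w = pt \<kappa> (ra + s) ua"
        proof (rule uniq)
          show "pt \<kappa> (ra + s) ua \<in> MP \<kappa>" by (rule pt_model[OF rs(1) radc_mono[OF rra(4) rs(2)] A(2)])
          show "dM \<kappa> a (pt \<kappa> (ra + s) ua) = s"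
            using dM_ray[of ra "ra + s" \<kappa> ua] A(1)[symmetric] A(2,3) st(1) radc_mono[OF rra(4) rs(2)] by simp
          show "dM \<kappa> (pt \<kappa> (ra + s) ua) b = t"
            using dM_ray[OF rs rra(4) A(2)] B(1)[symmetric] True D by simp
        qed
        then show ?thesis using on_ray[OF Rab(2)[unfolded B(1)], of "ra + s"] True rs A(2) rra by simp
      next
        case False
        then have le: "rb \<le> ra" by simp
        have D: "s + t = ra - rb"
          unfolding st(3) using dM_ray[OF less_imp_le[OF B(3)] le rra(2) B(2)] A(1)[symmetric] B(1)[symmetric] True dM_commute[of \<kappa> a b] by simp
        have rs: "0 \<le> rb + t" "rb + t \<le> ra" using B(3) st D by linarith+
        have "w = pt \<kappa> (rb + t) ua"
        proof (rule uniq)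
          show "pt \<kappa> (rb + t) ua \<in> MP \<kappa>" by (rule pt_model[OF rs(1) radc_mono[OF rra(2) rs(2)] A(2)])
          show "dM \<kappa> (pt \<kappa> (rb + t) ua) b = t"
            using dM_ray[of rb "rb + t" \<kappa> ua] B(1)[symmetric] B(2,3) st(2) radc_mono[OF rra(2) rs(2)] True dM_commute[of \<kappa> b] by simp
          show "dM \<kappa> a (pt \<kappa> (rb + t) ua) = s"
            using dM_ray[OF rs rra(2) A(2)] A(1)[symmetric] D dM_commute[of \<kappa> a] by simp
        qed
        then show ?thesis using on_ray[OF Rab(1)[unfolded A(1)], of "rb + t"] rs A(2) rra by simp
      qed
    next
      case False
      then have ubm: "ub = - ua" using uab by simp
      \<comment> \<open>Otherwise the shortest connection passes the antipode of the apex and the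
        perimeter is exactly 2 pi / sqrt \<kappa>, contrary to genericity.\<close>
      have rsum: "radc \<kappa> (ra + rb)"
      proof (rule ccontr)
        assume n: "\<not> radc \<kappa> (ra + rb)"
        then have k: "\<kappa> > 0" "pi / sqrt \<kappa> < ra + rb" by (auto simp: radc_def)
        have vi: "vv \<kappa> a \<bullet> vv \<kappa> b = - (sn \<kappa> ra * sn \<kappa> rb)" using A(2) by (simp add: vab ubm norm_eq_1)
        have "md \<kappa> (dM \<kappa> a b) = md \<kappa> (ra + rb)"
          using md_dM(1)[OF aM bM] vi md_org[OF aM] md_org[OF bM] by (simp add: md_add ra_def rb_def)
        then have "md \<kappa> (dM \<kappa> a b) = md \<kappa> (2 * pi / sqrt \<kappa> - (ra + rb))" using md_reflect[OF k(1)] by simp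
        then have "dM \<kappa> a b = 2 * pi / sqrt \<kappa> - (ra + rb)"
          by (rule md_inj) (use k rra md_dM(2)[OF aM bM] in \<open>auto simp: radc_def\<close>)
        then show False using g k by (simp add: gen_def small_def ra_def rb_def)
      qed
      have D: "s + t = ra + rb"
        unfolding st(3) using dM_opposite[OF less_imp_le[OF A(3)] less_imp_le[OF B(3)] rsum A(2)] A(1)[symmetric] B(1)[symmetric] ubm by simp
      show ?thesis
      proof (cases "s \<le> ra")
        case True
        have rs: "0 \<le> ra - s" "ra - s \<le> ra" using True st by auto
        have "w = pt \<kappa> (ra - s) ua"
        proof (rule uniq)
          show "pt \<kappa> (ra - s) ua \<in> MP \<kappa>" by (rule pt_model[OF rs(1) radc_mono[OF rra(2) rs(2)] A(2)])
          show "dM \<kappa> a (pt \<kappa> (ra - s) ua) = s"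
            using dM_ray[OF rs rra(2) A(2)] A(1)[symmetric] dM_commute[of \<kappa> a] by simp
          show "dM \<kappa> (pt \<kappa> (ra - s) ua) b = t"
            using dM_opposite[OF rs(1) less_imp_le[OF B(3)] radc_mono[OF rsum] A(2)] B(1)[symmetric] ubm D st by simp
        qed
        then show ?thesis using on_ray[OF Rab(1)[unfolded A(1)], of "ra - s"] rs A(2) rra by simp
      next
        case False
        have rs: "0 \<le> s - ra" "s - ra \<le> rb" using False st D by auto
        have "w = pt \<kappa> (s - ra) ub"
        proof (rule uniq)
          show "pt \<kappa> (s - ra) ub \<in> MP \<kappa>" by (rule pt_model[OF rs(1) radc_mono[OF rra(4) rs(2)] B(2)])
          show "dM \<kappa> (pt \<kappa> (s - ra) ub) b = t"
            using dM_ray[OF rs rra(4) B(2)] B(1)[symmetric] D by simp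
          show "dM \<kappa> a (pt \<kappa> (s - ra) ub) = s"
            using dM_opposite[OF less_imp_le[OF A(3)] rs(1) radc_mono[OF rsum] A(2)] A(1)[symmetric] ubm rs by simp
        qed
        then show ?thesis using on_ray[OF Rab(2)[unfolded B(1)], of "s - ra"] rs B(2) rra by simp
      qed
    qed
  qed
qed

lemma max_convex:
  assumes "maxgood R" "(za, a) \<in> R" "(zb, b) \<in> R" "gen a b" "w \<in> MP \<kappa>" "dM \<kappa> a w + dM \<kappa> w b = dM \<kappa> a b"
  shows "\<exists>z. (z, w) \<in> R"
proof (cases "indep a b")
  case True
  then show ?thesis using max_indep assms by blast
next
  case False
  have "good R" using assms(1) by (simp add: maxgood_def)
  then show ?thesis using good_dep[OF _ assms(2-4) False assms(5,6)] by blast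
qed

lemma good_Union:
  assumes C: "C \<noteq> {}" "subset.chain (Collect good) C"
  shows "good (\<Union>C)"
proof -
  have g: "good R" if "R \<in> C" for R using C that by (auto simp: subset.chain_def)
  obtain R0 where R0: "R0 \<in> C" using C by blast
  have two: "\<exists>R\<in>C. q \<in> R \<and> q' \<in> R" if qq: "q \<in> \<Union>C" "q' \<in> \<Union>C" for q q'
  proof -
    obtain R R' where RR: "R \<in> C" "q \<in> R" "R' \<in> C" "q' \<in> R'" using qq by blast
    have "R \<subseteq> R' \<or> R' \<subseteq> R" using C(2) RR(1,3) unfolding subset.chain_def by blast
    then show ?thesis using RR by blast
  qed
  show ?thesis
    unfolding good_def
  proof (intro conjI ballI allI impI)
    have "R \<subseteq> XS \<times> MP \<kappa>" if "R \<in> C" for R using g[OF that] unfolding good_def by (elim conjE)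
    then show "\<Union>C \<subseteq> XS \<times> MP \<kappa>" by blast
    fix q q' assume "q \<in> \<Union>C" "q' \<in> \<Union>C"
    then obtain R where R: "R \<in> C" "q \<in> R" "q' \<in> R" using two by blast
    then show "d (fst q) (fst q') = dM \<kappa> (snd q) (snd q')"
      using good_iso[OF g[OF R(1)], of "fst q" "snd q" "fst q'" "snd q'"] by simp
  next
    show "(p, org \<kappa>) \<in> \<Union>C" using good_org[OF g[OF R0]] R0 by blast
  next
    fix i t assume "i \<in> I" "0 < t \<and> t < \<rho> i"
    then show "(bpt i t, pt \<kappa> t (\<xi> i)) \<in> \<Union>C" using good_base[OF g[OF R0]] R0 by blast
  next
    fix q assume "q \<in> \<Union>C"
    then obtain R where R: "R \<in> C" "q \<in> R" by blast
    then show "vv \<kappa> (snd q) \<in> lin I \<xi>" using good_lin[OF g[OF R(1)], of "fst q" "snd q"] by simp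
  next
    fix z r u assume a: "norm u = 1 \<and> 0 < r \<and> radc \<kappa> r \<and> (z, pt \<kappa> r u) \<in> \<Union>C"
    then obtain R where R: "R \<in> C" "(z, pt \<kappa> r u) \<in> R" by blast
    obtain r' where "r < r'" "rad \<kappa> r'" "\<And>t. 0 \<le> t \<Longrightarrow> t < r' \<Longrightarrow> \<exists>z'. (z', pt \<kappa> t u) \<in> R"
      using good_ext[OF g[OF R(1)] R(2)] a by blast
    then show "\<exists>r'>r. rad \<kappa> r' \<and> (\<forall>t. 0 \<le> t \<and> t < r' \<longrightarrow> (\<exists>z'. (z', pt \<kappa> t u) \<in> \<Union>C))"
      using R(1) by blast
  qed
qed

text \<open>The outer end points of the base segments are left out because nothing is known beyond
  them; they are recovered by closure.\<close>

definition R0 :: "('b \<times> (real \<times> ell2) set) set" where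
  "R0 = insert (p, org \<kappa>) {(bpt i t, pt \<kappa> t (\<xi> i)) | i t. i \<in> I \<and> 0 < t \<and> t < \<rho> i}"

lemma good_R0: "good R0"
  unfolding good_def
proof (intro conjI ballI allI impI)
  have el: "P = org \<kappa> \<and> z = p \<or> (\<exists>i t. z = bpt i t \<and> P = pt \<kappa> t (\<xi> i) \<and> i \<in> I \<and> 0 < t \<and> t < \<rho> i)" if "(z, P) \<in> R0" for z P
    using that by (auto simp: R0_def)
  show "R0 \<subseteq> XS \<times> MP \<kappa>" using bptX pX pt_xi org_model by (auto simp: R0_def)
  fix q q' assume q: "q \<in> R0" "q' \<in> R0"
  obtain z P z' P' where e: "q = (z, P)" "q' = (z', P')" by fastforce
  have "d z z' = dM \<kappa> P P'"
    using el[OF q(1)[unfolded e(1)]] el[OF q(2)[unfolded e(2)]]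
  proof (elim disjE exE conjE)
    assume "P = org \<kappa>" "z = p" "P' = org \<kappa>" "z' = p"
    then show ?thesis using org_model by simp
  next
    fix i t assume h: "P = org \<kappa>" "z = p" "z' = bpt i t" "P' = pt \<kappa> t (\<xi> i)" "i \<in> I" "0 < t" "t < \<rho> i"
    show ?thesis unfolding h(1-4) bpt_p[OF h(5-7)] ab_xi[OF h(5-7)] ..
  next
    fix i t assume h: "z = bpt i t" "P = pt \<kappa> t (\<xi> i)" "i \<in> I" "0 < t" "t < \<rho> i" "P' = org \<kappa>" "z' = p"
    show ?thesis unfolding h(1,2,6,7) sym[of _ p] dM_commute[of \<kappa> _ "org \<kappa>"] bpt_p[OF h(3-5)] ab_xi[OF h(3-5)] ..
  next
    fix i t j s assume h: "z = bpt i t" "P = pt \<kappa> t (\<xi> i)" "i \<in> I" "0 < t" "t < \<rho> i" "z' = bpt j s" "P' = pt \<kappa> s (\<xi> j)" "j \<in> I" "0 < s" "s < \<rho> j"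
    show ?thesis unfolding h(1,2,6,7) by (rule bpt_iso[OF h(3,8,4,5,9,10)])
  qed
  then show "d (fst q) (fst q') = dM \<kappa> (snd q) (snd q')" by (simp add: e)
next
  show "(p, org \<kappa>) \<in> R0" by (simp add: R0_def)
next
  fix i t assume "i \<in> I" "0 < t \<and> t < \<rho> i"
  then show "(bpt i t, pt \<kappa> t (\<xi> i)) \<in> R0" by (auto simp: R0_def)
next
  fix q assume "q \<in> R0"
  then show "vv \<kappa> (snd q) \<in> lin I \<xi>"
    using lin_0 mv_xi(2) by (auto simp: R0_def intro!: lin_scale lin_base finI)
next
  fix z r u assume a: "norm u = 1 \<and> 0 < r \<and> radc \<kappa> r \<and> (z, pt \<kappa> r u) \<in> R0"
  have "pt \<kappa> r u \<noteq> org \<kappa>"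
  proof
    assume "pt \<kappa> r u = org \<kappa>"
    then have "dM \<kappa> (org \<kappa>) (pt \<kappa> r u) = 0" using org_model by simp
    then show False using dM_org_pt[of r \<kappa> u] a by simp
  qed
  then obtain i t where it: "pt \<kappa> r u = pt \<kappa> t (\<xi> i)" "i \<in> I" "0 < t" "t < \<rho> i" using a by (auto simp: R0_def)
  have "t = r" "\<xi> i = u"
    using pt_inj[OF it(3) rad_mono[OF rho(2)[OF it(2)]] unit[OF it(2)] _ _ _ it(1)[symmetric]] it a by simp_all
  then have rr: "r < \<rho> i" "u = \<xi> i" using it by auto
  have "\<exists>z'. (z', pt \<kappa> t u) \<in> R0" if "0 \<le> t" "t < \<rho> i" for t
  proof (cases "t = 0")
    case True
    then have "(p, pt \<kappa> t u) \<in> R0" using pt_0[OF unit[OF it(2)]] rr(2) by (simp add: R0_def)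
    then show ?thesis ..
  next
    case False
    then have "0 < t \<and> t < \<rho> i" using that by simp
    then have "(bpt i t, pt \<kappa> t u) \<in> R0" unfolding R0_def rr(2) using it(2) by blast
    then show ?thesis ..
  qed
  then show "\<exists>r'>r. rad \<kappa> r' \<and> (\<forall>t. 0 \<le> t \<and> t < r' \<longrightarrow> (\<exists>z'. (z', pt \<kappa> t u) \<in> R0))"
    using rho(2)[OF it(2)] rr(1) by blast
qed

lemma maxgood_exists: "\<exists>R. maxgood R"
proof -
  have "\<exists>M\<in>Collect good. \<forall>R\<in>Collect good. M \<subseteq> R \<longrightarrow> R = M"
  proof (rule subset_Zorn_nonempty)
    show "Collect good \<noteq> {}" using good_R0 by blast
    show "\<Union>C \<in> Collect good" if "C \<noteq> {}" "subset.chain (Collect good) C" for C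
      using good_Union[OF that] by simp
  qed
  then show ?thesis unfolding maxgood_def by blast
qed

end

section \<open>Geodesics, convex hulls and completion of isometries\<close>

lemma in_closure_of_metric:
  "x \<in> mtopology_of X closure_of S \<longleftrightarrow> x \<in> mspace X \<and> (\<forall>e>0. \<exists>y\<in>S. y \<in> mspace X \<and> mdist X x y < e)"
proof -
  interpret Metric_space "mspace X" "mdist X" by simp
  show ?thesis unfolding mtopology_of_def metric_closure_of by auto
qed

text \<open>Geodesics parametrized by arc length, which spares the length of curves in the
  sequel.\<close>

definition iso_path :: "'a metric \<Rightarrow> 'a \<Rightarrow> 'a \<Rightarrow> (real \<Rightarrow> 'a) \<Rightarrow> bool" where
  "iso_path X a b z \<longleftrightarrow> z 0 = a \<and> z (mdist X a b) = b \<and>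
     (\<forall>s\<in>{0..mdist X a b}. z s \<in> mspace X \<and> (\<forall>t\<in>{0..mdist X a b}. mdist X (z s) (z t) = \<bar>s - t\<bar>))"

text \<open>One segment is enough: antipodal points have many, and \<open>closed_conv_subset\<close>
  uses the condition only for pairs whose segment is unique.\<close>

definition weakly_convex :: "'a metric \<Rightarrow> 'a set \<Rightarrow> bool" where
  "weakly_convex X L \<longleftrightarrow> (\<forall>a\<in>L. \<forall>b\<in>L. \<exists>z. iso_path X a b z \<and> z ` {0..mdist X a b} \<subseteq> L)"

lemma curve_length_ge:
  assumes "s \<le> t"
  shows "ereal (mdist X (\<gamma> s) (\<gamma> t)) \<le> curve_length X \<gamma> s t"
  unfolding curve_length_def
  by (rule SUP_upper2[of "[s, t]"]) (use assms in auto)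

lemma sum_telescope_sorted:
  fixes ts :: "real list"
  assumes "sorted ts" "set ts \<subseteq> {s..t}" "s \<le> t"
  shows "(\<Sum>i<length ts - 1. \<bar>ts ! i - ts ! Suc i\<bar>) \<le> t - s"
proof (cases "ts = []")
  case True
  then show ?thesis using assms by simp
next
  case False
  have "(\<Sum>i<length ts - 1. \<bar>ts ! i - ts ! Suc i\<bar>) = (\<Sum>i<length ts - 1. ts ! Suc i - ts ! i)"
  proof (rule sum.cong)
    fix i assume "i \<in> {..<length ts - 1}"
    then have "ts ! i \<le> ts ! Suc i" using sorted_nth_mono[OF assms(1), of i "Suc i"] by simp
    then show "\<bar>ts ! i - ts ! Suc i\<bar> = ts ! Suc i - ts ! i" by simp
  qed simp
  also have "\<dots> = ts ! (length ts - 1) - ts ! 0" by (rule sum_lessThan_telescope)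
  also have "\<dots> \<le> t - s"
  proof -
    have "ts ! (length ts - 1) \<in> set ts" "ts ! 0 \<in> set ts" using False by simp_all
    then have "ts ! (length ts - 1) \<le> t" "s \<le> ts ! 0" using assms(2) by auto
    then show ?thesis by simp
  qed
  finally show ?thesis .
qed

lemma iso_path_segment:
  assumes z: "iso_path X a b z"
  shows "geodesic_segment X a b (z ` {0..mdist X a b})"
proof -
  define l where "l = mdist X a b"
  have l0: "0 \<le> l" by (simp add: l_def)
  define \<gamma> where "\<gamma> = (\<lambda>u. z (l * u))"
  have zz: "z 0 = a" "z l = b" "\<And>s. 0 \<le> s \<Longrightarrow> s \<le> l \<Longrightarrow> z s \<in> mspace X"
    "\<And>s t. 0 \<le> s \<Longrightarrow> s \<le> l \<Longrightarrow> 0 \<le> t \<Longrightarrow> t \<le> l \<Longrightarrow> mdist X (z s) (z t) = \<bar>s - t\<bar>"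
    using z unfolding iso_path_def l_def by auto
  have lu: "0 \<le> l * u" "l * u \<le> l" if "0 \<le> u" "u \<le> 1" for u
    using that l0 mult_left_mono[of u 1 l] by auto
  have g: "\<gamma> u \<in> mspace X" if "0 \<le> u" "u \<le> 1" for u using zz(3) lu[OF that] by (simp add: \<gamma>_def)
  have gd: "mdist X (\<gamma> u) (\<gamma> v) = l * \<bar>u - v\<bar>" if "0 \<le> u" "u \<le> 1" "0 \<le> v" "v \<le> 1" for u v
  proof -
    have "mdist X (\<gamma> u) (\<gamma> v) = \<bar>l * u - l * v\<bar>" unfolding \<gamma>_def by (rule zz(4)) (use lu that in auto)
    also have "\<dots> = l * \<bar>u - v\<bar>" using l0 by (simp add: abs_mult flip: right_diff_distrib)
    finally show ?thesis .
  qed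
  have len: "curve_length X \<gamma> s t = ereal (l * (t - s))" if st: "0 \<le> s" "s \<le> t" "t \<le> 1" for s t
  proof (rule antisym)
    show "curve_length X \<gamma> s t \<le> ereal (l * (t - s))"
      unfolding curve_length_def
    proof (rule SUP_least)
      fix ts assume "ts \<in> {ts. sorted ts \<and> set ts \<subseteq> {s..t}}"
      then have ts: "sorted ts" "set ts \<subseteq> {s..t}" by auto
      have "(\<Sum>i<length ts - 1. mdist X (\<gamma> (ts ! i)) (\<gamma> (ts ! Suc i))) = (\<Sum>i<length ts - 1. l * \<bar>ts ! i - ts ! Suc i\<bar>)"
      proof (rule sum.cong)
        fix i assume "i \<in> {..<length ts - 1}"
        then have "ts ! i \<in> set ts" "ts ! Suc i \<in> set ts" by auto
        then have "ts ! i \<in> {s..t}" "ts ! Suc i \<in> {s..t}" using ts(2) by blast+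
        then show "mdist X (\<gamma> (ts ! i)) (\<gamma> (ts ! Suc i)) = l * \<bar>ts ! i - ts ! Suc i\<bar>" using st by (intro gd) auto
      qed simp
      also have "\<dots> \<le> l * (t - s)"
        unfolding sum_distrib_left[symmetric] by (rule mult_left_mono[OF sum_telescope_sorted[OF ts st(2)] l0])
      finally show "ereal (\<Sum>i<length ts - 1. mdist X (\<gamma> (ts ! i)) (\<gamma> (ts ! Suc i))) \<le> ereal (l * (t - s))" by simp
    qed
    have "mdist X (\<gamma> s) (\<gamma> t) = l * (t - s)" using gd[of s t] st by simp
    then show "ereal (l * (t - s)) \<le> curve_length X \<gamma> s t" using curve_length_ge[OF st(2), of X \<gamma>] by simp
  qed
  have "Lipschitz_continuous_map (submetric euclidean_metric {0..1}) X \<gamma>"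
    unfolding Lipschitz_continuous_map_def
  proof (intro conjI exI[of _ l] ballI)
    show "\<gamma> \<in> mspace (submetric euclidean_metric {0..1}) \<rightarrow> mspace X" using g by auto
  qed (use gd in \<open>auto simp: dist_real_def\<close>)
  then have "continuous_map (mtopology_of (submetric euclidean_metric {0..1})) (mtopology_of X) \<gamma>"
    by (rule Lipschitz_continuous_imp_continuous_map)
  then have path: "pathin (mtopology_of X) \<gamma>"
    by (simp add: pathin_def mtopology_of_submetric)
  have "geodesic X \<gamma>"
    unfolding geodesic_def constant_speed_def
  proof (intro conjI exI[of _ l] allI impI)
    show "curve_length X \<gamma> 0 1 = ereal (mdist X (\<gamma> 0) (\<gamma> 1))" using len[of 0 1] zz(1,2) by (simp add: \<gamma>_def flip: l_def)
  qed (use path len in auto)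
  moreover have "z ` {0..l} = \<gamma> ` {0..1}"
  proof (intro equalityI subsetI)
    fix x assume "x \<in> z ` {0..l}"
    then obtain s where s: "0 \<le> s" "s \<le> l" "x = z s" by auto
    show "x \<in> \<gamma> ` {0..1}"
    proof (cases "l = 0")
      case True
      then have "x = \<gamma> 0" using s by (simp add: \<gamma>_def)
      then show ?thesis by auto
    next
      case False
      then have "x = \<gamma> (s / l)" "s / l \<in> {0..1}" using s l0 by (auto simp: \<gamma>_def divide_simps)
      then show ?thesis by blast
    qed
  next
    fix x assume "x \<in> \<gamma> ` {0..1}"
    then show "x \<in> z ` {0..l}" using lu by (auto simp: \<gamma>_def)
  qed
  ultimately show ?thesis unfolding geodesic_segment_def l_def[symmetric] using zz(1,2) by (auto simp: \<gamma>_def)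
qed

lemma geodesic_segmentD:
  assumes S: "geodesic_segment X a b S"
  shows "a \<in> mspace X" "b \<in> mspace X" "S \<subseteq> mspace X"
    "\<And>y. y \<in> S \<Longrightarrow> mdist X a y + mdist X y b = mdist X a b"
    "\<And>s. 0 \<le> s \<Longrightarrow> s \<le> mdist X a b \<Longrightarrow> \<exists>y\<in>S. mdist X a y = s"
proof -
  obtain \<gamma> v where g: "pathin (mtopology_of X) \<gamma>" "curve_length X \<gamma> 0 1 = ereal (mdist X a b)" "\<gamma> 0 = a" "\<gamma> 1 = b" "S = \<gamma> ` {0..1}"
    and v: "\<And>s t. 0 \<le> s \<Longrightarrow> s \<le> t \<Longrightarrow> t \<le> 1 \<Longrightarrow> curve_length X \<gamma> s t = ereal (v * (t - s))"
    using S unfolding geodesic_segment_def geodesic_def constant_speed_def by auto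
  define l where "l = mdist X a b"
  have "v = l" using v[of 0 1] g(2) by (simp add: l_def)
  note v = v[unfolded this]
  have M: "\<gamma> u \<in> mspace X" if "u \<in> {0..1}" for u
    using continuous_map_funspace[OF g(1)[unfolded pathin_def]] that by (auto simp: Pi_iff)
  show abM: "a \<in> mspace X" "b \<in> mspace X" using M[of 0] M[of 1] g by auto
  show "S \<subseteq> mspace X" using M g(5) by auto
  have dist: "mdist X a (\<gamma> u) = l * u \<and> mdist X (\<gamma> u) b = l * (1 - u)" if u: "0 \<le> u" "u \<le> 1" for u
  proof -
    have "mdist X a (\<gamma> u) \<le> l * u" "mdist X (\<gamma> u) b \<le> l * (1 - u)"
      using curve_length_ge[of 0 u X \<gamma>] curve_length_ge[of u 1 X \<gamma>] v[of 0 u] v[of u 1] u g by simp_all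
    moreover have "l \<le> mdist X a (\<gamma> u) + mdist X (\<gamma> u) b"
      unfolding l_def using mdist_triangle[OF abM(1) M[of u] abM(2)] u by simp
    moreover have "l * u + l * (1 - u) = l" by (simp add: algebra_simps)
    ultimately show ?thesis by linarith
  qed
  show "mdist X a y + mdist X y b = mdist X a b" if "y \<in> S" for y
    using dist that by (auto simp: g(5) l_def[symmetric] algebra_simps)
  show "\<exists>y\<in>S. mdist X a y = s" if s: "0 \<le> s" "s \<le> mdist X a b" for s
  proof (cases "l = 0")
    case True
    then have "mdist X a (\<gamma> 0) = s" using s dist[of 0] by (simp add: l_def)
    then show ?thesis using g(5) by force
  next
    case False
    then have "s / l \<in> {0..1}" using s by (auto simp: l_def divide_simps)
    then show ?thesis using dist[of "s / l"] False g(5) by auto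
  qed
qed

text \<open>Uniqueness of the between-points, which is what the metric arguments provide; it implies
  that the geodesic segment is unique.\<close>

definition unique_path :: "'a metric \<Rightarrow> 'a \<Rightarrow> 'a \<Rightarrow> (real \<Rightarrow> 'a) \<Rightarrow> bool" where
  "unique_path X a b z \<longleftrightarrow> iso_path X a b z \<and>
     (\<forall>y\<in>mspace X. mdist X a y + mdist X y b = mdist X a b \<longrightarrow> y = z (mdist X a y))"

lemma unique_path_segment:
  assumes z: "unique_path X a b z" and S: "geodesic_segment X a b S"
  shows "S = z ` {0..mdist X a b}"
proof (intro equalityI subsetI)
  fix y assume y: "y \<in> S"
  note D = geodesic_segmentD[OF S]
  have 1: "mdist X a y + mdist X y b = mdist X a b" by (rule D(4)[OF y])
  have "y = z (mdist X a y)" using z y D(3) 1 unfolding unique_path_def by blast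
  moreover have "mdist X a y \<in> {0..mdist X a b}" using 1 mdist_nonneg[where m=X] by (smt (verit) atLeastAtMost_iff)
  ultimately show "y \<in> z ` {0..mdist X a b}" by (rule image_eqI)
next
  fix y assume "y \<in> z ` {0..mdist X a b}"
  then obtain s where s: "0 \<le> s" "s \<le> mdist X a b" "y = z s" by auto
  obtain y' where y': "y' \<in> S" "mdist X a y' = s" using geodesic_segmentD(5)[OF S s(1,2)] by blast
  have "y' = z s" using z y' geodesic_segmentD(3,4)[OF S] unfolding unique_path_def by blast
  then show "y \<in> S" using y'(1) s(3) by simp
qed

lemma unique_path_conv_step:
  assumes "unique_path X a b z" "a \<in> E" "b \<in> E" "s \<in> {0..mdist X a b}"
  shows "z s \<in> conv_step X E"
proof -
  have "geodesic_segment X a b (z ` {0..mdist X a b})"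
    using assms(1) unfolding unique_path_def by (intro iso_path_segment) blast
  then show ?thesis using unique_path_segment[OF assms(1)] assms(2-4) unfolding conv_step_def by blast
qed

lemma conv_steps_mono:
  assumes "n \<le> m" shows "(conv_step X ^^ n) D \<subseteq> (conv_step X ^^ m) D"
  using assms
proof (induction rule: dec_induct)
  case (step m)
  then show ?case by (auto simp: conv_step_def)
qed simp

lemma unique_path_conv_steps:
  assumes "unique_path X a b z" "a \<in> (\<Union>n. (conv_step X ^^ n) D)" "b \<in> (\<Union>n. (conv_step X ^^ n) D)" "s \<in> {0..mdist X a b}"
  shows "z s \<in> (\<Union>n. (conv_step X ^^ n) D)"
proof -
  obtain n m where nm: "a \<in> (conv_step X ^^ n) D" "b \<in> (conv_step X ^^ m) D" using assms(2,3) by blast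
  then have "a \<in> (conv_step X ^^ max n m) D" "b \<in> (conv_step X ^^ max n m) D"
    using conv_steps_mono[of n "max n m" X D] conv_steps_mono[of m "max n m" X D] by auto
  then have "z s \<in> conv_step X ((conv_step X ^^ max n m) D)" by (rule unique_path_conv_step[OF assms(1) _ _ assms(4)])
  then have "z s \<in> (conv_step X ^^ Suc (max n m)) D" by simp
  then show ?thesis by blast
qed

text \<open>A step of the hull adds a segment only if it is the unique one, so it is the segment
  which weak convexity puts inside L.\<close>

lemma closed_conv_subset:
  assumes L: "weakly_convex X L" "mtopology_of X closure_of L \<subseteq> L" and D: "D \<subseteq> L"
  shows "closed_conv X D \<subseteq> L"
proof -
  have "(conv_step X ^^ n) D \<subseteq> L" for n
  proof (induction n)
    case (Suc n)
    show ?case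
    proof
      fix x assume "x \<in> (conv_step X ^^ Suc n) D"
      then have "x \<in> conv_step X ((conv_step X ^^ n) D)" by simp
      then consider "x \<in> (conv_step X ^^ n) D"
        | a b S where "a \<in> (conv_step X ^^ n) D" "b \<in> (conv_step X ^^ n) D" "\<And>S'. geodesic_segment X a b S' \<Longrightarrow> S' = S" "x \<in> S"
        unfolding conv_step_def by blast
      then show "x \<in> L"
      proof cases
        case 1 then show ?thesis using Suc by blast
      next
        case 2
        then have "a \<in> L" "b \<in> L" using Suc by auto
        then obtain z where "iso_path X a b z" "z ` {0..mdist X a b} \<subseteq> L" using L(1) unfolding weakly_convex_def by blast
        then show ?thesis using 2(3)[OF iso_path_segment] 2(4) by blast
      qed
    qed
  qed (use D in simp)
  then have "(\<Union>n. (conv_step X ^^ n) D) \<subseteq> L" by blast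
  then have "closed_conv X D \<subseteq> mtopology_of X closure_of L" unfolding closed_conv_def by (rule closure_of_mono)
  then show ?thesis using L(2) by blast
qed

section \<open>Isometric relations and their closures\<close>

definition iso_rel :: "'a metric \<Rightarrow> 'b metric \<Rightarrow> ('a \<times> 'b) set \<Rightarrow> bool" where
  "iso_rel X Y R \<longleftrightarrow> R \<subseteq> mspace X \<times> mspace Y \<and> (\<forall>x y x' y'. (x, y) \<in> R \<longrightarrow> (x', y') \<in> R \<longrightarrow> mdist X x x' = mdist Y y y')"

text \<open>The closure of the relation in the product. Relations are preferred to partial maps
  since passing to the converse exchanges the two spaces.\<close>

definition rel_closure :: "'a metric \<Rightarrow> 'b metric \<Rightarrow> ('a \<times> 'b) set \<Rightarrow> ('a \<times> 'b) set" where
  "rel_closure X Y R = {(x, y). x \<in> mspace X \<and> y \<in> mspace Y \<and> (\<forall>e>0. \<exists>(x', y')\<in>R. mdist X x x' < e \<and> mdist Y y y' < e)}"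

lemma iso_rel_converse: "iso_rel X Y R \<Longrightarrow> iso_rel Y X (R\<inverse>)"
  unfolding iso_rel_def by (fastforce simp: eq_commute)

lemma rel_closure_converse: "rel_closure Y X (R\<inverse>) = (rel_closure X Y R)\<inverse>"
proof -
  have "(\<exists>(y', x')\<in>R\<inverse>. mdist Y y y' < e \<and> mdist X x x' < e) \<longleftrightarrow> (\<exists>(x', y')\<in>R. mdist X x x' < e \<and> mdist Y y y' < e)" for x y e
    by auto
  then show ?thesis unfolding rel_closure_def by auto
qed

lemma rel_closure_superset: "iso_rel X Y R \<Longrightarrow> R \<subseteq> rel_closure X Y R"
proof (rule subsetI)
  fix q assume R: "iso_rel X Y R" and q: "q \<in> R"
  then have M: "fst q \<in> mspace X" "snd q \<in> mspace Y" unfolding iso_rel_def by auto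
  then have z: "mdist X (fst q) (fst q) = 0" "mdist Y (snd q) (snd q) = 0" by simp_all
  have "\<exists>(x', y')\<in>R. mdist X (fst q) x' < e \<and> mdist Y (snd q) y' < e" if "0 < e" for e
    by (rule bexI[OF _ q]) (simp add: case_prod_unfold z that del: mdist_zero)
  then show "q \<in> rel_closure X Y R" using M unfolding rel_closure_def by (simp add: case_prod_unfold)
qed

lemma mdist_near:
  assumes "x \<in> mspace X" "x' \<in> mspace X" "y \<in> mspace X" "y' \<in> mspace X" "mdist X x x' < e" "mdist X y y' < e"
  shows "\<bar>mdist X x y - mdist X x' y'\<bar> < 2 * e"
  using mdist_triangle[of x X x' y] mdist_triangle[of x' X y' y] mdist_triangle[of x' X x y'] mdist_triangle[of x X y y']
    mdist_commute[of X x x'] mdist_commute[of X y y'] assms by linarith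

lemma iso_rel_closure:
  assumes R: "iso_rel X Y R"
  shows "iso_rel X Y (rel_closure X Y R)"
  unfolding iso_rel_def
proof (intro conjI allI impI)
  show "rel_closure X Y R \<subseteq> mspace X \<times> mspace Y" unfolding rel_closure_def by auto
  fix x y x1 y1 assume a: "(x, y) \<in> rel_closure X Y R" "(x1, y1) \<in> rel_closure X Y R"
  show "mdist X x x1 = mdist Y y y1"
  proof (rule ccontr)
    define e where "e = \<bar>mdist X x x1 - mdist Y y y1\<bar> / 4"
    assume "mdist X x x1 \<noteq> mdist Y y y1"
    then have e: "0 < e" by (simp add: e_def)
    obtain x' y' where 1: "(x', y') \<in> R" "mdist X x x' < e" "mdist Y y y' < e" using a(1) e unfolding rel_closure_def by blast
    obtain x2 y2 where 2: "(x2, y2) \<in> R" "mdist X x1 x2 < e" "mdist Y y1 y2 < e" using a(2) e unfolding rel_closure_def by blast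
    have M: "x \<in> mspace X" "x1 \<in> mspace X" "x' \<in> mspace X" "x2 \<in> mspace X" "y \<in> mspace Y" "y1 \<in> mspace Y" "y' \<in> mspace Y" "y2 \<in> mspace Y"
      using a 1 2 R unfolding rel_closure_def iso_rel_def by auto
    have e4: "\<bar>mdist X x x1 - mdist Y y y1\<bar> = 4 * e" by (simp add: e_def)
    have "mdist X x' x2 = mdist Y y' y2" using R 1(1) 2(1) unfolding iso_rel_def by blast
    then show False
      using mdist_near[OF M(1,3,2,4) 1(2) 2(2)] mdist_near[OF M(5,7,6,8) 1(3) 2(3)] e4 by linarith
  qed
qed

text \<open>A sequence in the domain converging to x has Cauchy partners, which converge by
  completeness of the other space.\<close>

lemma Domain_rel_closure:
  assumes R: "iso_rel X Y R" and Y: "mcomplete_of Y"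
  shows "Domain (rel_closure X Y R) = mtopology_of X closure_of (Domain R)"
proof (intro equalityI subsetI)
  fix x assume "x \<in> Domain (rel_closure X Y R)"
  then obtain y where y: "(x, y) \<in> rel_closure X Y R" by blast
  show "x \<in> mtopology_of X closure_of (Domain R)"
    unfolding in_closure_of_metric
  proof (intro conjI allI impI)
    show "x \<in> mspace X" using y by (simp add: rel_closure_def)
    fix e :: real assume "0 < e"
    then obtain x' y' where x': "(x', y') \<in> R" "mdist X x x' < e" using y unfolding rel_closure_def by blast
    moreover have "x' \<in> mspace X" using x'(1) R unfolding iso_rel_def by blast
    ultimately show "\<exists>y\<in>Domain R. y \<in> mspace X \<and> mdist X x y < e" by blast
  qed
next
  interpret Y: Metric_space "mspace Y" "mdist Y" by simp
  fix x assume x: "x \<in> mtopology_of X closure_of (Domain R)"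
  then have xM: "x \<in> mspace X" by (simp add: in_closure_of_metric)
  have "\<exists>q. q \<in> R \<and> mdist X x (fst q) < inverse (real (Suc n))" for n
  proof -
    have "0 < inverse (real (Suc n))" by simp
    then obtain x' where "x' \<in> Domain R" "mdist X x x' < inverse (real (Suc n))" using x unfolding in_closure_of_metric by blast
    then show ?thesis by force
  qed
  then obtain q where q: "\<And>n. q n \<in> R" "\<And>n. mdist X x (fst (q n)) < inverse (real (Suc n))" by metis
  have qM: "fst (q n) \<in> mspace X" "snd (q n) \<in> mspace Y" for n using q(1)[of n] R unfolding iso_rel_def by auto
  have iso: "mdist X (fst (q n)) (fst (q m)) = mdist Y (snd (q n)) (snd (q m))" for n m
    using R q(1)[of n] q(1)[of m] unfolding iso_rel_def by (metis prod.collapse)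
  have small: "inverse (real (Suc n)) \<le> inverse (real (Suc N))" if "N \<le> n" for n N
    using that by (intro le_imp_inverse_le) auto
  have "Y.MCauchy (\<lambda>n. snd (q n))"
    unfolding Y.MCauchy_def
  proof (intro conjI allI impI)
    show "range (\<lambda>n. snd (q n)) \<subseteq> mspace Y" using qM by blast
    fix e :: real assume "0 < e"
    then obtain N where N: "inverse (real (Suc N)) < e / 2" using reals_Archimedean[of "e / 2"] by auto
    show "\<exists>N. \<forall>n n'. N \<le> n \<longrightarrow> N \<le> n' \<longrightarrow> mdist Y (snd (q n)) (snd (q n')) < e"
    proof (intro exI[of _ N] allI impI)
      fix n n' assume nn: "N \<le> n" "N \<le> n'"
      have "mdist X (fst (q n)) (fst (q n')) \<le> mdist X x (fst (q n)) + mdist X x (fst (q n'))"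
        using mdist_triangle[OF qM(1)[of n] xM qM(1)[of n']] mdist_commute[of X x "fst (q n)"] by simp
      then show "mdist Y (snd (q n)) (snd (q n')) < e"
        using iso[of n n'] q(2)[of n] q(2)[of n'] small[OF nn(1)] small[OF nn(2)] N by linarith
    qed
  qed
  then obtain y where y: "limitin Y.mtopology (\<lambda>n. snd (q n)) y sequentially"
    using Y unfolding mcomplete_of_def Y.mcomplete_def by blast
  have yM: "y \<in> mspace Y" using y by (rule Y.limitin_mspace)
  have "(x, y) \<in> rel_closure X Y R"
    unfolding rel_closure_def
  proof (clarsimp simp: xM yM)
    fix e :: real assume e: "0 < e"
    have "\<forall>\<^sub>F n in sequentially. mdist Y (snd (q n)) y < e" using y e unfolding Y.limitin_metric by (auto elim: eventually_mono)
    then obtain N1 where N1: "\<And>n. N1 \<le> n \<Longrightarrow> mdist Y (snd (q n)) y < e" unfolding eventually_sequentially by blast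
    obtain N where N: "inverse (real (Suc N)) < e" using reals_Archimedean[OF e] by auto
    have "mdist X x (fst (q (max N N1))) < e" using q(2)[of "max N N1"] small[of N "max N N1"] N by linarith
    moreover have "mdist Y y (snd (q (max N N1))) < e" using N1[of "max N N1"] mdist_commute[of Y y] by simp
    ultimately show "\<exists>(x', y')\<in>R. mdist X x x' < e \<and> mdist Y y y' < e"
      using q(1)[of "max N N1"] by (intro bexI[of _ "q (max N N1)"]) (auto simp: case_prod_unfold)
  qed
  then show "x \<in> Domain (rel_closure X Y R)" by blast
qed

lemma Range_rel_closure:
  assumes R: "iso_rel X Y R" and X: "mcomplete_of X"
  shows "Range (rel_closure X Y R) = mtopology_of Y closure_of (Range R)"
  using Domain_rel_closure[OF iso_rel_converse[OF R] X] by (simp add: rel_closure_converse)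

lemma iso_rel_path:
  assumes R: "iso_rel X Y R" and ab: "(a, a') \<in> R" "(b, b') \<in> R"
    and w: "iso_path Y a' b' w" "w ` {0..mdist Y a' b'} \<subseteq> Range R"
  obtains z where "iso_path X a b z" "\<And>s. s \<in> {0..mdist X a b} \<Longrightarrow> (z s, w s) \<in> R"
proof -
  have iso: "mdist X x x' = mdist Y y y'" if "(x, y) \<in> R" "(x', y') \<in> R" for x y x' y'
    using R that unfolding iso_rel_def by blast
  have M: "x \<in> mspace X" if "(x, y) \<in> R" for x y using R that unfolding iso_rel_def by blast
  have l: "mdist X a b = mdist Y a' b'" by (rule iso[OF ab])
  have "\<forall>s\<in>{0..mdist X a b}. \<exists>x. (x, w s) \<in> R" using w(2) l by auto
  then obtain z where z: "\<And>s. s \<in> {0..mdist X a b} \<Longrightarrow> (z s, w s) \<in> R" using bchoice[of "{0..mdist X a b}" "\<lambda>s x. (x, w s) \<in> R"] by blast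
  have eq: "x = x'" if "(x, y) \<in> R" "(x', y) \<in> R" for x x' y
  proof -
    have "mdist X x x = 0" using M[OF that(1)] by simp
    then have "mdist X x x' = 0" unfolding iso[OF that(1,1)] iso[OF that] .
    then show ?thesis using M that by simp
  qed
  have "iso_path X a b z"
    unfolding iso_path_def
  proof (intro conjI ballI)
    show "z 0 = a" using z[of 0] ab(1) w(1) by (auto simp: iso_path_def intro: eq)
    show "z (mdist X a b) = b" using z[of "mdist X a b"] ab(2) w(1) l by (auto simp: iso_path_def intro: eq)
    fix s assume s: "s \<in> {0..mdist X a b}"
    show "z s \<in> mspace X" by (rule M[OF z[OF s]])
    fix t assume t: "t \<in> {0..mdist X a b}"
    show "mdist X (z s) (z t) = \<bar>s - t\<bar>" using iso[OF z[OF s] z[OF t]] w(1) s t l by (simp add: iso_path_def)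
  qed
  then show thesis by (rule that) (rule z)
qed

lemma iso_rel_weakly_convex:
  assumes R: "iso_rel X Y R" and c: "weakly_convex Y (Range R)"
  shows "weakly_convex X (Domain R)"
  unfolding weakly_convex_def
proof (intro ballI)
  fix a b assume "a \<in> Domain R" "b \<in> Domain R"
  then obtain a' b' where ab: "(a, a') \<in> R" "(b, b') \<in> R" by blast
  obtain w where w: "iso_path Y a' b' w" "w ` {0..mdist Y a' b'} \<subseteq> Range R" using c ab unfolding weakly_convex_def by blast
  obtain z where "iso_path X a b z" "\<And>s. s \<in> {0..mdist X a b} \<Longrightarrow> (z s, w s) \<in> R" by (rule iso_rel_path[OF R ab w]) blast
  then show "\<exists>z. iso_path X a b z \<and> z ` {0..mdist X a b} \<subseteq> Domain R" by blast
qed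

lemma iso_rel_isometric:
  assumes R: "iso_rel X Y R"
  shows "isometric (submetric X (Domain R)) (submetric Y (Range R))"
proof -
  have M: "x \<in> mspace X" "y \<in> mspace Y" if "(x, y) \<in> R" for x y using R that unfolding iso_rel_def by blast+
  have iso: "mdist X x x' = mdist Y y y'" if "(x, y) \<in> R" "(x', y') \<in> R" for x y x' y'
    using R that unfolding iso_rel_def by blast
  define g where "g = (\<lambda>x. SOME y. (x, y) \<in> R)"
  have g: "(x, g x) \<in> R" if "x \<in> Domain R" for x using that unfolding g_def by (auto intro: someI)
  have eq: "y = y'" if "(x, y) \<in> R" "(x, y') \<in> R" for x y y'
  proof -
    have "mdist X x x = 0" using M(1)[OF that(1)] by simp
    then have "mdist Y y y' = 0" unfolding iso[OF that] .
    then show ?thesis using M that by simp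
  qed
  have "g ` Domain R = Range R"
  proof (intro equalityI subsetI)
    fix y assume "y \<in> Range R"
    then obtain x where x: "(x, y) \<in> R" by blast
    have "y = g x" using eq[OF x g] x by blast
    then show "y \<in> g ` Domain R" using x by blast
  qed (use g in blast)
  moreover have "Domain R \<inter> mspace X = Domain R" "Range R \<inter> mspace Y = Range R" using M by blast+
  moreover have "mdist Y (g x) (g x') = mdist X x x'" if "x \<in> Domain R" "x' \<in> Domain R" for x x'
    by (rule iso[OF g[OF that(1)] g[OF that(2)], symmetric])
  moreover have "g \<in> Domain R \<rightarrow> Range R" using g by blast
  ultimately show ?thesis
    unfolding isometric_def isometric_embedding_def mspace_submetric mdist_submetric by (metis (no_types))
qed

section \<open>Convexity of the generated hull\<close>

lemma md_tendsto_0: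
  assumes f: "((\<lambda>n. md \<kappa> (f n)) \<longlongrightarrow> 0) F" and r: "\<And>n. 0 \<le> f n" "\<And>n. radc \<kappa> (f n)"
  shows "(f \<longlongrightarrow> 0) F"
proof (rule tendstoI)
  fix e :: real assume e: "0 < e"
  show "\<forall>\<^sub>F n in F. dist (f n) 0 < e"
  proof (cases "radc \<kappa> e")
    case True
    have "\<forall>\<^sub>F n in F. md \<kappa> (f n) < md \<kappa> e" by (rule order_tendstoD(2)[OF f md_gt_0[OF e True]])
    then show ?thesis
    proof eventually_elim
      case (elim n)
      have "\<not> e \<le> f n" using md_mono[of e "f n" \<kappa>] e r elim by auto
      then show ?case using r(1)[of n] by simp
    qed
  next
    case False
    then have "f n < e" for n using r(2)[of n] by (auto simp: radc_def)
    then show ?thesis using r(1) by (simp add: dist_real_def)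
  qed
qed

text \<open>Both coordinates of a Cauchy sequence converge, and the limits satisfy the equation of
  the model because it is continuous; \<open>mv_surj\<close> supplies the limit point.\<close>

lemma mcomplete_model: "mcomplete_of (model_space \<kappa>)"
proof -
  interpret M: Metric_space "MP \<kappa>" "dM \<kappa>" by (rule Metric_space_model)
  have "\<exists>P. limitin M.mtopology \<sigma> P sequentially" if C: "M.MCauchy \<sigma>" for \<sigma>
  proof -
    have S: "\<sigma> n \<in> MP \<kappa>" for n using C unfolding M.MCauchy_def by blast
    have small: "\<exists>N. \<forall>n\<ge>N. \<forall>k\<ge>N. dM \<kappa> (\<sigma> n) (\<sigma> k) < e" if e: "0 < e" for e
    proof -
      have "\<forall>e>0. \<exists>N. \<forall>n k. N \<le> n \<longrightarrow> N \<le> k \<longrightarrow> dM \<kappa> (\<sigma> n) (\<sigma> k) < e"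
        using C unfolding M.MCauchy_def by (rule conjunct2)
      then obtain N where "\<forall>n k. N \<le> n \<longrightarrow> N \<le> k \<longrightarrow> dM \<kappa> (\<sigma> n) (\<sigma> k) < e" using e by meson
      then show ?thesis by (intro exI[of _ N]) simp
    qed
    define f where "f n = dM \<kappa> (org \<kappa>) (\<sigma> n)" for n
    have fle: "\<bar>f n - f k\<bar> \<le> dM \<kappa> (\<sigma> n) (\<sigma> k)" for n k
      unfolding f_def using dM_tri[OF org_model S S, of n k] dM_tri[OF org_model S S, of k n] dM_commute[of \<kappa> "\<sigma> n" "\<sigma> k"] by linarith
    have "Cauchy f"
    proof (rule metric_CauchyI)
      fix e :: real assume "0 < e"
      then obtain N where N: "\<And>n k. N \<le> n \<Longrightarrow> N \<le> k \<Longrightarrow> dM \<kappa> (\<sigma> n) (\<sigma> k) < e" using small by blast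
      show "\<exists>N. \<forall>n\<ge>N. \<forall>k\<ge>N. dist (f n) (f k) < e"
      proof (intro exI[of _ N] allI impI)
        fix n k assume "N \<le> n" "N \<le> k"
        then show "dist (f n) (f k) < e" using le_less_trans[OF fle[of n k] N[of n k]] by (simp add: dist_real_def)
      qed
    qed
    then obtain r where r: "f \<longlonglongrightarrow> r" using Cauchy_convergent convergent_def by blast
    define m where "m n = mm \<kappa> (\<sigma> n)" for n
    have "m n = md \<kappa> (f n)" for n unfolding m_def f_def by (rule md_org[OF S, symmetric])
    then have m: "m \<longlonglongrightarrow> md \<kappa> r" using tendsto_md[OF r, of \<kappa>] by presburger
    define V where "V n = vv \<kappa> (\<sigma> n)" for n
    \<comment> \<open>For \<kappa> < 0 the last term enlarges the norm, so the convergence of m is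
      needed before that of V.\<close>
    have VV: "(norm (V n - V k))\<^sup>2 = 2 * md \<kappa> (dM \<kappa> (\<sigma> n) (\<sigma> k)) - \<kappa> * (m n - m k)\<^sup>2" for n k
      unfolding power2_norm_eq_inner V_def m_def md_dM(1)[OF S S]
      using vv_norm[OF S[of n]] vv_norm[OF S[of k]]
      by (simp add: inner_diff inner_commute[of "vv \<kappa> (\<sigma> k)" "vv \<kappa> (\<sigma> n)"] power2_eq_square algebra_simps)
    have "Cauchy V"
    proof (rule metric_CauchyI)
      fix e :: real assume e: "0 < e"
      \<comment> \<open>Chosen so that the curvature term is at most e^2 / 4; with \<open>md\<close>
        below e^2 / 4 the sum stays below e^2.\<close>
      define c where "c = e\<^sup>2 / (4 * (\<bar>\<kappa>\<bar> + 1))"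
      have c: "0 < c" "\<bar>\<kappa>\<bar> * c \<le> e\<^sup>2 / 4"
      proof -
        show "0 < c" using e unfolding c_def by (intro divide_pos_pos) auto
        then have "\<bar>\<kappa>\<bar> * c \<le> (\<bar>\<kappa>\<bar> + 1) * c" by simp
        also have "\<dots> = e\<^sup>2 / 4" unfolding c_def by (simp add: field_simps add_nonneg_eq_0_iff)
        finally show "\<bar>\<kappa>\<bar> * c \<le> e\<^sup>2 / 4" .
      qed
      have "((\<lambda>x. md \<kappa> x) \<longlongrightarrow> md \<kappa> 0) (at_right 0)" by (intro tendsto_intros)
      then have "\<forall>\<^sub>F x in at_right 0. md \<kappa> x < e\<^sup>2 / 4" using e by (intro order_tendstoD(2)) auto
      then obtain b where b: "0 < b" "\<And>x. 0 < x \<Longrightarrow> x < b \<Longrightarrow> md \<kappa> x < e\<^sup>2 / 4"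
        unfolding eventually_at_right_field by blast
      obtain N where N: "\<And>n k. N \<le> n \<Longrightarrow> N \<le> k \<Longrightarrow> dM \<kappa> (\<sigma> n) (\<sigma> k) < b" using small[OF b(1)] by blast
      have "Cauchy m" using m LIMSEQ_imp_Cauchy by blast
      moreover have "0 < sqrt c" using c by simp
      ultimately obtain N' where N': "\<And>n k. N' \<le> n \<Longrightarrow> N' \<le> k \<Longrightarrow> dist (m n) (m k) < sqrt c"
        unfolding Cauchy_def by metis
      show "\<exists>N. \<forall>n\<ge>N. \<forall>k\<ge>N. dist (V n) (V k) < e"
      proof (intro exI[of _ "max N N'"] allI impI)
        fix n k assume nk: "max N N' \<le> n" "max N N' \<le> k"
        have "md \<kappa> (dM \<kappa> (\<sigma> n) (\<sigma> k)) < e\<^sup>2 / 4"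
        proof (cases "dM \<kappa> (\<sigma> n) (\<sigma> k) = 0")
          case True then show ?thesis using e by simp
        next
          case False
          then have "0 < dM \<kappa> (\<sigma> n) (\<sigma> k)" by (simp add: less_le)
          then show ?thesis using b(2) N nk by simp
        qed
        moreover have "(m n - m k)\<^sup>2 \<le> c"
        proof -
          have "\<bar>m n - m k\<bar> \<le> sqrt c" using N'[of n k] nk by (simp add: dist_real_def)
          then have "\<bar>m n - m k\<bar>\<^sup>2 \<le> (sqrt c)\<^sup>2" by (intro power_mono) auto
          then show ?thesis using c by simp
        qed
        then have "- (\<kappa> * (m n - m k)\<^sup>2) \<le> e\<^sup>2 / 4"
        proof -
          assume a: "(m n - m k)\<^sup>2 \<le> c"
          have "- (\<kappa> * (m n - m k)\<^sup>2) \<le> \<bar>\<kappa>\<bar> * (m n - m k)\<^sup>2" by (simp add: abs_if mult_right_mono)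
          also have "\<dots> \<le> \<bar>\<kappa>\<bar> * c" by (rule mult_left_mono[OF a]) simp
          finally show ?thesis using c(2) by linarith
        qed
        ultimately have "(norm (V n - V k))\<^sup>2 < e\<^sup>2" unfolding VV using e zero_less_power[of e 2] by linarith
        then have "norm (V n - V k) < e" by (rule power2_less_imp_less) (rule less_imp_le[OF e])
        then show "dist (V n) (V k) < e" by (simp add: dist_norm)
      qed
    qed
    then obtain v where v: "V \<longlonglongrightarrow> v" using ell2_complete by blast
    have "(\<lambda>n. V n \<bullet> V n) \<longlonglongrightarrow> v \<bullet> v" by (intro tendsto_intros v)
    moreover have "(\<lambda>n. V n \<bullet> V n) \<longlonglongrightarrow> md \<kappa> r * (2 - \<kappa> * md \<kappa> r)"
      unfolding V_def vv_norm[OF S] m_def[symmetric] by (intro tendsto_intros m)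
    ultimately have "v \<bullet> v = md \<kappa> r * (2 - \<kappa> * md \<kappa> r)" by (rule LIMSEQ_unique)
    moreover have "0 \<le> md \<kappa> r" by (simp add: md_def)
    ultimately obtain P where P: "P \<in> MP \<kappa>" "mm \<kappa> P = md \<kappa> r" "vv \<kappa> P = v" using mv_surj by blast
    have "(\<lambda>n. m n + md \<kappa> r - \<kappa> * m n * md \<kappa> r - V n \<bullet> v) \<longlonglongrightarrow> md \<kappa> r + md \<kappa> r - \<kappa> * md \<kappa> r * md \<kappa> r - v \<bullet> v"
      by (intro tendsto_intros m v)
    then have "(\<lambda>n. md \<kappa> (dM \<kappa> (\<sigma> n) P)) \<longlonglongrightarrow> 0"
      unfolding md_dM(1)[OF S P(1)] P(2,3) m_def V_def \<open>v \<bullet> v = _\<close> by (simp add: algebra_simps)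
    then have "(\<lambda>n. dM \<kappa> (\<sigma> n) P) \<longlonglongrightarrow> 0" by (rule md_tendsto_0) (use md_dM(2)[OF S P(1)] in auto)
    then show ?thesis using S P(1) unfolding M.limit_metric_sequentially
      by (intro exI[of _ P]) (auto simp: LIMSEQ_def dist_real_def)
  qed
  then show ?thesis unfolding mcomplete_of_def mspace_model_space mdist_model_space M.mcomplete_def by blast
qed

lemma model_unique_path:
  assumes ab: "a \<in> MP \<kappa>" "b \<in> MP \<kappa>" and l: "rad \<kappa> (dM \<kappa> a b)"
  shows "\<exists>w. unique_path (model_space \<kappa>) a b w"
proof -
  have "\<exists>w. \<forall>s\<in>{0..dM \<kappa> a b}. w s \<in> MP \<kappa> \<and> dM \<kappa> a (w s) = s \<and> dM \<kappa> (w s) b = dM \<kappa> a b - s"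
  proof (rule bchoice, rule ballI)
    fix s assume s: "s \<in> {0..dM \<kappa> a b}"
    then have s': "0 \<le> s" "s \<le> dM \<kappa> a b" by auto
    obtain w where "w \<in> MP \<kappa>" "dM \<kappa> a w = s" "dM \<kappa> w b = dM \<kappa> a b - s" by (rule point_between[OF ab s' l])
    then show "\<exists>w. w \<in> MP \<kappa> \<and> dM \<kappa> a w = s \<and> dM \<kappa> w b = dM \<kappa> a b - s" by blast
  qed
  then obtain w where "\<forall>s\<in>{0..dM \<kappa> a b}. w s \<in> MP \<kappa> \<and> dM \<kappa> a (w s) = s \<and> dM \<kappa> (w s) b = dM \<kappa> a b - s" ..
  then have w: "w s \<in> MP \<kappa> \<and> dM \<kappa> a (w s) = s \<and> dM \<kappa> (w s) b = dM \<kappa> a b - s" if "0 \<le> s" "s \<le> dM \<kappa> a b" for s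
    using that by simp
  have uniq: "y = w (dM \<kappa> a y)" if y: "y \<in> MP \<kappa>" "dM \<kappa> a y + dM \<kappa> y b = dM \<kappa> a b" for y
  proof -
    have "dM \<kappa> a y \<le> dM \<kappa> a b" using y(2) dM_nonneg[of \<kappa> y b] by linarith
    then have W: "w (dM \<kappa> a y) \<in> MP \<kappa>" "dM \<kappa> a (w (dM \<kappa> a y)) = dM \<kappa> a y" "dM \<kappa> (w (dM \<kappa> a y)) b = dM \<kappa> y b"
      using w[OF dM_nonneg[of \<kappa> a y]] y(2) by auto
    show ?thesis by (rule segment_unique[OF ab y(1) W(1) y(2) W(2,3) l])
  qed
  have ends: "w 0 = a" "w (dM \<kappa> a b) = b" using uniq[OF ab(1)] uniq[OF ab(2)] ab by simp_all
  \<comment> \<open>The points w s were chosen independently. The point at distance t - s from w s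
    towards b is also between a and b, so by uniqueness it is w t.\<close>
  have le: "dM \<kappa> (w s) (w t) = t - s" if st: "0 \<le> s" "s \<le> t" "t \<le> dM \<kappa> a b" for s t
  proof -
    have t: "0 \<le> t" and s: "s \<le> dM \<kappa> a b" using st by auto
    note Ws = w[OF st(1) s]
    have r: "rad \<kappa> (dM \<kappa> (w s) b)" using Ws by (intro rad_mono[OF l]) (use st in simp)
    have "t - s \<le> dM \<kappa> (w s) b" "0 \<le> t - s" using Ws st by auto
    then obtain y where y: "y \<in> MP \<kappa>" "dM \<kappa> (w s) y = t - s" "dM \<kappa> y b = dM \<kappa> (w s) b - (t - s)"
      using point_between[of "w s" \<kappa> b "t - s"] Ws ab(2) r by metis
    have b1: "dM \<kappa> a y \<le> t" using dM_tri[OF ab(1) _ y(1), of "w s"] Ws y(2) by simp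
    have b2: "dM \<kappa> a b \<le> dM \<kappa> a y + dM \<kappa> y b" by (rule dM_tri[OF ab(1) y(1) ab(2)])
    have "dM \<kappa> a y = t" "dM \<kappa> a y + dM \<kappa> y b = dM \<kappa> a b" using b1 b2 y(3) Ws by linarith+
    then have "y = w t" using uniq[OF y(1)] by simp
    then show ?thesis using y(2) by simp
  qed
  have dist: "dM \<kappa> (w s) (w t) = \<bar>s - t\<bar>" if "0 \<le> s" "s \<le> dM \<kappa> a b" "0 \<le> t" "t \<le> dM \<kappa> a b" for s t
    using le[of s t] le[of t s] dM_commute[of \<kappa> "w s" "w t"] that by (cases "s \<le> t") auto
  have "iso_path (model_space \<kappa>) a b w"
    unfolding iso_path_def mspace_model_space mdist_model_space using ends w dist by simp
  moreover have "\<forall>y\<in>MP \<kappa>. dM \<kappa> a y + dM \<kappa> y b = dM \<kappa> a b \<longrightarrow> y = w (dM \<kappa> a y)" using uniq by blast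
  ultimately show ?thesis unfolding unique_path_def mspace_model_space mdist_model_space by blast
qed

lemma dM_tendsto:
  assumes S: "a \<in> MP \<kappa>" "c \<in> MP \<kappa>" "\<And>n. an n \<in> MP \<kappa>" and a: "(\<lambda>n. dM \<kappa> a (an n)) \<longlonglongrightarrow> 0"
  shows "(\<lambda>n. dM \<kappa> (an n) c) \<longlonglongrightarrow> dM \<kappa> a c"
proof (rule LIM_zero_cancel, rule tendsto_rabs_zero_cancel, rule tendsto_sandwich[OF _ _ tendsto_const a])
  show "\<forall>\<^sub>F n in sequentially. \<bar>dM \<kappa> (an n) c - dM \<kappa> a c\<bar> \<le> dM \<kappa> a (an n)"
  proof (intro always_eventually allI)
    fix n
    show "\<bar>dM \<kappa> (an n) c - dM \<kappa> a c\<bar> \<le> dM \<kappa> a (an n)"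
      using dM_tri[OF S(1,3,2), of n] dM_tri[OF S(3) S(1,2), of n] dM_commute[of \<kappa> a "an n"] by linarith
  qed
qed simp

lemma dM_tendsto2:
  assumes S: "a \<in> MP \<kappa>" "b \<in> MP \<kappa>" "\<And>n. an n \<in> MP \<kappa>" "\<And>n. bn n \<in> MP \<kappa>"
    and a: "(\<lambda>n. dM \<kappa> a (an n)) \<longlonglongrightarrow> 0" and b: "(\<lambda>n. dM \<kappa> b (bn n)) \<longlonglongrightarrow> 0"
  shows "(\<lambda>n. dM \<kappa> (an n) (bn n)) \<longlonglongrightarrow> dM \<kappa> a b"
proof (rule LIM_zero_cancel, rule tendsto_rabs_zero_cancel, rule tendsto_sandwich[OF _ _ tendsto_const])
  show "(\<lambda>n. dM \<kappa> a (an n) + dM \<kappa> b (bn n)) \<longlonglongrightarrow> 0" using tendsto_add[OF a b] by simp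
  show "\<forall>\<^sub>F n in sequentially. \<bar>dM \<kappa> (an n) (bn n) - dM \<kappa> a b\<bar> \<le> dM \<kappa> a (an n) + dM \<kappa> b (bn n)"
  proof (intro always_eventually allI)
    fix n
    show "\<bar>dM \<kappa> (an n) (bn n) - dM \<kappa> a b\<bar> \<le> dM \<kappa> a (an n) + dM \<kappa> b (bn n)"
      using dM_tri[OF S(1,3,2), of n] dM_tri[OF S(3,4,2), of n n] dM_tri[OF S(3) S(1) S(4), of n n] dM_tri[OF S(1,2,4), of n]
        dM_commute[of \<kappa> a "an n"] dM_commute[of \<kappa> b "bn n"] by linarith
  qed
qed simp

text \<open>The points dividing the approximating segments in the ratio of w converge to w, by
  passing to the limit in the equation of \<open>between_model\<close> with third point w.\<close>

lemma segment_approx: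
  assumes S: "a \<in> MP \<kappa>" "b \<in> MP \<kappa>" "\<And>n. an n \<in> MP \<kappa>" "\<And>n. bn n \<in> MP \<kappa>"
    and w: "w \<in> MP \<kappa>" "dM \<kappa> a w + dM \<kappa> w b = dM \<kappa> a b" and l: "rad \<kappa> (dM \<kappa> a b)"
    and r: "\<And>n. rad \<kappa> (dM \<kappa> (an n) (bn n))"
    and a: "(\<lambda>n. dM \<kappa> a (an n)) \<longlonglongrightarrow> 0" and b: "(\<lambda>n. dM \<kappa> b (bn n)) \<longlonglongrightarrow> 0" and e: "0 < e"
  shows "\<exists>n. \<exists>w'\<in>MP \<kappa>. dM \<kappa> (an n) w' + dM \<kappa> w' (bn n) = dM \<kappa> (an n) (bn n) \<and> dM \<kappa> w w' < e"
proof (cases "dM \<kappa> a b = 0")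
  case True
  then have "dM \<kappa> a w = 0" using w(2) dM_nonneg[of \<kappa> a w] dM_nonneg[of \<kappa> w b] by linarith
  then have "w = a" using dM_zero[OF S(1) w(1)] by simp
  moreover obtain n where "dM \<kappa> a (an n) < e" using order_tendstoD(2)[OF a e] by (auto simp: eventually_sequentially)
  ultimately show ?thesis using S(3)[of n] by (intro exI[of _ n] bexI[of _ "an n"]) auto
next
  case False
  define L where "L = dM \<kappa> a b"
  have L: "0 < L" using False by (simp add: L_def less_le)
  define c where "c = dM \<kappa> a w / L"
  have awb: "dM \<kappa> a w \<le> L" using w(2) dM_nonneg[of \<kappa> w b] by (simp add: L_def del: dM_nonneg)
  have c: "0 \<le> c" "c \<le> 1" using L awb by (auto simp: c_def divide_simps)
  define ln where "ln n = dM \<kappa> (an n) (bn n)" for n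
  have "\<exists>w'. w' \<in> MP \<kappa> \<and> dM \<kappa> (an n) w' = c * ln n \<and> dM \<kappa> w' (bn n) = ln n - c * ln n" for n
  proof -
    have "0 \<le> c * ln n" "c * ln n \<le> ln n" using c by (auto simp: ln_def mult_left_le_one_le)
    then show ?thesis using point_between[OF S(3)[of n] S(4)[of n] _ _ r[of n], where s = "c * ln n"] unfolding ln_def by metis
  qed
  then obtain wn where wn: "\<And>n. wn n \<in> MP \<kappa>" "\<And>n. dM \<kappa> (an n) (wn n) = c * ln n" "\<And>n. dM \<kappa> (wn n) (bn n) = ln n - c * ln n" by metis
  have bt: "dM \<kappa> (an n) (wn n) + dM \<kappa> (wn n) (bn n) = dM \<kappa> (an n) (bn n)" for n using wn(2,3)[of n] by (simp add: ln_def)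
  have lnL: "ln \<longlonglongrightarrow> L" unfolding ln_def[abs_def] L_def by (rule dM_tendsto2[OF S a b])
  have cL: "c * L = dM \<kappa> a w" "L - c * L = dM \<kappa> w b" using L w(2) by (auto simp: c_def L_def)
  have aw: "(\<lambda>n. dM \<kappa> (an n) w) \<longlonglongrightarrow> c * L" unfolding cL by (rule dM_tendsto[OF S(1) w(1) S(3) a])
  have bw: "(\<lambda>n. dM \<kappa> (bn n) w) \<longlonglongrightarrow> L - c * L"
    unfolding cL(2) dM_commute[of \<kappa> w b] by (rule dM_tendsto[OF S(2) w(1) S(4) b])
  have eq: "sn \<kappa> (ln n) * md \<kappa> (dM \<kappa> (wn n) w) = sn \<kappa> (ln n - c * ln n) * md \<kappa> (dM \<kappa> (an n) w) + sn \<kappa> (c * ln n) * md \<kappa> (dM \<kappa> (bn n) w)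
      - sn \<kappa> (ln n - c * ln n) * md \<kappa> (c * ln n) - sn \<kappa> (c * ln n) * md \<kappa> (ln n - c * ln n)" for n
    using between_model(2)[OF S(3)[of n] S(4)[of n] wn(1) bt r w(1)] unfolding wn(2,3) ln_def[symmetric] by linarith
  have "(\<lambda>n. sn \<kappa> (ln n - c * ln n) * md \<kappa> (dM \<kappa> (an n) w) + sn \<kappa> (c * ln n) * md \<kappa> (dM \<kappa> (bn n) w)
      - sn \<kappa> (ln n - c * ln n) * md \<kappa> (c * ln n) - sn \<kappa> (c * ln n) * md \<kappa> (ln n - c * ln n)) \<longlonglongrightarrow>
      sn \<kappa> (L - c * L) * md \<kappa> (c * L) + sn \<kappa> (c * L) * md \<kappa> (L - c * L) - sn \<kappa> (L - c * L) * md \<kappa> (c * L) - sn \<kappa> (c * L) * md \<kappa> (L - c * L)"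
    by (intro tendsto_intros lnL aw bw)
  then have "(\<lambda>n. sn \<kappa> (ln n) * md \<kappa> (dM \<kappa> (wn n) w)) \<longlonglongrightarrow> 0" unfolding eq by simp
  moreover have snL: "(\<lambda>n. sn \<kappa> (ln n)) \<longlonglongrightarrow> sn \<kappa> L" by (intro tendsto_intros lnL)
  moreover have sn0: "0 < sn \<kappa> L" using L l by (intro sn_gt_0) (auto simp: L_def)
  ultimately have "(\<lambda>n. sn \<kappa> (ln n) * md \<kappa> (dM \<kappa> (wn n) w) / sn \<kappa> (ln n)) \<longlonglongrightarrow> 0 / sn \<kappa> L"
    by (intro tendsto_divide) auto
  moreover have "\<forall>\<^sub>F n in sequentially. sn \<kappa> (ln n) * md \<kappa> (dM \<kappa> (wn n) w) / sn \<kappa> (ln n) = md \<kappa> (dM \<kappa> (wn n) w)"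
    using order_tendstoD(1)[OF snL sn0] by eventually_elim simp
  ultimately have "(\<lambda>n. md \<kappa> (dM \<kappa> (wn n) w)) \<longlonglongrightarrow> 0" using tendsto_cong by force
  then have "(\<lambda>n. dM \<kappa> (wn n) w) \<longlonglongrightarrow> 0" by (rule md_tendsto_0) (use md_dM(2)[OF wn(1) w(1)] in auto)
  then have "\<forall>\<^sub>F n in sequentially. dM \<kappa> (wn n) w < e" by (rule order_tendstoD(2)[OF _ e])
  then obtain n where "dM \<kappa> (wn n) w < e" by (auto simp: eventually_sequentially)
  then show ?thesis using wn(1) bt dM_commute[of \<kappa> w "wn n"] by (intro exI[of _ n] bexI[of _ "wn n"]) auto
qed

text \<open>On the sphere b is the negative of a, so the angular distances of c to them add up to
  pi.\<close>

lemma dM_antipode: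
  assumes S: "a \<in> MP \<kappa>" "b \<in> MP \<kappa>" "c \<in> MP \<kappa>" and k: "\<kappa> > 0" and ab: "dM \<kappa> a b = pi / sqrt \<kappa>"
  shows "dM \<kappa> a c + dM \<kappa> c b = dM \<kappa> a b"
proof -
  define h where "h = (\<lambda>P. (1 - \<kappa> * mm \<kappa> P, sqrt \<kappa> *\<^sub>R vv \<kappa> P))"
  have hh: "h P \<bullet> h Q = cos (sqrt \<kappa> * dM \<kappa> P Q)" if "P \<in> MP \<kappa>" "Q \<in> MP \<kappa>" for P Q
  proof -
    have "h P \<bullet> h Q = (1 - \<kappa> * mm \<kappa> P) * (1 - \<kappa> * mm \<kappa> Q) + \<kappa> * (vv \<kappa> P \<bullet> vv \<kappa> Q)"
      using k by (simp add: h_def flip: mult.assoc)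
    also have "\<dots> = 1 - \<kappa> * md \<kappa> (dM \<kappa> P Q)" unfolding md_dM(1)[OF that] by (simp add: algebra_simps)
    finally show ?thesis using k by (simp add: md_pos)
  qed
  have "(h a + h b) \<bullet> (h a + h b) = 0"
    using hh[OF S(1,1)] hh[OF S(2,2)] hh[OF S(1,2)] S k by (simp add: inner_add inner_commute[of "h b" "h a"] ab)
  then have "h b = - h a" by (simp add: eq_neg_iff_add_eq_0 add.commute)
  then have "cos (sqrt \<kappa> * dM \<kappa> c b) = - cos (sqrt \<kappa> * dM \<kappa> a c)"
    using hh[OF S(3,2)] hh[OF S(3,1)] dM_commute[of \<kappa> a c] by simp
  also have "\<dots> = cos (pi - sqrt \<kappa> * dM \<kappa> a c)" by simp
  finally have cos: "cos (sqrt \<kappa> * dM \<kappa> c b) = cos (pi - sqrt \<kappa> * dM \<kappa> a c)" .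
  have le: "sqrt \<kappa> * dM \<kappa> P Q \<le> pi" if "P \<in> MP \<kappa>" "Q \<in> MP \<kappa>" for P Q
    using md_dM(2)[OF that] k by (simp add: radc_def field_simps)
  have "sqrt \<kappa> * dM \<kappa> c b = pi - sqrt \<kappa> * dM \<kappa> a c"
    by (rule cos_inj_pi[OF _ _ _ _ cos]) (use le[OF S(3,2)] le[OF S(1,3)] k in auto)
  then show ?thesis using k by (simp add: ab field_simps)
qed

lemma iso_path_concat:
  assumes z1: "iso_path X a c z1" and z2: "iso_path X c b z2" and l: "mdist X a c + mdist X c b = mdist X a b"
  shows "iso_path X a b (\<lambda>s. if s \<le> mdist X a c then z1 s else z2 (s - mdist X a c))"
proof -
  define l1 l2 where "l1 = mdist X a c" and "l2 = mdist X c b"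
  have l0: "0 \<le> l1" "0 \<le> l2" "mdist X a b = l1 + l2" using l by (simp_all add: l1_def l2_def)
  have 1: "z1 0 = a" "z1 l1 = c" "\<And>s. 0 \<le> s \<Longrightarrow> s \<le> l1 \<Longrightarrow> z1 s \<in> mspace X"
    "\<And>s t. 0 \<le> s \<Longrightarrow> s \<le> l1 \<Longrightarrow> 0 \<le> t \<Longrightarrow> t \<le> l1 \<Longrightarrow> mdist X (z1 s) (z1 t) = \<bar>s - t\<bar>"
    using z1 unfolding iso_path_def l1_def by auto
  have 2: "z2 0 = c" "z2 l2 = b" "\<And>s. 0 \<le> s \<Longrightarrow> s \<le> l2 \<Longrightarrow> z2 s \<in> mspace X"
    "\<And>s t. 0 \<le> s \<Longrightarrow> s \<le> l2 \<Longrightarrow> 0 \<le> t \<Longrightarrow> t \<le> l2 \<Longrightarrow> mdist X (z2 s) (z2 t) = \<bar>s - t\<bar>"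
    using z2 unfolding iso_path_def l2_def by auto
  have M: "a \<in> mspace X" "c \<in> mspace X" "b \<in> mspace X" using 1(3)[of 0] 1(3)[of l1] 2(3)[of l2] 1(1,2) 2(2) l0 by auto
  have cross: "mdist X (z1 s) (z2 t) = l1 - s + t" if st: "0 \<le> s" "s \<le> l1" "0 \<le> t" "t \<le> l2" for s t
  proof -
    note Ms = 1(3)[OF st(1,2)] and Mt = 2(3)[OF st(3,4)]
    have d: "mdist X a (z1 s) = s" "mdist X (z1 s) c = l1 - s" "mdist X c (z2 t) = t" "mdist X (z2 t) b = l2 - t"
      using 1(4)[of 0 s] 1(4)[of s l1] 2(4)[of 0 t] 2(4)[of t l2] st l0 1(1,2) 2(1,2) by auto
    have "mdist X a b \<le> mdist X a (z1 s) + mdist X (z1 s) b" "mdist X (z1 s) b \<le> mdist X (z1 s) (z2 t) + mdist X (z2 t) b"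
      "mdist X (z1 s) (z2 t) \<le> mdist X (z1 s) c + mdist X c (z2 t)"
      using M Ms Mt by (auto intro: mdist_triangle)
    then show ?thesis using d l0 by linarith
  qed
  define z where "z = (\<lambda>s. if s \<le> l1 then z1 s else z2 (s - l1))"
  have "z s \<in> mspace X" if "0 \<le> s" "s \<le> l1 + l2" for s
    using 1(3) 2(3)[of "s - l1"] that by (auto simp: z_def)
  moreover have "z 0 = a" using l0 1(1) by (simp add: z_def)
  moreover have "z (l1 + l2) = b" using l0 1(2) 2(1,2) by (auto simp: z_def)
  moreover have "mdist X (z s) (z t) = \<bar>s - t\<bar>" if "0 \<le> s" "s \<le> l1 + l2" "0 \<le> t" "t \<le> l1 + l2" for s t
    using that 1(4)[of s t] 2(4)[of "s - l1" "t - l1"] cross[of s "t - l1"] cross[of t "s - l1"] mdist_commute[of X "z2 (s - l1)" "z1 t"]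
    by (auto simp: z_def)
  ultimately have "iso_path X a b z" unfolding iso_path_def l0(3) by simp
  then show ?thesis unfolding z_def l1_def .
qed

section \<open>The set generated by generic pairs and its closure\<close>

context rigid
begin

text \<open>A maximal correspondence may reach beyond the hull; this is the part that is generated
  from the base and is certain to have partners.\<close>

inductive_set E0 :: "(real \<times> ell2) set set" where
  E0_org: "org \<kappa> \<in> E0"
| E0_base: "i \<in> I \<Longrightarrow> 0 < t \<Longrightarrow> t < \<rho> i \<Longrightarrow> pt \<kappa> t (\<xi> i) \<in> E0"
| E0_between: "a \<in> E0 \<Longrightarrow> b \<in> E0 \<Longrightarrow> gen a b \<Longrightarrow> w \<in> MP \<kappa> \<Longrightarrow> dM \<kappa> a w + dM \<kappa> w b = dM \<kappa> a b \<Longrightarrow> w \<in> E0"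

lemma E0_rel:
  assumes R: "maxgood R" and w: "w \<in> E0"
  shows "\<exists>z. (z, w) \<in> R"
  using w
proof induction
  case E0_org
  then show ?case using good_org R unfolding maxgood_def by blast
next
  case (E0_base i t)
  then show ?case using good_base R unfolding maxgood_def by blast
next
  case (E0_between a b w)
  then show ?case using max_convex[OF R] by blast
qed

lemma E0_good: obtains R where "good R" "\<And>w. w \<in> E0 \<Longrightarrow> \<exists>z. (z, w) \<in> R"
proof -
  obtain R where R: "maxgood R" using maxgood_exists by blast
  show thesis by (rule that[of R]) (use R E0_rel in \<open>auto simp: maxgood_def\<close>)
qed

lemma E0_model: "w \<in> E0 \<Longrightarrow> w \<in> MP \<kappa>"
  using E0_good good_in(3) by metis

lemma E0_polar:
  assumes "w \<in> E0" "w \<noteq> org \<kappa>"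
  obtains r u where "w = pt \<kappa> r u" "norm u = 1" "0 < r" "rad \<kappa> r" "r = ab w"
proof -
  obtain R z where "good R" "(z, w) \<in> R" using E0_good assms(1) by metis
  then show thesis using good_polar[OF _ _ assms(2)] that by metis
qed

text \<open>It serves the case that all base segments lie on one line through the apex, where a pair
  cannot be made generic by moving off the line.\<close>

definition base_gen :: bool where
  "base_gen \<longleftrightarrow> (\<forall>i\<in>I. \<forall>j\<in>I. \<forall>s t. 0 < s \<and> s < \<rho> i \<and> 0 < t \<and> t < \<rho> j \<longrightarrow> gen (pt \<kappa> s (\<xi> i)) (pt \<kappa> t (\<xi> j)))"

text \<open>On a line no pair is independent, so \<open>good_dep\<close> applies to
  \<open>R0\<close> itself and nothing new is generated.\<close>

lemma E0_line:
  assumes u: "\<And>j. j \<in> I \<Longrightarrow> \<xi> j = u \<or> \<xi> j = - u" and w: "w \<in> E0"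
  shows "w = org \<kappa> \<or> (\<exists>i\<in>I. \<exists>t. 0 < t \<and> t < \<rho> i \<and> w = pt \<kappa> t (\<xi> i))"
proof -
  have el: "P = org \<kappa> \<or> (\<exists>i\<in>I. \<exists>t. 0 < t \<and> t < \<rho> i \<and> P = pt \<kappa> t (\<xi> i))" if "(z, P) \<in> R0" for z P
    using that by (auto simp: R0_def)
  have mult: "\<exists>c. vv \<kappa> P = c *\<^sub>R u" if "(z, P) \<in> R0" for z P
    using el[OF that]
  proof
    assume "P = org \<kappa>"
    then have "vv \<kappa> P = 0 *\<^sub>R u" by simp
    then show ?thesis ..
  next
    assume "\<exists>i\<in>I. \<exists>t. 0 < t \<and> t < \<rho> i \<and> P = pt \<kappa> t (\<xi> i)"
    then obtain i t where i: "i \<in> I" "0 < t" "t < \<rho> i" "P = pt \<kappa> t (\<xi> i)" by blast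
    have "vv \<kappa> P = sn \<kappa> t *\<^sub>R \<xi> i" unfolding i(4) by (rule mv_xi(2)[OF i(1-3)])
    then have "vv \<kappa> P = sn \<kappa> t *\<^sub>R u \<or> vv \<kappa> P = (- sn \<kappa> t) *\<^sub>R u" using u[OF i(1)] by auto
    then show ?thesis by blast
  qed
  have "\<exists>z. (z, w) \<in> R0"
    using w
  proof induction
    case E0_org
    then show ?case by (auto simp: R0_def)
  next
    case (E0_base i t)
    then show ?case by (auto simp: R0_def)
  next
    case (E0_between a b w)
    then obtain za zb where z: "(za, a) \<in> R0" "(zb, b) \<in> R0" by blast
    obtain c c' where c: "vv \<kappa> a = c *\<^sub>R u" "vv \<kappa> b = c' *\<^sub>R u" using mult[OF z(1)] mult[OF z(2)] by blast
    have "\<not> indep a b"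
    proof
      assume i: "indep a b"
      have "c' *\<^sub>R vv \<kappa> a + (- c) *\<^sub>R vv \<kappa> b = 0" by (simp add: c)
      then have "c' = 0" "- c = 0" using i unfolding indep_def by blast+
      then have "1 *\<^sub>R vv \<kappa> a + 0 *\<^sub>R vv \<kappa> b = 0" by (simp add: c)
      then show False using i unfolding indep_def by (metis zero_neq_one)
    qed
    then show ?case using good_dep[OF good_R0 z E0_between.hyps(3) _ E0_between.hyps(4,5)] by blast
  qed
  then show ?thesis using el by blast
qed

lemma gen_org: "rad \<kappa> (ab b) \<Longrightarrow> b \<in> MP \<kappa> \<Longrightarrow> gen (org \<kappa>) b"
  unfolding gen_def by (rule small_mono[of \<kappa> "2 * ab b"]) (simp_all add: org_model)

lemma E0_rad: "w \<in> E0 \<Longrightarrow> rad \<kappa> (ab w)"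
  using E0_good good_rad by metis

text \<open>A pair that fails to be generic lies on a great circle through the origin; it becomes
  generic when one point is moved towards a base point off that circle.\<close>
lemma gen_approx:
  assumes bg: "base_gen" and a: "a \<in> E0" and b: "b \<in> E0" and e: "0 < e"
  shows "\<exists>a'\<in>E0. dM \<kappa> a a' < e \<and> gen a' b"
proof (cases "gen a b")
  case True
  then show ?thesis using a e E0_model[OF a] by (intro bexI[of _ a]) auto
next
  case ng: False
  note aM = E0_model[OF a] and bM = E0_model[OF b]
  have ao: "a \<noteq> org \<kappa>" using ng gen_org[OF E0_rad[OF b] bM] by auto
  have bo: "b \<noteq> org \<kappa>" using ng gen_org[OF E0_rad[OF a] aM] gen_sym[of a b] by auto
  obtain ra u where A: "a = pt \<kappa> ra u" "norm u = 1" "0 < ra" "rad \<kappa> ra" "ra = ab a" by (rule E0_polar[OF a ao])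
  obtain rb ub where B: "b = pt \<kappa> rb ub" "norm ub = 1" "0 < rb" "rad \<kappa> rb" "rb = ab b" by (rule E0_polar[OF b bo])
  have sab: "0 < sn \<kappa> ra" "0 < sn \<kappa> rb" using A B by (auto intro!: sn_gt_0)
  have va: "vv \<kappa> a = sn \<kappa> ra *\<^sub>R u" unfolding A(1) by (rule mv_pt(2)[OF less_imp_le[OF A(3)] rad_radc[OF A(4)] A(2)])
  have vb: "vv \<kappa> b = sn \<kappa> rb *\<^sub>R ub" unfolding B(1) by (rule mv_pt(2)[OF less_imp_le[OF B(3)] rad_radc[OF B(4)] B(2)])
  have "norm (vv \<kappa> b) *\<^sub>R vv \<kappa> a + norm (vv \<kappa> a) *\<^sub>R vv \<kappa> b = 0"
    by (rule not_small_opposite[OF aM bM]) (use ng in \<open>simp add: gen_def\<close>)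
  then have "(sn \<kappa> rb * sn \<kappa> ra) *\<^sub>R (u + ub) = 0"
    using A(2) B(2) sab by (simp add: va vb scaleR_add_right mult.commute)
  then have "u + ub = 0" using sab by simp
  then have ub: "ub = - u" by (simp add: eq_neg_iff_add_eq_0 add.commute)
  show ?thesis
  \<comment> \<open>If all base directions are on the line of u, then a and b are base points and
    generic by \<open>base_gen\<close>, a contradiction.\<close>
  proof (cases "\<forall>j\<in>I. \<xi> j = u \<or> \<xi> j = - u")
    case True
    obtain i s where i: "i \<in> I" "0 < s" "s < \<rho> i" "a = pt \<kappa> s (\<xi> i)" using E0_line[OF _ a, of u] True ao by blast
    obtain j t where j: "j \<in> I" "0 < t" "t < \<rho> j" "b = pt \<kappa> t (\<xi> j)" using E0_line[OF _ b, of u] True bo by blast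
    have "gen a b" using bg i(1-3) j(1-3) unfolding base_gen_def i(4) j(4) by blast
    then show ?thesis using ng by blast
  next
    case False
    then obtain j where j: "j \<in> I" "\<xi> j \<noteq> u" "\<xi> j \<noteq> - u" by blast
    define \<tau> where "\<tau> = \<rho> j / 2"
    have tau: "0 < \<tau>" "\<tau> < \<rho> j" using rho(1)[OF j(1)] by (auto simp: \<tau>_def)
    define c where "c = pt \<kappa> \<tau> (\<xi> j)"
    have c: "c \<in> E0" unfolding c_def by (rule E0_base[OF j(1) tau])
    note cM = E0_model[OF c]
    have vc: "vv \<kappa> c = sn \<kappa> \<tau> *\<^sub>R \<xi> j" unfolding c_def by (rule mv_xi(2)[OF j(1) tau])
    have snt: "0 < sn \<kappa> \<tau>" using rad_mono[OF rho(2)[OF j(1)]] tau by (intro sn_gt_0) auto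
    have nu: "norm (\<xi> j) = 1" by (rule unit[OF j(1)])
    have npar: False if "x *\<^sub>R \<xi> j = y *\<^sub>R u" "x \<noteq> 0" for x y
    proof -
      have "\<bar>x\<bar> = \<bar>y\<bar>" using arg_cong[OF that(1), of norm] nu A(2) by simp
      then have "y = x \<or> y = - x" by auto
      then have "x *\<^sub>R \<xi> j = x *\<^sub>R u \<or> x *\<^sub>R \<xi> j = x *\<^sub>R (- u)" using that(1) by auto
      then show False using j(2,3) that(2) unfolding scaleR_cancel_left by blast
    qed
    have gac: "gen a c"
    proof (rule ccontr)
      assume "\<not> gen a c"
      then have "norm (vv \<kappa> c) *\<^sub>R vv \<kappa> a + norm (vv \<kappa> a) *\<^sub>R vv \<kappa> c = 0"
        by (intro not_small_opposite[OF aM cM]) (simp add: gen_def)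
      then have "(sn \<kappa> ra * sn \<kappa> \<tau>) *\<^sub>R \<xi> j = (- (sn \<kappa> \<tau> * sn \<kappa> ra)) *\<^sub>R u"
        using A(2) nu sab snt by (simp add: va vc eq_neg_iff_add_eq_0 add.commute)
      then show False by (rule npar) (use sab snt in simp)
    qed
    have "a \<noteq> c"
    proof
      assume "a = c"
      then have "sn \<kappa> \<tau> *\<^sub>R \<xi> j = sn \<kappa> ra *\<^sub>R u" using va vc by simp
      then show False by (rule npar) (use snt in simp)
    qed
    then have l0: "0 < dM \<kappa> a c" using dM_zero[OF aM cM] by (simp add: less_le)
    have rl: "rad \<kappa> (dM \<kappa> a c)" by (rule gen_rad[OF aM cM gac])
    define s where "s = min (e / 2) (dM \<kappa> a c / 2)"
    have s: "0 < s" "s < e" "s < dM \<kappa> a c" using e l0 by (auto simp: s_def)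
    obtain a' where a': "a' \<in> MP \<kappa>" "dM \<kappa> a a' = s" "dM \<kappa> a' c = dM \<kappa> a c - s"
      by (rule point_between[OF aM cM _ _ rl, of s]) (use s in auto)
    have bt: "dM \<kappa> a a' + dM \<kappa> a' c = dM \<kappa> a c" using a' by simp
    have aE: "a' \<in> E0" by (rule E0_between[OF a c gac a'(1) bt])
    have sns: "0 < sn \<kappa> s" "0 < sn \<kappa> (dM \<kappa> a c)"
      using rad_mono[OF rl] s l0 rl by (auto intro!: sn_gt_0)
    have hat: "sn \<kappa> (dM \<kappa> a c) *\<^sub>R hat \<kappa> a' = sn \<kappa> (dM \<kappa> a' c) *\<^sub>R hat \<kappa> a + sn \<kappa> s *\<^sub>R hat \<kappa> c"
      using between_model(1)[OF aM cM a'(1) bt rl] a'(2) by simp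
    have v': "sn \<kappa> (dM \<kappa> a c) *\<^sub>R vv \<kappa> a' = sn \<kappa> (dM \<kappa> a' c) *\<^sub>R vv \<kappa> a + sn \<kappa> s *\<^sub>R vv \<kappa> c"
      using arg_cong[OF hat, of snd] by (simp add: hat_def)
    have "gen a' b"
    proof (rule ccontr)
      assume "\<not> gen a' b"
      then have o: "norm (vv \<kappa> b) *\<^sub>R vv \<kappa> a' + norm (vv \<kappa> a') *\<^sub>R vv \<kappa> b = 0"
        by (intro not_small_opposite[OF a'(1) bM]) (simp add: gen_def)
      have "norm (vv \<kappa> b) = sn \<kappa> rb" using B(2) sab by (simp add: vb)
      then have "sn \<kappa> rb *\<^sub>R vv \<kappa> a' = sn \<kappa> rb *\<^sub>R (norm (vv \<kappa> a') *\<^sub>R u)"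
        using o by (simp add: vb ub mult.commute)
      then have "vv \<kappa> a' = norm (vv \<kappa> a') *\<^sub>R u" using sab unfolding scaleR_cancel_left by auto
      then have "sn \<kappa> (dM \<kappa> a c) *\<^sub>R vv \<kappa> a' = (sn \<kappa> (dM \<kappa> a c) * norm (vv \<kappa> a')) *\<^sub>R u" by (metis scaleR_scaleR)
      then have "(sn \<kappa> s * sn \<kappa> \<tau>) *\<^sub>R \<xi> j = (sn \<kappa> (dM \<kappa> a c) * norm (vv \<kappa> a') - sn \<kappa> (dM \<kappa> a' c) * sn \<kappa> ra) *\<^sub>R u"
        unfolding v' by (simp add: va vc scaleR_diff_left eq_diff_eq add.commute)
      then show False by (rule npar) (use sns snt in simp)
    qed
    then show ?thesis using aE a'(2) s(2) by blast
  qed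
qed

text \<open>For points less than pi / sqrt \<kappa> apart, approximate the pair by generic pairs of
  \<open>E0\<close> and their segment by \<open>segment_approx\<close>. An antipodal pair has no
  unique segment; there two short segments are joined at a third point of \<open>E0\<close>.\<close>

lemma closure_E0_convex:
  assumes bg: base_gen and I: "I \<noteq> {}"
  shows "weakly_convex (model_space \<kappa>) (mtopology_of (model_space \<kappa>) closure_of E0)"
proof -
  define J where "J = mtopology_of (model_space \<kappa>) closure_of E0"
  have J: "P \<in> J \<longleftrightarrow> P \<in> MP \<kappa> \<and> (\<forall>e>0. \<exists>Q\<in>E0. dM \<kappa> P Q < e)" for P
    unfolding J_def in_closure_of_metric mspace_model_space mdist_model_space using E0_model by blast
  have short: "\<exists>z. iso_path (model_space \<kappa>) a b z \<and> z ` {0..dM \<kappa> a b} \<subseteq> J"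
    if ab: "a \<in> J" "b \<in> J" and l: "rad \<kappa> (dM \<kappa> a b)" for a b
  proof -
    have aM: "a \<in> MP \<kappa>" and bM: "b \<in> MP \<kappa>" using ab J by blast+
    have ex: "\<exists>q. fst q \<in> E0 \<and> snd q \<in> E0 \<and> dM \<kappa> a (fst q) < 2 * inverse (real (Suc n)) \<and> dM \<kappa> b (snd q) < 2 * inverse (real (Suc n)) \<and> gen (fst q) (snd q)" for n
    proof -
      have e: "0 < inverse (real (Suc n))" by simp
      obtain a0 where a0: "a0 \<in> E0" "dM \<kappa> a a0 < inverse (real (Suc n))" using ab(1) e unfolding J by blast
      obtain b0 where b0: "b0 \<in> E0" "dM \<kappa> b b0 < inverse (real (Suc n))" using ab(2) e unfolding J by blast
      obtain a1 where a1: "a1 \<in> E0" "dM \<kappa> a0 a1 < inverse (real (Suc n))" "gen a1 b0" using gen_approx[OF bg a0(1) b0(1) e] by blast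
      have "dM \<kappa> a a1 \<le> dM \<kappa> a a0 + dM \<kappa> a0 a1" by (rule dM_tri[OF aM E0_model[OF a0(1)] E0_model[OF a1(1)]])
      then have "dM \<kappa> a a1 < 2 * inverse (real (Suc n))" using a0(2) a1(2) by linarith
      moreover have "dM \<kappa> b b0 < 2 * inverse (real (Suc n))" using b0(2) e by linarith
      ultimately show ?thesis using a1 b0 by (intro exI[of _ "(a1, b0)"]) simp
    qed
    have "\<exists>q. \<forall>n. fst (q n) \<in> E0 \<and> snd (q n) \<in> E0 \<and> dM \<kappa> a (fst (q n)) < 2 * inverse (real (Suc n)) \<and>
      dM \<kappa> b (snd (q n)) < 2 * inverse (real (Suc n)) \<and> gen (fst (q n)) (snd (q n))"
      by (rule choice, rule allI, rule ex)
    then obtain q where q: "\<And>n. fst (q n) \<in> E0" "\<And>n. snd (q n) \<in> E0" "\<And>n. dM \<kappa> a (fst (q n)) < 2 * inverse (real (Suc n))"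
      "\<And>n. dM \<kappa> b (snd (q n)) < 2 * inverse (real (Suc n))" "\<And>n. gen (fst (q n)) (snd (q n))"
      by blast
    have lim0: "(\<lambda>n. 2 * inverse (real (Suc n))) \<longlonglongrightarrow> 0"
      using tendsto_mult[OF tendsto_const LIMSEQ_inverse_real_of_nat, of 2] by simp
    have lim: "(\<lambda>n. dM \<kappa> P (f n)) \<longlonglongrightarrow> 0" if f: "\<And>n. dM \<kappa> P (f n) < 2 * inverse (real (Suc n))" for P f
    proof (rule tendsto_sandwich[OF _ _ tendsto_const lim0])
      show "\<forall>\<^sub>F n in sequentially. 0 \<le> dM \<kappa> P (f n)" by (intro always_eventually allI dM_nonneg)
      show "\<forall>\<^sub>F n in sequentially. dM \<kappa> P (f n) \<le> 2 * inverse (real (Suc n))"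
        by (intro always_eventually allI less_imp_le f)
    qed
    note qM = E0_model[OF q(1)] E0_model[OF q(2)]
    obtain z where z: "unique_path (model_space \<kappa>) a b z" using model_unique_path[OF aM bM l] by blast
    then have zi: "iso_path (model_space \<kappa>) a b z" unfolding unique_path_def by blast
    have "z s \<in> J" if s: "0 \<le> s" "s \<le> dM \<kappa> a b" for s
    proof -
      have zs: "z s \<in> MP \<kappa>" "dM \<kappa> a (z s) = s" "dM \<kappa> (z s) b = dM \<kappa> a b - s"
      proof -
        have D: "dM \<kappa> (z s') (z t') = \<bar>s' - t'\<bar>" "z s' \<in> MP \<kappa>" if "s' \<in> {0..dM \<kappa> a b}" "t' \<in> {0..dM \<kappa> a b}" for s' t'
          using zi that unfolding iso_path_def mspace_model_space mdist_model_space by auto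
        have zz: "z 0 = a" "z (dM \<kappa> a b) = b" using zi unfolding iso_path_def mdist_model_space by auto
        show "z s \<in> MP \<kappa>" "dM \<kappa> a (z s) = s" "dM \<kappa> (z s) b = dM \<kappa> a b - s"
          using D[of s s] D(1)[of 0 s] D(1)[of s "dM \<kappa> a b"] s zz by simp_all
      qed
      have bt: "dM \<kappa> a (z s) + dM \<kappa> (z s) b = dM \<kappa> a b" using zs by simp
      have "\<exists>Q\<in>E0. dM \<kappa> (z s) Q < e" if e: "0 < e" for e
      proof -
        obtain n w where w: "w \<in> MP \<kappa>" "dM \<kappa> (fst (q n)) w + dM \<kappa> w (snd (q n)) = dM \<kappa> (fst (q n)) (snd (q n))" "dM \<kappa> (z s) w < e"
          using segment_approx[OF aM bM qM zs(1) bt l gen_rad[OF qM q(5)] lim[OF q(3)] lim[OF q(4)] e] by blast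
        have "w \<in> E0" by (rule E0_between[OF q(1,2,5) w(1,2)])
        then show ?thesis using w(3) by blast
      qed
      then show ?thesis using J zs(1) by blast
    qed
    then show ?thesis using zi by auto
  qed
  have "\<exists>z. iso_path (model_space \<kappa>) a b z \<and> z ` {0..dM \<kappa> a b} \<subseteq> J" if ab: "a \<in> J" "b \<in> J" for a b
  proof (cases "rad \<kappa> (dM \<kappa> a b)")
    case True
    then show ?thesis by (rule short[OF ab])
  next
    case False
    have aM: "a \<in> MP \<kappa>" and bM: "b \<in> MP \<kappa>" using ab J by blast+
    have k: "\<kappa> > 0" "dM \<kappa> a b = pi / sqrt \<kappa>" using False md_dM(2)[OF aM bM] by (auto simp: rad_def radc_def)
    have EJ: "P \<in> J" if P: "P \<in> E0" for P
      unfolding J using E0_model[OF P] by (auto intro!: bexI[OF _ P])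
    \<comment> \<open>If the apex is one of a and b, the other has radius pi / sqrt \<kappa>, so a
      base point, whose radius is strictly in between, differs from both.\<close>
    obtain c where c: "c \<in> E0" "c \<noteq> a" "c \<noteq> b"
    proof (cases "org \<kappa> = a \<or> org \<kappa> = b")
      case False
      then show thesis using that[OF E0_org] by blast
    next
      case True
      obtain i where i: "i \<in> I" using I by blast
      define t where "t = \<rho> i / 2"
      have t: "0 < t" "t < \<rho> i" using rho(1)[OF i] by (auto simp: t_def)
      have o: "ab (pt \<kappa> t (\<xi> i)) = t" by (rule ab_xi[OF i t])
      have "rad \<kappa> t" using rad_mono[OF rho(2)[OF i]] t by simp
      then have t': "t \<noteq> 0" "t \<noteq> pi / sqrt \<kappa>" using t k by (auto simp: rad_def)
      have ne: "pt \<kappa> t (\<xi> i) \<noteq> P" if "ab P = 0 \<or> ab P = pi / sqrt \<kappa>" for P using o that t' by auto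
      have "ab a = 0 \<or> ab a = pi / sqrt \<kappa>" "ab b = 0 \<or> ab b = pi / sqrt \<kappa>"
        using True k(2) dM_self[OF aM] dM_self[OF bM] dM_commute[of \<kappa> a b] by auto
      then show thesis using that[OF E0_base[OF i t]] ne by blast
    qed
    note cM = E0_model[OF c(1)]
    have sum: "dM \<kappa> a c + dM \<kappa> c b = dM \<kappa> a b" by (rule dM_antipode[OF aM bM cM k])
    have pos: "0 < dM \<kappa> a c" "0 < dM \<kappa> c b" using dM_zero[OF aM cM] dM_zero[OF cM bM] c by (auto simp: less_le)
    have "rad \<kappa> (dM \<kappa> a c)" "rad \<kappa> (dM \<kappa> c b)" using sum pos k by (auto simp: rad_def)
    then obtain z1 z2 where z: "iso_path (model_space \<kappa>) a c z1" "z1 ` {0..dM \<kappa> a c} \<subseteq> J"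
      "iso_path (model_space \<kappa>) c b z2" "z2 ` {0..dM \<kappa> c b} \<subseteq> J"
      using short[OF ab(1) EJ[OF c(1)]] short[OF EJ[OF c(1)] ab(2)] by blast
    define z where "z = (\<lambda>s. if s \<le> dM \<kappa> a c then z1 s else z2 (s - dM \<kappa> a c))"
    have "iso_path (model_space \<kappa>) a b z"
      using iso_path_concat[OF z(1,3)] sum unfolding z_def mdist_model_space by blast
    moreover have "z s \<in> J" if "0 \<le> s" "s \<le> dM \<kappa> a b" for s
    proof (cases "s \<le> dM \<kappa> a c")
      case True
      then show ?thesis using z(2) that by (auto simp: z_def)
    next
      case False
      then have "s - dM \<kappa> a c \<in> {0..dM \<kappa> c b}" using sum that by auto
      then have "z2 (s - dM \<kappa> a c) \<in> J" using z(4) by blast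
      then show ?thesis using False by (simp add: z_def)
    qed
    ultimately show ?thesis by auto
  qed
  then show ?thesis unfolding weakly_convex_def J_def[symmetric] mdist_model_space by blast
qed

end

section \<open>Distances between points of the base segments\<close>

context cbb
begin

text \<open>\<open>Phi_ray_mono\<close> gives one inequality between \<open>Phi\<close> at a point
  of a base segment and its model value against every base point, so \<open>half_match\<close> makes
  it an equality. For two such points \<open>match_inner\<close> gives one inequality and a second
  use of \<open>Phi_ray_mono\<close> the other.\<close>

lemma base_rays:
  assumes b: "base_at p I x \<beta>" and S: "y \<in> S" "z \<in> S" and ij: "i \<in> I" "j \<in> I"
    and y: "d p y + d y (x i) = d p (x i)" and z: "d p z + d z (x j) = d p (x j)"
    and D: "\<And>k. k \<in> I \<Longrightarrow> 0 < d p (x k) \<and> rad \<kappa> (d p (x k))"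
  shows "Phi p y z = (sn \<kappa> (d p y) * sn \<kappa> (d p z) / (sn \<kappa> (d p (x i)) * sn \<kappa> (d p (x j)))) * (\<beta> i \<bullet> \<beta> j)"
    and "radc \<kappa> (d y z)"
proof -
  have fin: "finite I" and p: "p \<in> S" and xS: "\<And>k. k \<in> I \<Longrightarrow> x k \<in> S"
    and sm: "\<And>k l. k \<in> I \<Longrightarrow> l \<in> I \<Longrightarrow> small \<kappa> (d p (x k) + d p (x l) + d (x k) (x l))"
    and ph: "\<And>k l. k \<in> I \<Longrightarrow> l \<in> I \<Longrightarrow> Phi p (x k) (x l) = \<beta> k \<bullet> \<beta> l"
    using b unfolding base_at_def by blast+
  have sD: "0 < sn \<kappa> (d p (x k))" if "k \<in> I" for k using D[OF that] by (auto intro: sn_gt_0)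
  define V where "V k w = (sn \<kappa> (d p w) / sn \<kappa> (d p (x k))) *\<^sub>R \<beta> k" for k w
  have ray: "small \<kappa> (d p w + d p (x l) + d w (x l)) \<and> Phi p w (x l) = V k w \<bullet> \<beta> l \<and> rad \<kappa> (d p w)
      \<and> V k w \<in> lin I \<beta> \<and> V k w \<bullet> V k w = (sn \<kappa> (d p w))\<^sup>2"
    if k: "k \<in> I" and w: "w \<in> S" "d p w + d w (x k) = d p (x k)" and l: "l \<in> I" for k w l
  proof -
    have sw: "small \<kappa> (d p w + d p (x l) + d w (x l))" if "l \<in> I" for l
      by (rule small_shrink[OF p xS[OF k] xS[OF that] w sm[OF k that]])
    have rw: "rad \<kappa> (d p w)"
      by (rule rad_mono[of _ "d p (x k)"]) (use D[OF k] w(2) nonneg[of w "x k"] in \<open>simp_all del: nonneg\<close>)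
    have "Phi p w (x l) \<le> V k w \<bullet> \<beta> l" if "l \<in> I" for l
      using Phi_ray_mono[OF p xS[OF k] xS[OF that] w sm[OF k that]] sD[OF k]
      by (simp add: V_def ph[OF k that] pos_le_divide_eq mult.commute)
    then have "Phi p w (x l) = V k w \<bullet> \<beta> l" by (intro half_match[OF b w(1) rw sw _ l])
    moreover have "V k w \<bullet> V k w = (sn \<kappa> (d p w))\<^sup>2"
    proof -
      have "\<beta> k \<bullet> \<beta> k = (sn \<kappa> (d p (x k)))\<^sup>2" using ph[OF k k] Phi_self[of p "x k"] by simp
      then show ?thesis using sD[OF k] unfolding V_def inner_scaleR_left inner_scaleR_right by (simp add: power2_eq_square)
    qed
    ultimately show ?thesis using sw[OF l] rw lin_scale[OF lin_base[OF fin k]] by (simp add: V_def)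
  qed
  note Y = ray[OF ij(1) S(1) y] and Z = ray[OF ij(2) S(2) z]
  have smyz: "small \<kappa> (d p z + d p y + d z y)"
    by (rule small_shrink[OF p xS[OF ij(2)] S(1,2) z]) (use Y[OF ij(2)] sym[of y] in \<open>simp add: add.commute\<close>)
  then have smzy: "small \<kappa> (d p y + d p z + d y z)" using sym[of y z] by (simp add: add.commute)
  have "V i y \<bullet> V j z \<le> Phi p y z"
    by (rule match_inner[OF b S(1) _ S(2)]) (use Y Z ij smzy in blast)+
  moreover have "Phi p y z \<le> V i y \<bullet> V j z"
  proof -
    have "small \<kappa> (d p (x j) + d p y + d (x j) y)" using Y[OF ij(2)] sym[of y "x j"] by (simp add: add.commute)
    from Phi_ray_mono[OF p xS[OF ij(2)] S(1,2) z this]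
    have "sn \<kappa> (d p (x j)) * Phi p z y \<le> sn \<kappa> (d p z) * Phi p (x j) y" .
    moreover have "Phi p (x j) y = V i y \<bullet> \<beta> j" using Y[OF ij(2)] Phi_sym[of p "x j" y] by simp
    ultimately show ?thesis using sD[OF ij(2)] Phi_sym[of p z y]
      by (simp add: V_def[of j] pos_le_divide_eq mult.commute)
  qed
  ultimately have "Phi p y z = V i y \<bullet> V j z" by simp
  then show "Phi p y z = (sn \<kappa> (d p y) * sn \<kappa> (d p z) / (sn \<kappa> (d p (x i)) * sn \<kappa> (d p (x j)))) * (\<beta> i \<bullet> \<beta> j)"
    by (simp add: V_def mult_ac)
  have "2 * d y z \<le> d p y + d p z + d y z" using tri[OF S(1) p S(2)] sym[of y p] by simp
  then have "small \<kappa> (2 * d y z)" by (rule small_mono[OF smzy])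
  then show "radc \<kappa> (d y z)" by (simp add: rad_radc)
qed

lemma base_rays_dist:
  assumes b: "base_at p I x (\<lambda>i. sn \<kappa> (d p (x i)) *\<^sub>R \<xi> i)" and S: "y \<in> S" "z \<in> S" and ij: "i \<in> I" "j \<in> I"
    and y: "d p y + d y (x i) = d p (x i)" and z: "d p z + d z (x j) = d p (x j)"
    and D: "\<And>k. k \<in> I \<Longrightarrow> 0 < d p (x k) \<and> rad \<kappa> (d p (x k))" and unit: "\<And>k. k \<in> I \<Longrightarrow> norm (\<xi> k) = 1"
  shows "d y z = dM \<kappa> (pt \<kappa> (d p y) (\<xi> i)) (pt \<kappa> (d p z) (\<xi> j))"
proof (rule md_inj)
  have ry: "radc \<kappa> (d p y)" by (rule radc_mono[of _ "d p (x i)"]) (use D[OF ij(1)] rad_radc y nonneg[of y "x i"] in \<open>auto simp del: nonneg\<close>)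
  have rz: "radc \<kappa> (d p z)" by (rule radc_mono[of _ "d p (x j)"]) (use D[OF ij(2)] rad_radc z nonneg[of z "x j"] in \<open>auto simp del: nonneg\<close>)
  note P = pt_model[OF nonneg ry unit[OF ij(1)]] and Q = pt_model[OF nonneg rz unit[OF ij(2)]]
  show "radc \<kappa> (dM \<kappa> (pt \<kappa> (d p y) (\<xi> i)) (pt \<kappa> (d p z) (\<xi> j)))" by (rule md_dM(2)[OF P Q])
  show "radc \<kappa> (d y z)" by (rule base_rays(2)[OF b S ij y z D])
  have sD: "0 < sn \<kappa> (d p (x k))" if "k \<in> I" for k using D[OF that] by (auto intro: sn_gt_0)
  have "Phi p y z = sn \<kappa> (d p y) * sn \<kappa> (d p z) * (\<xi> i \<bullet> \<xi> j)"
    using base_rays(1)[OF b S ij y z D] sD[OF ij(1)] sD[OF ij(2)] by simp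
  then show "md \<kappa> (d y z) = md \<kappa> (dM \<kappa> (pt \<kappa> (d p y) (\<xi> i)) (pt \<kappa> (d p z) (\<xi> j)))"
    unfolding md_dM(1)[OF P Q] mv_pt[OF nonneg ry unit[OF ij(1)]] mv_pt[OF nonneg rz unit[OF ij(2)]]
    by (simp add: Phi_def algebra_simps)
qed simp_all

end

lemma conv_steps_superset: "E \<subseteq> (\<Union>n. (conv_step X ^^ n) E)"
proof
  fix y assume "y \<in> E"
  then have "y \<in> (conv_step X ^^ 0) E" by simp
  then show "y \<in> (\<Union>n. (conv_step X ^^ n) E)" by blast
qed

section \<open>Rigidity\<close>

text \<open>The nondegenerate case, with the sum already expressed by \<open>md\<close>. The map c
  embeds the space in its ultrapower as constant sequences.\<close>

lemma rigidity:
  assumes X: "alexandrov_space \<kappa> X" and p: "p \<in> mspace X" and I: "finite I" "I \<noteq> {}"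
    and x: "\<And>i. i \<in> I \<Longrightarrow> x i \<in> mspace X" "\<And>i. i \<in> I \<Longrightarrow> 0 < mdist X p (x i)"
    and sm: "\<And>i j. i \<in> I \<Longrightarrow> j \<in> I \<Longrightarrow> small \<kappa> (mdist X p (x i) + mdist X p (x j) + mdist X (x i) (x j))"
    and mu: "\<And>i. i \<in> I \<Longrightarrow> 0 < \<mu> i"
    and zero: "(\<Sum>i\<in>I. \<Sum>j\<in>I. \<mu> i * \<mu> j * (md \<kappa> (mdist X p (x i)) + md \<kappa> (mdist X p (x j)) - md \<kappa> (mdist X (x i) (x j))
        - \<kappa> * md \<kappa> (mdist X p (x i)) * md \<kappa> (mdist X p (x j)))) = 0"
  shows "\<exists>f. isometric_embedding (submetric X (metric_between X {p} (x ` I))) (model_space \<kappa>) f \<and>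
           isometric (submetric X (closed_conv X (metric_between X {p} (x ` I))))
             (submetric (model_space \<kappa>) (closed_conv (model_space \<kappa>) (f ` metric_between X {p} (x ` I))))"
proof -
  define D where "D i = mdist X p (x i)" for i
  define c :: "'a \<Rightarrow> nat \<Rightarrow> 'a" where "c y = (\<lambda>_. y)" for y
  have cS: "c y \<in> seqs X" if "y \<in> mspace X" for y unfolding c_def by (rule const_seqs[OF that])
  have uc: "udist X (c y) (c z) = mdist X y z" if "y \<in> mspace X" "z \<in> mspace X" for y z unfolding c_def by (rule udist_const[OF that])
  interpret C: cbb \<kappa> "seqs X" "udist X" by (rule cbb_ultrapower[OF X])
  have Phi: "C.Phi (c p) (c (x i)) (c (x j)) = md \<kappa> (mdist X p (x i)) + md \<kappa> (mdist X p (x j)) - md \<kappa> (mdist X (x i) (x j))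
        - \<kappa> * md \<kappa> (mdist X p (x i)) * md \<kappa> (mdist X p (x j))" if "i \<in> I" "j \<in> I" for i j
    using that p x(1) by (simp add: C.Phi_def uc)
  have uD: "udist X (c p) (c (x i)) = D i" if "i \<in> I" for i using that p x(1) by (simp add: uc D_def)
  have D: "0 < D i \<and> rad \<kappa> (D i)" if "i \<in> I" for i
  proof -
    have "mdist X (x i) (x i) = 0" using x(1)[OF that] by simp
    then have "small \<kappa> (2 * D i)" using sm[OF that that] unfolding D_def by (simp del: small_double)
    then show ?thesis using x(2)[OF that] by (simp add: D_def)
  qed
  have sD: "0 < sn \<kappa> (D i)" if "i \<in> I" for i using D[OF that] by (auto intro: sn_gt_0)
  have smu: "small \<kappa> (udist X (c p) (c (x i)) + udist X (c p) (c (x j)) + udist X (c (x i)) (c (x j)))" if "i \<in> I" "j \<in> I" for i j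
    using sm[OF that] that p x(1) by (simp add: uc)
  have zero': "(\<Sum>i\<in>I. \<Sum>j\<in>I. \<mu> i * \<mu> j * C.Phi (c p) (c (x i)) (c (x j))) = 0"
    unfolding zero[symmetric] by (intro sum.cong refl) (simp add: Phi)
  obtain V :: "'b \<Rightarrow> ell2" where V: "\<And>i j. i \<in> I \<Longrightarrow> j \<in> I \<Longrightarrow> V i \<bullet> V j = C.Phi (c p) (c (x i)) (c (x j))"
    using gram_realization[OF I(1) C.Phi_sym C.Phi_psd[OF I(1) cS[OF p] cS[OF x(1)] mu smu zero']] by blast
  define \<xi> where "\<xi> i = V i /\<^sub>R sn \<kappa> (D i)" for i
  have Vx: "sn \<kappa> (D i) *\<^sub>R \<xi> i = V i" if "i \<in> I" for i using sD[OF that] by (simp add: \<xi>_def)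
  have normV: "norm (V i) = sn \<kappa> (D i)" if "i \<in> I" for i
    unfolding norm_eq_sqrt_inner V[OF that that] C.Phi_self uD[OF that] using sD[OF that] by simp
  have unit: "norm (\<xi> i) = 1" if "i \<in> I" for i using normV[OF that] sD[OF that] by (simp add: \<xi>_def)
  \<comment> \<open>The squared norm of this sum is the quadratic form at \<mu>, which is 0.\<close>
  have bal: "(\<Sum>i\<in>I. \<mu> i *\<^sub>R V i) = 0"
  proof -
    have "(\<Sum>i\<in>I. \<mu> i *\<^sub>R V i) \<bullet> (\<Sum>i\<in>I. \<mu> i *\<^sub>R V i) = (\<Sum>i\<in>I. \<Sum>j\<in>I. \<mu> i * \<mu> j * (V j \<bullet> V i))"
      by (simp add: inner_sum_left inner_sum_right sum_distrib_left mult.assoc)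
    also have "\<dots> = 0" unfolding zero'[symmetric] by (intro sum.cong refl, subst inner_commute) (simp add: V)
    finally show ?thesis by simp
  qed
  have base: "C.base_at (c p) I (\<lambda>i. c (x i)) (\<lambda>i. sn \<kappa> (udist X (c p) (c (x i))) *\<^sub>R \<xi> i)"
    unfolding C.base_at_def
  proof (intro conjI ballI)
    show "finite I" "c p \<in> seqs X" using I cS p by auto
    show "c (x i) \<in> seqs X" if "i \<in> I" for i by (rule cS[OF x(1)[OF that]])
    fix i j assume ij: "i \<in> I" "j \<in> I"
    show "small \<kappa> (udist X (c p) (c (x i)) + udist X (c p) (c (x j)) + udist X (c (x i)) (c (x j)))" by (rule smu[OF ij])
    show "C.Phi (c p) (c (x i)) (c (x j)) = (sn \<kappa> (udist X (c p) (c (x i))) *\<^sub>R \<xi> i) \<bullet> (sn \<kappa> (udist X (c p) (c (x j))) *\<^sub>R \<xi> j)"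
      unfolding uD[OF ij(1)] uD[OF ij(2)] Vx[OF ij(1)] Vx[OF ij(2)] V[OF ij] ..
  next
    have "(\<Sum>i\<in>I. \<mu> i *\<^sub>R sn \<kappa> (udist X (c p) (c (x i))) *\<^sub>R \<xi> i) = (\<Sum>i\<in>I. \<mu> i *\<^sub>R V i)"
      by (rule sum.cong[OF refl]) (simp only: uD Vx)
    then show "\<exists>\<nu>. (\<forall>i\<in>I. 0 < \<nu> i) \<and> (\<Sum>i\<in>I. \<nu> i *\<^sub>R sn \<kappa> (udist X (c p) (c (x i))) *\<^sub>R \<xi> i) = 0"
      using bal mu by auto
  qed
  \<comment> \<open>For i = j and equal radii this is the uniqueness in the ultrapower through which
    \<open>between_realized\<close> produces the base segments in the space itself.\<close>
  have A: "udist X y z = dM \<kappa> (pt \<kappa> (udist X (c p) y) (\<xi> i)) (pt \<kappa> (udist X (c p) z) (\<xi> j))"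
    if "y \<in> seqs X" "z \<in> seqs X" "i \<in> I" "j \<in> I" "udist X (c p) y + udist X y (c (x i)) = D i" "udist X (c p) z + udist X z (c (x j)) = D j" for y z i j
    by (rule C.base_rays_dist[OF base that(1-4) _ _ _ unit]) (use that uD D in simp_all)
  have AX: "mdist X y z = dM \<kappa> (pt \<kappa> (mdist X p y) (\<xi> i)) (pt \<kappa> (mdist X p z) (\<xi> j))"
    if "y \<in> mspace X" "z \<in> mspace X" "i \<in> I" "j \<in> I" "mdist X p y + mdist X y (x i) = D i" "mdist X p z + mdist X z (x j) = D j" for y z i j
    using A[OF cS[OF that(1)] cS[OF that(2)] that(3,4)] that p x(1) by (simp add: uc)
  have ptM: "pt \<kappa> t (\<xi> i) \<in> MP \<kappa>" if "i \<in> I" "0 \<le> t" "t \<le> D i" for i t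
    by (rule pt_model[OF that(2) radc_mono[OF rad_radc that(3)] unit[OF that(1)]]) (use D that in blast)
  have "\<exists>y\<in>mspace X. mdist X p y = t \<and> mdist X y (x i) = D i - t" if i: "i \<in> I" and t: "0 \<le> t" "t \<le> D i" for i t
    unfolding D_def
  proof (rule between_realized[OF X p x(1)[OF i] t(1) t(2)[unfolded D_def]])
    fix z z' assume z: "z \<in> seqs X" "z' \<in> seqs X" "udist X (\<lambda>_. p) z = t" "udist X z (\<lambda>_. x i) = mdist X p (x i) - t"
      "udist X (\<lambda>_. p) z' = t" "udist X z' (\<lambda>_. x i) = mdist X p (x i) - t"
    show "udist X z z' = 0" using A[OF z(1,2) i i] z ptM[OF i t] by (simp add: c_def D_def)
  qed
  then obtain yy where yy: "\<And>i t. i \<in> I \<Longrightarrow> 0 \<le> t \<Longrightarrow> t \<le> D i \<Longrightarrow> yy i t \<in> mspace X \<and> mdist X p (yy i t) = t \<and> mdist X (yy i t) (x i) = D i - t"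
    by metis
  have yyd: "mdist X (yy i s) (yy j t) = dM \<kappa> (pt \<kappa> s (\<xi> i)) (pt \<kappa> t (\<xi> j))"
    if "i \<in> I" "j \<in> I" "0 < s" "s < D i" "0 < t" "t < D j" for i j s t
    using AX[of "yy i s" "yy j t" i j] yy[of i s] yy[of j t] that by simp
  interpret R: rigid \<kappa> "seqs X" "udist X" "c ` mspace X" "c p" I \<xi> D "\<lambda>i t. c (yy i t)"
  proof
    show "c ` mspace X \<subseteq> seqs X" "c p \<in> c ` mspace X" "finite I" using cS p I by auto
    show "norm (\<xi> i) = 1" if "i \<in> I" for i by (rule unit[OF that])
    have "(\<Sum>i\<in>I. (\<mu> i * sn \<kappa> (D i)) *\<^sub>R \<xi> i) = (\<Sum>i\<in>I. \<mu> i *\<^sub>R V i)" by (rule sum.cong[OF refl]) (simp flip: Vx)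
    then show "\<exists>\<nu>. (\<forall>i\<in>I. 0 < \<nu> i) \<and> (\<Sum>i\<in>I. \<nu> i *\<^sub>R \<xi> i) = 0"
      using bal mu sD by (intro exI[of _ "\<lambda>i. \<mu> i * sn \<kappa> (D i)"]) simp
    show "0 < D i" "rad \<kappa> (D i)" if "i \<in> I" for i using D[OF that] by auto
    show "c (yy i t) \<in> c ` mspace X" "udist X (c p) (c (yy i t)) = t" if "i \<in> I" "0 < t" "t < D i" for i t
      using yy[of i t] that p by (auto simp: uc)
    show "udist X (c (yy i s)) (c (yy j t)) = dM \<kappa> (pt \<kappa> s (\<xi> i)) (pt \<kappa> t (\<xi> j))"
      if "i \<in> I" "j \<in> I" "0 < s" "s < D i" "0 < t" "t < D j" for i j s t
      using yyd[OF that] yy[of i s] yy[of j t] that by (simp add: uc)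
    fix a b s assume ab: "a \<in> c ` mspace X" "b \<in> c ` mspace X" and s: "0 \<le> s" "s \<le> udist X a b"
      and un: "\<And>z z'. z \<in> seqs X \<Longrightarrow> z' \<in> seqs X \<Longrightarrow> udist X a z = s \<Longrightarrow> udist X z b = udist X a b - s \<Longrightarrow>
        udist X a z' = s \<Longrightarrow> udist X z' b = udist X a b - s \<Longrightarrow> udist X z z' = 0"
    obtain a' b' where ab': "a = c a'" "a' \<in> mspace X" "b = c b'" "b' \<in> mspace X" using ab by blast
    have abd: "udist X a b = mdist X a' b'" unfolding ab' by (rule uc[OF ab'(2,4)])
    have "\<exists>z\<in>mspace X. mdist X a' z = s \<and> mdist X z b' = mdist X a' b' - s"
      by (rule between_realized[OF X ab'(2,4) s(1) s(2)[unfolded abd]]) (rule un, simp_all add: ab'(1,3) abd[unfolded ab'(1,3)] c_def[symmetric])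
    then obtain z where z: "z \<in> mspace X" "mdist X a' z = s" "mdist X z b' = mdist X a' b' - s" by blast
    then have "udist X a (c z) = s \<and> udist X (c z) b = udist X a b - s" using ab' abd by (simp add: uc)
    then show "\<exists>z\<in>c ` mspace X. udist X a z = s \<and> udist X z b = udist X a b - s" using z(1) by blast
  qed
  have bg: R.base_gen
    unfolding R.base_gen_def R.gen_def
  proof (intro ballI allI impI, elim conjE)
    fix i j s t assume h: "i \<in> I" "j \<in> I" "0 < s" "s < D i" "0 < t" "t < D j"
    note yi = yy[OF h(1) less_imp_le[OF h(3)] less_imp_le[OF h(4)]] and yj = yy[OF h(2) less_imp_le[OF h(5)] less_imp_le[OF h(6)]]
    have "mdist X (yy i s) (yy j t) \<le> mdist X (yy i s) (x i) + mdist X (x i) (yy j t)"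
      "mdist X (x i) (yy j t) \<le> mdist X (x i) (x j) + mdist X (x j) (yy j t)"
      by (rule mdist_triangle; use yi yj x(1)[OF h(1)] x(1)[OF h(2)] in blast)+
    then have le: "s + t + mdist X (yy i s) (yy j t) \<le> D i + D j + mdist X (x i) (x j)"
      using yi yj mdist_commute[of X "x j" "yy j t"] by linarith
    show "small \<kappa> (dM \<kappa> (org \<kappa>) (pt \<kappa> s (\<xi> i)) + dM \<kappa> (org \<kappa>) (pt \<kappa> t (\<xi> j)) + dM \<kappa> (pt \<kappa> s (\<xi> i)) (pt \<kappa> t (\<xi> j)))"
      unfolding R.ab_xi[OF h(1,3,4)] R.ab_xi[OF h(2,5,6)] yyd[OF h, symmetric]
      by (rule small_mono[OF sm[OF h(1,2)]]) (use le in \<open>simp add: D_def\<close>)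
  qed
  obtain R where mR: "R.maxgood R" using R.maxgood_exists by blast
  then have R: "R.good R" by (simp add: R.maxgood_def)
  \<comment> \<open>The maximal correspondence cut down to the generated set and brought back from
    constant sequences to points.\<close>
  define Q where "Q = {(y, w). w \<in> R.E0 \<and> y \<in> mspace X \<and> (c y, w) \<in> R}"
  have QI: "(y, w) \<in> Q" if "w \<in> R.E0" "y \<in> mspace X" "(c y, w) \<in> R" for y w using that by (simp add: Q_def)
  have QD: "w \<in> R.E0" "y \<in> mspace X" "(c y, w) \<in> R" if "(y, w) \<in> Q" for y w using that by (simp_all add: Q_def)
  have iso: "iso_rel X (model_space \<kappa>) Q"
    unfolding iso_rel_def mspace_model_space mdist_model_space
  proof (intro conjI allI impI)
    show "Q \<subseteq> mspace X \<times> MP \<kappa>" using R.E0_model by (auto simp: Q_def)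
    fix y w y' w' assume q: "(y, w) \<in> Q" "(y', w') \<in> Q"
    show "mdist X y y' = dM \<kappa> w w'" using R.good_iso[OF R QD(3)[OF q(1)] QD(3)[OF q(2)]] uc QD(2)[OF q(1)] QD(2)[OF q(2)] by simp
  qed
  have Qd: "mdist X y y' = dM \<kappa> w w'" if "(y, w) \<in> Q" "(y', w') \<in> Q" for y w y' w'
    using iso that unfolding iso_rel_def mdist_model_space by blast
  have partner: "\<exists>y. (y, w) \<in> Q" if w: "w \<in> R.E0" for w
  proof -
    obtain z where z: "(z, w) \<in> R" using R.E0_rel[OF mR w] by blast
    then obtain y where "z = c y" "y \<in> mspace X" using R.good_in(1)[OF R] by blast
    then show ?thesis using QI[OF w] z by blast
  qed
  have RangeQ: "Range Q = R.E0" using partner QD(1) by blast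
  define H where "H = metric_between X {p} (x ` I)"
  have H: "y \<in> H \<longleftrightarrow> y \<in> mspace X \<and> (\<exists>i\<in>I. mdist X p y + mdist X y (x i) = D i)" for y
    unfolding H_def metric_between_def D_def by (auto simp: eq_commute)
  define f where "f y = pt \<kappa> (mdist X p y) (\<xi> (SOME i. i \<in> I \<and> mdist X p y + mdist X y (x i) = D i))" for y
  have f: "\<exists>i\<in>I. mdist X p y + mdist X y (x i) = D i \<and> f y = pt \<kappa> (mdist X p y) (\<xi> i) \<and> mdist X p y \<le> D i" if y: "y \<in> H" for y
  proof -
    define i where "i = (SOME i. i \<in> I \<and> mdist X p y + mdist X y (x i) = D i)"
    have "i \<in> I \<and> mdist X p y + mdist X y (x i) = D i"
      unfolding i_def by (rule someI_ex) (use y H in blast)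
    moreover have "mdist X p y \<le> D i" using calculation mdist_nonneg[of X y "x i"] by linarith
    ultimately show ?thesis unfolding f_def i_def[symmetric] by blast
  qed
  \<comment> \<open>A point on several base segments has the same image for each of them:
    \<open>AX\<close> for y and y itself gives distance 0.\<close>
  have f_eq: "f y = pt \<kappa> (mdist X p y) (\<xi> i)" if y: "y \<in> H" and i: "i \<in> I" "mdist X p y + mdist X y (x i) = D i" for y i
  proof -
    obtain j where j: "j \<in> I" "mdist X p y + mdist X y (x j) = D j" "f y = pt \<kappa> (mdist X p y) (\<xi> j)" "mdist X p y \<le> D j" using f[OF y] by blast
    have yM: "y \<in> mspace X" using y H by blast
    have ile: "mdist X p y \<le> D i" using i(2) mdist_nonneg[of X y "x i"] by linarith
    have "mdist X y y = 0" using yM by simp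
    then have "dM \<kappa> (f y) (pt \<kappa> (mdist X p y) (\<xi> i)) = 0" unfolding j(3) AX[OF yM yM j(1) i(1) j(2) i(2)] .
    then show ?thesis
      unfolding j(3) using dM_zero[OF ptM[OF j(1) mdist_nonneg j(4)] ptM[OF i(1) mdist_nonneg ile]] by blast
  qed
  have emb: "isometric_embedding (submetric X H) (model_space \<kappa>) f"
    unfolding isometric_embedding_def mspace_submetric mdist_submetric mspace_model_space mdist_model_space
  proof (intro conjI ballI Pi_I)
    fix y assume "y \<in> H \<inter> mspace X"
    then show "f y \<in> MP \<kappa>" using f[of y] ptM mdist_nonneg[of X p y] by (metis IntD1)
  next
    fix y z assume y: "y \<in> H \<inter> mspace X" and z: "z \<in> H \<inter> mspace X"
    then obtain i j where i: "i \<in> I" "mdist X p y + mdist X y (x i) = D i" "f y = pt \<kappa> (mdist X p y) (\<xi> i)"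
      and j: "j \<in> I" "mdist X p z + mdist X z (x j) = D j" "f z = pt \<kappa> (mdist X p z) (\<xi> j)" using f[of y] f[of z] by blast
    show "dM \<kappa> (f y) (f z) = mdist X y z"
      unfolding i(3) j(3) by (rule AX[symmetric]) (use i j y z in blast)+
  qed
  define K where "K = rel_closure X (model_space \<kappa>) Q"
  have isoK: "iso_rel X (model_space \<kappa>) K" unfolding K_def by (rule iso_rel_closure[OF iso])
  have QK: "Q \<subseteq> K" unfolding K_def by (rule rel_closure_superset[OF iso])
  have compl: "mcomplete_of X" using X by (simp add: alexandrov_space_def)
  have DomK: "Domain K = mtopology_of X closure_of Domain Q" unfolding K_def by (rule Domain_rel_closure[OF iso mcomplete_model])
  have RanK: "Range K = mtopology_of (model_space \<kappa>) closure_of R.E0"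
    unfolding K_def RangeQ[symmetric] by (rule Range_rel_closure[OF iso compl])
  have yyQ: "(yy i t, pt \<kappa> t (\<xi> i)) \<in> Q" if "i \<in> I" "0 < t" "t < D i" for i t
    using QI[OF R.E0_base[OF that] _ R.good_base[OF R that]] yy[of i t] that by simp
  have pQ: "(p, org \<kappa>) \<in> Q" by (rule QI[OF R.E0_org p R.good_org[OF R]])
  have graph: "(y, f y) \<in> K" if y: "y \<in> H" for y
  proof (cases "mdist X p y = 0")
    case True
    have "y = p" using True y p H by simp
    moreover obtain i where "i \<in> I" "f y = pt \<kappa> (mdist X p y) (\<xi> i)" using f[OF y] by blast
    ultimately show ?thesis using True pt_0[OF unit] pQ QK by auto
  next
    case False
    define t where "t = mdist X p y"
    have t: "0 < t" using False mdist_nonneg[of X p y] unfolding t_def by linarith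
    obtain i where i: "i \<in> I" "t + mdist X y (x i) = D i" "f y = pt \<kappa> t (\<xi> i)" "t \<le> D i" using f[OF y] unfolding t_def by blast
    have yM: "y \<in> mspace X" using y H by blast
    have near: "\<exists>(y', w')\<in>Q. mdist X y y' < e \<and> dM \<kappa> (f y) w' < e" if e: "0 < e" for e
    proof -
      \<comment> \<open>A radius strictly below t and within e of it. The point y may be an end
        point of a base segment, which only the closure contains.\<close>
      define s where "s = max (t / 2) (t - e / 2)"
      have s: "0 < s" "s < t" "t - s < e" using t e by (auto simp: s_def)
      have sD: "s < D i" "s \<le> t" "0 \<le> s" "s \<le> D i" using s i(4) by auto
      note ys = yy[OF i(1) sD(3,4)]
      have "mdist X y (yy i s) = dM \<kappa> (pt \<kappa> t (\<xi> i)) (pt \<kappa> s (\<xi> i))"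
        using AX[of y "yy i s" i i] yM i ys by (simp add: t_def)
      also have "\<dots> = t - s"
        using dM_ray[OF sD(3,2) radc_mono[OF rad_radc i(4)] unit[OF i(1)]] D[OF i(1)] dM_commute[of \<kappa> "pt \<kappa> t (\<xi> i)"] by simp
      finally have 1: "mdist X y (yy i s) = t - s" .
      have 2: "dM \<kappa> (f y) (pt \<kappa> s (\<xi> i)) = t - s"
        using \<open>dM \<kappa> (pt \<kappa> t (\<xi> i)) (pt \<kappa> s (\<xi> i)) = t - s\<close> i(3) by simp
      show ?thesis by (rule bexI[OF _ yyQ[OF i(1) s(1) sD(1)]]) (simp add: 1 2 s(3))
    qed
    have "f y \<in> MP \<kappa>" unfolding i(3) by (rule ptM[OF i(1) less_imp_le[OF t] i(4)])
    then show ?thesis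
      unfolding K_def rel_closure_def mspace_model_space mdist_model_space using yM near by blast
  qed
  define UX UM where "UX = (\<Union>n. (conv_step X ^^ n) H)" and "UM = (\<Union>n. (conv_step (model_space \<kappa>) ^^ n) (f ` H))"
  have HU: "H \<subseteq> UX" "f ` H \<subseteq> UM" unfolding UX_def UM_def by (rule conv_steps_superset)+
  \<comment> \<open>Both hulls are treated in one induction, because uniqueness of the segment in
    the space is obtained from the generic segment in the model.\<close>
  have QU: "w \<in> UM \<and> (\<forall>y. (y, w) \<in> Q \<longrightarrow> y \<in> UX)" if "w \<in> R.E0" for w
    using that
  proof induction
    case E0_org
    obtain i where i: "i \<in> I" using I(2) by blast
    have z: "mdist X p p = 0" using p by simp
    then have pH: "p \<in> H" using p i unfolding H by (auto simp: D_def simp del: mdist_zero)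
    have "f p = org \<kappa>" using f[OF pH] z pt_0[OF unit] by auto
    moreover have "y = p" if "(y, org \<kappa>) \<in> Q" for y
    proof -
      have "mdist X y p = 0" using Qd[OF that pQ] org_model by simp
      then show ?thesis using QD(2)[OF that] p by simp
    qed
    ultimately show ?case using pH HU by (metis image_eqI subsetD)
  next
    case (E0_base i t)
    note yt = yy[OF E0_base(1) less_imp_le[OF E0_base(2)] less_imp_le[OF E0_base(3)]]
    have "mdist X p (yy i t) + mdist X (yy i t) (x i) = D i" using yt by simp
    then have yH: "yy i t \<in> H" using yt E0_base(1) unfolding H by blast
    have "f (yy i t) = pt \<kappa> t (\<xi> i)" using f_eq[OF yH E0_base(1)] yt by simp
    moreover have "y = yy i t" if "(y, pt \<kappa> t (\<xi> i)) \<in> Q" for y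
    proof -
      have "mdist X y (yy i t) = 0"
        using Qd[OF that yyQ[OF E0_base]] ptM[OF E0_base(1) less_imp_le[OF E0_base(2)] less_imp_le[OF E0_base(3)]] by simp
      then show ?thesis using QD(2)[OF that] yt by simp
    qed
    ultimately show ?case using yH HU by (metis image_eqI subsetD)
  next
    case (E0_between a b w)
    note aM = R.E0_model[OF E0_between(1)] and bM = R.E0_model[OF E0_between(2)]
    obtain z where z: "unique_path (model_space \<kappa>) a b z"
      using model_unique_path[OF aM bM R.gen_rad[OF aM bM E0_between(3)]] by blast
    then have zp: "iso_path (model_space \<kappa>) a b z" unfolding unique_path_def by blast
    have zu: "y = z (dM \<kappa> a y)" if "y \<in> MP \<kappa>" "dM \<kappa> a y + dM \<kappa> y b = dM \<kappa> a b" for y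
      using z that unfolding unique_path_def mspace_model_space mdist_model_space by blast
    have zM: "z s \<in> MP \<kappa>" "dM \<kappa> a (z s) = s" "dM \<kappa> (z s) b = dM \<kappa> a b - s" if s: "s \<in> {0..dM \<kappa> a b}" for s
    proof -
      have dd: "dM \<kappa> (z s') (z t') = \<bar>s' - t'\<bar>" "z s' \<in> MP \<kappa>" if "s' \<in> {0..dM \<kappa> a b}" "t' \<in> {0..dM \<kappa> a b}" for s' t'
        using zp that unfolding iso_path_def mspace_model_space mdist_model_space by auto
      have zz: "z 0 = a" "z (dM \<kappa> a b) = b" using zp unfolding iso_path_def mdist_model_space by auto
      show "z s \<in> MP \<kappa>" "dM \<kappa> a (z s) = s" "dM \<kappa> (z s) b = dM \<kappa> a b - s"
        using dd[of s s] dd(1)[of 0 s] dd(1)[of s "dM \<kappa> a b"] s zz by simp_all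
    qed
    have zE: "z s \<in> R.E0" if s: "s \<in> {0..dM \<kappa> a b}" for s
      by (rule R.E0_between[OF E0_between(1-3) zM(1)[OF s]]) (use zM[OF s] in simp)
    have aw: "dM \<kappa> a w \<in> {0..dM \<kappa> a b}" using E0_between(5) dM_nonneg[of \<kappa> w b] dM_nonneg[of \<kappa> a w] by (simp del: dM_nonneg)
    have "w = z (dM \<kappa> a w)" by (rule zu[OF E0_between(4,5)])
    moreover have "z (dM \<kappa> a w) \<in> UM"
      unfolding UM_def by (rule unique_path_conv_steps[OF z]) (use E0_between.IH aw in \<open>simp_all add: UM_def\<close>)
    ultimately have wU: "w \<in> UM" by simp
    obtain ya yb where yab: "(ya, a) \<in> Q" "(yb, b) \<in> Q" using partner E0_between(1,2) by blast
    obtain q where q: "iso_path X ya yb q" "\<And>s. s \<in> {0..mdist X ya yb} \<Longrightarrow> (q s, z s) \<in> Q"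
      using iso_rel_path[OF iso yab zp] zE RangeQ by (metis image_subsetI mdist_model_space)
    have l: "mdist X ya yb = dM \<kappa> a b" by (rule Qd[OF yab])
    \<comment> \<open>Uniqueness in the space is inherited from the ultrapower.\<close>
    have "y' = q (mdist X ya y')" if y': "y' \<in> mspace X" "mdist X ya y' + mdist X y' yb = mdist X ya yb" for y'
    proof -
      define s where "s = mdist X ya y'"
      have s: "s \<in> {0..mdist X ya yb}" using y'(2) mdist_nonneg[of X y' yb] mdist_nonneg[of X ya y'] unfolding s_def atLeastAtMost_iff by linarith
      note qs = q(2)[OF s]
      have sM: "s \<in> {0..dM \<kappa> a b}" using s l by simp
      have M: "ya \<in> mspace X" "yb \<in> mspace X" "q s \<in> mspace X" using QD(2) yab qs by blast+
      have "udist X (c y') (c (q s)) = 0"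
      proof (rule R.between_unique[OF R QD(3)[OF yab(1)] QD(3)[OF yab(2)] E0_between(3) zM(1)[OF sM]])
        show "c y' \<in> seqs X" "c (q s) \<in> seqs X" using cS y'(1) M by blast+
        show "dM \<kappa> a (z s) + dM \<kappa> (z s) b = dM \<kappa> a b" using zM[OF sM] by simp
        show "udist X (c ya) (c y') = dM \<kappa> a (z s)" "udist X (c y') (c yb) = dM \<kappa> (z s) b"
          using zM[OF sM] M y' l by (simp_all add: uc s_def)
        show "udist X (c ya) (c (q s)) = dM \<kappa> a (z s)" "udist X (c (q s)) (c yb) = dM \<kappa> (z s) b"
          using Qd[OF yab(1) qs] Qd[OF qs yab(2)] M by (simp_all add: uc)
      qed
      then have "mdist X y' (q s) = 0" using y'(1) M(3) by (simp add: uc)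
      then show ?thesis using y'(1) M(3) unfolding s_def by simp
    qed
    then have uq: "unique_path X ya yb q" using q(1) unfolding unique_path_def by blast
    have "y \<in> UX" if y: "(y, w) \<in> Q" for y
    proof -
      have bt: "mdist X ya y + mdist X y yb = mdist X ya yb" using Qd[OF yab(1) y] Qd[OF y yab(2)] l E0_between(5) by simp
      then have "y = q (mdist X ya y)" using uq QD(2)[OF y] unfolding unique_path_def by blast
      moreover have "mdist X ya y \<in> {0..mdist X ya yb}"
        using bt mdist_nonneg[of X y yb] mdist_nonneg[of X ya y] unfolding atLeastAtMost_iff by linarith
      then have "q (mdist X ya y) \<in> UX"
        unfolding UX_def by (intro unique_path_conv_steps[OF uq]) (use E0_between.IH yab in \<open>simp_all add: UX_def\<close>)
      ultimately show ?thesis by simp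
    qed
    then show ?case using wU by blast
  qed
  have clX: "mtopology_of X closure_of Domain K \<subseteq> Domain K" unfolding DomK by simp
  have clM: "mtopology_of (model_space \<kappa>) closure_of Range K \<subseteq> Range K" unfolding RanK by simp
  have cM: "weakly_convex (model_space \<kappa>) (Range K)" unfolding RanK by (rule R.closure_E0_convex[OF bg I(2)])
  have cX: "weakly_convex X (Domain K)" by (rule iso_rel_weakly_convex[OF isoK cM])
  \<comment> \<open>The domain is closed and weakly convex and contains H, so it contains the hull;
    conversely it is the closure of points reached by unique segments.\<close>
  have "closed_conv X H = Domain K"
  proof
    show "closed_conv X H \<subseteq> Domain K" by (rule closed_conv_subset[OF cX clX]) (use graph in blast)
    have "Domain Q \<subseteq> UX" using QU QD(1) by blast
    then show "Domain K \<subseteq> closed_conv X H" unfolding DomK closed_conv_def UX_def by (rule closure_of_mono)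
  qed
  moreover have "closed_conv (model_space \<kappa>) (f ` H) = Range K"
  proof
    show "closed_conv (model_space \<kappa>) (f ` H) \<subseteq> Range K" by (rule closed_conv_subset[OF cM clM]) (use graph in blast)
    have "R.E0 \<subseteq> UM" using QU by blast
    then show "Range K \<subseteq> closed_conv (model_space \<kappa>) (f ` H)" unfolding RanK closed_conv_def UM_def by (rule closure_of_mono)
  qed
  ultimately have "isometric (submetric X (closed_conv X H)) (submetric (model_space \<kappa>) (closed_conv (model_space \<kappa>) (f ` H)))"
    using iso_rel_isometric[OF isoK] by simp
  then show ?thesis using emb unfolding H_def by blast
qed

text \<open>Settles the degenerate case in which all given points coincide with p or there are
  none.\<close>

lemma closed_conv_trivial:
  assumes S: "S \<subseteq> {a}" and a: "a \<in> mspace X"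
  shows "closed_conv X S = S"
proof
  have z: "mdist X a a = 0" using a by simp
  have "iso_path X a a (\<lambda>_. a)" unfolding iso_path_def z using a by (auto simp: z)
  then have "weakly_convex X S"
    unfolding weakly_convex_def
  proof (intro ballI)
    fix b c assume b: "b \<in> S" and "c \<in> S"
    then have bc: "b = a" "c = a" using S by blast+
    assume "iso_path X a a (\<lambda>_. a)"
    then show "\<exists>z. iso_path X b c z \<and> z ` {0..mdist X b c} \<subseteq> S"
      unfolding bc using b bc by (intro exI[of _ "\<lambda>_. a"]) auto
  qed
  moreover have "mtopology_of X closure_of S \<subseteq> S"
  proof
    fix y assume "y \<in> mtopology_of X closure_of S"
    then have y: "y \<in> mspace X" "\<And>e. 0 < e \<Longrightarrow> \<exists>y'\<in>S. mdist X y y' < e" unfolding in_closure_of_metric by blast+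
    have Sa: "S = {a}" using y(2)[of 1] S by auto
    have "mdist X y a < e" if "0 < e" for e using y(2)[OF that] Sa by simp
    then have "\<not> 0 < mdist X y a" by blast
    then have "mdist X y a = 0" using mdist_nonneg[of X y a] by linarith
    then show "y \<in> S" using y(1) a Sa by simp
  qed
  ultimately show "closed_conv X S \<subseteq> S" by (rule closed_conv_subset) simp
  show "S \<subseteq> closed_conv X S"
  proof
    fix y assume y: "y \<in> S"
    have aU: "a \<in> (\<Union>n. (conv_step X ^^ n) S)" using conv_steps_superset[of S X] y S by blast
    have "\<exists>y'\<in>(\<Union>n. (conv_step X ^^ n) S). y' \<in> mspace X \<and> mdist X a y' < e" if "0 < e" for e
      by (rule bexI[OF _ aU]) (simp add: a z that)
    then show "y \<in> closed_conv X S" unfolding closed_conv_def in_closure_of_metric using a y S by blast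
  qed
qed

theorem theorem2:
  fixes \<kappa> :: real and X :: "'a metric" and p :: 'a
    and I :: "'i set" and x :: "'i \<Rightarrow> 'a" and l :: "'i \<Rightarrow> real"
  assumes "alexandrov_space \<kappa> X"
    and "p \<in> mspace X"
    and "finite I"
    and "\<And>i. i \<in> I \<Longrightarrow> x i \<in> mspace X"
    and "\<And>i. i \<in> I \<Longrightarrow> l i > 0"
    and "(\<Sum>i\<in>I. \<Sum>j\<in>I. ereal (l i * l j) * inner_prod \<kappa> X p (x i) (x j)) = 0"
  shows "\<exists>f. isometric_embedding (submetric X (metric_between X {p} (x ` I))) (model_space \<kappa>) f \<and>
           isometric (submetric X (closed_conv X (metric_between X {p} (x ` I))))
             (submetric (model_space \<kappa>)
               (closed_conv (model_space \<kappa>) (f ` metric_between X {p} (x ` I))))"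
proof -
  note X = assms(1) and p = assms(2) and fin = assms(3) and xM = assms(4) and lp = assms(5) and sum0 = assms(6)
  define D where "D i = mdist X p (x i)" for i
  define T where "T i j = ereal (l i * l j) * inner_prod \<kappa> X p (x i) (x j)" for i j
  have T0: "(\<Sum>i\<in>I. \<Sum>j\<in>I. T i j) = 0" using sum0 by (simp add: T_def)
  \<comment> \<open>An infinite term would make the whole sum infinite, as the weights are
    positive.\<close>
  have fin_ip: "inner_prod \<kappa> X p (x i) (x j) \<noteq> \<infinity>" if ij: "i \<in> I" "j \<in> I" for i j
  proof
    assume "inner_prod \<kappa> X p (x i) (x j) = \<infinity>"
    moreover have "0 < l i" "0 < l j" using lp ij by simp_all
    ultimately have "T i j = \<infinity>" by (simp add: T_def)
    then have "(\<Sum>j\<in>I. T i j) = \<infinity>" using fin ij(2) by (auto simp: sum_Pinfty)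
    then have "(\<Sum>i\<in>I. \<Sum>j\<in>I. T i j) = \<infinity>" using fin ij(1) by (auto simp: sum_Pinfty)
    then show False using T0 by simp
  qed
  define g where "g i j = (if D i * D j = 0 then 0 else D i * D j * cos (comparison_angle \<kappa> X p (x i) (x j)))" for i j
  have ip: "inner_prod \<kappa> X p (x i) (x j) = ereal (g i j)" if ij: "i \<in> I" "j \<in> I" for i j
    using fin_ip[OF ij] unfolding inner_prod_def g_def D_def by (auto split: if_splits simp del: mdist_zero)
  have "ereal (\<Sum>i\<in>I. \<Sum>j\<in>I. l i * l j * g i j) = (\<Sum>i\<in>I. \<Sum>j\<in>I. T i j)"
    unfolding sum_ereal[symmetric] by (intro sum.cong refl) (simp add: T_def ip)
  then have g0: "(\<Sum>i\<in>I. \<Sum>j\<in>I. l i * l j * g i j) = 0" unfolding T0 by simp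
  \<comment> \<open>Points equal to p have no direction and contribute 0 to the sum; they are
    removed.\<close>
  define J where "J = {i \<in> I. 0 < D i}"
  have J: "i \<in> I" "0 < D i" if "i \<in> J" for i using that by (simp_all add: J_def)
  have finJ: "finite J" using fin by (simp add: J_def)
  have D_0: "D i = 0" if "i \<in> I - J" for i using that mdist_nonneg[of X p "x i"] unfolding J_def D_def by auto
  \<comment> \<open>Finiteness of the inner product is what bounds the perimeters. The case i = j
    bounds the distances from p.\<close>
  have sm: "small \<kappa> (mdist X p (x i) + mdist X p (x j) + mdist X (x i) (x j))" if ij: "i \<in> J" "j \<in> J" for i j
  proof -
    have ne: "mdist X p (x i) * mdist X p (x j) \<noteq> 0" using J(2)[OF ij(1)] J(2)[OF ij(2)] unfolding D_def by simp
    have "\<kappa> > 0 \<longrightarrow> angle_defined \<kappa> X p (x i) (x j)"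
      using fin_ip[OF J(1)[OF ij(1)] J(1)[OF ij(2)]] ne unfolding inner_prod_def by (auto split: if_splits simp del: mdist_zero)
    then show ?thesis unfolding angle_defined_def peri_def small_def using mdist_commute[of X p "x j"] by auto
  qed
  have gJ: "(\<Sum>i\<in>J. \<Sum>j\<in>J. l i * l j * g i j) = 0"
  proof -
    have "(\<Sum>i\<in>I. \<Sum>j\<in>I. l i * l j * g i j) = (\<Sum>i\<in>J. \<Sum>j\<in>I. l i * l j * g i j)"
      using fin D_0 by (intro sum.mono_neutral_right) (auto simp: J_def g_def)
    also have "\<dots> = (\<Sum>i\<in>J. \<Sum>j\<in>J. l i * l j * g i j)"
      using fin D_0 by (intro sum.cong refl sum.mono_neutral_right) (auto simp: J_def g_def)
    finally show ?thesis using g0 by simp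
  qed
  define F where "F i j = md \<kappa> (D i) + md \<kappa> (D j) - md \<kappa> (mdist X (x i) (x j)) - \<kappa> * md \<kappa> (D i) * md \<kappa> (D j)" for i j
  have gF: "g i j * (sn \<kappa> (D i) * sn \<kappa> (D j)) = D i * D j * F i j" and snD: "0 < sn \<kappa> (D i)" if ij: "i \<in> J" "j \<in> J" for i j
  proof -
    note iM = xM[OF J(1)[OF ij(1)]] and jM = xM[OF J(1)[OF ij(2)]]
    have ok: "tri_ok \<kappa> (D i) (D j) (mdist X (x i) (x j))"
      unfolding tri_ok_def
      using J(2)[OF ij(1)] J(2)[OF ij(2)] sm[OF ij] mdist_triangle[OF p iM jM] mdist_triangle[OF p jM iM] mdist_triangle[OF iM p jM]
        mdist_commute[of X "x i" "x j"] mdist_commute[of X "x i" p]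
      unfolding D_def by linarith
    have "cos (comparison_angle \<kappa> X p (x i) (x j)) = cang \<kappa> (D i) (D j) (mdist X (x i) (x j))"
      unfolding comparison_angle_eq D_def[symmetric] using cang_bounds[OF ok] by (intro cos_arccos) auto
    then have "g i j = D i * D j * (F i j / (sn \<kappa> (D i) * sn \<kappa> (D j)))"
      using J(2)[OF ij(1)] J(2)[OF ij(2)] by (simp add: g_def cang_def F_def)
    then show "g i j * (sn \<kappa> (D i) * sn \<kappa> (D j)) = D i * D j * F i j" using tri_ok_sn[OF ok] by simp
    show "0 < sn \<kappa> (D i)" by (rule tri_ok_sn(1)[OF ok])
  qed
  \<comment> \<open>Turns the normalization d(p, x) cos of the given inner product into the
    normalization \<open>sn\<close> cos of \<open>Phi\<close>, so the weighted terms agree.\<close>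
  define \<mu> where "\<mu> i = l i * D i / sn \<kappa> (D i)" for i
  have mu: "0 < \<mu> i" if "i \<in> J" for i unfolding \<mu>_def using lp[OF J(1)[OF that]] J(2)[OF that] snD[OF that that] by simp
  have zero: "(\<Sum>i\<in>J. \<Sum>j\<in>J. \<mu> i * \<mu> j * F i j) = 0"
  proof -
    have "\<mu> i * \<mu> j * F i j = l i * l j * g i j" if "i \<in> J" "j \<in> J" for i j
      using gF[OF that] snD[OF that(1,1)] snD[OF that(2,2)] by (simp add: \<mu>_def field_simps)
    then have "(\<Sum>i\<in>J. \<Sum>j\<in>J. \<mu> i * \<mu> j * F i j) = (\<Sum>i\<in>J. \<Sum>j\<in>J. l i * l j * g i j)" by (intro sum.cong refl)
    then show ?thesis using gJ by simp
  qed
  have HI: "y \<in> metric_between X {p} (x ` K) \<longleftrightarrow> y \<in> mspace X \<and> (\<exists>i\<in>K. D i = mdist X p y + mdist X y (x i))" for y and K :: "'i set"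
    unfolding metric_between_def D_def by auto
  have deg: "y = p" if "i \<in> I - J" "y \<in> mspace X" "D i = mdist X p y + mdist X y (x i)" for y i
  proof -
    have "mdist X p y = 0" using that(3) D_0[OF that(1)] mdist_nonneg[of X p y] mdist_nonneg[of X y "x i"] by linarith
    then show ?thesis using that(2) p by simp
  qed
  show ?thesis
  proof (cases "J = {}")
    case True
    define H where "H = metric_between X {p} (x ` I)"
    have Hp: "H \<subseteq> {p}" using deg True unfolding H_def subset_iff HI by blast
    have H0: "mdist X y y' = 0" if "y \<in> H" "y' \<in> H" for y y'
    proof -
      have "y = p" "y' = p" using that Hp by blast+
      then show ?thesis using p by simp
    qed
    define f where "f = (\<lambda>y :: 'a. org \<kappa>)"
    define Q where "Q = (\<lambda>y. (y, org \<kappa>)) ` H"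
    have iso: "iso_rel X (model_space \<kappa>) Q"
      unfolding iso_rel_def mspace_model_space mdist_model_space using H0 Hp p org_model by (auto simp: Q_def simp del: mdist_zero)
    have DR: "Domain Q = H" "Range Q = f ` H" by (auto simp: Q_def f_def)
    have "closed_conv X H = H" by (rule closed_conv_trivial[OF Hp p])
    moreover have "closed_conv (model_space \<kappa>) (f ` H) = f ` H"
      by (rule closed_conv_trivial[of _ "org \<kappa>"]) (auto simp: f_def org_model)
    moreover have "isometric (submetric X H) (submetric (model_space \<kappa>) (f ` H))" using iso_rel_isometric[OF iso] unfolding DR .
    moreover have "isometric_embedding (submetric X H) (model_space \<kappa>) f"
      unfolding isometric_embedding_def using H0 p org_model by (auto simp: f_def simp del: mdist_zero)
    ultimately show ?thesis unfolding H_def by (intro exI[of _ f]) simp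
  next
    case False
    have "metric_between X {p} (x ` I) = metric_between X {p} (x ` J)"
    proof (rule set_eqI)
      fix y
      have "y \<in> metric_between X {p} (x ` J)" if i: "i \<in> I" "y \<in> mspace X" "D i = mdist X p y + mdist X y (x i)" for i
      proof (cases "i \<in> J")
        case True
        then show ?thesis using i unfolding HI by blast
      next
        case notJ: False
        \<comment> \<open>A removed index contributes only p, which lies on every remaining segment;
          J is nonempty here.\<close>
        then have yp: "y = p" using deg[of i y] i by blast
        obtain j where j: "j \<in> J" using False by blast
        have "mdist X p p = 0" using p by simp
        then have "D j = mdist X p p + mdist X p (x j)" by (simp add: D_def del: mdist_zero)
        then show ?thesis unfolding HI yp using j p by blast
      qed
      then show "y \<in> metric_between X {p} (x ` I) \<longleftrightarrow> y \<in> metric_between X {p} (x ` J)"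
        unfolding HI using J(1) by blast
    qed
    moreover have "\<exists>f. isometric_embedding (submetric X (metric_between X {p} (x ` J))) (model_space \<kappa>) f \<and>
           isometric (submetric X (closed_conv X (metric_between X {p} (x ` J))))
             (submetric (model_space \<kappa>)
               (closed_conv (model_space \<kappa>) (f ` metric_between X {p} (x ` J))))"
    proof (rule rigidity[OF X p finJ False xM[OF J(1)] _ sm mu])
      show "0 < mdist X p (x i)" if "i \<in> J" for i using J(2)[OF that] by (simp add: D_def)
    qed (use zero in \<open>simp_all add: F_def D_def\<close>)
    ultimately show ?thesis by simp
  qed
qed

end
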